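(* Assume $-\infty<l<r<\infty$ and (A3): $\inf\operatorname{supp}\mu>-\infty$ and $\sup\operatorname{supp}\mu<\infty$. Assume further: if $q(l+)<\infty$ then $\mu(\{\inf\operatorname{supp}\mu\})>0$; if $q(l+)=\infty$ then $\liminf_{y\searrow l}G_y(\bar a(y))>0$; if $q(r-)<\infty$ then $\mu(\{\sup\operatorname{supp}\mu\})>0$; if $q(r-)=\infty$ then $\liminf_{y\nearrow r}G_y(\bar a(y))>0$. Then there exists $N_0\in\mathbb N$ such that for every $N\ge N_0$ there is a unique scale factor $a_N\colon[l,r]\to[0,\infty)$ with $a_N(y)=\sup\{a\ge0:G_y(a)\le\frac1N\}$ for $y\in I$ and $a_N(l)=a_N(r)=0$, and the random walk $Y^N_0=m$, $Y^N_{k+1}=Y^N_k+a_N(Y^N_k)X_{k+1}$ can be embedded into $M$ by $(\mathcal F_t)$-stopping times $0=\tau_0\le\tau_1\le\dots$ with $(M_{\tau_k})_k\overset{d}{=}(Y^N_k)_k$ and $E[\tau_{k+1}\mid\mathcal F_{\tau_k}]=\tau_k+\frac1N$ for all $k\ge0$.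
   Context: Let $I=(l,r)$, $\eta\colon\mathbb R\to\mathbb R$ Borel with $\eta\ne0$ on $I$, $1/\eta^2\in L^1_{\mathrm{loc}}(I)$, $\eta=0$ off $I$. Let $m\in I$ and $(M,W)$ a weak solution of $dM_t=\eta(M_t)dW_t$, $M_0=m$, on a filtered probability space $(\Omega,\mathcal F,(\mathcal F_t),P)$ with usual conditions. $q(y,x)=\int_y^x\int_y^u\frac{2}{\eta^2(z)}dz\,du\in[0,\infty]$; $q(l+)=\lim_{x\searrow l}q(m,x)$, $q(r-)=\lim_{x\nearrow r}q(m,x)$. $\mu\ne\delta_0$ is a centered probability measure with finite first moment, $X_1,X_2,\dots$ i.i.d.\ with law $\mu$, $G_y(a)=\int q(y,y+ax)\mu(dx)$. For $y\in I$, $\bar a(y)=\frac{l-y}{\inf\operatorname{supp}\mu}\wedge\frac{r-y}{\sup\operatorname{supp}\mu}$. *)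

theory Defs
  imports "HOL-Probability.Probability"
begin

text \<open>Time index is real; only times t \<ge> 0 are relevant.
  Usual conditions: P complete, F_0 contains all P-null sets, F right-continuous.\<close>

definition usual_conditions :: "'a measure \<Rightarrow> (real \<Rightarrow> 'a measure) \<Rightarrow> bool" where
  "usual_conditions P F \<longleftrightarrow>
     prob_space P \<and> filtration (space P) F \<and> (\<forall>t. sets (F t) \<subseteq> sets P) \<and>
     (\<forall>N\<in>null_sets P. \<forall>A. A \<subseteq> N \<longrightarrow> A \<in> sets P) \<and>
     (\<forall>N\<in>null_sets P. \<forall>A. A \<subseteq> N \<longrightarrow> A \<in> sets (F 0)) \<and>
     (\<forall>t\<ge>0. sets (F t) = (\<Inter>s\<in>{t<..}. sets (F s)))"

definition adapted :: "(real \<Rightarrow> 'a measure) \<Rightarrow> (real \<Rightarrow> 'a \<Rightarrow> real) \<Rightarrow> bool" where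
  "adapted F X \<longleftrightarrow> (\<forall>t\<ge>0. X t \<in> borel_measurable (F t))"

definition progressive :: "(real \<Rightarrow> 'a measure) \<Rightarrow> (real \<Rightarrow> 'a \<Rightarrow> real) \<Rightarrow> bool" where
  "progressive F X \<longleftrightarrow>
     (\<forall>t\<ge>0. (\<lambda>(s,\<omega>). X s \<omega>) \<in> borel_measurable (restrict_space borel {0..t} \<Otimes>\<^sub>M F t))"

definition continuous_paths :: "'a measure \<Rightarrow> (real \<Rightarrow> 'a \<Rightarrow> real) \<Rightarrow> bool" where
  "continuous_paths P X \<longleftrightarrow> (\<forall>\<omega>\<in>space P. continuous_on {0..} (\<lambda>t. X t \<omega>))"

definition brownian_motion :: "'a measure \<Rightarrow> (real \<Rightarrow> 'a measure) \<Rightarrow> (real \<Rightarrow> 'a \<Rightarrow> real) \<Rightarrow> bool" where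
  "brownian_motion P F W \<longleftrightarrow>
     (\<forall>\<omega>\<in>space P. W 0 \<omega> = 0) \<and> continuous_paths P W \<and> adapted F W \<and>
     (\<forall>s t. 0 \<le> s \<and> s < t \<longrightarrow>
        distributed P lborel (\<lambda>\<omega>. W t \<omega> - W s \<omega>) (\<lambda>x. ennreal (normal_density 0 (sqrt (t - s)) x)) \<and>
        prob_space.indep_set P (sets (F s))
          {(\<lambda>\<omega>. W t \<omega> - W s \<omega>) -` A \<inter> space P | A. A \<in> sets borel})"

text \<open>Convergence in probability (with outer probability, so no measurability is presupposed).\<close>
definition conv_in_prob :: "'a measure \<Rightarrow> (nat \<Rightarrow> 'a \<Rightarrow> ennreal) \<Rightarrow> bool" where
  "conv_in_prob P f \<longleftrightarrow>
     (\<forall>\<epsilon>>0. \<forall>\<delta>>0. \<exists>n0. \<forall>n\<ge>n0. \<exists>A\<in>sets P.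
        {\<omega>\<in>space P. ennreal \<epsilon> < f n \<omega>} \<subseteq> A \<and> measure P A < \<delta>)"

definition simple_predictable ::
  "(real \<Rightarrow> 'a measure) \<Rightarrow> real list \<Rightarrow> (nat \<Rightarrow> 'a \<Rightarrow> real) \<Rightarrow> bool" where
  "simple_predictable F ts xi \<longleftrightarrow>
     ts \<noteq> [] \<and> ts ! 0 = 0 \<and> sorted_wrt (<) ts \<and>
     (\<forall>i < length ts - 1. xi i \<in> borel_measurable (F (ts ! i)) \<and> (\<exists>B. \<forall>\<omega>. \<bar>xi i \<omega>\<bar> \<le> B))"

definition simple_proc :: "real list \<Rightarrow> (nat \<Rightarrow> 'a \<Rightarrow> real) \<Rightarrow> real \<Rightarrow> 'a \<Rightarrow> real" where
  "simple_proc ts xi s \<omega> =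
     (\<Sum>i < length ts - 1. xi i \<omega> * indicator {ts ! i <.. ts ! Suc i} s)"

definition simple_integral ::
  "(real \<Rightarrow> 'a \<Rightarrow> real) \<Rightarrow> real list \<Rightarrow> (nat \<Rightarrow> 'a \<Rightarrow> real) \<Rightarrow> real \<Rightarrow> 'a \<Rightarrow> real" where
  "simple_integral W ts xi s \<omega> =
     (\<Sum>i < length ts - 1. xi i \<omega> * (W (min s (ts ! Suc i)) \<omega> - W (min s (ts ! i)) \<omega>))"

definition ito_integral ::
  "'a measure \<Rightarrow> (real \<Rightarrow> 'a measure) \<Rightarrow> (real \<Rightarrow> 'a \<Rightarrow> real) \<Rightarrow> (real \<Rightarrow> 'a \<Rightarrow> real)
     \<Rightarrow> (real \<Rightarrow> 'a \<Rightarrow> real) \<Rightarrow> bool" where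
  "ito_integral P F W H X \<longleftrightarrow>
     progressive F H \<and> continuous_paths P X \<and> adapted F X \<and>
     (\<exists>ts :: nat \<Rightarrow> real list. \<exists>xi :: nat \<Rightarrow> nat \<Rightarrow> 'a \<Rightarrow> real.
        (\<forall>n. simple_predictable F (ts n) (xi n)) \<and>
        (\<forall>t\<ge>0.
           conv_in_prob P (\<lambda>n \<omega>. \<integral>\<^sup>+ s. indicator {0..t} s *
               ennreal ((simple_proc (ts n) (xi n) s \<omega> - H s \<omega>)\<^sup>2) \<partial>lborel) \<and>
           conv_in_prob P (\<lambda>n \<omega>. SUP s\<in>{0..t}.
               ennreal \<bar>simple_integral W (ts n) (xi n) s \<omega> - X s \<omega>\<bar>)))"

definition weak_solution ::
  "'a measure \<Rightarrow> (real \<Rightarrow> 'a measure) \<Rightarrow> (real \<Rightarrow> real) \<Rightarrow> real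
     \<Rightarrow> (real \<Rightarrow> 'a \<Rightarrow> real) \<Rightarrow> (real \<Rightarrow> 'a \<Rightarrow> real) \<Rightarrow> bool" where
  "weak_solution P F \<eta> m M W \<longleftrightarrow>
     brownian_motion P F W \<and> continuous_paths P M \<and> adapted F M \<and>
     (\<exists>X. ito_integral P F W (\<lambda>s \<omega>. \<eta> (M s \<omega>)) X \<and>
          (\<forall>t\<ge>0. AE \<omega> in P. M t \<omega> = m + X t \<omega>))"

text \<open>Density 2/\<eta>^2, taken to be \<infinity> where \<eta> = 0 (i.e. outside I).\<close>
definition qdens :: "(real \<Rightarrow> real) \<Rightarrow> real \<Rightarrow> ennreal" where
  "qdens \<eta> z = (if \<eta> z = 0 then \<infinity> else ennreal (2 / (\<eta> z)\<^sup>2))"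

text \<open>q(y,x) = \<integral>_y^x \<integral>_y^u 2/\<eta>^2(z) dz du \<in> [0,\<infinity>] (oriented integrals, so both
  orientations give a nonnegative value).\<close>
definition q :: "(real \<Rightarrow> real) \<Rightarrow> real \<Rightarrow> real \<Rightarrow> ennreal" where
  "q \<eta> y x = (\<integral>\<^sup>+ u. indicator {min y x..max y x} u *
                 (\<integral>\<^sup>+ z. indicator {min y u..max y u} z * qdens \<eta> z \<partial>lborel) \<partial>lborel)"

definition G :: "real measure \<Rightarrow> (real \<Rightarrow> real) \<Rightarrow> real \<Rightarrow> real \<Rightarrow> ennreal" where
  "G \<mu> \<eta> y a = (\<integral>\<^sup>+ x. q \<eta> y (y + a * x) \<partial>\<mu>)"

definition supp :: "real measure \<Rightarrow> real set" where
  "supp \<mu> = {x. \<forall>e>0. 0 < emeasure \<mu> (ball x e)}"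

definition abar :: "real measure \<Rightarrow> real \<Rightarrow> real \<Rightarrow> real \<Rightarrow> real" where
  "abar \<mu> l r y = min ((l - y) / Inf (supp \<mu>)) ((r - y) / Sup (supp \<mu>))"

text \<open>Random walk Y_0 = m, Y_(k+1) = Y_k + a(Y_k) X_(k+1); here X k stands for X_(k+1).\<close>
primrec rwalk :: "real \<Rightarrow> (real \<Rightarrow> real) \<Rightarrow> (nat \<Rightarrow> 'b \<Rightarrow> real) \<Rightarrow> nat \<Rightarrow> 'b \<Rightarrow> real" where
  "rwalk m a X 0 \<omega> = m"
| "rwalk m a X (Suc k) \<omega> = rwalk m a X k \<omega> + a (rwalk m a X k \<omega>) * X k \<omega>"

definition scale_factor ::
  "real measure \<Rightarrow> (real \<Rightarrow> real) \<Rightarrow> real \<Rightarrow> real \<Rightarrow> nat \<Rightarrow> (real \<Rightarrow> real) \<Rightarrow> bool" where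
  "scale_factor \<mu> \<eta> l r N a \<longleftrightarrow>
     (\<forall>y. y \<notin> {l<..<r} \<longrightarrow> a y = 0) \<and>
     (\<forall>y\<in>{l<..<r}. 0 \<le> a y \<and>
        (\<forall>b\<ge>0. G \<mu> \<eta> y b \<le> ennreal (1 / real N) \<longrightarrow> b \<le> a y) \<and>
        (\<forall>c. (\<forall>b\<ge>0. G \<mu> \<eta> y b \<le> ennreal (1 / real N) \<longrightarrow> b \<le> c) \<longrightarrow> a y \<le> c))"

end

theory Submission
 imports Defs
begin

text \<open>Applied to cosines only, Ito's formula is the Gaussian characteristic function for simple integrands, and it
passes to the limit. Uniqueness of characteristic functions turns it into an occupation identity for \<open>M\<close> between
stopping times \<open>S\<close> and \<open>T\<close> that is valid for every nonnegative Borel function; for \<open>2 / \<eta>^2\<close> it says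
\<open>E (T - S) = E (q (M_S) (M_T))\<close> as long as \<open>M\<close> stays inside \<open>I\<close>, so intervals with finite \<open>q\<close> are left in finite time.

A step is embedded by Dubins' construction: cut the line successively at the rationals and let \<open>M\<close> exit from the
interval spanned by the (rescaled) barycentres of the two parts of the current cell. In the limit the scaled increment is independent
of the past with law \<open>\<mu>\<close>, and the step takes \<open>G (M_S) (a (M_S))\<close> time units in conditional mean. This is at most \<open>1 / N\<close>; for large \<open>N\<close>
it can be strictly less only if the step charges an endpoint of \<open>I\<close>, where \<open>M\<close> is absorbed and the missing time can be
spent waiting.\<close>

text \<open>Ito's formula for \<open>q\<close> itself is out of reach: \<open>\<eta>\<close> is only
  Borel, and neither the range nor any moment of \<open>M\<close> is known beforehand. For cosines
  the function and its second derivative are bounded, and the family determines finite measures.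
  Since \<open>2 / \<eta>^2\<close> is the second derivative of \<open>q \<eta> y\<close>, both
  sides of the occupation identity are measures in that derivative and need to be compared only on
  \<open>1 + cos\<close>. Limits are exchanged after cutting integrands off at quadratic variation
  \<open>K\<close>; once \<open>M\<close> is known to stay in \<open>[l, r]\<close>, a cosine of
  frequency \<open>1 / (r - l)\<close> bounds the expected quadratic variation independently of
  \<open>K\<close> and of time. Dubins' tree fits because a barycentre lies in its own cell: the
  position of \<open>M\<close> alone tells the current cell, so no memory or extra randomness is
  needed. By convexity of \<open>G\<close> in the step, \<open>G y (a y) < 1 / N\<close> forces the
  maximal step \<open>abar\<close>. At an end with infinite \<open>q\<close> the liminf hypothesis
  keeps \<open>G\<close> at that step above a positive constant, so for small \<open>1 / N\<close>
  this end is not reached; at an end with finite \<open>q\<close> the atom of \<open>\<mu>\<close>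
  gives the positive probability by which the missing time is divided.\<close>

abbreviation ind :: "'a set => 'a => 'b::zero_neq_one" where "ind \<equiv> indicator"

section \<open>Preliminaries on measures\<close>

text \<open>The summand 1 keeps the integrand nonnegative, so the hypothesis presupposes no
  integrability. \<open>u = 0\<close>, \<open>th = pi / 2\<close> gives equal total mass; the phases
  \<open>0\<close> and \<open>- (pi / 2)\<close> give real and imaginary part of the characteristic
  functions of the normalised measures, and Levy's uniqueness theorem applies. Zero mass is separate
  because it cannot be normalised.\<close>

lemma finite_measure_eqI_cos:
 assumes fin: "finite_measure N1" "finite_measure N2"
  and sets: "sets N1 = sets (borel :: real measure)" "sets N2 = sets (borel :: real measure)"
  and eq: "!!u th::real. (\<integral>\<^sup>+z. ennreal (1 + cos (u * z + th)) \<partial>N1) = (\<integral>\<^sup>+z. ennreal (1 + cos (u * z + th)) \<partial>N2)"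
 shows "N1 = N2"
proof -
 interpret N1: finite_measure N1 by fact
 interpret N2: finite_measure N2 by fact
 have sp: "space N1 = UNIV" "space N2 = UNIV"
  using sets_eq_imp_space_eq[OF sets(1)] sets_eq_imp_space_eq[OF sets(2)] by auto
 note [measurable_cong] = sets
 have mass: "emeasure N1 UNIV = emeasure N2 UNIV"
  using eq[of 0 "pi/2"] sp by simp
 have icos: "integrable N (%z. cos (u * z + th))" if "finite_measure N" "sets N = sets borel" for N :: "real measure" and u th :: real
 proof -
  interpret finite_measure N by fact
  note [measurable_cong] = that(2)
  show ?thesis by (rule integrable_const_bound[of _ 1]) auto
 qed
 have icos': "(\<integral>z. cos (u * z + th) \<partial>N) = enn2real (\<integral>\<^sup>+z. ennreal (1 + cos (u * z + th)) \<partial>N) - measure N UNIV"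
  if N: "finite_measure N" "sets N = sets borel" for N :: "real measure" and u th :: real
 proof -
  interpret finite_measure N by fact
  have sp: "space N = UNIV" using sets_eq_imp_space_eq[OF N(2)] by auto
  have pos: "0 <= 1 + cos (u * z + th)" for z using cos_ge_minus_one[of "u * z + th"] by linarith
  have "(\<integral>\<^sup>+z. ennreal (1 + cos (u * z + th)) \<partial>N) = ennreal (\<integral>z. 1 + cos (u * z + th) \<partial>N)"
   using icos[OF N, of u th] by (intro nn_integral_eq_integral) (auto simp: pos)
  hence "enn2real (\<integral>\<^sup>+z. ennreal (1 + cos (u * z + th)) \<partial>N) = (\<integral>z. 1 + cos (u * z + th) \<partial>N)"
   by (simp add: pos integral_nonneg_AE)
  thus ?thesis using icos[OF N, of u th] sp by simp
 qed
 have ic: "(\<integral>z. cos (u * z + th) \<partial>N1) = (\<integral>z. cos (u * z + th) \<partial>N2)" for u th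
  using icos'[OF fin(1) sets(1)] icos'[OF fin(2) sets(2)] eq mass by (simp add: measure_def)
 show ?thesis
 proof (cases "emeasure N1 UNIV = 0")
  case True
  show ?thesis
  proof (rule measure_eqI)
   fix A assume "A \<in> sets N1"
   have "emeasure N1 A <= emeasure N1 UNIV" "emeasure N2 A <= emeasure N2 UNIV"
    using sp sets by (auto intro!: emeasure_mono)
   thus "emeasure N1 A = emeasure N2 A" using True mass by auto
  qed (use sets in auto)
 next
  case False
  define c where "c = measure N1 UNIV"
  have c0: "c > 0" using False by (simp add: c_def N1.emeasure_eq_measure zero_less_measure_iff)
  have c1: "emeasure N1 UNIV = ennreal c" "emeasure N2 UNIV = ennreal c"
   using mass by (auto simp: c_def N1.emeasure_eq_measure)
  define D where "D = (%N::real measure. density N (%_. ennreal (1/c)))"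
  have rd: "real_distribution (D N)" if "sets N = sets borel" "emeasure N UNIV = ennreal c" for N
  proof -
   have sp: "space N = UNIV" using sets_eq_imp_space_eq[OF that(1)] by auto
   have "prob_space (D N)"
    using c0 that sp by (intro prob_spaceI) (auto simp: D_def emeasure_density nn_integral_cmult sp ennreal_mult[symmetric])
   thus ?thesis using that(1) by (auto simp: real_distribution_def real_distribution_axioms_def D_def)
  qed
  have ch: "char (D N) t = (1/c) * Complex (\<integral>z. cos (t * z + 0) \<partial>N) (\<integral>z. cos (t * z + (- (pi/2))) \<partial>N)"
   if N: "finite_measure N" "sets N = sets borel" for N t
  proof -
   interpret finite_measure N by fact
   note [measurable_cong] = that(2)
   have i: "integrable N (%x. iexp (t * x))"
    by (rule integrable_const_bound[of _ 1]) auto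
   have "char (D N) t = (\<integral>x. (1/c) *\<^sub>R iexp (t * x) \<partial>N)"
    unfolding char_def D_def using c0 by (subst integral_density) auto
   also have "... = (1/c) * (\<integral>x. iexp (t * x) \<partial>N)"
    by (simp add: scaleR_conv_of_real)
   also have "(\<integral>x. iexp (t * x) \<partial>N) = Complex (\<integral>z. Re (iexp (t * z)) \<partial>N) (\<integral>z. Im (iexp (t * z)) \<partial>N)"
    using i by (intro complex_eqI) simp_all
   also have "(%z. Re (iexp (t * z))) = (%z. cos (t * z + 0))" by (auto simp: Re_exp)
   also have "(%z. Im (iexp (t * z))) = (%z. cos (t * z + - (pi/2)))"
    by (auto simp: Im_exp cos_diff)
   finally show ?thesis .
  qed
  have "char (D N1) = char (D N2)"
   by (rule ext) (simp only: ch[OF fin(1) sets(1)] ch[OF fin(2) sets(2)] ic)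
  hence "D N1 = D N2"
   by (intro Levy_uniqueness rd sets c1)
  have unscale: "emeasure N A = ennreal c * emeasure (D N) A" if "sets N = sets borel" "A \<in> sets borel" for N A
  proof -
   note [measurable_cong] = that(1)
   have "emeasure (D N) A = ennreal (1/c) * emeasure N A"
    using that by (simp add: D_def emeasure_density nn_integral_cmult_indicator)
   thus ?thesis using c0 by (simp add: mult.assoc[symmetric] ennreal_mult[symmetric])
  qed
  show ?thesis
   using unscale[OF sets(1)] unscale[OF sets(2)] \<open>D N1 = D N2\<close> sets by (intro measure_eqI) auto
 qed
qed

text \<open>Rounding the time to multiples of \<open>1 / (n + 1)\<close> leaves countably many time
  values, each with a measurable section; continuity in time recovers the process as the
  limit.\<close>

lemma measurable_jointly_continuous:
 fixes Y :: "real => 'a => real"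
 assumes meas: "!!s. Y s \<in> borel_measurable N"
  and cont: "!!w. w \<in> space N ==> continuous_on UNIV (%s. Y s w)"
 shows "(%(s, w). Y s w) \<in> borel_measurable (borel \<Otimes>\<^sub>M N)"
proof -
 define f :: "nat => real \<times> 'a => real" where "f n x = Y (real_of_int \<lfloor>fst x * real (Suc n)\<rfloor> / real (Suc n)) (snd x)" for n x
 have m: "f n \<in> borel_measurable (borel \<Otimes>\<^sub>M N)" for n
 proof -
  have "(%x. (%k x. Y (real_of_int k / real (Suc n)) (snd x)) (\<lfloor>fst x * real (Suc n)\<rfloor>) x) \<in> borel_measurable (borel \<Otimes>\<^sub>M N)"
  proof (rule measurable_compose_countable[where f="%k x. Y (real_of_int k / real (Suc n)) (snd x)" and g="%x. \<lfloor>fst x * real (Suc n)\<rfloor>"])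
   fix k :: int
   show "(%x. Y (real_of_int k / real (Suc n)) (snd x)) \<in> borel_measurable (borel \<Otimes>\<^sub>M N)"
    by (rule measurable_compose[OF measurable_snd meas])
   show "(%x. \<lfloor>fst x * real (Suc n)\<rfloor>) \<in> borel \<Otimes>\<^sub>M N \<rightarrow>\<^sub>M count_space UNIV"
    by measurable
  qed
  thus ?thesis unfolding f_def .
 qed
 show ?thesis
 proof (rule borel_measurable_LIMSEQ_real[OF _ m])
  fix x :: "real \<times> 'a" assume "x \<in> space (borel \<Otimes>\<^sub>M N)"
  hence x: "snd x \<in> space N" by (auto simp: space_pair_measure)
  obtain a w where xa: "x = (a, w)" by (cases x)
  have l: "(%n. real_of_int \<lfloor>a * real (Suc n)\<rfloor> / real (Suc n)) \<longlonglongrightarrow> a"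
  proof (rule tendsto_sandwich[where f="%n. a - 1 / real (Suc n)" and h="%n. a"])
   have "a - 1 / real (Suc n) = (a * real (Suc n) - 1) / real (Suc n)" for n by (simp add: field_simps)
   thus "\<forall>\<^sub>F n in sequentially. a - 1 / real (Suc n) <= real_of_int \<lfloor>a * real (Suc n)\<rfloor> / real (Suc n)"
    by (intro always_eventually allI) (simp only:, intro divide_right_mono, linarith+)
   show "\<forall>\<^sub>F n in sequentially. real_of_int \<lfloor>a * real (Suc n)\<rfloor> / real (Suc n) <= a"
    by (intro always_eventually allI) (simp add: divide_le_eq del: of_nat_Suc)
   have "(%n. a - 1 / real (Suc n)) \<longlonglongrightarrow> a - 0"
    by (intro tendsto_diff tendsto_const LIMSEQ_Suc[OF lim_1_over_n])
   thus "(%n. a - 1 / real (Suc n)) \<longlonglongrightarrow> a" by simp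
  qed auto
  have "isCont (%s. Y s (w)) (a)"
   using cont x xa by (simp add: continuous_on_eq_continuous_at)
  from isCont_tendsto_compose[OF this l]
  show "(%n. f n x) \<longlonglongrightarrow> (case x of (s, w) => Y s w)"
   by (simp add: f_def xa)
 qed
qed

section \<open>Integrals of simple processes against Brownian motion\<close>

lemma integral_cos_std_normal:
 fixes a b :: real
 shows "(\<integral>x. cos (a + b * x) \<partial>std_normal_distribution) = cos a * exp (- (b^2) / 2)"
proof -
 interpret real_distribution std_normal_distribution by (rule real_dist_normal_dist)
 have i: "integrable std_normal_distribution (%x. iexp (b * x))"
  by (rule integrable_const_bound[of _ 1]) auto
 have "(\<integral>x. cos (a + b * x) \<partial>std_normal_distribution) = (\<integral>x. Re (iexp a * iexp (b * x)) \<partial>std_normal_distribution)"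
  by (intro Bochner_Integration.integral_cong) (auto simp: Re_exp Im_exp cos_add)
 also have "... = Re (\<integral>x. iexp a * iexp (b * x) \<partial>std_normal_distribution)"
  using i by (intro integral_Re) auto
 also have "... = Re (iexp a * char std_normal_distribution b)"
  using i by (simp add: char_def)
 also have "... = cos a * exp (- (b^2) / 2)"
  by (simp add: char_std_normal_distribution Re_exp)
 finally show ?thesis .
qed

section \<open>Filtrations under the usual conditions and jointly measurable processes\<close>

locale usual_filtration =
 fixes P :: "'a measure" and F :: "real => 'a measure"
 assumes usual: "usual_conditions P F"

sublocale usual_filtration \<subseteq> prob_space P
 using usual by (simp add: usual_conditions_def)

sublocale usual_filtration \<subseteq> filtration "space P" F
 using usual by (simp add: usual_conditions_def)

context usual_filtration
begin

lemma sets_F_sub: "A \<in> sets (F t) ==> A \<in> sets P"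
proof -
 have "ALL t. sets (F t) \<subseteq> sets P"
  using usual unfolding usual_conditions_def by (elim conjE) assumption
 thus "A \<in> sets (F t) ==> A \<in> sets P" by blast
qed

lemma subalgebra_F: "subalgebra P (F t)"
 by (auto simp: subalgebra_def space_F intro: sets_F_sub)

lemma measurable_F_P: "f \<in> measurable (F t) N ==> f \<in> measurable P N"
 by (rule measurable_from_subalg[OF subalgebra_F])

lemma measurable_F_mono: "f \<in> measurable (F s) N ==> s <= t ==> f \<in> measurable (F t) N"
 by (rule measurable_from_subalg[of "F t" "F s"]) (simp_all add: subalgebra_def space_F sets_F_mono)

lemma null_in_F0: "N \<in> null_sets P ==> A \<subseteq> N ==> A \<in> sets (F 0)"
proof -
 have "\<forall>N\<in>null_sets P. ALL A. A \<subseteq> N --> A \<in> sets (F 0)"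
  using usual unfolding usual_conditions_def by (elim conjE) assumption
 thus "N \<in> null_sets P ==> A \<subseteq> N ==> A \<in> sets (F 0)" by blast
qed

lemma null_in_F: "N \<in> null_sets P ==> A \<subseteq> N ==> 0 <= t ==> A \<in> sets (F t)"
 using null_in_F0[of N A] sets_F_mono[of 0 t] by (simp add: subset_iff)

text \<open>Processes are indexed by all reals but constrained only at nonnegative times, hence the
  clamp \<open>max 0\<close>; later measurability proofs reduce to this clamped form.\<close>

lemma process_joint_measurable:
 fixes Y :: "real => 'a => real"
 assumes "!!v. 0 <= v ==> Y v \<in> borel_measurable P" "continuous_paths P Y"
 shows "(%x. Y (max 0 (fst x)) (snd x)) \<in> borel_measurable (borel \<Otimes>\<^sub>M P)"
proof -
 have "(%(s, w). Y (max 0 s) w) \<in> borel_measurable (borel \<Otimes>\<^sub>M P)"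
 proof (rule measurable_jointly_continuous)
  fix w assume "w \<in> space P"
  hence "continuous_on {0..} (%t. Y t w)" using assms(2) by (auto simp: continuous_paths_def)
  thus "continuous_on UNIV (%s. Y (max 0 s) w)"
   by (rule continuous_on_compose2) (auto intro!: continuous_intros)
 qed (use assms(1) in auto)
 thus ?thesis by (simp add: split_beta')
qed

end

text \<open>The increment of \<open>cos (u * X + th)\<close> minus its Ito drift, the second
  derivative of that cosine being \<open>- u^2\<close> times itself. If \<open>X\<close> is the
  stochastic integral of \<open>H\<close>, this is a martingale increment; what is proved and used
  is that its mean vanishes on events of the past.\<close>

definition cos_increment :: "(real => 'a => real) => (real => 'a => real) => real => real => real => real => 'a => real" where
 "cos_increment X H u th s t w =
   cos (u * X t w + th) - cos (u * X s w + th)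
   + u^2 / 2 * (\<integral>v. ind {s<..t} v * (cos (u * X v w + th) * (H v w)^2) \<partial>lborel)"

locale bm_filtration = usual_filtration P F for P :: "'a measure" and F +
 fixes W :: "real => 'a => real"
 assumes bm: "brownian_motion P F W"
begin

lemma W_adapted: "0 <= t ==> W t \<in> borel_measurable (F t)"
 using bm by (auto simp: brownian_motion_def adapted_def)

lemma W_measurable: "0 <= t ==> W t \<in> borel_measurable P"
 by (rule measurable_F_P[OF W_adapted])

lemma W_cont: "continuous_paths P W"
 using bm by (auto simp: brownian_motion_def)

text \<open>The identity map into \<open>F s\<close> is the random variable that carries the whole
  past. It is independent of the Gaussian increment, so the past may be frozen and the increment
  integrated out; the sine part vanishes by symmetry and the cosine picks up the Gaussian
  factor.\<close>

lemma gauss_increment: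
 assumes st: "0 <= s" "s < t"
  and f: "f \<in> borel_measurable (F s)" "!!w. \<bar>f w\<bar> <= K"
  and \<psi>: "\<psi> \<in> borel_measurable (F s)" and c: "c \<in> borel_measurable (F s)"
 shows "expectation (%w. f w * cos (\<psi> w + c w * (W t w - W s w)))
   = expectation (%w. f w * (cos (\<psi> w) * exp (- ((c w)^2 * (t - s)) / 2)))"
proof -
 define D where "D = (%w. W t w - W s w)"
 have dD: "distributed P lborel D (%x. ennreal (normal_density 0 (sqrt (t - s)) x))"
  and ind: "indep_set (sets (F s)) {D -` A \<inter> space P | A. A \<in> sets borel}"
  using bm st by (auto simp: brownian_motion_def D_def)
 have [measurable]: "D \<in> borel_measurable P"
  using st unfolding D_def by (intro borel_measurable_diff W_measurable) auto
 have id: "(%w. w) \<in> measurable P (F s)"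
  by (rule measurable_F_P[of _ s]) simp
 interpret d1: prob_space "distr P (F s) (%w. w)" by (rule prob_space_distr[OF id])
 interpret d2: prob_space "distr P borel D" by (rule prob_space_distr) simp
 interpret pp: pair_prob_space "distr P (F s) (%w. w)" "distr P borel D" ..
 have idD[measurable]: "(%w. (w, D w)) \<in> P \<rightarrow>\<^sub>M F s \<Otimes>\<^sub>M borel"
  by (intro measurable_Pair id) simp
 \<comment> \<open>Independence of the event families is exactly agreement on rectangles, which
   determines the product measure.\<close>
 have pair: "distr P (F s) (%w. w) \<Otimes>\<^sub>M distr P borel D = distr P (F s \<Otimes>\<^sub>M borel) (%w. (w, D w))"
 proof (rule pair_measure_eqI)
  fix A B assume "A \<in> sets (distr P (F s) (%w. w))" and "B \<in> sets (distr P borel D)"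
  hence A: "A \<in> sets (F s)" and B[measurable]: "B \<in> sets borel" by auto
  have AP: "(%w. w) -` A \<inter> space P = A" using sets.sets_into_space[OF A] by (auto simp: space_F)
  have eq: "(%w. (w, D w)) -` (A \<times> B) \<inter> space P = A \<inter> (D -` B \<inter> space P)"
   using AP by auto
  have "prob (A \<inter> (D -` B \<inter> space P)) = prob A * prob (D -` B \<inter> space P)"
   by (rule indep_setD[OF ind A]) auto
  thus "emeasure (distr P (F s) (%w. w)) A * emeasure (distr P borel D) B = emeasure (distr P (F s \<Otimes>\<^sub>M borel) (%w. (w, D w))) (A \<times> B)"
   using A AP[simplified] by (simp add: emeasure_distr[OF id] emeasure_distr[OF idD] emeasure_distr eq emeasure_eq_measure ennreal_mult[symmetric])
 qed (unfold_locales, simp)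
 define g where "g = (%x. f (fst x) * cos (\<psi> (fst x) + c (fst x) * snd x))"
 note [measurable] = f(1) \<psi> c id
 have gm[measurable]: "g \<in> borel_measurable (F s \<Otimes>\<^sub>M borel)" unfolding g_def by measurable
 have gb: "\<bar>g x\<bar> <= K" for x
 proof -
  have "\<bar>g x\<bar> <= \<bar>f (fst x)\<bar> * 1" unfolding g_def abs_mult by (intro mult_left_mono) auto
  thus ?thesis using f(2)[of "fst x"] by simp
 qed
 have gi: "integrable (distr P (F s) (%w. w) \<Otimes>\<^sub>M distr P borel D) g"
  using gb by (intro pp.P.integrable_const_bound[of _ K]) auto
 have std: "distributed P lborel (%w. (D w - 0) / sqrt (t - s)) std_normal_density"
  using dD st by (subst (asm) normal_standard_normal_convert) auto
 have inner: "(\<integral>z. g (w, z) \<partial>distr P borel D) = f w * (cos (\<psi> w) * exp (- ((c w)^2 * (t - s)) / 2))" for w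
 proof -
  have "(\<integral>z. g (w, z) \<partial>distr P borel D) = expectation (%x. f w * cos (\<psi> w + c w * D x))"
   by (subst integral_distr) (auto simp: g_def)
  also have "... = f w * expectation (%x. cos (\<psi> w + c w * D x))" by simp
  also have "expectation (%x. cos (\<psi> w + c w * D x)) = expectation (%x. cos (\<psi> w + (c w * sqrt (t - s)) * ((D x - 0) / sqrt (t - s))))"
   using st by (intro Bochner_Integration.integral_cong) auto
  also have "... = (\<integral>z. std_normal_density z * cos (\<psi> w + (c w * sqrt (t - s)) * z) \<partial>lborel)"
   by (rule distributed_integral[OF std, symmetric]) auto
  also have "... = (\<integral>z. cos (\<psi> w + (c w * sqrt (t - s)) * z) \<partial>std_normal_distribution)"
   by (subst integral_density) auto
  also have "... = cos (\<psi> w) * exp (- ((c w)^2 * (t - s)) / 2)"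
   using st by (simp add: integral_cos_std_normal power_mult_distrib)
  finally show ?thesis .
 qed
 have "expectation (%w. f w * cos (\<psi> w + c w * (W t w - W s w))) = expectation (%w. g (w, D w))"
  by (simp add: g_def D_def)
 also have "... = (\<integral>x. g x \<partial>distr P (F s \<Otimes>\<^sub>M borel) (%w. (w, D w)))"
  by (subst integral_distr) auto
 also have "... = (\<integral>x. g x \<partial>(distr P (F s) (%w. w) \<Otimes>\<^sub>M distr P borel D))"
  by (simp add: pair)
 also have "... = (\<integral>w. (\<integral>z. g (w, z) \<partial>distr P borel D) \<partial>distr P (F s) (%w. w))"
  by (rule pp.integral_fst'[OF gi, symmetric])
 also have "... = expectation (%w. f w * (cos (\<psi> w) * exp (- ((c w)^2 * (t - s)) / 2)))"
  unfolding inner by (subst integral_distr) auto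
 finally show ?thesis .
qed

lemma exp_time_integral:
 fixes k s t :: real
 assumes "s <= t"
 shows "integrable lborel (%v. ind {s<..t} v * exp (- (k * (v - s)) / 2))"
  "k / 2 * (\<integral>v. ind {s<..t} v * exp (- (k * (v - s)) / 2) \<partial>lborel) = 1 - exp (- (k * (t - s)) / 2)"
proof -
 have ae: "AE v in lborel. ind {s<..t} v * exp (- (k * (v - s)) / 2) = ind {s..t} v *\<^sub>R exp (- (k * (v - s)) / 2)"
  using AE_lborel_singleton[of s] by eventually_elim (auto split: split_indicator)
 have "set_integrable lborel {s..t} (%v. exp (- (k * (v - s)) / 2))"
  by (intro borel_integrable_atLeastAtMost') (auto intro!: continuous_intros)
 thus i: "integrable lborel (%v. ind {s<..t} v * exp (- (k * (v - s)) / 2))"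
  using integrable_cong_AE[THEN iffD2, OF _ _ ae] by (auto simp: set_integrable_def)
 have "(\<integral>v. ind {s<..t} v * (k / 2 * exp (- (k * (v - s)) / 2)) \<partial>lborel) = (\<integral>v. ind {s..t} v *\<^sub>R (k / 2 * exp (- (k * (v - s)) / 2)) \<partial>lborel)"
 proof (intro integral_cong_AE)
  show "AE v in lborel. ind {s<..t} v * (k / 2 * exp (- (k * (v - s)) / 2)) = ind {s..t} v *\<^sub>R (k / 2 * exp (- (k * (v - s)) / 2))"
   using AE_lborel_singleton[of s] by eventually_elim (auto split: split_indicator)
 qed simp_all
 also have "... = (- exp (- (k * (t - s)) / 2)) - (- exp (- (k * (s - s)) / 2))"
 proof (rule integral_FTC_atLeastAtMost[OF assms])
  fix x show "((%v. - exp (- (k * (v - s)) / 2)) has_vector_derivative k / 2 * exp (- (k * (x - s)) / 2)) (at x within {s..t})"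
   by (auto intro!: derivative_eq_intros simp: has_real_derivative_iff_has_vector_derivative[symmetric])
 qed (auto intro!: continuous_intros)
 finally have "(\<integral>v. k / 2 * (ind {s<..t} v * exp (- (k * (v - s)) / 2)) \<partial>lborel) = 1 - exp (- (k * (t - s)) / 2)"
  by (simp add: mult.left_commute)
 thus "k / 2 * (\<integral>v. ind {s<..t} v * exp (- (k * (v - s)) / 2) \<partial>lborel) = 1 - exp (- (k * (t - s)) / 2)"
  by simp
qed

text \<open>With a frozen coefficient the conditional mean of the cosine at time \<open>v\<close> is
  \<open>cos (\<psi> w) * exp (- (k w * (v - s)) / 2)\<close>, where
  \<open>k w = u^2 * (\<xi> w)^2\<close>. Integrating \<open>k w / 2\<close> times this over
  \<open>v\<close> gives \<open>cos (\<psi> w)\<close> times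
  \<open>1 - exp (- (k w * (t - s)) / 2)\<close>, which cancels the mean difference of the
  cosines.\<close>

lemma cos_increment_interval:
 assumes st: "0 <= s" "s <= t" and B: "B \<in> sets (F s)"
  and xi: "\<xi> \<in> borel_measurable (F s)" "!!w. \<bar>\<xi> w\<bar> <= K"
  and Xs: "X s \<in> borel_measurable (F s)"
  and X: "!!v w. s <= v ==> v <= t ==> X v w = X s w + \<xi> w * (W v w - W s w)"
  and H: "!!v w. s < v ==> v <= t ==> H v w = \<xi> w"
 shows "expectation (%w. ind B w * cos_increment X H u th s t w) = 0"
proof (cases "s = t")
 case True thus ?thesis by (simp add: cos_increment_def)
next
 case False
 with st have lt: "s < t" by simp
 define \<psi> where "\<psi> w = u * X s w + th" for w
 define k where "k w = u^2 * (\<xi> w)^2" for w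
 have [measurable]: "\<xi> \<in> borel_measurable P" "X s \<in> borel_measurable P" "B \<in> sets P"
  by (auto intro: measurable_F_P[OF xi(1)] measurable_F_P[OF Xs] sets_F_sub[OF B])
 have [measurable]: "\<psi> \<in> borel_measurable P" unfolding \<psi>_def by measurable
 have [measurable]: "\<psi> \<in> borel_measurable (F s)" unfolding \<psi>_def using Xs by measurable
 note [measurable] = process_joint_measurable[OF W_measurable W_cont]
 have [measurable]: "W s \<in> borel_measurable P" "W t \<in> borel_measurable P" using st W_measurable by auto
 define Wv where "Wv v w = W (max 0 v) w" for v w
 have [measurable]: "(%x. Wv (fst x) (snd x)) \<in> borel_measurable (borel \<Otimes>\<^sub>M P)"
  unfolding Wv_def by measurable
 have [measurable]: "Wv v \<in> borel_measurable P" for v unfolding Wv_def by (rule W_measurable) simp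
 \<comment> \<open>\<open>h\<close> is the drift integrand and \<open>e\<close> what conditioning on
   \<open>F s\<close> makes of it. Their means agree for every \<open>v\<close>, and Fubini carries
   this over to the time integrals.\<close>
 define h where "h v w = ind B w * (ind {s<..t} v * (cos (\<psi> w + u * \<xi> w * (Wv v w - W s w)) * (\<xi> w)^2))" for v w
 define e where "e v w = ind B w * (ind {s<..t} v * ((\<xi> w)^2 * (cos (\<psi> w) * exp (- (k w * (v - s)) / 2))))" for v w
 have [measurable]: "k \<in> borel_measurable P" unfolding k_def by measurable
 have K0: "0 <= K" using xi(2)[of undefined] by linarith
 have xiK: "(\<xi> w)^2 <= K^2" for w using xi(2)[of w] K0 by (simp add: abs_le_square_iff[symmetric])
 interpret lp: pair_sigma_finite lborel P ..
 have ind_int: "integrable (lborel \<Otimes>\<^sub>M P) (%x. ind {s<..t} (fst x) * K^2)"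
 proof -
  have "integrable (lborel \<Otimes>\<^sub>M P) (%x. ind ({s<..t} \<times> space P) x :: real)"
   using lt by (intro integrable_real_indicator) (auto simp: emeasure_pair_measure_Times emeasure_space_1)
  also have "?this \<longleftrightarrow> integrable (lborel \<Otimes>\<^sub>M P) (%x. ind {s<..t} (fst x) :: real)"
   by (intro Bochner_Integration.integrable_cong) (auto simp: space_pair_measure split: split_indicator)
  finally show ?thesis by (rule integrable_mult_left)
 qed
 have hi: "integrable (lborel \<Otimes>\<^sub>M P) (%(v, w). h v w)"
 proof (rule Bochner_Integration.integrable_bound[OF ind_int])
  show "(%(v, w). h v w) \<in> borel_measurable (lborel \<Otimes>\<^sub>M P)" unfolding h_def split_beta' by measurable
  have "\<bar>cos a * (\<xi> w)^2\<bar> <= 1 * K^2" for a w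
   unfolding abs_mult using xiK by (intro mult_mono) auto
  hence "\<bar>h v w\<bar> <= ind {s<..t} v * K^2" for v w
   by (cases "v \<in> {s<..t}"; cases "w \<in> B"; simp add: h_def)
  thus "AE x in lborel \<Otimes>\<^sub>M P. norm (case x of (v, w) => h v w) <= norm (ind {s<..t} (fst x) * K^2)"
   by (intro AE_I2) (simp add: split_beta' abs_mult)
 qed
 have ei: "integrable (lborel \<Otimes>\<^sub>M P) (%(v, w). e v w)"
 proof (rule Bochner_Integration.integrable_bound[OF ind_int])
  show "(%(v, w). e v w) \<in> borel_measurable (lborel \<Otimes>\<^sub>M P)" unfolding e_def split_beta' by measurable
  have "\<bar>(\<xi> w)\<^sup>2 * (cos (\<psi> w) * exp (- (k w * (v - s)) / 2))\<bar> <= K^2 * (1 * 1)" if "s < v" for v w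
   unfolding abs_mult using that xiK by (intro mult_mono) (auto simp: k_def)
  hence "\<bar>e v w\<bar> <= ind {s<..t} v * K^2" for v w
   by (cases "v \<in> {s<..t}"; cases "w \<in> B"; simp add: e_def)
  thus "AE x in lborel \<Otimes>\<^sub>M P. norm (case x of (v, w) => e v w) <= norm (ind {s<..t} (fst x) * K^2)"
   by (intro AE_I2) (simp add: split_beta' abs_mult)
 qed
 have sw: "(\<integral>w. (\<integral>v. f v w \<partial>lborel) \<partial>P) = (\<integral>v. (\<integral>w. f v w \<partial>P) \<partial>lborel)"
  if "integrable (lborel \<Otimes>\<^sub>M P) (%(v, w). f v w)" for f :: "real => 'a => real"
  using lp.integral_fst'[OF that] lp.integral_snd[OF that] by simp
 have he: "(\<integral>w. h v w \<partial>P) = (\<integral>w. e v w \<partial>P)" for v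
 proof (cases "v \<in> {s<..t}")
  case True
  have "(\<integral>w. h v w \<partial>P) = (\<integral>w. (ind B w * (\<xi> w)^2) * cos (\<psi> w + (u * \<xi> w) * (W v w - W s w)) \<partial>P)"
   using True st by (intro Bochner_Integration.integral_cong) (auto simp: h_def Wv_def max_def)
  also have "... = (\<integral>w. (ind B w * (\<xi> w)^2) * (cos (\<psi> w) * exp (- ((u * \<xi> w)^2 * (v - s)) / 2)) \<partial>P)"
   using True st xi B xiK by (intro gauss_increment[where K="K^2"]) (auto split: split_indicator)
  also have "... = (\<integral>w. e v w \<partial>P)"
   using True by (intro Bochner_Integration.integral_cong) (auto simp: e_def k_def power_mult_distrib)
  finally show ?thesis .
 qed (auto simp: h_def e_def)
 have hP: "integrable P (%w. \<integral>v. h v w \<partial>lborel)"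
  using lp.integrable_snd[OF hi] .
 have key: "expectation (%w. \<integral>v. h v w \<partial>lborel) = expectation (%w. \<integral>v. e v w \<partial>lborel)"
  by (simp add: sw hi ei he)
 have ek: "u^2 / 2 * (\<integral>v. e v w \<partial>lborel) = ind B w * (cos (\<psi> w) * (1 - exp (- (k w * (t - s)) / 2)))" for w
 proof -
  have "(\<integral>v. e v w \<partial>lborel) = (\<integral>v. (ind B w * (\<xi> w)^2 * cos (\<psi> w)) * (ind {s<..t} v * exp (- (k w * (v - s)) / 2)) \<partial>lborel)"
   by (intro Bochner_Integration.integral_cong) (auto simp: e_def)
  hence "u^2 / 2 * (\<integral>v. e v w \<partial>lborel) = ind B w * cos (\<psi> w) * (k w / 2 * (\<integral>v. ind {s<..t} v * exp (- (k w * (v - s)) / 2) \<partial>lborel))"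
   by (simp add: k_def)
  thus ?thesis using exp_time_integral(2)[OF st(2), of "k w"] by simp
 qed
 have main: "expectation (%w. ind B w * cos (\<psi> w + (u * \<xi> w) * (W t w - W s w))) = expectation (%w. ind B w * (cos (\<psi> w) * exp (- ((u * \<xi> w)^2 * (t - s)) / 2)))"
  using lt st xi B by (intro gauss_increment[where K=1]) (auto split: split_indicator)
 have bi: "integrable P (%w. ind B w * cos (f w))" if [measurable]: "f \<in> borel_measurable P" for f :: "'a => real"
  by (rule integrable_const_bound[of _ 1]) (auto split: split_indicator)
 have bi2: "integrable P (%w. ind B w * (cos (\<psi> w) * exp (- (k w * (t - s)) / 2)))"
 proof (rule integrable_const_bound[of _ 1])
  have "\<bar>cos (\<psi> w)\<bar> * exp (- (k w * (t - s)) / 2) <= 1 * 1" for w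
   using lt by (intro mult_mono) (auto simp: k_def)
  thus "AE w in P. norm (ind B w * (cos (\<psi> w) * exp (- (k w * (t - s)) / 2))) <= 1"
   by (auto simp: abs_mult split: split_indicator)
 qed measurable
 have "expectation (%w. ind B w * cos_increment X H u th s t w)
   = expectation (%w. ind B w * cos (\<psi> w + (u * \<xi> w) * (W t w - W s w)) - ind B w * cos (\<psi> w) + u^2 / 2 * (\<integral>v. h v w \<partial>lborel))"
 proof (intro Bochner_Integration.integral_cong refl)
  fix w
  have "u^2 / 2 * (\<integral>v. h v w \<partial>lborel) = ind B w * (u^2 / 2 * (\<integral>v. ind {s<..t} v * (cos (u * X v w + th) * (H v w)^2) \<partial>lborel))"
  proof -
   have "(\<integral>v. h v w \<partial>lborel) = (\<integral>v. ind B w * (ind {s<..t} v * (cos (u * X v w + th) * (H v w)^2)) \<partial>lborel)"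
   proof (intro Bochner_Integration.integral_cong refl)
    fix v
    show "h v w = ind B w * (ind {s<..t} v * (cos (u * X v w + th) * (H v w)^2))"
    proof (cases "v \<in> {s<..t}")
     case True
     hence v: "s <= v" "v <= t" "s < v" "max 0 v = v" using st by auto
     have "u * X v w + th = \<psi> w + u * \<xi> w * (Wv v w - W s w)"
      by (simp add: X[OF v(1,2)] Wv_def v(4) \<psi>_def algebra_simps)
     thus ?thesis using True H[OF v(3,2)] by (simp add: h_def)
    qed (simp add: h_def)
   qed
   thus ?thesis by simp
  qed
  note hI = this
  show "ind B w * cos_increment X H u th s t w = ind B w * cos (\<psi> w + (u * \<xi> w) * (W t w - W s w)) - ind B w * cos (\<psi> w) + u^2 / 2 * (\<integral>v. h v w \<partial>lborel)"
  proof -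
   have t: "u * X t w + th = \<psi> w + (u * \<xi> w) * (W t w - W s w)"
    by (simp add: X[OF st(2) order_refl] \<psi>_def algebra_simps)
   show ?thesis unfolding cos_increment_def t hI
    by (simp add: \<psi>_def ring_distribs)
  qed
 qed
 also have "... = expectation (%w. ind B w * cos (\<psi> w + (u * \<xi> w) * (W t w - W s w))) - expectation (%w. ind B w * cos (\<psi> w)) + u^2 / 2 * expectation (%w. \<integral>v. h v w \<partial>lborel)"
  using hP bi by simp
 also have "u^2 / 2 * expectation (%w. \<integral>v. h v w \<partial>lborel) = expectation (%w. u\<^sup>2 / 2 * (\<integral>v. e v w \<partial>lborel))"
  by (simp add: key)
 also have "... = expectation (%w. ind B w * cos (\<psi> w) - ind B w * (cos (\<psi> w) * exp (- (k w * (t - s)) / 2)))"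
  unfolding ek by (simp add: algebra_simps)
 also have "... = expectation (%w. ind B w * cos (\<psi> w)) - expectation (%w. ind B w * (cos (\<psi> w) * exp (- (k w * (t - s)) / 2)))"
  using bi bi2 by simp
 finally show ?thesis using main by (simp add: k_def power_mult_distrib)
qed

end

lemma integrable_indicator_Ioc: "integrable lborel (ind {s<..t::real} :: real => real)"
 by (cases "s <= t") (auto intro!: integrable_real_indicator)

context usual_filtration
begin

lemma pathwise_measurable:
 assumes "(%x. f (fst x) (snd x)) \<in> borel_measurable (borel \<Otimes>\<^sub>M P)" "w \<in> space P"
 shows "(%v. f v w) \<in> borel_measurable borel"
 using measurable_compose[OF measurable_Pair2'[OF assms(2)] assms(1)] by simp

lemma time_integrand_measurable:
 fixes X H :: "real => 'a => real"
 assumes X: "!!v. 0 <= v ==> X v \<in> borel_measurable P" "continuous_paths P X"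
  and H: "(%x. H (max 0 (fst x)) (snd x)) \<in> borel_measurable (borel \<Otimes>\<^sub>M P)"
  and g: "g \<in> borel_measurable borel" and s: "0 <= s"
 shows "(%x. ind {s<..t} (fst x) * (g (X (fst x) (snd x)) * (H (fst x) (snd x))^2) :: real) \<in> borel_measurable (borel \<Otimes>\<^sub>M P)"
proof -
 have "(%x. ind {s<..t} (fst x) * (g (X (fst x) (snd x)) * (H (fst x) (snd x))^2) :: real)
  = (%x. ind {s<..t} (fst x) * (g (X (max 0 (fst x)) (snd x)) * (H (max 0 (fst x)) (snd x))^2))"
  using s by (auto simp: fun_eq_iff max_def split: split_indicator)
 moreover note [measurable] = process_joint_measurable[OF X] H g
 have "(%x. ind {s<..t} (fst x) * (g (X (max 0 (fst x)) (snd x)) * (H (max 0 (fst x)) (snd x))^2) :: real) \<in> borel_measurable (borel \<Otimes>\<^sub>M P)"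
  by measurable
 ultimately show ?thesis by simp
qed

lemma integral_over_time_measurable:
 assumes "(%x. f (fst x) (snd x) :: real) \<in> borel_measurable (borel \<Otimes>\<^sub>M P)"
 shows "(%w. \<integral>v. f v w \<partial>lborel) \<in> borel_measurable P"
proof -
 have [measurable]: "(%x. f (fst x) (snd x)) \<in> borel_measurable (lborel \<Otimes>\<^sub>M P)"
  using assms by (subst measurable_cong_sets[OF sets_pair_measure_cong[OF sets_lborel refl] refl])
 have "(%(w, v). f v w) = (%x. f (fst x) (snd x)) \<circ> (%(w, v). (v, w))" by auto
 also have "... \<in> borel_measurable (P \<Otimes>\<^sub>M lborel)"
  by (rule measurable_comp[OF measurable_pair_swap']) measurable
 finally show ?thesis by (rule lborel.borel_measurable_lebesgue_integral)
qed

lemma cos_increment_measurable: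
 fixes X H :: "real => 'a => real"
 assumes X: "!!v. 0 <= v ==> X v \<in> borel_measurable P" "continuous_paths P X"
  and H: "(%x. H (max 0 (fst x)) (snd x)) \<in> borel_measurable (borel \<Otimes>\<^sub>M P)"
  and s: "0 <= s" "s <= t"
 shows "cos_increment X H u th s t \<in> borel_measurable P"
proof -
 have [measurable]: "X s \<in> borel_measurable P" "X t \<in> borel_measurable P" using X s by auto
 have [measurable]: "(%w. \<integral>v. ind {s<..t} v * (cos (u * X v w + th) * (H v w)^2) \<partial>lborel) \<in> borel_measurable P"
  by (rule integral_over_time_measurable[OF time_integrand_measurable[OF X H _ s(1)]]) measurable
 show ?thesis unfolding cos_increment_def[abs_def] by measurable
qed

end

lemma cos_increment_add:
 assumes "s <= t" "t <= r"
  and i: "integrable lborel (%v. ind {s<..r} v * (cos (u * X v w + th) * (H v w)^2))"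
 shows "cos_increment X H u th s r w = cos_increment X H u th s t w + cos_increment X H u th t r w"
proof -
 let ?f = "%v. cos (u * X v w + th) * (H v w)^2"
 have sub: "integrable lborel (%v. ind A v * ?f v)" if "A \<subseteq> {s<..r}" "A \<in> sets borel" for A
 proof -
  have "(%v. ind A v * ?f v) = (%v. ind A v *\<^sub>R (ind {s<..r} v * ?f v))"
   using that(1) by (auto simp: fun_eq_iff split: split_indicator)
  thus ?thesis using integrable_mult_indicator[OF _ i, of A] that by simp
 qed
 have "(\<integral>v. ind {s<..r} v * ?f v \<partial>lborel) = (\<integral>v. ind {s<..t} v * ?f v + ind {t<..r} v * ?f v \<partial>lborel)"
  using assms by (intro Bochner_Integration.integral_cong) (auto split: split_indicator)
 also have "... = (\<integral>v. ind {s<..t} v * ?f v \<partial>lborel) + (\<integral>v. ind {t<..r} v * ?f v \<partial>lborel)"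
  using assms by (intro Bochner_Integration.integral_add sub) auto
 finally show ?thesis by (simp add: cos_increment_def algebra_simps)
qed

section \<open>Ito's formula for a simple integrand\<close>

locale simple_process = bm_filtration P F W for P :: "'a measure" and F W +
 fixes ts :: "real list" and xi :: "nat => 'a => real"
 assumes sp: "simple_predictable F ts xi"
begin

abbreviation "n \<equiv> length ts - 1"
abbreviation "X \<equiv> simple_integral W ts xi"
abbreviation "H \<equiv> simple_proc ts xi"

lemma ts_less: "i < j ==> j <= n ==> ts ! i < ts ! j"
 using sp by (auto simp: simple_predictable_def sorted_wrt_iff_nth_less)

lemma ts_le: "i <= j ==> j <= n ==> ts ! i <= ts ! j"
 using ts_less[of i j] by (cases "i = j") auto

lemma ts_0: "ts ! 0 = 0"
 using sp by (auto simp: simple_predictable_def)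

lemma ts_nonneg: "i <= n ==> 0 <= ts ! i"
 using ts_le[of 0 i] ts_0 by simp

lemma xi_meas: "i < n ==> xi i \<in> borel_measurable (F (ts ! i))"
 using sp by (auto simp: simple_predictable_def)

lemma xi_meas': "i < n ==> xi i \<in> borel_measurable P"
 using xi_meas measurable_F_P by blast

lemma xi_bound: "i < n ==> EX B. ALL w. \<bar>xi i w\<bar> <= B"
 using sp by (auto simp: simple_predictable_def)

lemma integral_diff:
 "X v w - X s w = (\<Sum>j<n. xi j w * (W (min v (ts ! Suc j)) w - W (min v (ts ! j)) w - (W (min s (ts ! Suc j)) w - W (min s (ts ! j)) w)))"
 unfolding simple_integral_def by (simp add: sum_subtractf[symmetric] algebra_simps)

lemma integral_step:
 assumes i: "i < n" and s: "ts ! i <= s" "s <= v" "v <= ts ! Suc i"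
 shows "X v w = X s w + xi i w * (W v w - W s w)"
proof -
 have "X v w - X s w = (\<Sum>j<n. if i = j then xi i w * (W v w - W s w) else 0)"
  unfolding integral_diff
 proof (intro sum.cong refl)
  fix j assume j: "j \<in> {..<n}"
  consider "j < i" | "j = i" | "i < j" by linarith
  thus "xi j w * (W (min v (ts ! Suc j)) w - W (min v (ts ! j)) w - (W (min s (ts ! Suc j)) w - W (min s (ts ! j)) w)) =
   (if i = j then xi i w * (W v w - W s w) else 0)"
  proof cases
   case 1
   hence "ts ! Suc j <= s" "ts ! j <= s" using ts_le[of "Suc j" i] ts_le[of j i] i s by auto
   thus ?thesis using 1 s by (simp add: min_absorb2)
  next
   case 2
   thus ?thesis using s by (simp add: min_absorb1 min_absorb2)
  next
   case 3
   hence "v <= ts ! Suc j" "v <= ts ! j" using ts_le[of "Suc i" j] ts_le[of "Suc i" "Suc j"] j s by auto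
   thus ?thesis using 3 s by (simp add: min_absorb1)
  qed
 qed
 also have "... = xi i w * (W v w - W s w)" using i by (subst sum.delta') auto
 finally show ?thesis by simp
qed

lemma integral_const:
 assumes "ts ! n <= s" "s <= v" shows "X v w = X s w"
proof -
 have "X v w - X s w = (\<Sum>j<n. 0)"
  unfolding integral_diff
 proof (intro sum.cong refl)
  fix j assume j: "j \<in> {..<n}"
  hence "ts ! Suc j <= s" "ts ! j <= s" using ts_le[of "Suc j" n] ts_le[of j n] assms by auto
  thus "xi j w * (W (min v (ts ! Suc j)) w - W (min v (ts ! j)) w - (W (min s (ts ! Suc j)) w - W (min s (ts ! j)) w)) = 0"
   using assms by (simp add: min_absorb2)
 qed
 thus ?thesis by simp
qed

lemma integral_0: "X 0 w = 0"
 unfolding simple_integral_def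
 by (rule sum.neutral) (auto simp: min_absorb1 ts_nonneg)

lemma proc_step:
 assumes i: "i < n" and v: "ts ! i < v" "v <= ts ! Suc i"
 shows "H v w = xi i w"
proof -
 have "H v w = (\<Sum>j<n. if i = j then xi i w else 0)"
  unfolding simple_proc_def
 proof (intro sum.cong refl)
  fix j assume j: "j \<in> {..<n}"
  consider "j < i" | "j = i" | "i < j" by linarith
  thus "xi j w * ind {ts ! j<..ts ! Suc j} v = (if i = j then xi i w else 0)"
  proof cases
   case 1
   thus ?thesis using ts_le[of "Suc j" i] i v by auto
  next
   case 2 thus ?thesis using v by auto
  next
   case 3 thus ?thesis using ts_le[of "Suc i" j] j v by auto
  qed
 qed
 also have "... = xi i w" using i by (subst sum.delta') auto
 finally show ?thesis .
qed

lemma proc_out: "ts ! n < v ==> H v w = 0"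
 unfolding simple_proc_def
proof (rule sum.neutral, intro ballI)
 fix j assume "ts ! n < v" "j \<in> {..<n}"
 thus "xi j w * ind {ts ! j<..ts ! Suc j} v = 0" using ts_le[of "Suc j" n] by auto
qed

lemma integral_adapted:
 assumes v: "0 <= v" shows "X v \<in> borel_measurable (F v)"
proof -
 have "(%w. xi j w * (W (min v (ts ! Suc j)) w - W (min v (ts ! j)) w)) \<in> borel_measurable (F v)" if j: "j < n" for j
 proof (cases "ts ! j <= v")
  case True
  have [measurable]: "xi j \<in> borel_measurable (F v)" by (rule measurable_F_mono[OF xi_meas[OF j] True])
  have [measurable]: "W (min v (ts ! Suc j)) \<in> borel_measurable (F v)" "W (min v (ts ! j)) \<in> borel_measurable (F v)"
   using v ts_nonneg[of j] ts_nonneg[of "Suc j"] j by (auto intro!: measurable_F_mono[OF W_adapted])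
  show ?thesis by measurable
 next
  case False
  hence "min v (ts ! Suc j) = v" "min v (ts ! j) = v" using ts_less[of j "Suc j"] j by auto
  thus ?thesis by simp
 qed
 thus ?thesis unfolding simple_integral_def[abs_def] by (intro borel_measurable_sum) auto
qed

lemma integral_measurable: "0 <= v ==> X v \<in> borel_measurable P"
 by (rule measurable_F_P[OF integral_adapted])

lemma integral_continuous: "continuous_paths P X"
 unfolding continuous_paths_def
proof (intro ballI)
 fix w assume "w \<in> space P"
 hence W: "continuous_on {0..} (%t. W t w)" using W_cont by (auto simp: continuous_paths_def)
 show "continuous_on {0..} (%t. X t w)"
  unfolding simple_integral_def
  by (intro continuous_intros continuous_on_compose2[OF W]) (auto simp: ts_nonneg)
qed

lemma proc_measurable: "(%x. H (fst x) (snd x)) \<in> borel_measurable (borel \<Otimes>\<^sub>M P)"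
proof -
 have [measurable]: "(%x. xi j (snd x)) \<in> borel_measurable (borel \<Otimes>\<^sub>M P)" if "j < n" for j
  by (rule measurable_compose[OF measurable_snd xi_meas'[OF that]])
 show ?thesis unfolding simple_proc_def
  by (intro borel_measurable_sum borel_measurable_times) (auto intro: measurable_compose[OF measurable_fst])
qed

lemma proc_measurable': "(%x. H (max 0 (fst x)) (snd x)) \<in> borel_measurable (borel \<Otimes>\<^sub>M P)"
proof -
 have "(%x. (max 0 (fst x), snd x)) \<in> (borel :: real measure) \<Otimes>\<^sub>M P \<rightarrow>\<^sub>M borel \<Otimes>\<^sub>M P" by measurable
 from measurable_compose[OF this proc_measurable] show ?thesis by simp
qed

lemma proc_bounded: "\<exists>K\<ge>0. ALL v w. \<bar>H v w\<bar> <= K"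
proof -
 obtain b where b: "!!i w. i < n ==> \<bar>xi i w\<bar> <= b i" using xi_bound by metis
 have "\<bar>H v w\<bar> <= (\<Sum>j<n. \<bar>b j\<bar>)" for v w
  unfolding simple_proc_def
 proof (intro order_trans[OF sum_abs] sum_mono)
  fix i assume "i \<in> {..<n}"
  hence "\<bar>xi i w\<bar> <= \<bar>b i\<bar>" using b[of i w] by auto
  thus "\<bar>xi i w * ind {ts ! i<..ts ! Suc i} v\<bar> <= \<bar>b i\<bar>"
   by (cases "v \<in> {ts ! i<..ts ! Suc i}") auto
 qed
 thus ?thesis by (intro exI[of _ "\<Sum>j<n. \<bar>b j\<bar>"]) (auto intro!: sum_nonneg)
qed

lemma bounded_time_integrable:
 fixes f :: "real => real"
 assumes m: "f \<in> borel_measurable borel" and b: "!!v. \<bar>f v\<bar> <= (K::real)"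
 shows "integrable lborel (%v. ind {s<..t} v * f v)"
proof (rule Bochner_Integration.integrable_bound)
 show "integrable lborel (%v. K * ind {s<..t} v)"
  by (intro integrable_mult_right integrable_indicator_Ioc)
 show "AE v in lborel. norm (ind {s<..t} v * f v) <= norm (K * ind {s<..t} v)"
  unfolding real_norm_def using order_trans[OF b abs_ge_self] by (intro AE_I2) (simp split: split_indicator)
qed (use m in measurable)

text \<open>The bounded function \<open>g\<close> is left open because it is a cosine in Ito's
  formula but a distance to \<open>[l, r]\<close> when the range of the solution is studied.\<close>

lemma path_integrable:
 assumes w: "w \<in> space P" and s: "0 <= s" and g: "g \<in> borel_measurable borel" "!!x. \<bar>g x\<bar> <= L"
 shows "integrable lborel (%v. ind {s<..t} v * (g (X v w) * (H v w)^2))"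
  "\<bar>\<integral>v. ind {s<..t} v * (g (X v w) * (H v w)^2) \<partial>lborel\<bar> <= L * (\<integral>v. ind {s<..t} v * (H v w)^2 \<partial>lborel)"
proof -
 obtain K where K: "0 <= K" "!!v w. \<bar>H v w\<bar> <= K" using proc_bounded by auto
 have L: "0 <= L" using g(2)[of 0] by linarith
 have K2: "(H v w)^2 <= K^2" for v using K by (simp add: abs_le_square_iff[symmetric])
 have m: "(%v. ind {s<..t} v * (g (X v w) * (H v w)^2)) \<in> borel_measurable borel"
  by (rule pathwise_measurable[OF time_integrand_measurable[OF integral_measurable integral_continuous proc_measurable' g(1) s] w])
 have m1: "(%v. H v w) \<in> borel_measurable borel"
  by (rule pathwise_measurable[OF proc_measurable w])
 have i1: "integrable lborel (%v. ind {s<..t} v * (H v w)^2)"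
  using m1 K2 by (intro bounded_time_integrable[where K="K^2"]) auto
 have le: "\<bar>ind {s<..t} v * (g (X v w) * (H v w)^2)\<bar> <= L * (ind {s<..t} v * (H v w)^2)" for v
  using mult_right_mono[OF g(2)[of "X v w"], of "(H v w)^2"] by (simp add: abs_mult split: split_indicator)
 show i: "integrable lborel (%v. ind {s<..t} v * (g (X v w) * (H v w)^2))"
 proof (rule Bochner_Integration.integrable_bound)
  show "integrable lborel (%v. L * (ind {s<..t} v * (H v w)^2))" using i1 by simp
  show "AE v in lborel. norm (ind {s<..t} v * (g (X v w) * (H v w)^2)) <= norm (L * (ind {s<..t} v * (H v w)^2))"
   unfolding real_norm_def by (intro AE_I2 order_trans[OF le abs_ge_self])
 qed (use m in simp)
 have "\<bar>\<integral>v. ind {s<..t} v * (g (X v w) * (H v w)^2) \<partial>lborel\<bar> <= (\<integral>v. \<bar>ind {s<..t} v * (g (X v w) * (H v w)^2)\<bar> \<partial>lborel)"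
  by (rule integral_abs_bound)
 also have "... <= (\<integral>v. L * (ind {s<..t} v * (H v w)^2) \<partial>lborel)"
  using i i1 le by (intro integral_mono) auto
 finally show "\<bar>\<integral>v. ind {s<..t} v * (g (X v w) * (H v w)^2) \<partial>lborel\<bar> <= L * (\<integral>v. ind {s<..t} v * (H v w)^2 \<partial>lborel)"
  by simp
qed

lemma proc_time_bound:
 assumes "0 <= s" "s <= t"
 shows "EX K. ALL w. (\<integral>v. ind {s<..t} v * (H v w)^2 \<partial>lborel) <= K"
proof -
 obtain K where K: "0 <= K" "!!v w. \<bar>H v w\<bar> <= K" using proc_bounded by auto
 have K2: "(H v w)^2 <= K^2" for v w using K by (simp add: abs_le_square_iff[symmetric])
 have "(\<integral>v. ind {s<..t} v * (H v w)^2 \<partial>lborel) <= (\<integral>v. K\<^sup>2 * ind {s<..t} v \<partial>lborel)" for w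
  by (intro integral_mono' integrable_mult_right integrable_indicator_Ioc)
    (use K2 in \<open>auto split: split_indicator\<close>)
 thus ?thesis by blast
qed

lemma cos_increment_integrable:
 assumes s: "0 <= s" "s <= t" and B: "B \<in> sets P"
 shows "integrable P (%w. ind B w * cos_increment X H u th s t w)"
proof -
 obtain K where K: "!!w. (\<integral>v. ind {s<..t} v * (H v w)^2 \<partial>lborel) <= K" using proc_time_bound[OF s] by auto
 note [measurable] = cos_increment_measurable[OF integral_measurable integral_continuous proc_measurable' s] B
 have "\<bar>cos_increment X H u th s t w\<bar> <= 2 + u^2 / 2 * K" if w: "w \<in> space P" for w
 proof -
  let ?I = "\<integral>v. ind {s<..t} v * (cos (u * X v w + th) * (H v w)^2) \<partial>lborel"
  have "\<bar>?I\<bar> <= 1 * (\<integral>v. ind {s<..t} v * (H v w)^2 \<partial>lborel)"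
   by (rule path_integrable(2)[OF w s(1), where g="%x. cos (u * x + th)"]) auto
  hence I: "\<bar>?I\<bar> <= K" using K[of w] by simp
  have "\<bar>u\<^sup>2 / 2 * ?I\<bar> <= u^2 / 2 * K" unfolding abs_mult using I by (intro mult_mono) auto
  moreover have "\<bar>cos (u * X t w + th)\<bar> <= 1" "\<bar>cos (u * X s w + th)\<bar> <= 1" by auto
  ultimately show ?thesis unfolding cos_increment_def by linarith
 qed
 hence "\<bar>ind B w * cos_increment X H u th s t w\<bar> <= \<bar>2 + u^2 / 2 * K\<bar>" if "w \<in> space P" for w
  using order_trans[OF _ abs_ge_self] that by (cases "w \<in> B") auto
 thus ?thesis
  unfolding real_norm_def[symmetric] by (intro integrable_const_bound[of _ "norm (2 + u^2 / 2 * K)"] AE_I2) auto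
qed

lemma cos_increment_compose:
 assumes "0 <= s" "s <= t" "t <= r" and B: "B \<in> sets (F s)"
  and e1: "expectation (%w. ind B w * cos_increment X H u th s t w) = 0"
  and e2: "expectation (%w. ind B w * cos_increment X H u th t r w) = 0"
 shows "expectation (%w. ind B w * cos_increment X H u th s r w) = 0"
proof -
 have "expectation (%w. ind B w * cos_increment X H u th s r w) =
  expectation (%w. ind B w * cos_increment X H u th s t w + ind B w * cos_increment X H u th t r w)"
 proof (intro Bochner_Integration.integral_cong refl)
  fix w assume w: "w \<in> space P"
  have "cos_increment X H u th s r w = cos_increment X H u th s t w + cos_increment X H u th t r w"
   by (rule cos_increment_add) (use assms path_integrable(1)[OF w, where g="%x. cos (u * x + th)" and L=1] in auto)
  thus "ind B w * cos_increment X H u th s r w = ind B w * cos_increment X H u th s t w + ind B w * cos_increment X H u th t r w"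
   by (simp add: algebra_simps)
 qed
 also have "... = 0"
  using assms sets_F_sub[OF B] by (subst Bochner_Integration.integral_add) (auto intro!: cos_increment_integrable)
 finally show ?thesis .
qed

text \<open>Induction on the partition point that bounds \<open>t\<close>. A time interval
  straddling \<open>ts ! i\<close> is split there, and the event \<open>B\<close> of
  \<open>F s\<close> also belongs to the later sigma-algebra at the splitting point.\<close>

lemma simple_cos_increment_upto:
 assumes "i <= n" "0 <= s" "s <= t" "t <= ts ! i" "B \<in> sets (F s)"
 shows "expectation (%w. ind B w * cos_increment X H u th s t w) = 0"
 using assms
proof (induction i arbitrary: s t B)
 case 0
 hence "s = t" using ts_0 by simp
 thus ?case by (simp add: cos_increment_def)
next
 case (Suc i)
 note st = Suc.prems
 have i: "i < n" using st by simp
 have step: "expectation (%w. ind B w * cos_increment X H u th s t w) = 0"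
  if "ts ! i <= s" "s <= t" "t <= ts ! Suc i" "B \<in> sets (F s)" for s t B
 proof -
  have s0: "0 <= s" using ts_nonneg[of i] i that(1) by simp
  obtain K where K: "!!w. \<bar>xi i w\<bar> <= K" using xi_bound[OF i] by auto
  show ?thesis
  proof (rule cos_increment_interval[where \<xi>="xi i" and K=K])
   show "xi i \<in> borel_measurable (F s)" by (rule measurable_F_mono[OF xi_meas[OF i] that(1)])
   show "X s \<in> borel_measurable (F s)" by (rule integral_adapted[OF s0])
   show "X v w = X s w + xi i w * (W v w - W s w)" if "s <= v" "v <= t" for v w
    using that \<open>ts ! i <= s\<close> \<open>t <= ts ! Suc i\<close> by (intro integral_step[OF i]) linarith+
   show "H v w = xi i w" if "s < v" "v <= t" for v w
    using that \<open>ts ! i <= s\<close> \<open>t <= ts ! Suc i\<close> by (intro proc_step[OF i]) linarith+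
  qed (fact s0 that K)+
 qed
 show ?case
 proof (cases "t <= ts ! i")
  case True
  thus ?thesis using Suc.IH[of s t B] st by auto
 next
  case F1: False
  show ?thesis
  proof (cases "ts ! i <= s")
   case True thus ?thesis using step st by auto
  next
   case False
   hence "B \<in> sets (F (ts ! i))" using st sets_F_mono[of s "ts ! i"] by auto
   thus ?thesis
    using False F1 st Suc.IH[of s "ts ! i" B] step[of "ts ! i" t B]
    by (intro cos_increment_compose[of s "ts ! i" t]) auto
  qed
 qed
qed

theorem simple_cos_increment:
 assumes st: "0 <= s" "s <= t" and B: "B \<in> sets (F s)"
 shows "expectation (%w. ind B w * cos_increment X H u th s t w) = 0"
proof -
 \<comment> \<open>Behind the last partition point the integral is constant and the integrand is
   zero, so the compensated increment vanishes pathwise.\<close>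
 have z: "expectation (%w. ind B w * cos_increment X H u th s t w) = 0"
  if "ts ! n <= s" "s <= t" "B \<in> sets (F s)" for s t B
 proof -
  have s0: "0 <= s" using ts_nonneg[of n] that(1) by simp
  have X: "X v w = X s w" if "s <= v" for v w using integral_const[of s v w] \<open>ts ! n <= s\<close> that by simp
  have H: "H v w = 0" if "s < v" for v w using proc_out[of v w] \<open>ts ! n <= s\<close> that by simp
  have "(%v. ind {s<..t} v * (cos (u * X v w + th) * (H v w)^2)) = (%_. 0)" for w
   using H by (auto simp: fun_eq_iff split: split_indicator)
  hence "cos_increment X H u th s t w = 0" for w
   using X[of t w] \<open>s <= t\<close> by (simp add: cos_increment_def)
  thus ?thesis by simp
 qed
 show ?thesis
 proof (cases "t <= ts ! n")
  case True
  thus ?thesis using simple_cos_increment_upto[of n s t B] st B by auto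
 next
  case F1: False
  show ?thesis
  proof (cases "ts ! n <= s")
   case True thus ?thesis using z st B by auto
  next
   case False
   hence "B \<in> sets (F (ts ! n))" using B sets_F_mono[of s "ts ! n"] by auto
   thus ?thesis
    using False F1 st B simple_cos_increment_upto[of n s "ts ! n" B] z[of "ts ! n" t B]
    by (intro cos_increment_compose[of s "ts ! n" t]) auto
  qed
 qed
qed

end

section \<open>Identification of occupation measures\<close>

text \<open>The function of \<open>x\<close> with second derivative \<open>g\<close> that vanishes
  to first order at \<open>y\<close>. Nonnegative integrals let \<open>g\<close> take the value
  infinity, as \<open>qdens \<eta>\<close> does outside the open interval.\<close>

definition double_integral :: "(real => ennreal) => real => real => ennreal" where
 "double_integral g y x = (\<integral>\<^sup>+ u. ind {min y x..max y x} u *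
   (\<integral>\<^sup>+ z. ind {min y u..max y u} z * g z \<partial>lborel) \<partial>lborel)"

lemma q_eq_double_integral: "q \<eta> = double_integral (qdens \<eta>)"
 by (simp add: fun_eq_iff q_def double_integral_def)

text \<open>For a regular \<open>g\<close> this is the first-order Taylor remainder of an
  antiderivative. Its nonnegativity is stated as well, because \<open>ennreal\<close> would
  otherwise truncate.\<close>

lemma double_integral_FTC:
 fixes F F1 g :: "real => real"
 assumes F: "!!x. (F has_real_derivative F1 x) (at x)"
  and F1: "!!x. (F1 has_real_derivative g x) (at x)"
  and g: "!!x. 0 <= g x" "g \<in> borel_measurable borel"
 shows "double_integral (%z. ennreal (g z)) y x = ennreal (F x - F y - F1 y * (x - y))"
  and "0 <= F x - F y - F1 y * (x - y)"
proof -
 have mono: "F1 a <= F1 b" if "a <= b" for a b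
  using that by (rule DERIV_nonneg_imp_nondecreasing) (use F1 g in blast)
 have F1c: "continuous_on UNIV F1"
  using F1 by (intro DERIV_continuous_on) (auto intro: DERIV_subset)
 have [measurable]: "F1 \<in> borel_measurable borel" using F1c by (rule borel_measurable_continuous_onI)
 have inner: "(\<integral>\<^sup>+ z. ind {min y u..max y u} z * ennreal (g z) \<partial>lborel) = ennreal \<bar>F1 u - F1 y\<bar>" for u
 proof -
  have "(\<integral>\<^sup>+ z. ennreal (g z) * ind {min y u..max y u} z \<partial>lborel) = F1 (max y u) - F1 (min y u)"
   by (rule nn_integral_FTC_Icc) (use F1 g in auto)
  thus ?thesis using mono[of y u] mono[of u y] by (auto simp: mult.commute min_def max_def abs_if)
 qed
 have D: "double_integral (%z. ennreal (g z)) y x = (\<integral>\<^sup>+ u. ennreal \<bar>F1 u - F1 y\<bar> * ind {min y x..max y x} u \<partial>lborel)"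
  unfolding double_integral_def inner by (simp add: mult.commute)
 have "double_integral (%z. ennreal (g z)) y x = ennreal (F x - F y - F1 y * (x - y)) & 0 <= F x - F y - F1 y * (x - y)"
 proof (cases "y <= x")
  case True
  have "(\<integral>\<^sup>+ u. ennreal \<bar>F1 u - F1 y\<bar> * ind {y..x} u \<partial>lborel) = (\<integral>\<^sup>+ u. ennreal (F1 u - F1 y) * ind {y..x} u \<partial>lborel)"
   using mono by (intro nn_integral_cong) (auto split: split_indicator)
  also have "... = (F x - F1 y * x) - (F y - F1 y * y)"
   using True mono by (intro nn_integral_FTC_Icc) (auto intro!: derivative_eq_intros F)
  finally have 1: "double_integral (%z. ennreal (g z)) y x = ennreal (F x - F y - F1 y * (x - y))"
   using True unfolding D by (simp add: algebra_simps)
  have "F y - F1 y * y <= F x - F1 y * x"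
  proof (rule DERIV_nonneg_imp_nondecreasing[OF True])
   fix u assume "y <= u" "u <= x"
   thus "EX d. ((%u. F u - F1 y * u) has_real_derivative d) (at u) & 0 <= d"
    using mono[of y u] by (intro exI[of _ "F1 u - F1 y"]) (auto intro!: derivative_eq_intros F)
  qed
  with 1 show ?thesis by (simp add: algebra_simps)
 next
  case False
  have "(\<integral>\<^sup>+ u. ennreal \<bar>F1 u - F1 y\<bar> * ind {x..y} u \<partial>lborel) = (\<integral>\<^sup>+ u. ennreal (F1 y - F1 u) * ind {x..y} u \<partial>lborel)"
   using mono by (intro nn_integral_cong) (auto split: split_indicator)
  also have "... = (F1 y * y - F y) - (F1 y * x - F x)"
   using False mono by (intro nn_integral_FTC_Icc) (auto intro!: derivative_eq_intros F)
  finally have 1: "double_integral (%z. ennreal (g z)) y x = ennreal (F x - F y - F1 y * (x - y))"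
   using False unfolding D by (simp add: algebra_simps)
  have "F1 y * x - F x <= F1 y * y - F y"
  proof (rule DERIV_nonneg_imp_nondecreasing[of x y "%u. F1 y * u - F u"])
   fix u assume "x <= u" "u <= y"
   thus "EX d. ((%u. F1 y * u - F u) has_real_derivative d) (at u) & 0 <= d"
    using mono[of u y] by (intro exI[of _ "F1 y - F1 u"]) (auto intro!: derivative_eq_intros F)
  qed (use False in simp)
  with 1 show ?thesis by (simp add: algebra_simps)
 qed
 thus "double_integral (%z. ennreal (g z)) y x = ennreal (F x - F y - F1 y * (x - y))"
  "0 <= F x - F y - F1 y * (x - y)" by auto
qed

section \<open>Moments recovered from trigonometric expectations at small frequencies\<close>

declare of_nat_Suc [simp del]

lemma sin_scaled_limit: "(%k. sin (a / real (Suc k)) * real (Suc k)) \<longlonglongrightarrow> a"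
proof (cases "a = 0")
 case False
 have "((%h. (sin (0 + h) - sin 0) / h) \<longlongrightarrow> (1::real)) (at 0)"
  using DERIV_sin[of "0::real"] by (simp add: DERIV_def)
 hence l: "((%h. sin h / h) \<longlongrightarrow> (1::real)) (at 0)" by simp
 have "(%k. a * (1 / real (Suc k))) \<longlonglongrightarrow> a * 0"
  by (intro tendsto_mult tendsto_const LIMSEQ_Suc[OF lim_1_over_n])
 hence "filterlim (%k. a / real (Suc k)) (at 0) sequentially"
  using False by (auto simp: filterlim_at)
 from filterlim_compose[OF l this]
 have "(%k. a * (sin (a / real (Suc k)) / (a / real (Suc k)))) \<longlonglongrightarrow> a * 1"
  by (intro tendsto_mult tendsto_const)
 moreover have "a * (sin (a / real (Suc k)) / (a / real (Suc k))) = sin (a / real (Suc k)) * real (Suc k)" for k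
  using False by (simp add: divide_simps del: of_nat_Suc)
 ultimately show ?thesis by simp
qed simp

lemma one_minus_cos_eq: "1 - cos x = 2 * (sin (x / 2))^2" for x :: real
 using cos_double_sin[of "x/2"] by simp

lemma cos_scaled_limit: "(%k. (1 - cos (a / real (Suc k))) * (real (Suc k))^2) \<longlonglongrightarrow> a\<^sup>2 / 2"
proof -
 have "(%k. 2 * (sin ((a / 2) / real (Suc k)) * real (Suc k))^2) \<longlonglongrightarrow> 2 * (a / 2)^2"
  by (intro tendsto_intros sin_scaled_limit)
 moreover have "(1 - cos (a / real (Suc k))) * (real (Suc k))^2 = 2 * (sin ((a / 2) / real (Suc k)) * real (Suc k))^2" for k
  unfolding one_minus_cos_eq by (simp add: power_mult_distrib mult.commute del: of_nat_Suc)
 ultimately show ?thesis by (simp add: power_divide)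
qed

lemma cos_scaled_bound: "0 <= (1 - cos (a / real (Suc k))) * (real (Suc k))^2" "(1 - cos (a / real (Suc k))) * (real (Suc k))^2 <= a^2 / 2"
proof -
 show "0 <= (1 - cos (a / real (Suc k))) * (real (Suc k))^2" by simp
 have "(1 - cos (a / real (Suc k))) <= 2 * (a / real (Suc k) / 2)^2"
  unfolding one_minus_cos_eq
  by (intro mult_left_mono abs_le_square_iff[THEN iffD1] abs_sin_x_le_abs_x) simp
 hence "(1 - cos (a / real (Suc k))) * (real (Suc k))^2 <= 2 * (a / real (Suc k) / 2)^2 * (real (Suc k))^2"
  by (intro mult_right_mono) auto
 thus "(1 - cos (a / real (Suc k))) * (real (Suc k))^2 <= a^2 / 2"
  by (simp add: field_simps)
qed

lemma sin_scaled_bound: "\<bar>sin (a / real (Suc k)) * real (Suc k)\<bar> <= \<bar>a\<bar>"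
proof -
 have "\<bar>sin (a / real (Suc k))\<bar> * real (Suc k) <= \<bar>a / real (Suc k)\<bar> * real (Suc k)"
  by (intro mult_right_mono abs_sin_x_le_abs_x) simp
 thus ?thesis by (simp add: abs_mult)
qed

context prob_space
begin

text \<open>Fatou along \<open>u = 1 / (k + 1)\<close>: the quotients
  \<open>(1 - cos (u * Y)) / u^2\<close> are nonnegative, tend to \<open>Y^2 / 2\<close>, and have
  means at most \<open>C\<close>.\<close>

lemma square_integrable_from_cos:
 fixes Y :: "'a => real"
 assumes Y[measurable]: "Y \<in> borel_measurable M"
  and C: "!!u. 0 < u ==> expectation (%w. 1 - cos (u * Y w)) <= C * u^2"
 shows "integrable M (%w. (Y w)\<^sup>2)"
proof -
 have ic: "integrable M (%w. cos (u * Y w))" for u by (rule integrable_const_bound[of _ 1]) auto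
 have le: "(\<integral>\<^sup>+w. ennreal ((1 - cos (Y w / real (Suc k))) * (real (Suc k))^2) \<partial>M) <= ennreal C" for k
 proof -
  have "(\<integral>\<^sup>+w. ennreal ((1 - cos (Y w / real (Suc k))) * (real (Suc k))^2) \<partial>M) = ennreal (\<integral>w. (1 - cos (Y w / real (Suc k))) * (real (Suc k))^2 \<partial>M)"
   using ic[of "1 / real (Suc k)"] cos_scaled_bound(1) by (intro nn_integral_eq_integral) auto
  also have "(\<integral>w. (1 - cos (Y w / real (Suc k))) * (real (Suc k))^2 \<partial>M) = expectation (%w. 1 - cos (1 / real (Suc k) * Y w)) * (real (Suc k))^2"
   by simp
  also have "... <= C * (1 / real (Suc k))^2 * (real (Suc k))^2"
   by (intro mult_right_mono C) auto
  finally show ?thesis by (simp add: power_divide ennreal_leI)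
 qed
 have "(\<integral>\<^sup>+w. ennreal ((Y w)^2 / 2) \<partial>M) = (\<integral>\<^sup>+w. liminf (%k. ennreal ((1 - cos (Y w / real (Suc k))) * (real (Suc k))^2)) \<partial>M)"
 proof (intro nn_integral_cong)
  fix w
  show "ennreal ((Y w)^2 / 2) = liminf (%k. ennreal ((1 - cos (Y w / real (Suc k))) * (real (Suc k))^2))"
   by (rule lim_imp_Liminf[symmetric]) (auto intro!: tendsto_ennrealI cos_scaled_limit)
 qed
 also have "... <= liminf (%k. \<integral>\<^sup>+w. ennreal ((1 - cos (Y w / real (Suc k))) * (real (Suc k))^2) \<partial>M)"
  by (rule nn_integral_liminf) measurable
 also have "... <= ennreal C"
  using Liminf_mono[of "%k. \<integral>\<^sup>+w. ennreal ((1 - cos (Y w / real (Suc k))) * (real (Suc k))^2) \<partial>M" "%_. ennreal C" sequentially] le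
  by (simp add: Liminf_const)
 finally have "integrable M (%w. (Y w)\<^sup>2 / 2)"
  by (intro integrableI_bounded) (auto intro: le_less_trans)
 from integrable_mult_right[OF this, of 2] show ?thesis by simp
qed

text \<open>\<open>sin (u * Y) / u\<close> tends to \<open>Y\<close> and is dominated by its
  modulus, while its mean is at most \<open>C * u\<close> in modulus.\<close>

lemma mean_zero_from_sin:
 fixes Y :: "'a => real"
 assumes Y: "integrable M Y"
  and C: "!!u. 0 < u ==> \<bar>expectation (%w. sin (u * Y w))\<bar> <= C * u^2"
 shows "expectation Y = 0"
proof -
 have [measurable]: "Y \<in> borel_measurable M" using Y by simp
 have l: "(%k. expectation (%w. sin (Y w / real (Suc k)) * real (Suc k))) \<longlonglongrightarrow> expectation Y"
 proof (rule integral_dominated_convergence[where w="%w. \<bar>Y w\<bar>"])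
  show "AE x in M. norm (sin (Y x / real (Suc k)) * real (Suc k)) <= \<bar>Y x\<bar>" for k
   unfolding real_norm_def by (intro AE_I2 sin_scaled_bound)
  show "AE x in M. (%k. sin (Y x / real (Suc k)) * real (Suc k)) \<longlonglongrightarrow> Y x"
   by (intro AE_I2 sin_scaled_limit)
 qed (use Y in auto)
 have b: "\<bar>expectation (%w. sin (Y w / real (Suc k)) * real (Suc k))\<bar> <= C * (1 / real (Suc k))" for k
 proof -
  have "\<bar>expectation (%w. sin (1 / real (Suc k) * Y w))\<bar> * real (Suc k) <= C * (1 / real (Suc k))^2 * real (Suc k)"
   by (intro mult_right_mono C) auto
  moreover have "expectation (%w. sin (Y w / real (Suc k)) * real (Suc k)) = expectation (%w. sin (1 / real (Suc k) * Y w)) * real (Suc k)"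
   by simp
  ultimately show ?thesis unfolding power2_eq_square by (simp add: abs_mult)
 qed
 have lim: "(%k. C * (1 / real (Suc k))) \<longlonglongrightarrow> 0"
  using tendsto_mult[OF tendsto_const LIMSEQ_Suc[OF lim_1_over_n], of C] by simp
 have "(%k. expectation (%w. sin (Y w / real (Suc k)) * real (Suc k))) \<longlonglongrightarrow> 0"
  by (rule Lim_null_comparison[OF _ lim]) (intro always_eventually allI, unfold real_norm_def, rule b)
 from LIMSEQ_unique[OF l this] show ?thesis .
qed

text \<open>Divide the cosine identity by \<open>u^2\<close> and let the frequency tend to zero: the
  left side yields half the difference of the second moments, the right side half the total mass of
  the finite measure \<open>\<nu>\<close>.\<close>

lemma second_moment_from_cos:
 fixes Y0 Y1 :: "'a => real"
 assumes Y: "integrable M (%w. (Y0 w)\<^sup>2)" "integrable M (%w. (Y1 w)\<^sup>2)"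
  and m[measurable]: "Y0 \<in> borel_measurable M" "Y1 \<in> borel_measurable M"
  and fin: "finite_measure \<nu>" and sets_nu: "sets \<nu> = sets (borel :: real measure)"
  and cosid: "!!u. expectation (%w. cos (u * Y1 w) - cos (u * Y0 w)) = - (u^2 / 2) * (\<integral>z. cos (u * z) \<partial>\<nu>)"
 shows "expectation (%w. (Y1 w)\<^sup>2) - expectation (%w. (Y0 w)\<^sup>2) = measure \<nu> UNIV"
proof -
 interpret nu: finite_measure \<nu> by fact
 note [measurable_cong] = sets_nu
 have sp: "space \<nu> = UNIV" using sets_eq_imp_space_eq[OF sets_nu] by simp
 have l: "(%k. expectation (%w. (1 - cos (Y w / real (Suc k))) * (real (Suc k))^2)) \<longlonglongrightarrow> expectation (%w. (Y w)\<^sup>2 / 2)"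
  if "integrable M (%w. (Y w)\<^sup>2)" and [measurable]: "Y \<in> borel_measurable M" for Y :: "'a => real"
 proof (rule integral_dominated_convergence[where w="%w. (Y w)\<^sup>2 / 2"])
  show "AE x in M. norm ((1 - cos (Y x / real (Suc k))) * (real (Suc k))^2) <= (Y x)^2 / 2" for k
   using cos_scaled_bound(1) cos_scaled_bound(2)[of _ k] by (intro AE_I2) (simp only: real_norm_def abs_of_nonneg)
 qed (use that in \<open>auto intro!: cos_scaled_limit\<close>)
 have l2: "(%k. \<integral>z. cos (z / real (Suc k)) \<partial>\<nu>) \<longlonglongrightarrow> (\<integral>z. 1 \<partial>\<nu>)"
 proof (rule integral_dominated_convergence[where w="%_. 1"])
  show "AE z in \<nu>. (%k. cos (z / real (Suc k))) \<longlonglongrightarrow> 1"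
  proof (intro AE_I2)
   fix z :: real
   have "(%k. cos (z * (1 / real (Suc k)))) \<longlonglongrightarrow> cos (z * 0)"
    by (intro tendsto_intros LIMSEQ_Suc[OF lim_1_over_n])
   thus "(%k. cos (z / real (Suc k))) \<longlonglongrightarrow> 1" by simp
  qed
 qed auto
 have ic: "integrable M (%w. cos (Y w / c))" if [measurable]: "Y \<in> borel_measurable M" for Y :: "'a => real" and c :: real by (rule integrable_const_bound[of _ 1]) auto
 have eq: "expectation (%w. (1 - cos (Y1 w / real (Suc k))) * (real (Suc k))^2) - expectation (%w. (1 - cos (Y0 w / real (Suc k))) * (real (Suc k))^2)
   = (\<integral>z. cos (z / real (Suc k)) \<partial>\<nu>) / 2" for k
 proof -
  have "expectation (%w. (1 - cos (Y1 w / real (Suc k))) * (real (Suc k))^2) - expectation (%w. (1 - cos (Y0 w / real (Suc k))) * (real (Suc k))^2)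
   = - expectation (%w. cos (1 / real (Suc k) * Y1 w) - cos (1 / real (Suc k) * Y0 w)) * (real (Suc k))^2"
   using ic[OF m(1)] ic[OF m(2)] by (simp add: algebra_simps)
  also have "... = (\<integral>z. cos (z / real (Suc k)) \<partial>\<nu>) / 2"
   unfolding cosid by (simp add: power_divide)
  finally show ?thesis .
 qed
 have "(%k. (\<integral>z. cos (z / real (Suc k)) \<partial>\<nu>) / 2) \<longlonglongrightarrow> expectation (%w. (Y1 w)\<^sup>2 / 2) - expectation (%w. (Y0 w)\<^sup>2 / 2)"
  using tendsto_diff[OF l[OF Y(2) m(2)] l[OF Y(1) m(1)]] unfolding eq .
 moreover have "(%k. (\<integral>z. cos (z / real (Suc k)) \<partial>\<nu>) / 2) \<longlonglongrightarrow> (\<integral>z. 1 \<partial>\<nu>) / 2"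
  using l2 by (intro tendsto_intros) auto
 ultimately have "expectation (%w. (Y1 w)\<^sup>2 / 2) - expectation (%w. (Y0 w)\<^sup>2 / 2) = (\<integral>z. 1 \<partial>\<nu>) / 2"
  using LIMSEQ_unique by blast
 thus ?thesis by (simp add: sp)
qed

declare of_nat_Suc [simp]

text \<open>By Tonelli the expected double integral is integration of \<open>g\<close> against a
  density, that is, a measure in \<open>g\<close>. This is what makes uniqueness of measures
  applicable to it.\<close>

lemma double_integral_kernel:
 fixes Y0 Y1 :: "'a => real"
 assumes [measurable]: "Y0 \<in> borel_measurable M" "Y1 \<in> borel_measurable M"
 shows "\<exists>\<kappa> \<in> borel_measurable borel. \<forall>g \<in> borel_measurable borel.
  (\<integral>\<^sup>+w. double_integral g (Y0 w) (Y1 w) \<partial>M) = (\<integral>\<^sup>+z. \<kappa> z * g z \<partial>lborel)"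
proof -
 interpret pl: pair_sigma_finite M lborel ..
 define J where "J w u z = (ind {min (Y0 w) (Y1 w)..max (Y0 w) (Y1 w)} u * ind {min (Y0 w) u..max (Y0 w) u} z :: ennreal)" for w u z
 have Jm: "(%(x, u). J (fst x) u (snd x)) \<in> borel_measurable ((M \<Otimes>\<^sub>M lborel) \<Otimes>\<^sub>M lborel)"
  unfolding J_def indicator_def atLeastAtMost_iff split_beta' by measurable
 have Ju[measurable]: "(%(w, z). \<integral>\<^sup>+u. J w u z \<partial>lborel) \<in> borel_measurable (M \<Otimes>\<^sub>M lborel)"
  using lborel.borel_measurable_nn_integral[OF Jm] by (simp add: split_beta')
 have Jp[measurable]: "(%(u, z). J w u z) \<in> borel_measurable (lborel \<Otimes>\<^sub>M lborel)" for w
  unfolding J_def indicator_def atLeastAtMost_iff split_beta' by measurable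
 have Jz[measurable]: "(%u. J w u z) \<in> borel_measurable lborel" for w z
  unfolding J_def indicator_def atLeastAtMost_iff by measurable
 define \<kappa> where "\<kappa> z = (\<integral>\<^sup>+w. \<integral>\<^sup>+u. J w u z \<partial>lborel \<partial>M)" for z
 have sw: "(%(z, w). \<integral>\<^sup>+u. J w u z \<partial>lborel) \<in> borel_measurable (lborel \<Otimes>\<^sub>M M)"
  using measurable_pair_swap[OF Ju] by (simp add: split_beta')
 have \<kappa>[measurable]: "\<kappa> \<in> borel_measurable borel"
  using borel_measurable_nn_integral[OF sw] unfolding \<kappa>_def by simp
 have "(\<integral>\<^sup>+w. double_integral g (Y0 w) (Y1 w) \<partial>M) = (\<integral>\<^sup>+z. \<kappa> z * g z \<partial>lborel)" if g[measurable]: "g \<in> borel_measurable borel" for g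
 proof -
  have "(\<integral>\<^sup>+z. \<kappa> z * g z \<partial>lborel) = (\<integral>\<^sup>+z. \<integral>\<^sup>+w. (\<integral>\<^sup>+u. J w u z \<partial>lborel) * g z \<partial>M \<partial>lborel)"
   unfolding \<kappa>_def using sw by (intro nn_integral_cong nn_integral_multc[symmetric]) (auto dest: measurable_Pair2)
  also have "... = (\<integral>\<^sup>+w. \<integral>\<^sup>+z. (\<integral>\<^sup>+u. J w u z \<partial>lborel) * g z \<partial>lborel \<partial>M)"
   by (rule pl.Fubini') (use Ju in \<open>measurable\<close>)
  also have "... = (\<integral>\<^sup>+w. \<integral>\<^sup>+z. \<integral>\<^sup>+u. J w u z * g z \<partial>lborel \<partial>lborel \<partial>M)"
   by (intro nn_integral_cong nn_integral_multc[symmetric]) simp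
  also have "... = (\<integral>\<^sup>+w. \<integral>\<^sup>+u. \<integral>\<^sup>+z. J w u z * g z \<partial>lborel \<partial>lborel \<partial>M)"
   by (intro nn_integral_cong lborel_pair.Fubini') measurable
  also have "... = (\<integral>\<^sup>+w. double_integral g (Y0 w) (Y1 w) \<partial>M)"
   unfolding double_integral_def J_def
   by (intro nn_integral_cong) (auto simp: mult.assoc nn_integral_cmult split: split_indicator)
  finally show ?thesis by simp
 qed
 with \<kappa> show ?thesis by blast
qed

text \<open>Both sides are integrals of \<open>g\<close> against measures, and the test functions
  \<open>1 + cos (u * z + th)\<close> decide equality of finite measures. For such a test function
  the double integral is an explicit Taylor remainder: its quadratic part is evaluated by the second
  moments, its cosine part by \<open>cosid\<close>, and its first-order sine part has mean zero by
  \<open>mart\<close>. Equality as measures then covers every nonnegative Borel \<open>g\<close>,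
  finite or not.\<close>

theorem occupation_identity:
 fixes Y0 Y1 :: "'a => real"
 assumes Y: "integrable M (%w. (Y0 w)\<^sup>2)" "integrable M (%w. (Y1 w)\<^sup>2)"
  and m[measurable]: "Y0 \<in> borel_measurable M" "Y1 \<in> borel_measurable M"
  and fin: "finite_measure \<nu>" and sets_nu: "sets \<nu> = sets (borel :: real measure)"
  and cosid: "!!u th. expectation (%w. cos (u * Y1 w + th) - cos (u * Y0 w + th)) = - (u^2 / 2) * (\<integral>z. cos (u * z + th) \<partial>\<nu>)"
  and mart: "!!u th. expectation (%w. sin (u * Y0 w + th) * (Y1 w - Y0 w)) = 0"
  and mart2: "expectation (%w. Y0 w * (Y1 w - Y0 w)) = 0"
  and g: "g \<in> borel_measurable borel"
 shows "(\<integral>\<^sup>+z. g z \<partial>\<nu>) = 2 * (\<integral>\<^sup>+w. double_integral g (Y0 w) (Y1 w) \<partial>M)"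
proof -
 interpret nu: finite_measure \<nu> by fact
 note [measurable_cong] = sets_nu
 have sp: "space \<nu> = UNIV" using sets_eq_imp_space_eq[OF sets_nu] by simp
 obtain \<kappa> where [measurable]: "\<kappa> \<in> borel_measurable borel"
  and \<kappa>: "!!g. g \<in> borel_measurable borel ==> (\<integral>\<^sup>+w. double_integral g (Y0 w) (Y1 w) \<partial>M) = (\<integral>\<^sup>+z. \<kappa> z * g z \<partial>lborel)"
  using double_integral_kernel[OF m] by blast
 define \<nu>2 where "\<nu>2 = density lborel (%z. 2 * \<kappa> z)"
 have n2: "(\<integral>\<^sup>+z. g z \<partial>\<nu>2) = 2 * (\<integral>\<^sup>+w. double_integral g (Y0 w) (Y1 w) \<partial>M)" if [measurable]: "g \<in> borel_measurable borel" for g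
  unfolding \<nu>2_def \<kappa>[OF that] by (simp add: nn_integral_density mult.assoc nn_integral_cmult)
 have YY: "integrable M (%w. Y0 w * Y1 w)"
 proof (rule Bochner_Integration.integrable_bound)
  show "integrable M (%w. (Y0 w)\<^sup>2 + (Y1 w)^2)" using Y by simp
  have "\<bar>a * b\<bar> <= a^2 + b^2" for a b :: real
   using zero_le_power2[of "\<bar>a\<bar> - \<bar>b\<bar>"] zero_le_power2[of a] zero_le_power2[of b] unfolding power2_diff abs_mult power2_abs by linarith
  thus "AE x in M. norm (Y0 x * Y1 x) <= norm ((Y0 x)^2 + (Y1 x)^2)" by (intro AE_I2) auto
 qed measurable
 have Y1': "integrable M Y" if "integrable M (%w. (Y w)\<^sup>2)" "Y \<in> borel_measurable M" for Y :: "'a => real"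
  using square_integrable_imp_integrable[OF that(2,1)] .
 have mom: "expectation (%w. (Y1 w - Y0 w)\<^sup>2) = measure \<nu> UNIV"
 proof -
  have "expectation (%w. (Y1 w - Y0 w)\<^sup>2) = expectation (%w. ((Y1 w)^2 - (Y0 w)^2) - 2 * (Y0 w * (Y1 w - Y0 w)))"
   by (intro Bochner_Integration.integral_cong) (auto simp: power2_eq_square algebra_simps)
  also have "... = (expectation (%w. (Y1 w)\<^sup>2) - expectation (%w. (Y0 w)\<^sup>2)) - 2 * expectation (%w. Y0 w * (Y1 w - Y0 w))"
   using Y YY by (simp add: right_diff_distrib power2_eq_square)
  also have "... = measure \<nu> UNIV"
   using second_moment_from_cos[OF Y m fin sets_nu] cosid[of _ 0] mart2 by simp
  finally show ?thesis .
 qed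
 have i2: "integrable M (%w. (Y1 w - Y0 w)\<^sup>2)"
  using Y YY by (simp add: power2_diff mult.assoc mult.commute[of "Y1 _"])
 have id: "integrable M (%w. Y1 w - Y0 w)" using Y1'[OF Y(1)] Y1'[OF Y(2)] by simp
 have nuc: "integrable \<nu> (%z. cos (u * z + th))" for u th by (rule nu.integrable_const_bound[of _ 1]) auto
 have pos: "0 <= 1 + cos x" for x :: real using cos_ge_minus_one[of x] by linarith
 have key: "(\<integral>\<^sup>+z. ennreal (1 + cos (u * z + th)) \<partial>\<nu>) = (\<integral>\<^sup>+z. ennreal (1 + cos (u * z + th)) \<partial>\<nu>2)" for u th
 proof -
  have L: "(\<integral>\<^sup>+z. ennreal (1 + cos (u * z + th)) \<partial>\<nu>) = ennreal (measure \<nu> UNIV + (\<integral>z. cos (u * z + th) \<partial>\<nu>))"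
   using nuc[of u th] pos by (subst nn_integral_eq_integral) (auto simp: sp)
  show ?thesis
  \<comment> \<open>The antiderivative used for general \<open>u\<close> divides by
    \<open>u\<close>, so the constant test function gets a quadratic one and reduces to
    \<open>mom\<close>.\<close>
  proof (cases "u = 0")
   case True
   have d: "double_integral (%z. ennreal (1 + cos th)) y x = ennreal ((1 + cos th) * (x - y)^2 / 2)" for x y
   proof -
    have e: "(1 + cos th) * x^2 / 2 - (1 + cos th) * y^2 / 2 - (1 + cos th) * y * (x - y) = (1 + cos th) * (x - y)^2 / 2"
     by (simp add: field_simps power2_eq_square)
    show ?thesis
     by (subst double_integral_FTC(1)[where F="%z. (1 + cos th) * z^2 / 2" and ?F1.0="%z. (1 + cos th) * z"])
      (auto intro!: derivative_eq_intros simp: pos e)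
   qed
   have "(\<integral>\<^sup>+w. ennreal ((1 + cos th) * (Y1 w - Y0 w)^2 / 2) \<partial>M) = ennreal ((1 + cos th) * measure \<nu> UNIV / 2)"
    using i2 mom pos by (subst nn_integral_eq_integral) auto
   hence "(\<integral>\<^sup>+z. ennreal (1 + cos th) \<partial>\<nu>2) = 2 * ennreal ((1 + cos th) * measure \<nu> UNIV / 2)"
    by (subst n2) (auto simp: d)
   also have "... = ennreal ((1 + cos th) * measure \<nu> UNIV)"
    by (subst ennreal_numeral[symmetric], subst ennreal_mult[symmetric]) (auto simp: pos)
   finally show ?thesis using L True by (simp add: sp algebra_simps)
  next
   case False
   \<comment> \<open>Taylor remainder at \<open>y\<close> of
     \<open>z^2 / 2 - cos (u * z + th) / u^2\<close>, whose second derivative is the test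
     function.\<close>
   define D where "D y x = (x^2 / 2 - cos (u * x + th) / u^2) - (y^2 / 2 - cos (u * y + th) / u^2) - (y + sin (u * y + th) / u) * (x - y)" for x y
   have d: "double_integral (%z. ennreal (1 + cos (u * z + th))) y x = ennreal (D y x)" "0 <= D y x" for x y
    unfolding D_def using False
    by (intro double_integral_FTC[where F="%z. z\<^sup>2 / 2 - cos (u * z + th) / u^2" and ?F1.0="%z. z + sin (u * z + th) / u" and g="%z. 1 + cos (u * z + th)"];
      auto intro!: derivative_eq_intros simp: pos power2_eq_square field_simps)+
   have ic: "integrable M (%w. cos (u * Y1 w + th) - cos (u * Y0 w + th))"
   proof (rule integrable_const_bound[of _ 2])
    have "\<bar>cos a - cos b\<bar> <= 2" for a b :: real using abs_cos_le_one[of a] abs_cos_le_one[of b] by linarith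
    thus "AE x in M. norm (cos (u * Y1 x + th) - cos (u * Y0 x + th)) <= 2" by auto
   qed measurable
   have isn: "integrable M (%w. sin (u * Y0 w + th) * (Y1 w - Y0 w))"
   proof (rule Bochner_Integration.integrable_bound[OF id])
    have "\<bar>sin a * b\<bar> <= \<bar>b\<bar>" for a b :: real using mult_right_mono[OF abs_sin_le_one[of a], of "\<bar>b\<bar>"] by (simp add: abs_mult)
    thus "AE x in M. norm (sin (u * Y0 x + th) * (Y1 x - Y0 x)) <= norm (Y1 x - Y0 x)" by auto
   qed measurable
   have De: "D y x = (x - y)^2 / 2 - (cos (u * x + th) - cos (u * y + th)) / u^2 - sin (u * y + th) * (x - y) / u" for x y
   proof -
    have "x^2 / 2 - y\<^sup>2 / 2 - y * (x - y) = (x - y)^2 / 2" by (simp add: power2_eq_square field_simps)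
    thus ?thesis unfolding D_def diff_divide_distrib ring_distribs times_divide_eq_left by (simp add: algebra_simps)
   qed
   define c s where "c w = cos (u * Y1 w + th) - cos (u * Y0 w + th)" and "s w = sin (u * Y0 w + th) * (Y1 w - Y0 w)" for w
   have Dc: "D (Y0 w) (Y1 w) = (Y1 w - Y0 w)^2 / 2 - c w / u^2 - s w / u" for w
    by (simp add: De c_def s_def)
   have i: "integrable M c" "integrable M s" using ic isn by (simp_all add: c_def[abs_def] s_def[abs_def])
   have e: "expectation c = - (u^2 / 2) * (\<integral>z. cos (u * z + th) \<partial>\<nu>)" "expectation s = 0"
    using cosid[of u th] mart[of u th] by (simp_all add: c_def[abs_def] s_def[abs_def])
   have iD: "integrable M (%w. D (Y0 w) (Y1 w))"
    unfolding Dc using i2 i by simp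
   have ED: "expectation (%w. D (Y0 w) (Y1 w)) = (measure \<nu> UNIV + (\<integral>z. cos (u * z + th) \<partial>\<nu>)) / 2"
    unfolding Dc using i2 i False mom e by (simp add: field_simps)
   have "(\<integral>\<^sup>+z. ennreal (1 + cos (u * z + th)) \<partial>\<nu>2) = 2 * (\<integral>\<^sup>+w. ennreal (D (Y0 w) (Y1 w)) \<partial>M)"
    by (subst n2) (auto simp: d)
   also have "... = 2 * ennreal ((measure \<nu> UNIV + (\<integral>z. cos (u * z + th) \<partial>\<nu>)) / 2)"
    by (subst nn_integral_eq_integral) (simp_all add: iD d(2) ED)
   also have "... = ennreal (measure \<nu> UNIV + (\<integral>z. cos (u * z + th) \<partial>\<nu>))"
   proof -
    have "0 <= (measure \<nu> UNIV + (\<integral>z. cos (u * z + th) \<partial>\<nu>)) / 2"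
     unfolding ED[symmetric] using d(2) by (intro integral_nonneg_AE) auto
    thus ?thesis by (subst ennreal_numeral[symmetric], subst ennreal_mult[symmetric]) auto
   qed
   finally show ?thesis using L by simp
  qed
 qed
 \<comment> \<open>Finiteness does not follow from the definition of \<open>\<nu>2\<close>; it comes
   from \<open>key\<close> at frequency 0 and phase \<open>pi / 2\<close>, where the test function
   is 1.\<close>
 have fin2: "finite_measure \<nu>2"
 proof
  have "emeasure \<nu>2 (space \<nu>2) = (\<integral>\<^sup>+z. ennreal (1 + cos (0 * z + pi / 2)) \<partial>\<nu>2)" by simp
  also have "... = emeasure \<nu> (space \<nu>)" unfolding key[symmetric] by simp
  finally show "emeasure \<nu>2 (space \<nu>2) ~= \<infinity>" by simp
 qed
 have "\<nu> = \<nu>2"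
  by (rule finite_measure_eqI_cos[OF fin fin2 sets_nu _ key]) (simp add: \<nu>2_def)
 thus ?thesis using n2[OF g] by simp
qed

end

text \<open>The weight with which \<open>g z\<close> enters \<open>double_integral g y x\<close>
  after exchanging the integrals: the distance from \<open>z\<close> to \<open>x\<close> when
  \<open>z\<close> lies between \<open>y\<close> and \<open>x\<close>, and zero otherwise. For fixed
  \<open>y\<close> and \<open>z\<close> it is the positive part of an affine function of
  \<open>x\<close>; monotonicity, convexity and semicontinuity of \<open>q\<close> are all read off
  from this form.\<close>

definition kern :: "real => real => real => real" where
 "kern y x z = (if y <= z then max 0 (x - z) else max 0 (z - x))"

lemma kern_nonneg: "0 <= kern y x z"
 by (simp add: kern_def)

lemma kern_measurable[measurable]: "(%x. kern (f x) (g x) (h x)) \<in> borel_measurable N"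
 if [measurable]: "f \<in> borel_measurable N" "g \<in> borel_measurable N" "h \<in> borel_measurable N"
 unfolding kern_def by measurable

lemma double_integral_eq_kern:
 assumes [measurable]: "g \<in> borel_measurable borel"
 shows "double_integral g y x = (\<integral>\<^sup>+z. ennreal (kern y x z) * g z \<partial>lborel)"
proof -
 define J :: "real => real => ennreal" where "J u z = ind {min y x..max y x} u * ind {min y u..max y u} z" for u z
 have Jm[measurable]: "(%(u, z). J u z) \<in> borel_measurable (lborel \<Otimes>\<^sub>M lborel)"
  unfolding J_def indicator_def atLeastAtMost_iff split_beta' by measurable
 have Jz[measurable]: "(%u. J u z) \<in> borel_measurable lborel" for z
  unfolding J_def indicator_def atLeastAtMost_iff by measurable
 have "double_integral g y x = (\<integral>\<^sup>+ u. \<integral>\<^sup>+ z. J u z * g z \<partial>lborel \<partial>lborel)"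
  unfolding double_integral_def J_def
  by (intro nn_integral_cong) (auto simp: mult.assoc nn_integral_cmult split: split_indicator)
 also have "... = (\<integral>\<^sup>+ z. \<integral>\<^sup>+ u. J u z * g z \<partial>lborel \<partial>lborel)"
  by (intro lborel_pair.Fubini'[symmetric]) measurable
 also have "... = (\<integral>\<^sup>+ z. (\<integral>\<^sup>+ u. J u z \<partial>lborel) * g z \<partial>lborel)"
  by (intro nn_integral_cong nn_integral_multc) simp
 also have "... = (\<integral>\<^sup>+z. ennreal (kern y x z) * g z \<partial>lborel)"
 proof (rule nn_integral_cong_AE)
  \<comment> \<open>The point \<open>z = y\<close> must be left out: for \<open>x < y\<close> the
    definition of \<open>kern\<close> takes the wrong branch there.\<close>
  show "AE z in lborel. (\<integral>\<^sup>+ u. J u z \<partial>lborel) * g z = ennreal (kern y x z) * g z"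
   using AE_lborel_singleton[of y]
  proof eventually_elim
   case (elim z)
   have "(\<integral>\<^sup>+ u. J u z \<partial>lborel) = ennreal (kern y x z)"
   proof (cases "y < z")
    case True
    hence "J u z = ind {z..x} u" for u
     by (auto simp: J_def split: split_indicator)
    thus ?thesis using True by (simp add: kern_def max_def)
   next
    case False
    with elim have "z < y" by simp
    hence "J u z = ind {x..z} u" for u
     by (auto simp: J_def split: split_indicator)
    thus ?thesis using \<open>z < y\<close> by (simp add: kern_def max_def)
   qed
   thus ?case by simp
  qed
 qed
 finally show ?thesis .
qed

text \<open>Fatou in the kernel form. Where \<open>g\<close> is infinite and the limiting kernel is
  positive, the approximating kernels are eventually positive too, so their products are also
  infinite. Continuity cannot be expected: \<open>q\<close> may jump to infinity behind an
  endpoint.\<close>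

lemma double_integral_lsc:
 assumes [measurable]: "g \<in> borel_measurable borel" and x: "xs \<longlonglongrightarrow> x"
 shows "double_integral g y x <= liminf (%k. double_integral g y (xs k))"
proof -
 have "double_integral g y x <= (\<integral>\<^sup>+z. liminf (%k. ennreal (kern y (xs k) z) * g z) \<partial>lborel)"
  unfolding double_integral_eq_kern[OF assms(1)]
 proof (intro nn_integral_mono)
  fix z
  have "(%k. kern y (xs k) z) \<longlonglongrightarrow> kern y x z"
   unfolding kern_def by (auto intro!: tendsto_intros x)
  hence l: "(%k. ennreal (kern y (xs k) z)) \<longlonglongrightarrow> ennreal (kern y x z)" by (rule tendsto_ennrealI)
  show "ennreal (kern y x z) * g z <= liminf (%k. ennreal (kern y (xs k) z) * g z)"
  proof (cases "kern y x z = 0")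
   case False
   hence pos: "0 < ennreal (kern y x z)" using kern_nonneg[of y x z] by simp
   show ?thesis
   proof (cases "g z < top")
    case True
    have "(%k. g z * ennreal (kern y (xs k) z)) \<longlonglongrightarrow> g z * ennreal (kern y x z)"
     by (rule ennreal_tendsto_cmult[OF True l])
    thus ?thesis by (simp add: mult.commute lim_imp_Liminf)
   next
    case False
    have "\<forall>\<^sub>F k in sequentially. ennreal (kern y x z) * g z <= ennreal (kern y (xs k) z) * g z"
     using order_tendstoD(1)[OF l pos]
    proof eventually_elim
     case (elim k)
     have "g z = top" using False by (metis top.not_eq_extremum)
     with elim show ?case by (simp add: ennreal_mult_top)
    qed
    thus ?thesis by (rule Liminf_bounded)
   qed
  qed simp
 qed
 also have "... <= liminf (%k. double_integral g y (xs k))"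
  unfolding double_integral_eq_kern[OF assms(1)] by (rule nn_integral_liminf) measurable
 finally show ?thesis .
qed

text \<open>The weight \<open>wt\<close> will be \<open>ind {S<..T} v * (\<eta> (M v))^2\<close> for stopping times \<open>S <= T\<close>.\<close>

definition occupation_measure :: "'a measure => (real => 'a => real) => (real => 'a => real) => real measure" where
 "occupation_measure P X wt = distr (density (lborel \<Otimes>\<^sub>M P) (%x. ennreal (wt (fst x) (snd x)))) borel (%x. X (max 0 (fst x)) (snd x))"

context prob_space
begin

lemma abs_expectation_le:
 fixes f :: "'a => real"
 assumes "!!w. w \<in> space M ==> \<bar>f w\<bar> <= K"
 shows "\<bar>expectation f\<bar> <= K"
proof (cases "integrable M f")
 case True
 have "\<bar>expectation f\<bar> <= expectation (%w. \<bar>f w\<bar>)" by (rule integral_abs_bound)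
 also have "... <= K" using True assms by (intro integral_le_const) auto
 finally show ?thesis .
next
 case False
 obtain w where "w \<in> space M" using not_empty by auto
 hence "0 <= K" using assms[of w] by linarith
 thus ?thesis using False by (simp add: not_integrable_integral_eq)
qed

lemma occupation_measure:
 fixes X wt :: "real => 'a => real"
 assumes X[measurable]: "(%x. X (max 0 (fst x)) (snd x)) \<in> borel_measurable (borel \<Otimes>\<^sub>M M)"
  and wt[measurable]: "(%x. wt (fst x) (snd x)) \<in> borel_measurable (borel \<Otimes>\<^sub>M M)"
  and w0: "!!v w. 0 <= wt v w" "!!v w. v <= 0 ==> wt v w = 0"
 shows "sets (occupation_measure M X wt) = sets borel"
  and "!!g. g \<in> borel_measurable borel ==>
   (\<integral>\<^sup>+z. g z \<partial>occupation_measure M X wt) = (\<integral>\<^sup>+w. \<integral>\<^sup>+v. ennreal (wt v w) * g (X v w) \<partial>lborel \<partial>M)"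
  and "integrable (lborel \<Otimes>\<^sub>M M) (%x. wt (fst x) (snd x)) ==> finite_measure (occupation_measure M X wt)"
  and "integrable (lborel \<Otimes>\<^sub>M M) (%x. wt (fst x) (snd x)) ==>
   (\<integral>z. cos (u * z + th) \<partial>occupation_measure M X wt) = (\<integral>w. \<integral>v. wt v w * cos (u * X v w + th) \<partial>lborel \<partial>M)"
proof -
 interpret pl: pair_sigma_finite lborel M ..
 have cong: "sets (lborel \<Otimes>\<^sub>M M) = sets (borel \<Otimes>\<^sub>M M)" by (rule sets_pair_measure_cong) auto
 have [measurable]: "(%x. X (max 0 (fst x)) (snd x)) \<in> borel_measurable (lborel \<Otimes>\<^sub>M M)"
  "(%x. wt (fst x) (snd x)) \<in> borel_measurable (lborel \<Otimes>\<^sub>M M)"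
  using X wt by (simp_all cong: measurable_cong_sets add: measurable_cong_sets[OF cong refl])
 have wX: "wt v w * h (X (max 0 v) w) = wt v w * h (X v w)" for v w and h :: "real => real"
  using w0(2)[of v w] by (cases "v <= 0") (auto simp: max_def)
 have wX': "ennreal (wt v w) * h (X (max 0 v) w) = ennreal (wt v w) * h (X v w)" for v w and h :: "real => ennreal"
  using w0(2)[of v w] by (cases "v <= 0") (auto simp: max_def)
 show "sets (occupation_measure M X wt) = sets borel" by (simp add: occupation_measure_def)
 show nn: "(\<integral>\<^sup>+z. g z \<partial>occupation_measure M X wt) = (\<integral>\<^sup>+w. \<integral>\<^sup>+v. ennreal (wt v w) * g (X v w) \<partial>lborel \<partial>M)"
  if [measurable]: "g \<in> borel_measurable borel" for g
 proof -
  have "(\<integral>\<^sup>+z. g z \<partial>occupation_measure M X wt) = (\<integral>\<^sup>+x. ennreal (wt (fst x) (snd x)) * g (X (max 0 (fst x)) (snd x)) \<partial>(lborel \<Otimes>\<^sub>M M))"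
   unfolding occupation_measure_def by (subst nn_integral_distr) (auto simp: nn_integral_density)
  also have "... = (\<integral>\<^sup>+w. \<integral>\<^sup>+v. ennreal (wt v w) * g (X (max 0 v) w) \<partial>lborel \<partial>M)"
   by (subst pl.nn_integral_snd[symmetric]) auto
  finally show ?thesis unfolding wX' .
 qed
 assume i: "integrable (lborel \<Otimes>\<^sub>M M) (%x. wt (fst x) (snd x))"
 show "finite_measure (occupation_measure M X wt)"
 proof
  have "emeasure (occupation_measure M X wt) (space (occupation_measure M X wt)) = (\<integral>\<^sup>+x. ennreal (wt (fst x) (snd x)) \<partial>(lborel \<Otimes>\<^sub>M M))"
  proof -
   have "emeasure (density (lborel \<Otimes>\<^sub>M M) (%x. ennreal (wt (fst x) (snd x)))) (space (lborel \<Otimes>\<^sub>M M)) = (\<integral>\<^sup>+x. ennreal (wt (fst x) (snd x)) \<partial>(lborel \<Otimes>\<^sub>M M))"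
    using sets.top[of "lborel \<Otimes>\<^sub>M M"] by (subst emeasure_density) (auto simp del: space_pair_measure intro!: nn_integral_cong)
   thus ?thesis unfolding occupation_measure_def by (subst emeasure_distr) simp_all
  qed
  also have "... < \<infinity>" using i w0(1) by (simp add: integrable_iff_bounded)
  finally show "emeasure (occupation_measure M X wt) (space (occupation_measure M X wt)) ~= \<infinity>" by simp
 qed
 have i2: "integrable (lborel \<Otimes>\<^sub>M M) (%(v, w). wt v w * cos (u * X (max 0 v) w + th))"
 proof (rule Bochner_Integration.integrable_bound[OF i])
  have "\<bar>a * cos b\<bar> <= \<bar>a\<bar>" for a b :: real
   using mult_left_mono[OF abs_cos_le_one[of b], of "\<bar>a\<bar>"] by (simp add: abs_mult)
  thus "AE x in lborel \<Otimes>\<^sub>M M. norm (case x of (v, w) => wt v w * cos (u * X (max 0 v) w + th)) <= norm (wt (fst x) (snd x))"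
   by (intro AE_I2) (auto simp: split_beta')
 qed (unfold split_beta', measurable)
 have "(\<integral>z. cos (u * z + th) \<partial>occupation_measure M X wt) = (\<integral>x. wt (fst x) (snd x) * cos (u * X (max 0 (fst x)) (snd x) + th) \<partial>(lborel \<Otimes>\<^sub>M M))"
  unfolding occupation_measure_def using w0(1) by (subst integral_distr) (auto simp: integral_density)
 also have "... = (\<integral>w. \<integral>v. wt v w * cos (u * X (max 0 v) w + th) \<partial>lborel \<partial>M)"
  using pl.integral_snd[OF i2] by (simp add: split_beta')
 also have "... = (\<integral>w. \<integral>v. wt v w * cos (u * X v w + th) \<partial>lborel \<partial>M)"
  by (intro Bochner_Integration.integral_cong refl wX[of _ _ "%x. cos (u * x + th)"])
 finally show "(\<integral>z. cos (u * z + th) \<partial>occupation_measure M X wt) = (\<integral>w. \<integral>v. wt v w * cos (u * X v w + th) \<partial>lborel \<partial>M)" .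
qed

end

context simple_process
begin

abbreviation "weight t v w \<equiv> ind {0<..t} v * (H v w)^2"

lemma weight_measurable: "(%x. weight t (fst x) (snd x)) \<in> borel_measurable (borel \<Otimes>\<^sub>M P)"
 using proc_measurable by measurable

lemma weight_integrable: "integrable (lborel \<Otimes>\<^sub>M P) (%x. weight t (fst x) (snd x))"
proof -
 interpret pl: pair_sigma_finite lborel P ..
 have cong: "sets (lborel \<Otimes>\<^sub>M P) = sets (borel \<Otimes>\<^sub>M P)" by (rule sets_pair_measure_cong) auto
 obtain K where K: "0 <= K" "!!v w. \<bar>H v w\<bar> <= K" using proc_bounded by auto
 have K2: "(H v w)^2 <= K^2" for v w using K by (simp add: abs_le_square_iff[symmetric])
 have "integrable (lborel \<Otimes>\<^sub>M P) (%x. ind ({0<..t} \<times> space P) x :: real)"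
  by (cases "0 <= t") (auto intro!: integrable_real_indicator simp: emeasure_pair_measure_Times emeasure_space_1)
 also have "?this \<longleftrightarrow> integrable (lborel \<Otimes>\<^sub>M P) (%x. ind {0<..t} (fst x) :: real)"
  by (intro Bochner_Integration.integrable_cong) (auto simp: space_pair_measure split: split_indicator)
 finally have "integrable (lborel \<Otimes>\<^sub>M P) (%x. ind {0<..t} (fst x) * K^2)" by (rule integrable_mult_left)
 thus ?thesis
 proof (rule Bochner_Integration.integrable_bound)
  show "(%x. weight t (fst x) (snd x)) \<in> borel_measurable (lborel \<Otimes>\<^sub>M P)"
   using weight_measurable by (simp add: measurable_cong_sets[OF cong refl])
  show "AE x in lborel \<Otimes>\<^sub>M P. norm (weight t (fst x) (snd x)) <= norm (ind {0<..t} (fst x) * K^2)"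
   using K2 by (intro AE_I2) (simp add: abs_mult mult_left_mono)
 qed
qed

lemma simple_cos_expectation:
 assumes t: "0 <= t"
 shows "expectation (%w. cos (u * X t w + th)) - cos th = - (u^2 / 2) * expectation (%w. \<integral>v. weight t v w * cos (u * X v w + th) \<partial>lborel)"
proof -
 note [measurable] = integral_measurable[OF t]
 obtain K where K: "!!w. (\<integral>v. weight t v w \<partial>lborel) <= K" using proc_time_bound[of 0 t] t by auto
 have [measurable]: "(%w. \<integral>v. ind {0<..t} v * (cos (u * X v w + th) * (H v w)^2) \<partial>lborel) \<in> borel_measurable P"
  by (rule integral_over_time_measurable[OF time_integrand_measurable[OF integral_measurable integral_continuous proc_measurable']]) auto
 have i: "integrable P (%w. \<integral>v. ind {0<..t} v * (cos (u * X v w + th) * (H v w)^2) \<partial>lborel)"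
 proof (rule integrable_const_bound[of _ K])
  have "\<bar>\<integral>v. ind {0<..t} v * (cos (u * X v w + th) * (H v w)^2) \<partial>lborel\<bar> <= 1 * (\<integral>v. weight t v w \<partial>lborel)" if "w \<in> space P" for w
   by (rule path_integrable(2)[OF that, where g="%x. cos (u * x + th)"]) auto
  thus "AE w in P. norm (\<integral>v. ind {0<..t} v * (cos (u * X v w + th) * (H v w)^2) \<partial>lborel) <= K"
   using K by (intro AE_I2) (smt (verit) real_norm_def)
 qed measurable
 have ic: "integrable P (%w. cos (u * X t w + th))" by (rule integrable_const_bound[of _ 1]) auto
 have "expectation (%w. ind (space P) w * cos_increment X H u th 0 t w) = 0"
  by (rule simple_cos_increment) (use t sets.top[of "F 0"] space_F in auto)
 also have "expectation (%w. ind (space P) w * cos_increment X H u th 0 t w)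
  = expectation (%w. cos (u * X t w + th) - cos th + u^2 / 2 * (\<integral>v. ind {0<..t} v * (cos (u * X v w + th) * (H v w)^2) \<partial>lborel))"
  by (intro Bochner_Integration.integral_cong) (auto simp: cos_increment_def integral_0)
 also have "... = expectation (%w. cos (u * X t w + th)) - cos th + u^2 / 2 * expectation (%w. \<integral>v. ind {0<..t} v * (cos (u * X v w + th) * (H v w)^2) \<partial>lborel)"
  using i ic by (simp add: prob_space)
 finally show ?thesis by (simp add: mult_ac)
qed

lemma simple_cos_expectation_bound:
 assumes t: "0 <= t" and K: "!!w. w \<in> space P ==> (\<integral>v. weight t v w \<partial>lborel) <= K"
 shows "\<bar>expectation (%w. cos (u * X t w + th)) - cos th\<bar> <= K / 2 * u^2"
proof -
 have "\<bar>\<integral>v. weight t v w * cos (u * X v w + th) \<partial>lborel\<bar> <= K" if "w \<in> space P" for w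
  using path_integrable(2)[OF that, of 0 "%x. cos (u * x + th)" 1 t] K[OF that] by (simp add: mult_ac)
 hence "\<bar>expectation (%w. \<integral>v. weight t v w * cos (u * X v w + th) \<partial>lborel)\<bar> <= K"
  by (rule abs_expectation_le)
 hence "u^2 / 2 * \<bar>expectation (%w. \<integral>v. weight t v w * cos (u * X v w + th) \<partial>lborel)\<bar> <= u^2 / 2 * K"
  by (intro mult_left_mono) auto
 thus ?thesis unfolding simple_cos_expectation[OF t] by (simp add: abs_mult mult.commute)
qed

text \<open>The bound \<open>K\<close> on the accumulated weight supplies the moments that
  \<open>occupation_identity\<close> asks for: through Ito's formula it bounds the cosine and sine
  means by a multiple of \<open>u^2\<close>. Truncation will provide such a bound.\<close>

theorem simple_occupation:
 assumes t: "0 <= t" and g[measurable]: "g \<in> borel_measurable borel"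
  and K: "!!w. w \<in> space P ==> (\<integral>v. weight t v w \<partial>lborel) <= K"
 shows "(\<integral>\<^sup>+w. \<integral>\<^sup>+v. ennreal (weight t v w) * g (c + X v w) \<partial>lborel \<partial>P) = 2 * (\<integral>\<^sup>+w. double_integral g c (c + X t w) \<partial>P)"
proof -
 note [measurable] = integral_measurable[OF t]
 note [measurable] = process_joint_measurable[OF integral_measurable integral_continuous]
 have Xm: "(%x. (%v w. c + X v w) (max 0 (fst x)) (snd x)) \<in> borel_measurable (borel \<Otimes>\<^sub>M P)" by measurable
 let ?\<nu> = "occupation_measure P (%v w. c + X v w) (weight t)"
 note occ = occupation_measure[OF Xm weight_measurable[of t]]
 have sq: "integrable P (%w. (X t w)\<^sup>2)"
 proof (rule square_integrable_from_cos)
  fix u :: real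
  have ic: "integrable P (%w. cos (u * X t w))" by (rule integrable_const_bound[of _ 1]) auto
  show "expectation (%w. 1 - cos (u * X t w)) <= K / 2 * u^2"
  proof -
   have "\<bar>expectation (%w. cos (u * X t w)) - 1\<bar> <= K / 2 * u^2"
    using simple_cos_expectation_bound[OF t K, of u 0] by simp
   moreover have "expectation (%w. 1 - cos (u * X t w)) = 1 - expectation (%w. cos (u * X t w))"
    using ic by (simp add: prob_space)
   ultimately show ?thesis by linarith
  qed
 qed measurable
 have iX: "integrable P (X t)" by (rule square_integrable_imp_integrable[OF _ sq]) measurable
 have EX: "expectation (X t) = 0"
 proof (rule mean_zero_from_sin[OF iX])
  fix u :: real
  have "(%w. cos (u * X t w + - (pi / 2))) = (%w. sin (u * X t w))" by (simp add: cos_diff)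
  thus "\<bar>expectation (%w. sin (u * X t w))\<bar> <= K / 2 * u^2"
   using simple_cos_expectation_bound[OF t K, of u "- (pi / 2)"] by simp
 qed
 have "(\<integral>\<^sup>+z. g z \<partial>?\<nu>) = 2 * (\<integral>\<^sup>+w. double_integral g c (c + X t w) \<partial>P)"
 proof (rule occupation_identity)
  show "integrable P (%w. (c + X t w)\<^sup>2)" using sq iX by (simp add: power2_sum)
  show "finite_measure ?\<nu>" by (rule occ(3)) (auto simp: weight_integrable)
  show "sets ?\<nu> = sets borel" by (rule occ(1)) auto
  fix u th :: real
  have ic: "integrable P (%w. cos (u * (c + X t w) + th))" by (rule integrable_const_bound[of _ 1]) auto
  have "(\<integral>z. cos (u * z + th) \<partial>?\<nu>) = expectation (%w. \<integral>v. weight t v w * cos (u * (c + X v w) + th) \<partial>lborel)"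
   by (rule occ(4)) (auto simp: weight_integrable)
  thus "expectation (%w. cos (u * (c + X t w) + th) - cos (u * c + th)) = - (u^2 / 2) * (\<integral>z. cos (u * z + th) \<partial>?\<nu>)"
   using simple_cos_expectation[OF t, of u "u * c + th"] ic by (simp add: prob_space algebra_simps)
 qed (use iX EX in simp_all)
 also have "(\<integral>\<^sup>+z. g z \<partial>?\<nu>) = (\<integral>\<^sup>+w. \<integral>\<^sup>+v. ennreal (weight t v w) * g (c + X v w) \<partial>lborel \<partial>P)"
  by (rule occ(2)) auto
 finally show ?thesis .
qed

end

section \<open>Truncation of simple processes\<close>

text \<open>Switches the integrand off from the first partition interval whose contribution would
  lift the squared integral up to \<open>t\<close> above \<open>K\<close>. The interval
  \<open>i\<close> itself is included in the sum; its length is deterministic and its coefficient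
  known at \<open>ts ! i\<close>, so the cut stays predictable and the bound \<open>K\<close> is
  never overshot.\<close>

definition truncated_coeff :: "real list => (nat => 'a => real) => real => real => nat => 'a => real" where
 "truncated_coeff ts xi t K i w =
   (if (\<Sum>j\<le>i. (xi j w)\<^sup>2 * (min t (ts ! Suc j) - min t (ts ! j))) <= K then xi i w else 0)"

context simple_process
begin

lemma min_step: "i < n ==> min t (ts ! i) <= min t (ts ! Suc i)"
 using ts_less[of i "Suc i"] by (auto simp: min_def)

lemma partial_term_nonneg: "i < n ==> 0 <= (xi i w)^2 * (min t (ts ! Suc i) - min t (ts ! i))"
 using min_step[of i t] by (intro mult_nonneg_nonneg) simp_all

lemma weight_integral:
 assumes t: "0 <= t"
 shows "(\<integral>v. weight t v w \<partial>lborel) = (\<Sum>i<n. (xi i w)\<^sup>2 * (min t (ts ! Suc i) - min t (ts ! i)))"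
proof -
 have sq: "(H v w)^2 = (\<Sum>i<n. (xi i w)\<^sup>2 * ind {ts ! i<..ts ! Suc i} v)" for v
 proof (cases "\<exists>i<n. ts ! i < v & v <= ts ! Suc i")
  case True
  then obtain i where i: "i < n" "ts ! i < v" "v <= ts ! Suc i" by auto
  have "(\<Sum>j<n. (xi j w)\<^sup>2 * ind {ts ! j<..ts ! Suc j} v) = (\<Sum>j<n. if i = j then (xi i w)\<^sup>2 else 0)"
  proof (intro sum.cong refl)
   fix j assume j: "j \<in> {..<n}"
   consider "j < i" | "j = i" | "i < j" by linarith
   thus "(xi j w)^2 * ind {ts ! j<..ts ! Suc j} v = (if i = j then (xi i w)\<^sup>2 else 0)"
   proof cases
    case 1
    thus ?thesis using ts_le[of "Suc j" i] i by auto
   next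
    case 2 thus ?thesis using i by auto
   next
    case 3 thus ?thesis using ts_le[of "Suc i" j] j i by auto
   qed
  qed
  also have "... = (xi i w)^2" using i by (subst sum.delta') auto
  finally show ?thesis using proc_step[OF i] by simp
 next
  case False
  hence z: "ind {ts ! i<..ts ! Suc i} v = (0::real)" if "i < n" for i
   using that by (auto split: split_indicator)
  have "H v w = 0" "(\<Sum>i<n. (xi i w)\<^sup>2 * ind {ts ! i<..ts ! Suc i} v) = 0"
   unfolding simple_proc_def by (rule sum.neutral, use z in force)+
  thus ?thesis by simp
 qed
 have "(\<integral>v. weight t v w \<partial>lborel) = (\<integral>v. (\<Sum>i<n. (xi i w)\<^sup>2 * ind {min t (ts ! i)<..min t (ts ! Suc i)} v) \<partial>lborel)"
  unfolding sq
 proof (intro Bochner_Integration.integral_cong refl)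
  fix v
  have "ind {0<..t} v * ind {ts ! i<..ts ! Suc i} v = (ind {min t (ts ! i)<..min t (ts ! Suc i)} v :: real)" if "i < n" for i
   using ts_nonneg[of i] that by (auto split: split_indicator)
  thus "ind {0<..t} v * (\<Sum>i<n. (xi i w)\<^sup>2 * ind {ts ! i<..ts ! Suc i} v) = (\<Sum>i<n. (xi i w)\<^sup>2 * ind {min t (ts ! i)<..min t (ts ! Suc i)} v)"
   unfolding sum_distrib_left by (intro sum.cong) (simp_all add: mult.left_commute)
 qed
 also have "... = (\<Sum>i<n. \<integral>v. (xi i w)\<^sup>2 * ind {min t (ts ! i)<..min t (ts ! Suc i)} v \<partial>lborel)"
  by (intro Bochner_Integration.integral_sum integrable_mult_right integrable_indicator_Ioc)
 also have "... = (\<Sum>i<n. (xi i w)\<^sup>2 * (min t (ts ! Suc i) - min t (ts ! i)))"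
 proof (intro sum.cong refl)
  fix i assume "i \<in> {..<n}"
  hence "min t (ts ! i) <= min t (ts ! Suc i)" using ts_less[of i "Suc i"] by auto
  thus "(\<integral>v. (xi i w)\<^sup>2 * ind {min t (ts ! i)<..min t (ts ! Suc i)} v \<partial>lborel) = (xi i w)^2 * (min t (ts ! Suc i) - min t (ts ! i))"
   by simp
 qed
 finally show ?thesis .
qed

context
 fixes t K :: real
 assumes t: "0 <= t" and K: "0 <= K"
begin

abbreviation "xi' \<equiv> truncated_coeff ts xi t K"
abbreviation "partial i w \<equiv> (\<Sum>j\<le>i. (xi j w)\<^sup>2 * (min t (ts ! Suc j) - min t (ts ! j)))"

lemma partial_mono: "i <= j ==> j < n ==> partial i w <= partial j w"
 by (rule sum_mono2) (simp, force, rule partial_term_nonneg, simp)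

lemma truncated_simple_predictable: "simple_predictable F ts xi'"
 unfolding simple_predictable_def
proof (intro conjI allI impI)
 fix i assume i: "i < n"
 have [measurable]: "xi j \<in> borel_measurable (F (ts ! i))" if "j <= i" for j
  using that i by (intro measurable_F_mono[OF xi_meas ts_le]) auto
 have [measurable]: "partial i \<in> borel_measurable (F (ts ! i))"
  by (intro borel_measurable_sum borel_measurable_times borel_measurable_power) auto
 show "xi' i \<in> borel_measurable (F (ts ! i))"
  unfolding truncated_coeff_def[abs_def] by measurable
 obtain B where "!!w. \<bar>xi i w\<bar> <= B" using xi_bound[OF i] by auto
 hence "\<bar>xi' i w\<bar> <= \<bar>B\<bar>" for w unfolding truncated_coeff_def by (smt (verit))
 thus "EX B. ALL w. \<bar>xi' i w\<bar> <= B" by blast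
qed (use sp in \<open>auto simp: simple_predictable_def\<close>)

interpretation trunc: simple_process P F W ts xi'
 by unfold_locales (rule truncated_simple_predictable)

lemma truncated_simple_process: "simple_process P F W ts xi'"
 by (rule trunc.simple_process_axioms)

lemma truncated_weight_le: "(\<integral>v. ind {0<..t} v * (simple_proc ts xi' v w)^2 \<partial>lborel) <= K"
proof -
 have "(\<Sum>i<k. (xi' i w)\<^sup>2 * (min t (ts ! Suc i) - min t (ts ! i))) <= (if \<exists>i<k. partial i w <= K then K else 0)
  & ((\<forall>i<k. partial i w <= K) --> (\<Sum>i<k. (xi' i w)\<^sup>2 * (min t (ts ! Suc i) - min t (ts ! i))) = (\<Sum>i<k. (xi i w)\<^sup>2 * (min t (ts ! Suc i) - min t (ts ! i))))" if "k <= n" for k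
  using that
 proof (induction k)
  case (Suc k)
  show ?case
  proof (cases "partial k w <= K")
   case True
   hence all: "\<forall>i<Suc k. partial i w <= K" using partial_mono[of _ k w] Suc.prems by (meson Suc_le_lessD less_Suc_eq_le order_trans)
   hence "(\<Sum>i<Suc k. (xi' i w)\<^sup>2 * (min t (ts ! Suc i) - min t (ts ! i))) = (\<Sum>i<Suc k. (xi i w)\<^sup>2 * (min t (ts ! Suc i) - min t (ts ! i)))"
    by (intro sum.cong refl) (simp add: truncated_coeff_def)
   moreover have "... <= K" using True by (simp only: lessThan_Suc_atMost)
   ultimately show ?thesis using True by auto
  next
   case False
   hence "xi' k w = 0" by (simp add: truncated_coeff_def)
   hence "(\<Sum>i<Suc k. (xi' i w)\<^sup>2 * (min t (ts ! Suc i) - min t (ts ! i))) = (\<Sum>i<k. (xi' i w)\<^sup>2 * (min t (ts ! Suc i) - min t (ts ! i)))" by simp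
   thus ?thesis using Suc False K by (auto simp: less_Suc_eq split: if_splits)
  qed
 qed auto
 from this[of n] show ?thesis unfolding trunc.weight_integral[OF t] using K by (auto split: if_splits)
qed

text \<open>A nonzero value at \<open>v\<close> means that the coefficient of the interval around
  \<open>v\<close> was kept, hence by monotonicity also all earlier ones; the integral up to
  \<open>v\<close> involves no others.\<close>

lemma truncated_eq:
 assumes "simple_proc ts xi' v w ~= 0"
 shows "simple_proc ts xi' v w = H v w" "simple_integral W ts xi' v w = X v w"
proof -
 obtain i where i: "i < n" "ts ! i < v" "v <= ts ! Suc i"
 proof -
  have "\<exists>i<n. ts ! i < v & v <= ts ! Suc i"
  proof (rule ccontr)
   assume "~ ?thesis"
   hence z: "ind {ts ! i<..ts ! Suc i} v = (0::real)" if "i < n" for i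
    using that by (auto split: split_indicator)
   have "simple_proc ts xi' v w = 0"
    unfolding simple_proc_def by (rule sum.neutral, use z in force)
   thus False using assms by simp
  qed
  thus ?thesis using that by blast
 qed
 have "xi' i w ~= 0" using assms trunc.proc_step[OF i] by simp
 hence pi: "partial i w <= K" and xi_i: "xi' i w = xi i w" by (auto simp: truncated_coeff_def split: if_splits)
 show "simple_proc ts xi' v w = H v w" using trunc.proc_step[OF i] proc_step[OF i] xi_i by simp
 show "simple_integral W ts xi' v w = X v w"
  unfolding simple_integral_def
 proof (intro sum.cong refl)
  fix j assume j: "j \<in> {..<n}"
  show "xi' j w * (W (min v (ts ! Suc j)) w - W (min v (ts ! j)) w) = xi j w * (W (min v (ts ! Suc j)) w - W (min v (ts ! j)) w)"
  proof (cases "j <= i")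
   case True
   hence "xi' j w = xi j w" using pi partial_mono[of j i w] i by (simp add: truncated_coeff_def)
   thus ?thesis by simp
  next
   case False
   hence "v <= ts ! Suc j" "v <= ts ! j" using ts_le[of "Suc i" j] ts_le[of "Suc i" "Suc j"] j i by auto
   thus ?thesis by (simp add: min_absorb1)
  qed
 qed
qed

lemma truncated_eq_all:
 assumes "(\<integral>v. weight t v w \<partial>lborel) <= K"
 shows "simple_proc ts xi' v w = H v w" "simple_integral W ts xi' v w = X v w"
proof -
 have "xi' i w = xi i w" if i: "i < n" for i
 proof -
  have "partial i w <= (\<Sum>i<n. (xi i w)\<^sup>2 * (min t (ts ! Suc i) - min t (ts ! i)))"
   using i by (intro sum_mono2) (simp, force, rule partial_term_nonneg, simp)
  thus ?thesis using assms unfolding weight_integral[OF t] by (simp add: truncated_coeff_def)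
 qed
 thus "simple_proc ts xi' v w = H v w" "simple_integral W ts xi' v w = X v w"
  by (simp_all add: simple_proc_def simple_integral_def)
qed

end

end

section \<open>Passing to the limit\<close>

lemma floor_approx: "(%n. real_of_int \<lfloor>a * real (Suc n)\<rfloor> / real (Suc n)) \<longlonglongrightarrow> a"
proof (rule tendsto_sandwich[where f="%n. a - 1 / real (Suc n)" and h="%n. a"])
 have "a - 1 / real (Suc n) = (a * real (Suc n) - 1) / real (Suc n)" for n by (simp add: field_simps)
 thus "\<forall>\<^sub>F n in sequentially. a - 1 / real (Suc n) <= real_of_int \<lfloor>a * real (Suc n)\<rfloor> / real (Suc n)"
  by (intro always_eventually allI) (simp only:, intro divide_right_mono, linarith+)
 show "\<forall>\<^sub>F n in sequentially. real_of_int \<lfloor>a * real (Suc n)\<rfloor> / real (Suc n) <= a"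
  by (intro always_eventually allI) (simp add: divide_le_eq del: of_nat_Suc)
 have "(%n. a - 1 / real (Suc n)) \<longlonglongrightarrow> a - 0"
  by (intro tendsto_diff tendsto_const LIMSEQ_Suc[OF lim_1_over_n])
 thus "(%n. a - 1 / real (Suc n)) \<longlonglongrightarrow> a" by simp
qed auto

lemma closed_property_from_rationals:
 fixes f :: "real => real"
 assumes f: "continuous_on {0..} f" and C: "closed C" and rat: "!!q. q \<in> \<rat> ==> 0 <= q ==> f q \<in> C" and s: "0 <= s"
 shows "f s \<in> C"
proof (rule closed_sequentially[OF C])
 let ?q = "%n. real_of_int \<lfloor>s * real (Suc n)\<rfloor> / real (Suc n)"
 have q: "?q n \<in> \<rat>" "0 <= ?q n" for n using s by (auto intro!: Rats_divide)
 thus "f (?q n) \<in> C" for n using rat by auto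
 show "(%n. f (?q n)) \<longlonglongrightarrow> f s"
  by (rule continuous_on_tendsto_compose[OF f floor_approx]) (use s q in auto)
qed

text \<open>Borel-Cantelli with exceptional sets of probability below \<open>2 * (1/2)^k\<close>.
  The two sequences are treated together to obtain one common subsequence, and \<open>A k\<close>
  are measurable covers, since no measurability of \<open>f\<close> or \<open>g\<close> is
  assumed.\<close>

lemma (in prob_space) conv_in_prob_choose:
 assumes f: "conv_in_prob M f" and g: "conv_in_prob M g"
 shows "\<exists>\<sigma>. AE w in M. (%k. f (\<sigma> k) w) \<longlonglongrightarrow> 0 & (%k. g (\<sigma> k) w) \<longlonglongrightarrow> 0"
proof -
 define Q where "Q k n A \<longleftrightarrow> A \<in> sets M & measure M A < 2 * (1/2)^k &
  {w\<in>space M. ennreal ((1/2)^k) < f n w | ennreal ((1/2)^k) < g n w} \<subseteq> A" for k :: nat and n A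
 have "EX n A. Q k n A" for k :: nat
 proof -
  have k: "(0::real) < (1/2)^k" by simp
  obtain n1 where n1: "\<forall>n\<ge>n1. \<exists>A\<in>sets M. {w\<in>space M. ennreal ((1/2)^k) < f n w} \<subseteq> A & measure M A < (1/2)^k"
   using f[unfolded conv_in_prob_def, rule_format, OF k k] by (elim exE)
  obtain n2 where n2: "\<forall>n\<ge>n2. \<exists>A\<in>sets M. {w\<in>space M. ennreal ((1/2)^k) < g n w} \<subseteq> A & measure M A < (1/2)^k"
   using g[unfolded conv_in_prob_def, rule_format, OF k k] by (elim exE)
  define n where "n = max n1 n2"
  have "n1 <= n" "n2 <= n" by (auto simp: n_def)
  obtain A where A: "A \<in> sets M" "{w\<in>space M. ennreal ((1/2)^k) < f n w} \<subseteq> A" "measure M A < (1/2)^k"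
   using n1[rule_format, OF \<open>n1 <= n\<close>] by (elim bexE conjE)
  obtain B where B: "B \<in> sets M" "{w\<in>space M. ennreal ((1/2)^k) < g n w} \<subseteq> B" "measure M B < (1/2)^k"
   using n2[rule_format, OF \<open>n2 <= n\<close>] by (elim bexE conjE)
  have "measure M (A \<union> B) < 2 * (1/2)^k"
   using measure_Un_le[OF A(1) B(1)] A(3) B(3) by linarith
  moreover have "{w\<in>space M. ennreal ((1/2)^k) < f n w | ennreal ((1/2)^k) < g n w} \<subseteq> A \<union> B"
   using A(2) B(2) by blast
  ultimately have "Q k n (A \<union> B)" unfolding Q_def using A(1) B(1) by (intro conjI sets.Un)
  thus ?thesis by blast
 qed
 then obtain \<sigma> A where Q: "!!k. Q k (\<sigma> k) (A k)" by metis
 have A: "!!k. A k \<in> sets M" "!!k. measure M (A k) < 2 * (1/2)^k"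
  and sub: "!!k. {w\<in>space M. ennreal ((1/2)^k) < f (\<sigma> k) w | ennreal ((1/2)^k) < g (\<sigma> k) w} \<subseteq> A k"
  using Q unfolding Q_def by auto
 have "summable (%k. measure M (A k))"
 proof (rule summable_comparison_test'[where g="%k. 2 * (1/2)^k" and N=0])
  show "summable (%k. 2 * (1 / 2 :: real) ^ k)" by (intro summable_mult summable_geometric) simp
  show "norm (measure M (A k)) <= 2 * (1 / 2) ^ k" for k using A(2)[of k] by simp
 qed
 hence "AE w in M. eventually (%k. w \<in> space M - A k) sequentially"
  by (intro borel_cantelli_AE1 A) (auto simp: less_top[symmetric])
 hence "AE w in M. (%k. f (\<sigma> k) w) \<longlonglongrightarrow> 0 & (%k. g (\<sigma> k) w) \<longlonglongrightarrow> 0"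
 proof eventually_elim
  case (elim w)
  have lim: "(%k. ennreal ((1/2)^k)) \<longlonglongrightarrow> 0"
   using tendsto_ennrealI[OF LIMSEQ_power_zero[of "1/2::real"]] by simp
  have le: "f (\<sigma> k) w <= ennreal ((1/2)^k) & g (\<sigma> k) w <= ennreal ((1/2)^k)" if "w \<in> space M - A k" for k
  proof -
   have "~ (ennreal ((1/2)^k) < f (\<sigma> k) w | ennreal ((1/2)^k) < g (\<sigma> k) w)" using sub[of k] that by blast
   thus ?thesis by (simp only: de_Morgan_disj not_less)
  qed
  have "eventually (%k. f (\<sigma> k) w <= ennreal ((1/2)^k)) sequentially" "eventually (%k. g (\<sigma> k) w <= ennreal ((1/2)^k)) sequentially"
   by (rule eventually_mono[OF elim], use le in blast)+
  hence "(%k. f (\<sigma> k) w) \<longlonglongrightarrow> 0" "(%k. g (\<sigma> k) w) \<longlonglongrightarrow> 0"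
   by (auto intro: tendsto_sandwich[OF _ _ tendsto_const lim])
  thus ?case by blast
 qed
 thus ?thesis by blast
qed

text \<open>Young's inequality with parameter \<open>e\<close>. It turns convergence of integrands
  in the square mean into convergence of their squares in the mean without taking square roots of
  integrals.\<close>

lemma square_diff_bound:
 fixes a b e :: real
 assumes "0 < e"
 shows "\<bar>a\<^sup>2 - b\<^sup>2\<bar> <= (1 + 1 / e) * (a - b)^2 + e * b^2"
proof -
 have "\<bar>a\<^sup>2 - b\<^sup>2\<bar> <= (a - b)^2 + 2 * \<bar>a - b\<bar> * \<bar>b\<bar>"
 proof -
  have "a^2 - b\<^sup>2 = (a - b)^2 + 2 * (a - b) * b" by (simp add: power2_eq_square algebra_simps)
  moreover have "\<bar>(a - b)\<^sup>2 + 2 * (a - b) * b\<bar> <= \<bar>(a - b)\<^sup>2\<bar> + \<bar>2 * (a - b) * b\<bar>" by (rule abs_triangle_ineq)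
  moreover have "\<bar>2 * (a - b) * b\<bar> = 2 * \<bar>a - b\<bar> * \<bar>b\<bar>" by (simp only: abs_mult abs_numeral)
  ultimately show ?thesis by simp
 qed
 also have "2 * \<bar>a - b\<bar> * \<bar>b\<bar> <= 1 / e * (a - b)^2 + e * b^2"
 proof -
  have "2 * p * q <= 1 / e * p^2 + e * q^2" for p q :: real
  proof -
   have "0 <= (p - e * q)^2 / e" using assms by simp
   also have "... = 1 / e * p^2 + e * q^2 - 2 * p * q" using assms by (simp add: power2_eq_square field_simps)
   finally show ?thesis by simp
  qed
  from this[of "\<bar>a - b\<bar>" "\<bar>b\<bar>"] show ?thesis by simp
 qed
 finally show ?thesis by (simp add: algebra_simps)
qed

lemma square_approx_limit:
 fixes Hk :: "nat => real => real" and h :: "real => real"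
 assumes [measurable]: "!!k. Hk k \<in> borel_measurable borel" "h \<in> borel_measurable borel"
  and bd: "!!k. EX B. ALL v. \<bar>Hk k v\<bar> <= B"
  and e: "(%k. \<integral>\<^sup>+v. ind {0..t} v * ennreal ((Hk k v - h v)^2) \<partial>lborel) \<longlonglongrightarrow> 0"
 shows "integrable lborel (%v. ind {0<..t} v * (h v)^2)"
  and "!!k. integrable lborel (%v. ind {0<..t} v * \<bar>(Hk k v)\<^sup>2 - (h v)^2\<bar>)"
  and "(%k. \<integral>v. ind {0<..t} v * \<bar>(Hk k v)\<^sup>2 - (h v)^2\<bar> \<partial>lborel) \<longlonglongrightarrow> 0"
proof -
 define E where "E k = (\<integral>\<^sup>+v. ind {0..t} v * ennreal ((Hk k v - h v)^2) \<partial>lborel)" for k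
 have E: "E \<longlonglongrightarrow> 0" using e by (simp add: E_def[abs_def])
 have le: "(\<integral>\<^sup>+v. ennreal (ind {0<..t} v * (Hk k v - h v)^2) \<partial>lborel) <= E k" for k
  unfolding E_def by (intro nn_integral_mono) (auto split: split_indicator)
 have Hi: "integrable lborel (%v. ind {0<..t} v * (Hk k v)^2)" for k
 proof -
  obtain B where B: "!!v. \<bar>Hk k v\<bar> <= B" using bd by blast
  have "0 <= B" using B[of 0] by linarith
  hence B2: "(Hk k v)^2 <= B^2" for v using B[of v] by (simp add: abs_le_square_iff[symmetric])
  show ?thesis
  proof (rule Bochner_Integration.integrable_bound)
   show "integrable lborel (%v. B\<^sup>2 * ind {0<..t} v)" by (intro integrable_mult_right integrable_indicator_Ioc)
   show "AE v in lborel. norm (ind {0<..t} v * (Hk k v)^2) <= norm (B^2 * ind {0<..t} v)"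
    using B2 by (intro AE_I2) (simp split: split_indicator)
  qed measurable
 qed
 have di: "integrable lborel (%v. ind {0<..t} v * (Hk k v - h v)^2)" if "E k < \<infinity>" for k
  using le[of k] that by (intro integrableI_bounded) (auto simp: abs_mult intro: le_less_trans)
 \<comment> \<open>A single index at finite distance already makes \<open>h\<close> square
   integrable, because the approximating integrand is bounded.\<close>
 obtain k0 where "E k0 < 1" using order_tendstoD(2)[OF E, of 1] by (auto simp: eventually_sequentially)
 hence di0: "integrable lborel (%v. ind {0<..t} v * (Hk k0 v - h v)^2)"
  by (intro di) (metis ennreal_one_less_top order.strict_trans infinity_ennreal_def)
 have two: "(a - b)^2 <= 2 * a^2 + 2 * b^2" for a b :: real
  using zero_le_power2[of "a + b"] by (simp add: power2_diff power2_sum)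
 show hi: "integrable lborel (%v. ind {0<..t} v * (h v)^2)"
 proof (rule Bochner_Integration.integrable_bound)
  show "integrable lborel (%v. 2 * (ind {0<..t} v * (Hk k0 v)^2) + 2 * (ind {0<..t} v * (Hk k0 v - h v)^2))"
   using Hi[of k0] di0 by simp
  have "(h v)^2 <= 2 * (Hk k0 v)^2 + 2 * (Hk k0 v - h v)^2" for v
   using two[of "Hk k0 v" "Hk k0 v - h v"] by simp
  thus "AE v in lborel. norm (ind {0<..t} v * (h v)^2) <= norm (2 * (ind {0<..t} v * (Hk k0 v)^2) + 2 * (ind {0<..t} v * (Hk k0 v - h v)^2))"
   by (intro AE_I2) (simp split: split_indicator)
 qed measurable
 have dik: "integrable lborel (%v. ind {0<..t} v * (Hk k v - h v)^2)" for k
 proof (rule Bochner_Integration.integrable_bound)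
  show "integrable lborel (%v. 2 * (ind {0<..t} v * (Hk k v)^2) + 2 * (ind {0<..t} v * (h v)^2))"
   using Hi[of k] hi by simp
  show "AE v in lborel. norm (ind {0<..t} v * (Hk k v - h v)^2) <= norm (2 * (ind {0<..t} v * (Hk k v)^2) + 2 * (ind {0<..t} v * (h v)^2))"
   using two by (intro AE_I2) (simp split: split_indicator)
 qed measurable
 define D where "D k = (\<integral>v. ind {0<..t} v * (Hk k v - h v)^2 \<partial>lborel)" for k
 have D0: "0 <= D k" for k unfolding D_def by (intro integral_nonneg_AE) auto
 have "ennreal (D k) <= E k" for k
  using le[of k] dik[of k] by (simp add: D_def nn_integral_eq_integral)
 hence "(%k. ennreal (D k)) \<longlonglongrightarrow> ennreal 0"
  using tendsto_sandwich[OF _ _ tendsto_const E, of "%k. ennreal (D k)"] by simp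
 hence D: "D \<longlonglongrightarrow> 0" using D0 by (subst (asm) tendsto_ennreal_iff) auto
 show ai: "integrable lborel (%v. ind {0<..t} v * \<bar>(Hk k v)\<^sup>2 - (h v)^2\<bar>)" for k
 proof -
  have "integrable lborel (%v. \<bar>ind {0<..t} v * (Hk k v)^2 - ind {0<..t} v * (h v)^2\<bar>)"
   using Hi hi by (intro integrable_abs Bochner_Integration.integrable_diff)
  thus ?thesis by (simp add: right_diff_distrib[symmetric] abs_mult)
 qed
 define S where "S = (\<integral>v. ind {0<..t} v * (h v)^2 \<partial>lborel)"
 have S0: "0 <= S" unfolding S_def by (intro integral_nonneg_AE) auto
 have bound: "(\<integral>v. ind {0<..t} v * \<bar>(Hk k v)\<^sup>2 - (h v)^2\<bar> \<partial>lborel) <= (1 + 1 / e) * D k + e * S" if "0 < e" for e k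
 proof -
  have "(\<integral>v. ind {0<..t} v * \<bar>(Hk k v)\<^sup>2 - (h v)^2\<bar> \<partial>lborel) <= (\<integral>v. (1 + 1 / e) * (ind {0<..t} v * (Hk k v - h v)^2) + e * (ind {0<..t} v * (h v)^2) \<partial>lborel)"
  proof (rule integral_mono)
   show "integrable lborel (%v. (1 + 1 / e) * (ind {0<..t} v * (Hk k v - h v)^2) + e * (ind {0<..t} v * (h v)^2))"
    using dik hi by (intro Bochner_Integration.integrable_add integrable_mult_right)
   fix v
   show "ind {0<..t} v * \<bar>(Hk k v)\<^sup>2 - (h v)^2\<bar> <= (1 + 1 / e) * (ind {0<..t} v * (Hk k v - h v)^2) + e * (ind {0<..t} v * (h v)^2)"
    using square_diff_bound[OF that, of "Hk k v" "h v"] by (simp split: split_indicator)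
  qed (rule ai)
  also have "... = (1 + 1 / e) * D k + e * S"
   unfolding D_def S_def using dik hi by (subst Bochner_Integration.integral_add) (auto simp del: distrib_right_numeral)
  finally show ?thesis .
 qed
 show "(%k. \<integral>v. ind {0<..t} v * \<bar>(Hk k v)\<^sup>2 - (h v)^2\<bar> \<partial>lborel) \<longlonglongrightarrow> 0"
 proof (rule LIMSEQ_I)
  fix \<delta> :: real assume \<delta>: "0 < \<delta>"
  \<comment> \<open>The parameter keeps the term that does not depend on \<open>k\<close> below half
    of \<open>\<delta>\<close>; \<open>S + 1\<close> avoids division by zero.\<close>
  define e where "e = \<delta> / (2 * (S + 1))"
  have e0: "0 < e" using \<delta> S0 by (simp add: e_def)
  have "e * S < \<delta> / 2 + 0"
  proof -
   have "e * S < e * (S + 1)" using e0 by simp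
   also have "... = \<delta> / 2" using S0 by (simp add: e_def field_simps)
   finally show ?thesis by simp
  qed
  moreover have "(%k. (1 + 1 / e) * D k) \<longlonglongrightarrow> (1 + 1 / e) * 0" by (intro tendsto_intros D)
  hence "eventually (%k. (1 + 1 / e) * D k < \<delta> / 2) sequentially" using \<delta> by (intro order_tendstoD(2)) auto
  ultimately obtain k0 where k0: "!!k. k >= k0 ==> (1 + 1 / e) * D k + e * S < \<delta>"
   unfolding eventually_sequentially by (smt (verit) field_sum_of_halves)
  have nn: "0 <= (\<integral>v. ind {0<..t} v * \<bar>(Hk k v)\<^sup>2 - (h v)^2\<bar> \<partial>lborel)" for k
   by (intro integral_nonneg_AE) auto
  show "EX no. \<forall>k\<ge>no. norm ((\<integral>v. ind {0<..t} v * \<bar>(Hk k v)\<^sup>2 - (h v)^2\<bar> \<partial>lborel) - 0) < \<delta>"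
  proof (intro exI allI impI)
   fix k assume "k0 <= k"
   show "norm ((\<integral>v. ind {0<..t} v * \<bar>(Hk k v)\<^sup>2 - (h v)^2\<bar> \<partial>lborel) - 0) < \<delta>"
    using bound[OF e0, of k] k0[OF \<open>k0 <= k\<close>] nn[of k] by simp
  qed
 qed
qed

text \<open>Weights converging uniformly against squares converging in the mean: the error splits
  into a bounded weight times the difference of squares and a small weight difference times the
  fixed square.\<close>

lemma weighted_square_limit:
 fixes Hk Gk :: "nat => real => real" and h G :: "real => real"
 assumes [measurable]: "!!k. Hk k \<in> borel_measurable borel" "h \<in> borel_measurable borel"
  "!!k. Gk k \<in> borel_measurable borel" "G \<in> borel_measurable borel"
  and hi: "integrable lborel (%v. ind {0<..t} v * (h v)^2)"
  and ai: "!!k. integrable lborel (%v. ind {0<..t} v * \<bar>(Hk k v)\<^sup>2 - (h v)^2\<bar>)"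
  and lim: "(%k. \<integral>v. ind {0<..t} v * \<bar>(Hk k v)\<^sup>2 - (h v)^2\<bar> \<partial>lborel) \<longlonglongrightarrow> 0"
  and L: "!!k v. \<bar>Gk k v\<bar> <= L"
  and unif: "!!e. 0 < e ==> eventually (%k. \<forall>v\<in>{0<..t}. \<bar>Gk k v - G v\<bar> <= e) sequentially"
  and st: "0 <= s"
 shows "(%k. \<integral>v. ind {s<..t} v * (Gk k v * (Hk k v)^2) \<partial>lborel) \<longlonglongrightarrow> (\<integral>v. ind {s<..t} v * (G v * (h v)^2) \<partial>lborel)"
proof -
 define S where "S = (\<integral>v. ind {0<..t} v * (h v)^2 \<partial>lborel)"
 have S0: "0 <= S" unfolding S_def by (intro integral_nonneg_AE) auto
 define a where "a k = (\<integral>v. ind {0<..t} v * \<bar>(Hk k v)\<^sup>2 - (h v)^2\<bar> \<partial>lborel)" for k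
 have L0: "0 <= L" using L[of 0 0] by linarith
 have Gb: "\<bar>G v\<bar> <= L + 1" if "v \<in> {0<..t}" for v
 proof -
  have "eventually (%k. \<forall>v\<in>{0<..t}. \<bar>Gk k v - G v\<bar> <= 1) sequentially" by (rule unif) simp
  hence "EX k. \<forall>v\<in>{0<..t}. \<bar>Gk k v - G v\<bar> <= 1" by (rule eventually_happens'[OF sequentially_bot])
  then obtain k where "\<forall>v\<in>{0<..t}. \<bar>Gk k v - G v\<bar> <= 1" by (elim exE)
  hence "\<bar>Gk k v - G v\<bar> <= 1" using that by (rule bspec)
  thus ?thesis using L[of k v] by linarith
 qed
 have i1: "integrable lborel (%v. ind {s<..t} v * (G v * (h v)^2))"
 proof (rule Bochner_Integration.integrable_bound)
  show "integrable lborel (%v. (L + 1) * (ind {0<..t} v * (h v)^2))" using hi by simp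
  have "\<bar>ind {s<..t} v * (G v * (h v)^2)\<bar> <= (L + 1) * (ind {0<..t} v * (h v)^2)" for v
  proof (cases "v \<in> {s<..t}")
   case True
   hence v: "v \<in> {0<..t}" using st by simp
   show ?thesis using mult_right_mono[OF Gb[OF v], of "(h v)^2"] True v by (simp add: abs_mult)
  next
   case False
   have "0 <= (L + 1) * (ind {0<..t} v * (h v)^2)" using L0 by (intro mult_nonneg_nonneg) auto
   thus ?thesis using False by simp
  qed
  thus "AE v in lborel. norm (ind {s<..t} v * (G v * (h v)^2)) <= norm ((L + 1) * (ind {0<..t} v * (h v)^2))"
   using L0 by (intro AE_I2) (simp add: abs_mult)
 qed measurable
 have Hi: "integrable lborel (%v. ind {0<..t} v * (Hk k v)^2)" for k
 proof (rule Bochner_Integration.integrable_bound)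
  show "integrable lborel (%v. ind {0<..t} v * \<bar>(Hk k v)\<^sup>2 - (h v)^2\<bar> + ind {0<..t} v * (h v)^2)" using ai hi by simp
  show "AE v in lborel. norm (ind {0<..t} v * (Hk k v)^2) <= norm (ind {0<..t} v * \<bar>(Hk k v)\<^sup>2 - (h v)^2\<bar> + ind {0<..t} v * (h v)^2)"
  proof (intro AE_I2)
   fix v
   have "(Hk k v)^2 <= \<bar>(Hk k v)\<^sup>2 - (h v)^2\<bar> + (h v)^2" by linarith
   thus "norm (ind {0<..t} v * (Hk k v)^2) <= norm (ind {0<..t} v * \<bar>(Hk k v)\<^sup>2 - (h v)^2\<bar> + ind {0<..t} v * (h v)^2)"
    by (cases "v \<in> {0<..t}") simp_all
  qed
 qed measurable
 have i2: "integrable lborel (%v. ind {s<..t} v * (Gk k v * (Hk k v)^2))" for k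
 proof (rule Bochner_Integration.integrable_bound)
  show "integrable lborel (%v. L * (ind {0<..t} v * (Hk k v)^2))" using Hi by simp
  have "\<bar>ind {s<..t} v * (Gk k v * (Hk k v)^2)\<bar> <= L * (ind {0<..t} v * (Hk k v)^2)" for v
  proof (cases "v \<in> {s<..t}")
   case True
   hence v: "v \<in> {0<..t}" using st by simp
   show ?thesis using mult_right_mono[OF L[of k v], of "(Hk k v)^2"] True v by (simp add: abs_mult)
  next
   case False
   have "0 <= L * (ind {0<..t} v * (Hk k v)^2)" using L0 by (intro mult_nonneg_nonneg) auto
   thus ?thesis using False by simp
  qed
  thus "AE v in lborel. norm (ind {s<..t} v * (Gk k v * (Hk k v)^2)) <= norm (L * (ind {0<..t} v * (Hk k v)^2))"
   using L0 by (intro AE_I2) (simp add: abs_mult)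
 qed measurable
 have bound: "\<bar>(\<integral>v. ind {s<..t} v * (Gk k v * (Hk k v)^2) \<partial>lborel) - (\<integral>v. ind {s<..t} v * (G v * (h v)^2) \<partial>lborel)\<bar> <= L * a k + e * S"
  if k: "\<forall>v\<in>{0<..t}. \<bar>Gk k v - G v\<bar> <= e" and e: "0 < e" for k e
 proof -
  have "\<bar>(\<integral>v. ind {s<..t} v * (Gk k v * (Hk k v)^2) \<partial>lborel) - (\<integral>v. ind {s<..t} v * (G v * (h v)^2) \<partial>lborel)\<bar>
   = \<bar>\<integral>v. ind {s<..t} v * (Gk k v * (Hk k v)^2) - ind {s<..t} v * (G v * (h v)^2) \<partial>lborel\<bar>"
   using i1 i2 by simp
  also have "... <= (\<integral>v. \<bar>ind {s<..t} v * (Gk k v * (Hk k v)^2) - ind {s<..t} v * (G v * (h v)^2)\<bar> \<partial>lborel)"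
   by (rule integral_abs_bound)
  also have "... <= (\<integral>v. L * (ind {0<..t} v * \<bar>(Hk k v)\<^sup>2 - (h v)^2\<bar>) + e * (ind {0<..t} v * (h v)^2) \<partial>lborel)"
  proof (rule integral_mono)
   show "integrable lborel (%v. \<bar>ind {s<..t} v * (Gk k v * (Hk k v)^2) - ind {s<..t} v * (G v * (h v)^2)\<bar>)"
    using i1 i2 by (intro integrable_abs Bochner_Integration.integrable_diff)
   show "integrable lborel (%v. L * (ind {0<..t} v * \<bar>(Hk k v)\<^sup>2 - (h v)^2\<bar>) + e * (ind {0<..t} v * (h v)^2))"
    using ai hi by (intro Bochner_Integration.integrable_add integrable_mult_right)
   fix v
   show "\<bar>ind {s<..t} v * (Gk k v * (Hk k v)^2) - ind {s<..t} v * (G v * (h v)^2)\<bar> <= L * (ind {0<..t} v * \<bar>(Hk k v)\<^sup>2 - (h v)^2\<bar>) + e * (ind {0<..t} v * (h v)^2)"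
   proof (cases "v \<in> {s<..t}")
    case True
    hence v: "v \<in> {0<..t}" using st by auto
    have "Gk k v * (Hk k v)^2 - G v * (h v)^2 = Gk k v * ((Hk k v)^2 - (h v)^2) + (Gk k v - G v) * (h v)^2"
     by (simp add: algebra_simps)
    hence "\<bar>Gk k v * (Hk k v)^2 - G v * (h v)^2\<bar> <= \<bar>Gk k v\<bar> * \<bar>(Hk k v)\<^sup>2 - (h v)^2\<bar> + \<bar>Gk k v - G v\<bar> * (h v)^2"
     using abs_triangle_ineq[of "Gk k v * ((Hk k v)^2 - (h v)^2)" "(Gk k v - G v) * (h v)^2"] by (simp add: abs_mult)
    also have "... <= L * \<bar>(Hk k v)\<^sup>2 - (h v)^2\<bar> + e * (h v)^2"
     using L[of k v] k v by (intro add_mono mult_right_mono) auto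
    finally show ?thesis using True v by simp
   next
    case False
    have "0 <= L * (ind {0<..t} v * \<bar>(Hk k v)\<^sup>2 - (h v)^2\<bar>)" "0 <= e * (ind {0<..t} v * (h v)^2)"
     using L0 e by simp_all
    thus ?thesis using False by simp
   qed
  qed
  also have "... = L * a k + e * S"
   unfolding a_def S_def using ai hi by simp
  finally show ?thesis .
 qed
 show ?thesis
 proof (rule LIMSEQ_I)
  fix \<delta> :: real assume \<delta>: "0 < \<delta>"
  define e where "e = \<delta> / (2 * (S + 1))"
  have e0: "0 < e" using \<delta> S0 by (simp add: e_def)
  have eS: "e * S < \<delta> / 2"
  proof -
   have "e * S < e * (S + 1)" using e0 by simp
   also have "... = \<delta> / 2" using S0 by (simp add: e_def field_simps)
   finally show ?thesis by simp
  qed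
  have "(%k. L * a k) \<longlonglongrightarrow> L * 0" by (intro tendsto_mult tendsto_const) (use lim in \<open>simp add: a_def[abs_def]\<close>)
  hence "eventually (%k. L * a k < \<delta> / 2) sequentially" using \<delta> by (intro order_tendstoD(2)) auto
  with unif[OF e0] have "eventually (%k. norm ((\<integral>v. ind {s<..t} v * (Gk k v * (Hk k v)^2) \<partial>lborel) - (\<integral>v. ind {s<..t} v * (G v * (h v)^2) \<partial>lborel)) < \<delta>) sequentially"
  proof eventually_elim
   case (elim k)
   show ?case using bound[OF elim(1) e0] elim(2) eS by simp
  qed
  thus "EX no. \<forall>k\<ge>no. norm ((\<integral>v. ind {s<..t} v * (Gk k v * (Hk k v)^2) \<partial>lborel) - (\<integral>v. ind {s<..t} v * (G v * (h v)^2) \<partial>lborel)) < \<delta>"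
   by (simp add: eventually_sequentially)
 qed
qed

lemma double_integral_measurable:
 assumes [measurable]: "g \<in> borel_measurable borel" "f \<in> borel_measurable N" "h \<in> borel_measurable N"
 shows "(%w. double_integral g (f w) (h w)) \<in> borel_measurable N"
 unfolding double_integral_eq_kern[OF assms(1)] by measurable

lemma AE_lborel_notin_Ioo:
 assumes "AE z in lborel. z ~: {a<..<b::real}" shows "b <= a"
proof (rule ccontr)
 assume "~ b <= a"
 moreover have "{a<..<b} \<in> null_sets lborel" using assms by (subst AE_iff_null_sets) auto
 ultimately show False by (simp add: null_sets_def)
qed

lemma cos_lower_bound: "1 - x\<^sup>2 / 2 <= cos x" for x :: real
 using cos_scaled_bound(2)[of x 0] by simp

section \<open>Weak solutions and their pathwise approximation by simple integrals\<close>

locale weak_sol = bm_filtration P F W for P :: "'a measure" and F W +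
 fixes M :: "real => 'a => real" and \<eta> :: "real => real" and m l r :: real
 assumes lr: "l < r"
  and eta_borel: "\<eta> \<in> borel_measurable borel"
  and eta_zero: "!!x. x ~: {l<..<r} ==> \<eta> x = 0"
  and m_in: "m \<in> {l<..<r}"
  and sol: "weak_solution P F \<eta> m M W"
begin

lemma M_cont: "continuous_paths P M"
 using sol by (simp add: weak_solution_def)

lemma M_path: "w \<in> space P ==> continuous_on {0..} (%t. M t w)"
 using M_cont by (simp add: continuous_paths_def)

lemma M_adapted: "0 <= t ==> M t \<in> borel_measurable (F t)"
 using sol by (simp add: weak_solution_def adapted_def)

lemma M_measurable: "0 <= t ==> M t \<in> borel_measurable P"
 by (rule measurable_F_P[OF M_adapted])

abbreviation "Eta v w \<equiv> \<eta> (M v w)"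

lemma Eta_measurable: "(%x. Eta (max 0 (fst x)) (snd x)) \<in> borel_measurable (borel \<Otimes>\<^sub>M P)"
 using measurable_compose[OF process_joint_measurable[OF M_measurable M_cont] eta_borel] by simp

definition QV :: "real => 'a => real" where
 "QV t w = (\<integral>v. ind {0<..t} v * (Eta v w)^2 \<partial>lborel)"

lemma QV_integrand_measurable:
 "g \<in> borel_measurable borel ==> 0 <= s ==>
  (%x. ind {s<..t} (fst x) * (g (M (fst x) (snd x)) * (Eta (fst x) (snd x))^2) :: real) \<in> borel_measurable (borel \<Otimes>\<^sub>M P)"
 by (rule time_integrand_measurable[OF M_measurable M_cont Eta_measurable])

lemma QV_measurable: "QV t \<in> borel_measurable P"
proof -
 have "(%w. \<integral>v. ind {0<..t} v * ((%_. 1) (M v w) * (Eta v w)^2) \<partial>lborel) \<in> borel_measurable P"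
  by (rule integral_over_time_measurable[OF QV_integrand_measurable]) auto
 thus ?thesis by (simp add: QV_def[abs_def])
qed

lemma QV_nonneg: "0 <= QV t w"
 unfolding QV_def by (intro integral_nonneg_AE) auto

text \<open>The Ito approximation as a property of a single path: squared integrands converge in the
  mean over time and the integrals converge uniformly up to \<open>t\<close>. In this form the limit
  arguments are deterministic for almost every path.\<close>

definition approximates :: "real => (nat => real list) => (nat => nat => 'a => real) => 'a => bool" where
 "approximates t ts xi w \<longleftrightarrow>
   integrable lborel (%v. ind {0<..t} v * (Eta v w)^2) &
   (ALL k. integrable lborel (%v. ind {0<..t} v * \<bar>(simple_proc (ts k) (xi k) v w)\<^sup>2 - (Eta v w)^2\<bar>)) &
   (%k. \<integral>v. ind {0<..t} v * \<bar>(simple_proc (ts k) (xi k) v w)\<^sup>2 - (Eta v w)^2\<bar> \<partial>lborel) \<longlonglongrightarrow> 0 &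
   (\<forall>e>0. eventually (%k. \<forall>s\<in>{0..t}. \<bar>m + simple_integral W (ts k) (xi k) s w - M s w\<bar> < e) sequentially)"

lemma simple_processI: "simple_predictable F ts xi ==> simple_process P F W ts xi"
 by unfold_locales

text \<open>A subsequence turns both convergences in probability into almost sure ones. The equation
  \<open>M = m + X\<close> holds almost surely at each fixed time; rational times and continuity
  make it hold at all times on one event of full measure.\<close>

lemma approximation:
 assumes t: "0 <= t"
 shows "EX ts xi. (ALL k. simple_process P F W (ts k) (xi k)) & (AE w in P. approximates t ts xi w)"
proof -
 obtain X where ito: "ito_integral P F W Eta X" and MX: "!!t. 0 <= t ==> AE w in P. M t w = m + X t w"
  using sol by (auto simp: weak_solution_def)
 have Xc: "continuous_paths P X" using ito by (simp add: ito_integral_def)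
 obtain ts0 xi0 where sp0: "!!n. simple_predictable F (ts0 n) (xi0 n)"
  and c: "\<forall>t\<ge>0.
      conv_in_prob P (%n w. \<integral>\<^sup>+ s. ind {0..t} s *
        ennreal ((simple_proc (ts0 n) (xi0 n) s w - Eta s w)^2) \<partial>lborel) &
      conv_in_prob P (%n w. SUP s\<in>{0..t}.
        ennreal \<bar>simple_integral W (ts0 n) (xi0 n) s w - X s w\<bar>)"
  using ito unfolding ito_integral_def by (elim conjE exE) blast
 obtain \<sigma> where \<sigma>: "AE w in P. (%k. \<integral>\<^sup>+ s. ind {0..t} s *
        ennreal ((simple_proc (ts0 (\<sigma> k)) (xi0 (\<sigma> k)) s w - Eta s w)^2) \<partial>lborel) \<longlonglongrightarrow> 0 &
      (%k. SUP s\<in>{0..t}. ennreal \<bar>simple_integral W (ts0 (\<sigma> k)) (xi0 (\<sigma> k)) s w - X s w\<bar>) \<longlonglongrightarrow> 0"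
  using conv_in_prob_choose[OF conjunct1[OF c[rule_format, OF t]] conjunct2[OF c[rule_format, OF t]]] by (elim exE)
 define ts xi where "ts k = ts0 (\<sigma> k)" and "xi k = xi0 (\<sigma> k)" for k
 have sp: "simple_process P F W (ts k) (xi k)" for k
  unfolding ts_def xi_def by (rule simple_processI[OF sp0])
 have "AE w in P. \<forall>q\<in>\<rat> \<inter> {0..}. M q w = m + X q w"
  using MX by (subst AE_ball_countable) (auto intro: countable_subset[OF _ countable_rat])
 hence "AE w in P. approximates t ts xi w"
  using \<sigma> AE_space
 proof eventually_elim
  case (elim w)
  have all: "M s w = m + X s w" if "0 <= s" for s
  proof -
   have cM: "continuous_on {0..} (%s. M s w)" "continuous_on {0..} (%s. X s w)"
    using M_cont Xc elim(3) by (auto simp: continuous_paths_def)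
   have "M s w - (m + X s w) \<in> {0}"
    by (rule closed_property_from_rationals[where f="%s. M s w - (m + X s w)"])
      (use elim(1) that cM in \<open>auto intro!: continuous_intros\<close>)
   thus ?thesis by simp
  qed
  define h where "h v = Eta (max 0 v) w" for v
  have hm: "h \<in> borel_measurable borel"
   unfolding h_def using pathwise_measurable[of "%v w. Eta (max 0 v) w", OF Eta_measurable elim(3)] by simp
  have Hm: "(%v. simple_proc (ts k) (xi k) v w) \<in> borel_measurable borel" for k
   by (rule pathwise_measurable[OF simple_process.proc_measurable[OF sp] elim(3)])
  have Hb: "EX B. ALL v. \<bar>simple_proc (ts k) (xi k) v w\<bar> <= B" for k
   using simple_process.proc_bounded[OF sp, of k] by (elim exE conjE) blast
  have e: "(%k. \<integral>\<^sup>+v. ind {0..t} v * ennreal ((simple_proc (ts k) (xi k) v w - h v)^2) \<partial>lborel) \<longlonglongrightarrow> 0"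
  proof -
   have "(%v. ind {0..t} v * ennreal ((simple_proc (ts k) (xi k) v w - h v)^2)) = (%v. ind {0..t} v * ennreal ((simple_proc (ts k) (xi k) v w - Eta v w)^2))" for k
    by (auto simp: fun_eq_iff h_def max_def split: split_indicator)
   thus ?thesis using elim(2) by (simp add: ts_def xi_def)
  qed
  have h1: "(%v. ind {0<..t} v * (h v)^2) = (%v. ind {0<..t} v * (Eta v w)^2)"
   by (auto simp: fun_eq_iff h_def max_def split: split_indicator)
  have h2: "(%v. ind {0<..t} v * \<bar>(simple_proc (ts k) (xi k) v w)\<^sup>2 - (h v)^2\<bar>) = (%v. ind {0<..t} v * \<bar>(simple_proc (ts k) (xi k) v w)\<^sup>2 - (Eta v w)^2\<bar>)" for k
   by (auto simp: fun_eq_iff h_def max_def split: split_indicator)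
  note lim = square_approx_limit[where Hk="%k v. simple_proc (ts k) (xi k) v w" and h=h, OF Hm hm Hb e]
  have u: "eventually (%k. \<forall>s\<in>{0..t}. \<bar>m + simple_integral W (ts k) (xi k) s w - M s w\<bar> < e) sequentially" if e: "0 < e" for e
  proof -
   have "(%k. SUP s\<in>{0..t}. ennreal \<bar>simple_integral W (ts k) (xi k) s w - X s w\<bar>) \<longlonglongrightarrow> 0"
    using elim(2) by (simp add: ts_def xi_def)
   hence "eventually (%k. (SUP s\<in>{0..t}. ennreal \<bar>simple_integral W (ts k) (xi k) s w - X s w\<bar>) < ennreal e) sequentially"
    using e by (intro order_tendstoD(2)) auto
   thus ?thesis
   proof eventually_elim
    case (elim k)
    show ?case
    proof
     fix s assume s: "s \<in> {0..t}"
     have "ennreal \<bar>simple_integral W (ts k) (xi k) s w - X s w\<bar> < ennreal e"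
      by (rule le_less_trans[OF SUP_upper[OF s] elim])
     hence "\<bar>simple_integral W (ts k) (xi k) s w - X s w\<bar> < e" by (simp add: ennreal_less_iff)
     thus "\<bar>m + simple_integral W (ts k) (xi k) s w - M s w\<bar> < e" using all[of s] s by simp
    qed
   qed
  qed
  show ?case
   unfolding approximates_def using lim[unfolded h1 h2] u by blast
 qed
 thus ?thesis using sp by blast
qed

text \<open>The Lipschitz bound on \<open>g\<close> converts uniform convergence of the integrals
  into uniform convergence of the weights required by \<open>weighted_square_limit\<close>.\<close>

lemma good_limit:
 assumes sp: "!!k. simple_process P F W (ts k) (xi k)" and a: "approximates t ts xi w" and w: "w \<in> space P"
  and g[measurable]: "g \<in> borel_measurable borel" and L: "!!x. \<bar>g x\<bar> <= L" and lip: "!!x y. \<bar>g x - g y\<bar> <= c * \<bar>x - y\<bar>" and s: "0 <= s"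
 shows "(%k. \<integral>v. ind {s<..t} v * (g (m + simple_integral W (ts k) (xi k) v w) * (simple_proc (ts k) (xi k) v w)^2) \<partial>lborel)
  \<longlonglongrightarrow> (\<integral>v. ind {s<..t} v * (g (M v w) * (Eta v w)^2) \<partial>lborel)"
proof -
 define h where "h v = Eta (max 0 v) w" for v
 define Gk where "Gk k v = g (m + simple_integral W (ts k) (xi k) (max 0 v) w)" for k v
 define G0 where "G0 v = g (M (max 0 v) w)" for v
 have hm: "h \<in> borel_measurable borel"
  unfolding h_def using pathwise_measurable[of "%v w. Eta (max 0 v) w", OF Eta_measurable w] by simp
 have Hm: "(%v. simple_proc (ts k) (xi k) v w) \<in> borel_measurable borel" for k
  by (rule pathwise_measurable[OF simple_process.proc_measurable[OF sp] w])
 have Gm: "Gk k \<in> borel_measurable borel" for k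
 proof -
  have [measurable]: "(%v. simple_integral W (ts k) (xi k) (max 0 v) w) \<in> borel_measurable borel"
   using pathwise_measurable[of "%v w. simple_integral W (ts k) (xi k) (max 0 v) w", OF process_joint_measurable[OF simple_process.integral_measurable[OF sp] simple_process.integral_continuous[OF sp]] w] by simp
  show ?thesis unfolding Gk_def[abs_def] by measurable
 qed
 have G0m: "G0 \<in> borel_measurable borel"
 proof -
  have [measurable]: "(%v. M (max 0 v) w) \<in> borel_measurable borel"
   using pathwise_measurable[of "%v w. M (max 0 v) w", OF process_joint_measurable[OF M_measurable M_cont] w] by simp
  show ?thesis unfolding G0_def[abs_def] by measurable
 qed
 have h1: "(%v. ind {0<..t} v * (h v)^2) = (%v. ind {0<..t} v * (Eta v w)^2)"
  by (auto simp: fun_eq_iff h_def max_def split: split_indicator)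
 have h2: "(%v. ind {0<..t} v * \<bar>(simple_proc (ts k) (xi k) v w)\<^sup>2 - (h v)^2\<bar>) = (%v. ind {0<..t} v * \<bar>(simple_proc (ts k) (xi k) v w)\<^sup>2 - (Eta v w)^2\<bar>)" for k
  by (auto simp: fun_eq_iff h_def max_def split: split_indicator)
 have c0: "0 <= c" using lip[of 1 0] by simp
 have "(%k. \<integral>v. ind {s<..t} v * (Gk k v * (simple_proc (ts k) (xi k) v w)^2) \<partial>lborel) \<longlonglongrightarrow> (\<integral>v. ind {s<..t} v * (G0 v * (h v)^2) \<partial>lborel)"
 proof (rule weighted_square_limit[OF Hm hm Gm G0m _ _ _ _ _ s, where L=L])
  show "integrable lborel (%v. ind {0<..t} v * (h v)^2)" using a unfolding h1 approximates_def by simp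
  show "integrable lborel (%v. ind {0<..t} v * \<bar>(simple_proc (ts k) (xi k) v w)\<^sup>2 - (h v)^2\<bar>)" for k
   using a unfolding h2 approximates_def by simp
  show "(%k. \<integral>v. ind {0<..t} v * \<bar>(simple_proc (ts k) (xi k) v w)\<^sup>2 - (h v)^2\<bar> \<partial>lborel) \<longlonglongrightarrow> 0"
   using a unfolding h2 approximates_def by simp
  show "\<bar>Gk k v\<bar> <= L" for k v unfolding Gk_def by (rule L)
  fix e :: real assume e: "0 < e"
  have "0 < e / (c + 1)" using e c0 by simp
  hence "eventually (%k. \<forall>s\<in>{0..t}. \<bar>m + simple_integral W (ts k) (xi k) s w - M s w\<bar> < e / (c + 1)) sequentially"
   using a unfolding approximates_def by blast
  thus "eventually (%k. \<forall>v\<in>{0<..t}. \<bar>Gk k v - G0 v\<bar> <= e) sequentially"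
  proof eventually_elim
   case (elim k)
   show ?case
   proof
    fix v assume v: "v \<in> {0<..t}"
    hence vm: "max 0 v = v" "v \<in> {0..t}" by auto
    have "\<bar>Gk k v - G0 v\<bar> <= c * \<bar>m + simple_integral W (ts k) (xi k) v w - M v w\<bar>"
     unfolding Gk_def G0_def vm(1) by (rule lip)
    also have "... <= c * (e / (c + 1))" by (intro mult_left_mono[OF less_imp_le[OF bspec[OF elim vm(2)]] c0])
    also have "... <= e" using c0 e by (simp add: field_simps)
    finally show "\<bar>Gk k v - G0 v\<bar> <= e" .
   qed
  qed
 qed
 moreover have "(%v. ind {s<..t} v * (Gk k v * (simple_proc (ts k) (xi k) v w)^2)) = (%v. ind {s<..t} v * (g (m + simple_integral W (ts k) (xi k) v w) * (simple_proc (ts k) (xi k) v w)^2))" for k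
  using s by (auto simp: fun_eq_iff Gk_def max_def split: split_indicator)
 moreover have "(%v. ind {s<..t} v * (G0 v * (h v)^2)) = (%v. ind {s<..t} v * (g (M v w) * (Eta v w)^2))"
  using s by (auto simp: fun_eq_iff G0_def h_def max_def split: split_indicator)
 ultimately show ?thesis by simp
qed

lemma QV_limit:
 assumes sp: "!!k. simple_process P F W (ts k) (xi k)" and a: "approximates t ts xi w" and w: "w \<in> space P"
 shows "(%k. \<integral>v. ind {0<..t} v * (simple_proc (ts k) (xi k) v w)^2 \<partial>lborel) \<longlonglongrightarrow> QV t w"
 using good_limit[OF sp a w, of "%_. 1" 1 0 0] by (simp add: QV_def)

text \<open>The quantity tested by the truncation converges to \<open>QV t w\<close>, so a strict
  inequality in the limit is eventually inherited and nothing is cut.\<close>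

lemma eventually_not_truncated:
 assumes sp: "!!k. simple_process P F W (ts k) (xi k)" and a: "approximates t ts xi w" and w: "w \<in> space P"
  and t: "0 <= t" and K: "QV t w < K"
 shows "eventually (%k. ALL v. simple_proc (ts k) (truncated_coeff (ts k) (xi k) t K) v w = simple_proc (ts k) (xi k) v w
   & simple_integral W (ts k) (truncated_coeff (ts k) (xi k) t K) v w = simple_integral W (ts k) (xi k) v w) sequentially"
proof -
 have K0: "0 <= K" using K QV_nonneg[of t w] by linarith
 have "eventually (%k. (\<integral>v. ind {0<..t} v * (simple_proc (ts k) (xi k) v w)^2 \<partial>lborel) < K) sequentially"
  by (rule order_tendstoD(2)[OF QV_limit[OF sp a w] K])
 thus ?thesis
 proof eventually_elim
  case (elim k)
  show ?case
   using simple_process.truncated_eq_all[OF sp t K0 less_imp_le[OF elim]] by blast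
 qed
qed

lemma approximates_endpoint:
 assumes "approximates t ts xi w" "s \<in> {0..t}"
 shows "(%k. m + simple_integral W (ts k) (xi k) s w) \<longlonglongrightarrow> M s w"
proof (rule LIMSEQ_I)
 fix e :: real assume "0 < e"
 hence "eventually (%k. \<forall>s\<in>{0..t}. \<bar>m + simple_integral W (ts k) (xi k) s w - M s w\<bar> < e) sequentially"
  using assms(1) unfolding approximates_def by blast
 hence "eventually (%k. norm (m + simple_integral W (ts k) (xi k) s w - M s w) < e) sequentially"
  by eventually_elim (use assms(2) in auto)
 thus "EX no. \<forall>k\<ge>no. norm (m + simple_integral W (ts k) (xi k) s w - M s w) < e"
  by (simp add: eventually_sequentially)
qed

subsection \<open>The solution stays in the closed interval\<close>

text \<open>A bounded Lipschitz function that is positive exactly outside \<open>[l, r]\<close>. Its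
  product with \<open>\<eta>^2\<close> vanishes identically, so \<open>M\<close> can accumulate no
  occupation weighted by it.\<close>

definition outside_dist :: "real => real" where
 "outside_dist z = min 1 (max 0 (l - z) + max 0 (z - r))"

lemma outside_dist: "0 <= outside_dist z" "\<bar>outside_dist z\<bar> <= 1" "\<bar>outside_dist x - outside_dist y\<bar> <= 2 * \<bar>x - y\<bar>"
 "z \<in> {l<..<r} ==> outside_dist z = 0" "outside_dist \<in> borel_measurable borel"
 unfolding outside_dist_def[abs_def] by (auto simp: min_def max_def abs_if) 

lemma outside_dist_eq_0:
 assumes "double_integral (%z. ennreal (outside_dist z)) m x = 0"
 shows "x \<in> {l..r}"
proof -
 note [measurable] = outside_dist(5)
 have "(\<integral>\<^sup>+z. ennreal (kern m x z) * ennreal (outside_dist z) \<partial>lborel) = 0"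
  using assms by (subst (asm) double_integral_eq_kern) auto
 hence ae: "AE z in lborel. ennreal (kern m x z) * ennreal (outside_dist z) = 0"
  by (subst (asm) nn_integral_0_iff_AE) auto
 have pos: "kern m x z = 0 | outside_dist z = 0" if "ennreal (kern m x z) * ennreal (outside_dist z) = 0" for z
  using that kern_nonneg[of m x z] outside_dist(1)[of z] by auto
 have "AE z in lborel. z ~: {r<..<x}"
  using ae by eventually_elim (use pos m_in in \<open>fastforce simp: kern_def outside_dist_def min_def max_def split: if_splits\<close>)
 moreover have "AE z in lborel. z ~: {x<..<l}"
  using ae by eventually_elim (use pos m_in in \<open>fastforce simp: kern_def outside_dist_def min_def max_def split: if_splits\<close>)
 ultimately show ?thesis using AE_lborel_notin_Ioo by auto
qed

text \<open>Apply the occupation identity to truncated approximations with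
  \<open>outside_dist\<close>. The occupation side tends to zero because \<open>\<eta>\<close>
  vanishes where \<open>outside_dist\<close> does not; lower semicontinuity and Fatou push this to
  the double integral at \<open>M t\<close> on the event \<open>QV t < K\<close>. A vanishing double
  integral excludes points outside \<open>[l, r]\<close>, since there kernel and test function are
  both positive on an interval.\<close>

lemma M_range_at:
 assumes t: "0 <= t"
 shows "AE w in P. M t w \<in> {l..r}"
proof -
 obtain ts xi where sp: "!!k. simple_process P F W (ts k) (xi k)" and ap: "AE w in P. approximates t ts xi w"
  using approximation[OF t] by blast
 note [measurable] = outside_dist(5) QV_measurable M_measurable[OF t]
 let ?\<phi> = "double_integral (%z. ennreal (outside_dist z)) m"
 have \<phi>m: "(%w. ?\<phi> (f w)) \<in> borel_measurable P" if "f \<in> borel_measurable P" for f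
  using that by (intro double_integral_measurable) auto
 have main: "AE w in P. QV t w < real K --> ?\<phi> (M t w) = 0" for K :: nat
 proof -
  have K0: "0 <= real K" by simp
  define xi' where "xi' k = truncated_coeff (ts k) (xi k) t (real K)" for k
  have sp': "simple_process P F W (ts k) (xi' k)" for k
   unfolding xi'_def by (rule simple_process.truncated_simple_process[OF sp t K0])
  \<comment> \<open>Built from the untruncated approximation, so that its limit is known, and capped
    at \<open>K\<close>, so that it is dominated; both are upper bounds for the truncated
    integral.\<close>
  define u where "u k w = min (real K) (\<integral>v. ind {0<..t} v * (outside_dist (m + simple_integral W (ts k) (xi k) v w) * (simple_proc (ts k) (xi k) v w)^2) \<partial>lborel)" for k w
  have u0: "0 <= u k w" for k w
   unfolding u_def by (intro min.boundedI integral_nonneg_AE) (auto simp: outside_dist(1))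
  have um[measurable]: "u k \<in> borel_measurable P" for k
  proof -
   have [measurable]: "(%w. \<integral>v. ind {0<..t} v * ((%x. outside_dist (m + x)) (simple_integral W (ts k) (xi k) v w) * (simple_proc (ts k) (xi k) v w)^2) \<partial>lborel) \<in> borel_measurable P"
    by (rule integral_over_time_measurable[OF time_integrand_measurable[OF simple_process.integral_measurable[OF sp] simple_process.integral_continuous[OF sp] simple_process.proc_measurable'[OF sp]]]) auto
   show ?thesis unfolding u_def[abs_def] by measurable
  qed
  have le: "2 * (\<integral>\<^sup>+w. ?\<phi> (m + simple_integral W (ts k) (xi' k) t w) \<partial>P) <= (\<integral>\<^sup>+w. ennreal (u k w) \<partial>P)" for k
  proof -
   have wK: "(\<integral>v. ind {0<..t} v * (simple_proc (ts k) (xi' k) v w)^2 \<partial>lborel) <= real K" for w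
    unfolding xi'_def by (rule simple_process.truncated_weight_le[OF sp t K0])
   have "2 * (\<integral>\<^sup>+w. ?\<phi> (m + simple_integral W (ts k) (xi' k) t w) \<partial>P)
    = (\<integral>\<^sup>+w. \<integral>\<^sup>+v. ennreal (ind {0<..t} v * (simple_proc (ts k) (xi' k) v w)^2) * ennreal (outside_dist (m + simple_integral W (ts k) (xi' k) v w)) \<partial>lborel \<partial>P)"
    by (rule simple_process.simple_occupation[OF sp' t _ wK, symmetric]) measurable
   also have "... <= (\<integral>\<^sup>+w. ennreal (u k w) \<partial>P)"
   proof (rule nn_integral_mono)
    fix w assume w: "w \<in> space P"
    let ?f' = "%v. ind {0<..t} v * (outside_dist (m + simple_integral W (ts k) (xi' k) v w) * (simple_proc (ts k) (xi' k) v w)^2)"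
    let ?f = "%v. ind {0<..t} v * (outside_dist (m + simple_integral W (ts k) (xi k) v w) * (simple_proc (ts k) (xi k) v w)^2)"
    have i': "integrable lborel ?f'" and b': "\<bar>integral\<^sup>L lborel ?f'\<bar> <= 1 * (\<integral>v. ind {0<..t} v * (simple_proc (ts k) (xi' k) v w)^2 \<partial>lborel)"
     using simple_process.path_integrable[OF sp' w, of 0 "%x. outside_dist (m + x)" 1 t] outside_dist(2) by auto
    have i: "integrable lborel ?f"
     using simple_process.path_integrable(1)[OF sp w, of 0 "%x. outside_dist (m + x)" 1 t] outside_dist(2) by auto
    have p: "0 <= ?f' v" "0 <= ?f v" for v by (simp_all add: outside_dist(1))
    have "(\<integral>\<^sup>+v. ennreal (ind {0<..t} v * (simple_proc (ts k) (xi' k) v w)^2) * ennreal (outside_dist (m + simple_integral W (ts k) (xi' k) v w)) \<partial>lborel) = (\<integral>\<^sup>+v. ennreal (?f' v) \<partial>lborel)"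
     by (intro nn_integral_cong) (simp add: ennreal_mult[symmetric] outside_dist(1) mult_ac)
    also have "... = ennreal (integral\<^sup>L lborel ?f')" by (rule nn_integral_eq_integral[OF i']) (simp add: outside_dist(1))
    also have "... <= ennreal (u k w)"
    proof (intro ennreal_leI)
     have "integral\<^sup>L lborel ?f' <= integral\<^sup>L lborel ?f"
     proof (rule integral_mono[OF i' i])
      fix v
      show "?f' v <= ?f v"
      \<comment> \<open>The truncated integrand is either zero or has the same value and the same
        integral as the original, so the integrands compare pointwise.\<close>
      proof (cases "simple_proc (ts k) (xi' k) v w = 0")
       case True thus ?thesis using p(2)[of v] by simp
      next
       case False
       show ?thesis
        using simple_process.truncated_eq[OF sp t K0 False[unfolded xi'_def]] by (simp add: xi'_def)
      qed
     qed
     thus "integral\<^sup>L lborel ?f' <= u k w" using b' wK[of w] unfolding u_def by linarith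
    qed
    finally show "(\<integral>\<^sup>+v. ennreal (ind {0<..t} v * (simple_proc (ts k) (xi' k) v w)^2) * ennreal (outside_dist (m + simple_integral W (ts k) (xi' k) v w)) \<partial>lborel) <= ennreal (u k w)" .
   qed
   finally show ?thesis .
  qed
  have "(%k. expectation (u k)) \<longlonglongrightarrow> expectation (%_. 0)"
  proof (rule integral_dominated_convergence[where w="%_. real K"])
   show "AE w in P. (%k. u k w) \<longlonglongrightarrow> 0"
    using ap AE_space
   proof eventually_elim
    case (elim w)
    have z: "(%v. ind {0<..t} v * (outside_dist (M v w) * (Eta v w)^2)) = (%_. 0)"
    proof
     fix v
     show "ind {0<..t} v * (outside_dist (M v w) * (Eta v w)^2) = 0"
      using outside_dist(4)[of "M v w"] eta_zero[of "M v w"] by (cases "M v w \<in> {l<..<r}") simp_all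
    qed
    have "(%k. \<integral>v. ind {0<..t} v * (outside_dist (m + simple_integral W (ts k) (xi k) v w) * (simple_proc (ts k) (xi k) v w)^2) \<partial>lborel) \<longlonglongrightarrow> (\<integral>v. ind {0<..t} v * (outside_dist (M v w) * (Eta v w)^2) \<partial>lborel)"
     by (rule good_limit[OF sp elim(1) elim(2) outside_dist(5,2,3)]) simp
    hence "(%k. u k w) \<longlonglongrightarrow> min (real K) 0"
     unfolding z u_def by (intro tendsto_min tendsto_const) simp
    thus ?case by simp
   qed
   show "AE w in P. norm (u k w) <= real K" for k
    using u0[of k] by (intro AE_I2) (simp add: u_def)
  qed simp_all
  hence Eu: "(%k. \<integral>\<^sup>+w. ennreal (u k w) \<partial>P) \<longlonglongrightarrow> 0"
  proof -
   have "(\<integral>\<^sup>+w. ennreal (u k w) \<partial>P) = ennreal (expectation (u k))" for k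
   proof (rule nn_integral_eq_integral)
    have "AE w in P. norm (u k w) <= real K"
     using u0[of k] by (intro AE_I2) (simp add: u_def)
    thus "integrable P (u k)" by (rule integrable_const_bound) simp
   qed (use u0 in simp)
   moreover have "(%k. ennreal (expectation (u k))) \<longlonglongrightarrow> ennreal (expectation (%_. 0))"
    by (rule tendsto_ennrealI) fact
   ultimately show ?thesis by simp
  qed
  have Xm[measurable]: "(%w. m + simple_integral W (ts k) (xi' k) t w) \<in> borel_measurable P" for k
   using simple_process.integral_measurable[OF sp' t] by measurable
  have "(\<integral>\<^sup>+w. ?\<phi> (M t w) * ind {w \<in> space P. QV t w < real K} w \<partial>P) <= (\<integral>\<^sup>+w. liminf (%k. ?\<phi> (m + simple_integral W (ts k) (xi' k) t w)) \<partial>P)"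
  proof (rule nn_integral_mono_AE)
   show "AE w in P. ?\<phi> (M t w) * ind {w \<in> space P. QV t w < real K} w <= liminf (%k. ?\<phi> (m + simple_integral W (ts k) (xi' k) t w))"
    using ap AE_space
   proof eventually_elim
    case (elim w)
    show ?case
    proof (cases "QV t w < real K")
     case True
     have "eventually (%k. m + simple_integral W (ts k) (xi k) t w = m + simple_integral W (ts k) (xi' k) t w) sequentially"
      using eventually_not_truncated[OF sp elim t True] by eventually_elim (simp add: xi'_def)
     moreover have "(%k. m + simple_integral W (ts k) (xi k) t w) \<longlonglongrightarrow> M t w"
      by (rule approximates_endpoint[OF elim(1)]) (use t in simp)
     ultimately have "(%k. m + simple_integral W (ts k) (xi' k) t w) \<longlonglongrightarrow> M t w"
      by (rule Lim_transform_eventually[rotated])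
     hence "?\<phi> (M t w) <= liminf (%k. ?\<phi> (m + simple_integral W (ts k) (xi' k) t w))"
      by (intro double_integral_lsc) auto
     thus ?thesis using True elim by simp
    qed simp
   qed
  qed
  also have "... <= liminf (%k. \<integral>\<^sup>+w. ?\<phi> (m + simple_integral W (ts k) (xi' k) t w) \<partial>P)"
   by (rule nn_integral_liminf[OF \<phi>m[OF Xm]])
  also have "... <= liminf (%k. \<integral>\<^sup>+w. ennreal (u k w) \<partial>P)"
  proof (rule Liminf_mono, rule always_eventually, rule allI)
   fix k
   have "(x::ennreal) <= 2 * x" for x using mult_right_mono[of 1 2 x] by simp
   from order_trans[OF this le[of k]] show "(\<integral>\<^sup>+w. ?\<phi> (m + simple_integral W (ts k) (xi' k) t w) \<partial>P) <= (\<integral>\<^sup>+w. ennreal (u k w) \<partial>P)" .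
  qed
  also have "... = 0" using Eu by (intro lim_imp_Liminf) auto
  finally have "(\<integral>\<^sup>+w. ?\<phi> (M t w) * ind {w \<in> space P. QV t w < real K} w \<partial>P) = 0" by simp
  hence "AE w in P. ?\<phi> (M t w) * ind {w \<in> space P. QV t w < real K} w = 0"
   by (subst (asm) nn_integral_0_iff_AE) (auto intro!: borel_measurable_times_ennreal \<phi>m)
  thus ?thesis using AE_space
  proof eventually_elim
   case (elim w) thus ?case by (auto split: split_indicator_asm)
  qed
 qed
 have "AE w in P. ALL K. QV t w < real K --> ?\<phi> (M t w) = 0"
  by (subst AE_all_countable) (intro allI main)
 thus ?thesis
 proof eventually_elim
  case (elim w)
  obtain K where "QV t w < real K" using reals_Archimedean2 by blast
  with elim show ?case by (intro outside_dist_eq_0) blast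
 qed
qed

lemma M_range: "AE w in P. \<forall>t\<ge>0. M t w \<in> {l..r}"
proof -
 have "AE w in P. \<forall>q\<in>\<rat> \<inter> {0..}. M q w \<in> {l..r}"
  using M_range_at by (subst AE_ball_countable) (auto intro: countable_subset[OF _ countable_rat])
 thus ?thesis
  using AE_space
 proof eventually_elim
  case (elim w)
  show ?case
  proof (intro allI impI)
   fix t :: real assume t: "0 <= t"
   show "M t w \<in> {l..r}"
   proof (rule closed_property_from_rationals[where f="%t. M t w", OF M_path[OF elim(2)] closed_atLeastAtMost _ t])
    fix q :: real assume "q \<in> \<rat>" "0 <= q"
    thus "M q w \<in> {l..r}" using bspec[OF elim(1), of q] by simp
   qed
  qed
 qed
qed

end

subsection \<open>Integrability of the quadratic variation\<close>

context weak_sol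
begin

lemma M_0: "AE w in P. M 0 w = m"
proof -
 obtain ts xi where sp: "!!k. simple_process P F W (ts k) (xi k)" and ap: "AE w in P. approximates 0 ts xi w"
  using approximation[of 0] by auto
 show ?thesis
  using ap
 proof eventually_elim
  case (elim w)
  have "(%k. m + simple_integral W (ts k) (xi k) 0 w) \<longlonglongrightarrow> M 0 w"
   by (rule approximates_endpoint[OF elim]) simp
  hence "(%k. m) \<longlonglongrightarrow> M 0 w" by (simp add: simple_process.integral_0[OF sp])
  thus ?case using LIMSEQ_unique[OF tendsto_const] by blast
 qed
qed

lemma path_integrable_AE: "AE w in P. ALL t. integrable lborel (%v. ind {0<..t} v * (Eta v w)^2)"
proof -
 have "AE w in P. integrable lborel (%v. ind {0<..real n} v * (Eta v w)^2)" for n :: nat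
 proof -
  obtain ts xi where ap: "AE w in P. approximates (real n) ts xi w"
   using approximation[of "real n"] by auto
  show ?thesis using ap by eventually_elim (simp add: approximates_def)
 qed
 hence "AE w in P. \<forall>n::nat. integrable lborel (%v. ind {0<..real n} v * (Eta v w)^2)"
  by (subst AE_all_countable) simp
 thus ?thesis
 proof eventually_elim
  case (elim w)
  show ?case
  proof
   fix t :: real
   obtain n :: nat where "t <= real n" using real_arch_simple by blast
   hence "(%v. ind {0<..t} v * (Eta v w)^2) = (%v. ind {..t} v *\<^sub>R (ind {0<..real n} v * (Eta v w)^2))"
    by (auto simp: fun_eq_iff split: split_indicator)
   thus "integrable lborel (%v. ind {0<..t} v * (Eta v w)^2)"
    using integrable_mult_indicator[OF _ spec[OF elim, of n], of "{..t}"] by simp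
  qed
 qed
qed

lemma truncated_measurable:
 assumes "simple_process P F W ts xi" "g \<in> borel_measurable borel" "0 <= s"
 shows "(%w. \<integral>v. ind {s<..t} v * (g (simple_integral W ts xi v w) * (simple_proc ts xi v w)^2) \<partial>lborel) \<in> borel_measurable P"
 by (rule integral_over_time_measurable[OF time_integrand_measurable[OF simple_process.integral_measurable[OF assms(1)] simple_process.integral_continuous[OF assms(1)] simple_process.proc_measurable'[OF assms(1)] assms(2,3)]])

text \<open>A cosine that is at least 1/2 on all of \<open>[l, r]\<close> has an Ito drift
  controlling the quadratic variation, while its own increment is at most 2 in modulus. Hence
  \<open>u^2 / 2 * expectation (J k) <= 2\<close>, which for \<open>u = 1 / (r - l)\<close> is the
  constant \<open>4 * (r - l)^2\<close>, free of \<open>K\<close> and \<open>t\<close>.\<close>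

lemma QV_truncated_bound:
 assumes t: "0 <= t"
 shows "(\<integral>\<^sup>+w. ennreal (ind {w \<in> space P. QV t w < real K} w * QV t w / 2) \<partial>P) <= ennreal (4 * (r - l)^2)"
proof -
 obtain ts xi where sp: "!!k. simple_process P F W (ts k) (xi k)" and ap: "AE w in P. approximates t ts xi w"
  using approximation[OF t] by blast
 note [measurable] = QV_measurable M_measurable[OF t]
 have K0: "0 <= real K" by simp
 define xi' where "xi' k = truncated_coeff (ts k) (xi k) t (real K)" for k
 have sp': "simple_process P F W (ts k) (xi' k)" for k
  unfolding xi'_def by (rule simple_process.truncated_simple_process[OF sp t K0])
 have wK: "(\<integral>v. ind {0<..t} v * (simple_proc (ts k) (xi' k) v w)^2 \<partial>lborel) <= real K" for w k
  unfolding xi'_def by (rule simple_process.truncated_weight_le[OF sp t K0])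
 \<comment> \<open>With this frequency and the phase centred at the midpoint, the argument of the
   cosine stays in \<open>[-1/2, 1/2]\<close> on \<open>[l, r]\<close>.\<close>
 define u where "u = 1 / (r - l)"
 define th where "th = - u * (l + r) / 2"
 have u0: "0 < u" using lr by (simp add: u_def)
 have half: "\<bar>u * z + th\<bar> <= 1 / 2" if "z \<in> {l..r}" for z
 proof -
  have "u * z + th = u * (2 * z - l - r) / 2"
   unfolding th_def by (simp add: algebra_simps add_divide_distrib diff_divide_distrib)
  hence "\<bar>u * z + th\<bar> = \<bar>u * (2 * z - l - r) / 2\<bar>" by (simp only:)
  also have "... = u * \<bar>2 * z - l - r\<bar> / 2" using u0 by (simp add: abs_mult)
  also have "... <= u * (r - l) / 2" using that u0 by (intro divide_right_mono mult_left_mono) auto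
  also have "... = 1 / 2" using lr by (simp add: u_def)
  finally show ?thesis .
 qed
 have cosb: "1 / 2 <= cos (u * z + th)" if "z \<in> {l..r}" for z
 proof -
  have "\<bar>u * z + th\<bar> <= 1 / 2" by (rule half[OF that])
  hence "(u * z + th)^2 <= (1 / 2)^2" by (subst abs_le_square_iff[symmetric]) simp
  thus ?thesis using cos_lower_bound[of "u * z + th"] by (simp add: power2_eq_square)
 qed
 define J where "J k w = (\<integral>v. ind {0<..t} v * (cos (u * simple_integral W (ts k) (xi' k) v w + (u * m + th)) * (simple_proc (ts k) (xi' k) v w)^2) \<partial>lborel)" for k w
 have Jm[measurable]: "J k \<in> borel_measurable P" for k
  unfolding J_def[abs_def] by (rule truncated_measurable[OF sp', where g="%x. cos (u * x + (u * m + th))"]) auto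
 have Jb: "\<bar>J k w\<bar> <= real K" if "w \<in> space P" for k w
 proof -
  have "\<bar>J k w\<bar> <= 1 * (\<integral>v. ind {0<..t} v * (simple_proc (ts k) (xi' k) v w)^2 \<partial>lborel)"
   unfolding J_def by (rule simple_process.path_integrable(2)[OF sp' that, where g="%x. cos (u * x + (u * m + th))"]) auto
  also have "1 * (\<integral>v. ind {0<..t} v * (simple_proc (ts k) (xi' k) v w)^2 \<partial>lborel) <= real K"
   using wK by simp
  finally show ?thesis .
 qed
 have Ji: "integrable P (J k)" for k
  by (rule integrable_const_bound[of _ "real K"]) (use Jb in auto)
 have EJ: "expectation (J k) <= 4 * (r - l)^2" for k
 proof -
  have "expectation (%w. cos (u * simple_integral W (ts k) (xi' k) t w + (u * m + th))) - cos (u * m + th) = - (u^2 / 2) * expectation (J k)"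
   using simple_process.simple_cos_expectation[OF sp'[of k] t, of u "u * m + th"] by (simp add: J_def[abs_def] mult_ac)
  moreover have "\<bar>expectation (%w. cos (u * simple_integral W (ts k) (xi' k) t w + (u * m + th)))\<bar> <= 1"
   by (rule abs_expectation_le) simp
  moreover have "cos (u * m + th) <= 1" by simp
  ultimately have "u^2 / 2 * expectation (J k) <= 2" by linarith
  hence "expectation (J k) <= 4 / u^2" using u0 by (simp add: field_simps)
  thus ?thesis by (simp add: u_def power_divide)
 qed
 have Jeq: "J k w = (\<integral>v. ind {0<..t} v * (cos (u * (m + simple_integral W (ts k) (xi k) v w) + th) * (simple_proc (ts k) (xi' k) v w)^2) \<partial>lborel)" for k w
  unfolding J_def
 proof (intro Bochner_Integration.integral_cong refl)
  fix v
  show "ind {0<..t} v * (cos (u * simple_integral W (ts k) (xi' k) v w + (u * m + th)) * (simple_proc (ts k) (xi' k) v w)^2) = ind {0<..t} v * (cos (u * (m + simple_integral W (ts k) (xi k) v w) + th) * (simple_proc (ts k) (xi' k) v w)^2)"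
  proof (cases "simple_proc (ts k) (xi' k) v w = 0")
   case False
   show ?thesis
    using simple_process.truncated_eq(2)[OF sp t K0 False[unfolded xi'_def]] by (simp add: xi'_def algebra_simps)
  qed simp
 qed
 \<comment> \<open>\<open>J k\<close> can be negative but never falls below \<open>- real K\<close>;
   the added constant makes Fatou applicable and is cancelled at the end.\<close>
 have lim: "AE w in P. ennreal (ind {w \<in> space P. QV t w < real K} w * QV t w / 2) + ennreal (real K) <= liminf (%k. ennreal (J k w + real K))"
  using ap M_range AE_space
 proof eventually_elim
  case (elim w)
  show ?case
  proof (cases "QV t w < real K")
   case True
   define c where "c = (\<integral>v. ind {0<..t} v * (cos (u * M v w + th) * (Eta v w)^2) \<partial>lborel)"
   have i: "integrable lborel (%v. ind {0<..t} v * (Eta v w)^2)" using elim(1) by (simp add: approximates_def)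
   have lip: "\<bar>cos (u * x + th) - cos (u * y + th)\<bar> <= u * \<bar>x - y\<bar>" for x y
   proof -
    have "\<bar>cos a - cos b\<bar> <= \<bar>a - b\<bar>" for a b :: real
    proof -
     have "cos a - cos b = 2 * (sin ((a + b) / 2) * sin ((b - a) / 2))" by (rule cos_diff_cos[of a b, unfolded mult.assoc])
     hence "\<bar>cos a - cos b\<bar> = 2 * (\<bar>sin ((a + b) / 2)\<bar> * \<bar>sin ((b - a) / 2)\<bar>)" by (simp add: abs_mult)
     also have "... <= 2 * (1 * \<bar>(b - a) / 2\<bar>)"
      by (intro mult_left_mono mult_mono abs_sin_x_le_abs_x) auto
     finally show ?thesis by simp
    qed
    from this[of "u * x + th" "u * y + th"] have "\<bar>cos (u * x + th) - cos (u * y + th)\<bar> <= \<bar>u * (x - y)\<bar>" by (simp add: algebra_simps)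
    thus ?thesis using u0 by (simp add: abs_mult)
   qed
   have l: "(%k. \<integral>v. ind {0<..t} v * (cos (u * (m + simple_integral W (ts k) (xi k) v w) + th) * (simple_proc (ts k) (xi k) v w)^2) \<partial>lborel) \<longlonglongrightarrow> c"
    unfolding c_def by (rule good_limit[OF sp elim(1) elim(3), where g="%z. cos (u * z + th)" and L=1 and c=u]) (use lip in auto)
   have "eventually (%k. (\<integral>v. ind {0<..t} v * (cos (u * (m + simple_integral W (ts k) (xi k) v w) + th) * (simple_proc (ts k) (xi k) v w)^2) \<partial>lborel) = J k w) sequentially"
    using eventually_not_truncated[OF sp elim(1) elim(3) t True] by eventually_elim (simp add: Jeq xi'_def)
   with l have "(%k. J k w) \<longlonglongrightarrow> c" by (rule Lim_transform_eventually)
   hence "(%k. ennreal (J k w + real K)) \<longlonglongrightarrow> ennreal (c + real K)" by (intro tendsto_ennrealI tendsto_intros)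
   hence L: "liminf (%k. ennreal (J k w + real K)) = ennreal (c + real K)" by (intro lim_imp_Liminf) auto
   have "QV t w / 2 <= c"
   proof -
    have "QV t w / 2 = (\<integral>v. (ind {0<..t} v * (Eta v w)^2) / 2 \<partial>lborel)" by (simp add: QV_def)
    also have "... <= c" unfolding c_def
    proof (rule integral_mono)
     show "integrable lborel (%v. (ind {0<..t} v * (Eta v w)^2) / 2)" using i by simp
     have mm: "(%v. ind {0<..t} v * (cos (u * M v w + th) * (Eta v w)^2)) \<in> borel_measurable borel"
      by (rule pathwise_measurable[OF QV_integrand_measurable[where g="%z. cos (u * z + th)"] elim(3)]) auto
     show "integrable lborel (%v. ind {0<..t} v * (cos (u * M v w + th) * (Eta v w)^2))"
     proof (rule Bochner_Integration.integrable_bound[OF i])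
      have "\<bar>cos (u * M v w + th) * (Eta v w)^2\<bar> <= (Eta v w)^2" for v
       using mult_right_mono[OF abs_cos_le_one[of "u * M v w + th"], of "(Eta v w)^2"] by (simp add: abs_mult)
      thus "AE v in lborel. norm (ind {0<..t} v * (cos (u * M v w + th) * (Eta v w)^2)) <= norm (ind {0<..t} v * (Eta v w)^2)"
       by (intro AE_I2) (simp split: split_indicator)
     qed (use mm in simp)
     fix v
     show "(ind {0<..t} v * (Eta v w)^2) / 2 <= ind {0<..t} v * (cos (u * M v w + th) * (Eta v w)^2)"
     proof (cases "v \<in> {0<..t}")
      case True
      hence "1 / 2 <= cos (u * M v w + th)" using elim(2) by (intro cosb) simp
      from mult_right_mono[OF this, of "(Eta v w)^2"] True show ?thesis by simp
     qed simp
    qed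
    finally show ?thesis .
   qed
   thus ?thesis using True elim(3) QV_nonneg[of t w] unfolding L by (simp add: ennreal_plus[symmetric] del: ennreal_plus)
  next
   case False
   \<comment> \<open>On the remaining event only an asymptotic lower bound 0 for \<open>J k\<close>
     is needed. An approximation within \<open>1 / (2 * u)\<close> of a point of
     \<open>[l, r]\<close> still gives a cosine argument of modulus at most 1, hence a nonnegative
     cosine.\<close>
   have "eventually (%k. \<forall>s\<in>{0..t}. \<bar>m + simple_integral W (ts k) (xi k) s w - M s w\<bar> < 1 / (2 * u)) sequentially"
    using elim(1) u0 unfolding approximates_def by simp
   hence "eventually (%k. ennreal (real K) <= ennreal (J k w + real K)) sequentially"
   proof eventually_elim
    case (elim k)
    have "0 <= J k w"
     unfolding Jeq
    proof (intro integral_nonneg_AE AE_I2)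
     fix v
     show "0 <= ind {0<..t} v * (cos (u * (m + simple_integral W (ts k) (xi k) v w) + th) * (simple_proc (ts k) (xi' k) v w)^2)"
     proof (cases "v \<in> {0<..t}")
      case True
      let ?x = "m + simple_integral W (ts k) (xi k) v w"
      have v: "v \<in> {0..t}" using True by auto
      have "\<bar>?x - M v w\<bar> < 1 / (2 * u)" using elim v by blast
      hence "u * \<bar>?x - M v w\<bar> < 1 / 2" using u0 by (simp add: field_simps)
      hence d: "\<bar>u * ?x - u * M v w\<bar> < 1 / 2" using u0 by (simp add: abs_mult right_diff_distrib[symmetric])
      have Mr: "M v w \<in> {l..r}" using \<open>\<forall>t\<ge>0. M t w \<in> {l..r}\<close> v by simp
      have "\<bar>u * M v w + th\<bar> <= 1 / 2" by (rule half[OF Mr])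
      with d have "\<bar>u * ?x + th\<bar> <= 1" by linarith
      hence "(u * ?x + th)^2 <= 1^2" by (subst abs_le_square_iff[symmetric]) simp
      hence "0 <= cos (u * ?x + th)" using cos_lower_bound[of "u * ?x + th"] by simp
      thus ?thesis by simp
     qed simp
    qed
    thus ?case by (intro ennreal_leI) simp
   qed
   hence "ennreal (real K) <= liminf (%k. ennreal (J k w + real K))" by (rule Liminf_bounded)
   thus ?thesis using False by simp
  qed
 qed
 have "(\<integral>\<^sup>+w. ennreal (ind {w \<in> space P. QV t w < real K} w * QV t w / 2) \<partial>P) + ennreal (real K)
  = (\<integral>\<^sup>+w. ennreal (ind {w \<in> space P. QV t w < real K} w * QV t w / 2) + ennreal (real K) \<partial>P)"
  by (subst nn_integral_add) (auto simp: emeasure_space_1)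
 also have "... <= (\<integral>\<^sup>+w. liminf (%k. ennreal (J k w + real K)) \<partial>P)" by (rule nn_integral_mono_AE[OF lim])
 also have "... <= liminf (%k. \<integral>\<^sup>+w. ennreal (J k w + real K) \<partial>P)" by (rule nn_integral_liminf) measurable
 also have "... <= ennreal (4 * (r - l)^2 + real K)"
 proof -
  have le: "(\<integral>\<^sup>+w. ennreal (J k w + real K) \<partial>P) <= ennreal (4 * (r - l)^2 + real K)" for k
  proof -
   have "(\<integral>\<^sup>+w. ennreal (J k w + real K) \<partial>P) = ennreal (\<integral>w. J k w + real K \<partial>P)"
   proof (rule nn_integral_eq_integral)
    show "AE w in P. 0 <= J k w + real K" using Jb[of _ k] by (intro AE_I2) (smt (verit))
   qed (use Ji in simp)
   also have "... <= ennreal (4 * (r - l)^2 + real K)"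
    using Ji[of k] EJ[of k] by (intro ennreal_leI) (simp add: prob_space)
   finally show ?thesis .
  qed
  have "liminf (%k. \<integral>\<^sup>+w. ennreal (J k w + real K) \<partial>P) <= liminf (%k::nat. ennreal (4 * (r - l)^2 + real K))"
   by (intro Liminf_mono always_eventually allI le)
  thus ?thesis by (simp add: Liminf_const)
 qed
 also have "... = ennreal (4 * (r - l)^2) + ennreal (real K)" by simp
 finally have "ennreal (real K) + (\<integral>\<^sup>+w. ennreal (ind {w \<in> space P. QV t w < real K} w * QV t w / 2) \<partial>P) <= ennreal (real K) + ennreal (4 * (r - l)^2)"
  by (simp only: add.commute)
 thus ?thesis by (simp only: ennreal_add_left_cancel_le) simp
qed

text \<open>The level \<open>K\<close> is sent to infinity by Fatou. That the bound does not grow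
  with \<open>t\<close> is what later makes the quadratic variation over the whole half-line
  integrable.\<close>

lemma QV_bound:
 assumes t: "0 <= t"
 shows "(\<integral>\<^sup>+w. ennreal (QV t w) \<partial>P) <= ennreal (8 * (r - l)^2)"
proof -
 note [measurable] = QV_measurable
 have "(\<integral>\<^sup>+w. ennreal (QV t w / 2) \<partial>P) <= (\<integral>\<^sup>+w. liminf (%K. ennreal (ind {w \<in> space P. QV t w < real K} w * QV t w / 2)) \<partial>P)"
 proof (rule nn_integral_mono)
  fix w assume w: "w \<in> space P"
  obtain K0 where K0: "QV t w < real K0" using reals_Archimedean2 by blast
  have "eventually (%K. ennreal (QV t w / 2) <= ennreal (ind {w \<in> space P. QV t w < real K} w * QV t w / 2)) sequentially"
   using eventually_ge_at_top[of K0] by eventually_elim (use K0 w in auto)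
  thus "ennreal (QV t w / 2) <= liminf (%K. ennreal (ind {w \<in> space P. QV t w < real K} w * QV t w / 2))"
   by (rule Liminf_bounded)
 qed
 also have "... <= liminf (%K. \<integral>\<^sup>+w. ennreal (ind {w \<in> space P. QV t w < real K} w * QV t w / 2) \<partial>P)"
  by (rule nn_integral_liminf) measurable
 also have "... <= liminf (%K::nat. ennreal (4 * (r - l)^2))"
  by (rule Liminf_mono) (simp add: QV_truncated_bound[OF t])
 also have "... = ennreal (4 * (r - l)^2)" by (simp add: Liminf_const)
 finally have h: "(\<integral>\<^sup>+w. ennreal (QV t w / 2) \<partial>P) <= ennreal (4 * (r - l)^2)" .
 have "(\<integral>\<^sup>+w. ennreal (QV t w) \<partial>P) = (\<integral>\<^sup>+w. 2 * ennreal (QV t w / 2) \<partial>P)"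
  using QV_nonneg by (intro nn_integral_cong) (simp add: ennreal_numeral[symmetric] ennreal_mult[symmetric] del: ennreal_numeral)
 also have "... = 2 * (\<integral>\<^sup>+w. ennreal (QV t w / 2) \<partial>P)" by (rule nn_integral_cmult) measurable
 also have "... <= 2 * ennreal (4 * (r - l)^2)" by (intro mult_left_mono h) simp
 also have "... = ennreal (8 * (r - l)^2)"
  by (simp add: ennreal_numeral[symmetric] ennreal_mult[symmetric] del: ennreal_numeral)
 finally show ?thesis .
qed

lemma QV_integrable: "0 <= t ==> integrable P (QV t)"
 using QV_bound[of t] QV_measurable QV_nonneg by (intro integrableI_bounded) (auto intro: le_less_trans)

lemma cos_increment_bound:
 assumes i: "integrable lborel (%v. ind {0<..t} v * (Eta v w)^2)" and s: "0 <= s"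
 shows "\<bar>cos_increment M Eta u th s t w\<bar> <= 2 + u^2 / 2 * QV t w"
proof -
 let ?I = "\<integral>v. ind {s<..t} v * (cos (u * M v w + th) * (Eta v w)^2) \<partial>lborel"
 have "\<bar>?I\<bar> <= (\<integral>v. \<bar>ind {s<..t} v * (cos (u * M v w + th) * (Eta v w)^2)\<bar> \<partial>lborel)" by (rule integral_abs_bound)
 also have "... <= QV t w" unfolding QV_def
 proof (rule integral_mono'[OF i])
  fix v
  have "\<bar>cos (u * M v w + th) * (Eta v w)^2\<bar> <= (Eta v w)^2"
   using mult_right_mono[OF abs_cos_le_one[of "u * M v w + th"], of "(Eta v w)^2"] by (simp add: abs_mult)
  thus "\<bar>ind {s<..t} v * (cos (u * M v w + th) * (Eta v w)^2)\<bar> <= ind {0<..t} v * (Eta v w)^2"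
   using s by (simp split: split_indicator)
 qed simp
 finally have "u^2 / 2 * \<bar>?I\<bar> <= u^2 / 2 * QV t w" by (intro mult_left_mono) auto
 hence "\<bar>u\<^sup>2 / 2 * ?I\<bar> <= u^2 / 2 * QV t w" by (simp add: abs_mult)
 moreover have "\<bar>cos (u * M t w + th)\<bar> <= 1" "\<bar>cos (u * M s w + th)\<bar> <= 1" by auto
 ultimately show ?thesis unfolding cos_increment_def by linarith
qed

lemma M_cos_increment_measurable: "0 <= s ==> s <= t ==> cos_increment M Eta u th s t \<in> borel_measurable P"
 by (rule cos_increment_measurable[OF M_measurable M_cont Eta_measurable])

text \<open>Truncated approximations satisfy the identity on all of \<open>B\<close>. Their
  convergence is known only on \<open>A K\<close>, where the truncation is eventually inactive; the
  contribution of the rest is at most \<open>\<epsilon> K\<close> uniformly in the approximation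
  index. First this index and then \<open>K\<close> tends to infinity.\<close>

theorem M_cos_increment:
 assumes st: "0 <= s" "s <= t" and B: "B \<in> sets (F s)"
 shows "integrable P (%w. ind B w * cos_increment M Eta u th s t w)"
  and "expectation (%w. ind B w * cos_increment M Eta u th s t w) = 0"
proof -
 have t: "0 <= t" using st by simp
 have BP[measurable]: "B \<in> sets P" by (rule sets_F_sub[OF B])
 note [measurable] = QV_measurable M_cos_increment_measurable[OF st]
 obtain ts xi where sp: "!!k. simple_process P F W (ts k) (xi k)" and ap: "AE w in P. approximates t ts xi w"
  using approximation[OF t] by blast
 define D where "D = cos_increment M Eta u th s t"
 have [measurable]: "D \<in> borel_measurable P" by (simp add: D_def)
 have Db: "AE w in P. \<bar>D w\<bar> <= 2 + u^2 / 2 * QV t w"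
  using path_integrable_AE by eventually_elim (use st cos_increment_bound in \<open>simp add: D_def\<close>)
 have domi: "integrable P (%w. 2 + u^2 / 2 * QV t w)" using QV_integrable[OF t] by simp
 show "integrable P (%w. ind B w * cos_increment M Eta u th s t w)"
 proof (rule Bochner_Integration.integrable_bound[OF domi])
  show "AE w in P. norm (ind B w * cos_increment M Eta u th s t w) <= norm (2 + u^2 / 2 * QV t w)"
   using Db by eventually_elim (use QV_nonneg in \<open>auto simp: D_def split: split_indicator\<close>)
 qed measurable
 define A where "A K = {w \<in> space P. QV t w < real K}" for K :: nat
 have Am[measurable]: "A K \<in> sets P" for K unfolding A_def by measurable
 define \<epsilon> where "\<epsilon> K = expectation (%w. ind (space P - A K) w * (2 + u^2 / 2 * QV t w))" for K
 have step: "\<bar>expectation (%w. ind B w * ind (A K) w * D w)\<bar> <= \<epsilon> K" for K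
 proof -
  have K0: "0 <= real K" by simp
  define xi' where "xi' k = truncated_coeff (ts k) (xi k) t (real K)" for k
  have sp': "simple_process P F W (ts k) (xi' k)" for k
   unfolding xi'_def by (rule simple_process.truncated_simple_process[OF sp t K0])
  have wK: "(\<integral>v. ind {0<..t} v * (simple_proc (ts k) (xi' k) v w)^2 \<partial>lborel) <= real K" for w k
   unfolding xi'_def by (rule simple_process.truncated_weight_le[OF sp t K0])
  define D' where "D' k = cos_increment (simple_integral W (ts k) (xi' k)) (simple_proc (ts k) (xi' k)) u (u * m + th) s t" for k
  have D'm[measurable]: "D' k \<in> borel_measurable P" for k
   unfolding D'_def by (rule cos_increment_measurable[OF simple_process.integral_measurable[OF sp'] simple_process.integral_continuous[OF sp'] simple_process.proc_measurable'[OF sp'] st])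
  have D'b: "\<bar>D' k w\<bar> <= 2 + u^2 / 2 * real K" if w: "w \<in> space P" for k w
  proof -
   let ?I = "\<integral>v. ind {s<..t} v * (cos (u * simple_integral W (ts k) (xi' k) v w + (u * m + th)) * (simple_proc (ts k) (xi' k) v w)^2) \<partial>lborel"
   have "\<bar>?I\<bar> <= 1 * (\<integral>v. ind {s<..t} v * (simple_proc (ts k) (xi' k) v w)^2 \<partial>lborel)"
    by (rule simple_process.path_integrable(2)[OF sp' w st(1), where g="%x. cos (u * x + (u * m + th))"]) auto
   also have "... <= (\<integral>v. ind {0<..t} v * (simple_proc (ts k) (xi' k) v w)^2 \<partial>lborel)"
   proof -
    have "integrable lborel (%v. ind {0<..t} v * ((%_. 1) (simple_integral W (ts k) (xi' k) v w) * (simple_proc (ts k) (xi' k) v w)^2))"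
     by (rule simple_process.path_integrable(1)[OF sp' w, where L=1]) auto
    thus ?thesis using st by (simp, intro integral_mono') (auto split: split_indicator)
   qed
   finally have "\<bar>?I\<bar> <= real K" using wK[of k w] by linarith
   hence "u^2 / 2 * \<bar>?I\<bar> <= u^2 / 2 * real K" by (intro mult_left_mono) auto
   hence "\<bar>u\<^sup>2 / 2 * ?I\<bar> <= u^2 / 2 * real K" by (simp add: abs_mult)
   moreover have "\<bar>cos (u * simple_integral W (ts k) (xi' k) t w + (u * m + th))\<bar> <= 1" "\<bar>cos (u * simple_integral W (ts k) (xi' k) s w + (u * m + th))\<bar> <= 1" by auto
   ultimately show ?thesis unfolding D'_def cos_increment_def by linarith
  qed
  have bi: "integrable P (%w. ind C w * D' k w)" if [measurable]: "C \<in> sets P" for C k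
  proof (rule integrable_const_bound[of _ "2 + u^2 / 2 * real K"])
   have "0 <= 2 + u^2 / 2 * real K" by simp
   thus "AE w in P. norm (ind C w * D' k w) <= 2 + u^2 / 2 * real K"
    using D'b[of _ k] by (intro AE_I2) (simp split: split_indicator)
  qed measurable
  have E0: "expectation (%w. ind B w * D' k w) = 0" for k
   unfolding D'_def by (rule simple_process.simple_cos_increment[OF sp' st B])
  \<comment> \<open>Off \<open>A K\<close> the truncation level is at most the quadratic variation,
    so the bound in terms of \<open>K\<close> may be replaced by the integrable variable
    \<open>2 + u^2 / 2 * QV t w\<close>.\<close>
  have bound: "\<bar>expectation (%w. ind (B \<inter> A K) w * D' k w)\<bar> <= \<epsilon> K" for k
  proof -
   have "expectation (%w. ind B w * D' k w) = expectation (%w. ind (B \<inter> A K) w * D' k w + ind (B - A K) w * D' k w)"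
    by (intro Bochner_Integration.integral_cong) (auto split: split_indicator)
   also have "... = expectation (%w. ind (B \<inter> A K) w * D' k w) + expectation (%w. ind (B - A K) w * D' k w)"
    by (intro Bochner_Integration.integral_add bi) auto
   finally have "\<bar>expectation (%w. ind (B \<inter> A K) w * D' k w)\<bar> = \<bar>expectation (%w. ind (B - A K) w * D' k w)\<bar>"
    using E0[of k] by linarith
   also have "... <= expectation (%w. \<bar>ind (B - A K) w * D' k w\<bar>)" by (rule integral_abs_bound)
   also have "... <= \<epsilon> K" unfolding \<epsilon>_def
   proof (rule integral_mono)
    show "integrable P (%w. \<bar>ind (B - A K) w * D' k w\<bar>)" by (intro integrable_abs bi) simp
    show "integrable P (%w. ind (space P - A K) w * (2 + u^2 / 2 * QV t w))"
     using integrable_mult_indicator[OF _ domi, of "space P - A K"] by simp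
    fix w assume w: "w \<in> space P"
    show "\<bar>ind (B - A K) w * D' k w\<bar> <= ind (space P - A K) w * (2 + u^2 / 2 * QV t w)"
    proof (cases "w \<in> B - A K")
     case True
     hence "real K <= QV t w" using w by (simp add: A_def)
     hence "u^2 / 2 * real K <= u^2 / 2 * QV t w" by (intro mult_left_mono) auto
     thus ?thesis using True w D'b[OF w, of k] by simp
    next
     case False
     have "0 <= ind (space P - A K) w * (2 + u^2 / 2 * QV t w)" using QV_nonneg[of t w] by simp
     thus ?thesis using False by simp
    qed
   qed
   finally show ?thesis .
  qed
  have "(%k. expectation (%w. ind (B \<inter> A K) w * D' k w)) \<longlonglongrightarrow> expectation (%w. ind (B \<inter> A K) w * D w)"
  proof (rule integral_dominated_convergence[where w="%_. 2 + u^2 / 2 * real K"])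
   show "AE w in P. (%k. ind (B \<inter> A K) w * D' k w) \<longlonglongrightarrow> ind (B \<inter> A K) w * D w"
    using ap AE_space
   proof eventually_elim
    case (elim w)
    show ?case
    proof (cases "w \<in> A K")
     case True
     hence QK: "QV t w < real K" by (simp add: A_def)
     have lip: "\<bar>cos (u * x + th) - cos (u * y + th)\<bar> <= \<bar>u\<bar> * \<bar>x - y\<bar>" for x y
     proof -
      have "\<bar>cos a - cos b\<bar> <= \<bar>a - b\<bar>" for a b :: real
      proof -
       have "cos a - cos b = 2 * (sin ((a + b) / 2) * sin ((b - a) / 2))" by (rule cos_diff_cos[of a b, unfolded mult.assoc])
       hence "\<bar>cos a - cos b\<bar> = 2 * (\<bar>sin ((a + b) / 2)\<bar> * \<bar>sin ((b - a) / 2)\<bar>)" by (simp add: abs_mult)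
       also have "... <= 2 * (1 * \<bar>(b - a) / 2\<bar>)"
        by (intro mult_left_mono mult_mono abs_sin_x_le_abs_x) auto
       finally show ?thesis by simp
      qed
      from this[of "u * x + th" "u * y + th"] show ?thesis by (simp add: right_diff_distrib[symmetric] abs_mult)
     qed
     have l1: "(%k. \<integral>v. ind {s<..t} v * (cos (u * (m + simple_integral W (ts k) (xi k) v w) + th) * (simple_proc (ts k) (xi k) v w)^2) \<partial>lborel)
       \<longlonglongrightarrow> (\<integral>v. ind {s<..t} v * (cos (u * M v w + th) * (Eta v w)^2) \<partial>lborel)"
      by (rule good_limit[OF sp elim(1) elim(2), where g="%z. cos (u * z + th)" and L=1 and c="\<bar>u\<bar>"]) (use lip st in auto)
     have l2: "(%k. cos (u * (m + simple_integral W (ts k) (xi k) t w) + th)) \<longlonglongrightarrow> cos (u * M t w + th)"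
      "(%k. cos (u * (m + simple_integral W (ts k) (xi k) s w) + th)) \<longlonglongrightarrow> cos (u * M s w + th)"
      using st by (auto intro!: tendsto_intros approximates_endpoint[OF elim(1)])
     have "(%k. cos (u * (m + simple_integral W (ts k) (xi k) t w) + th) - cos (u * (m + simple_integral W (ts k) (xi k) s w) + th)
       + u^2 / 2 * (\<integral>v. ind {s<..t} v * (cos (u * (m + simple_integral W (ts k) (xi k) v w) + th) * (simple_proc (ts k) (xi k) v w)^2) \<partial>lborel)) \<longlonglongrightarrow> D w"
      unfolding D_def cos_increment_def by (intro tendsto_intros l1 l2)
     moreover have "eventually (%k. cos (u * (m + simple_integral W (ts k) (xi k) t w) + th) - cos (u * (m + simple_integral W (ts k) (xi k) s w) + th)
       + u^2 / 2 * (\<integral>v. ind {s<..t} v * (cos (u * (m + simple_integral W (ts k) (xi k) v w) + th) * (simple_proc (ts k) (xi k) v w)^2) \<partial>lborel) = D' k w) sequentially"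
      using eventually_not_truncated[OF sp elim(1) elim(2) t QK]
      by eventually_elim (simp add: D'_def cos_increment_def xi'_def distrib_left add.assoc add.left_commute)
     ultimately have "(%k. D' k w) \<longlonglongrightarrow> D w" by (rule Lim_transform_eventually)
     thus ?thesis by (intro tendsto_intros)
    qed simp
   qed
   show "AE w in P. norm (ind (B \<inter> A K) w * D' k w) <= 2 + u^2 / 2 * real K" for k
   proof -
    have "0 <= 2 + u^2 / 2 * real K" by simp
    thus ?thesis using D'b[of _ k] by (intro AE_I2) (simp split: split_indicator)
   qed
  qed measurable
  hence "(%k. \<bar>expectation (%w. ind (B \<inter> A K) w * D' k w)\<bar>) \<longlonglongrightarrow> \<bar>expectation (%w. ind (B \<inter> A K) w * D w)\<bar>"
   by (rule tendsto_rabs)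
  hence "\<bar>expectation (%w. ind (B \<inter> A K) w * D w)\<bar> <= \<epsilon> K"
   by (rule LIMSEQ_le_const2) (use bound in blast)
  thus ?thesis by (simp add: indicator_inter_arith)
 qed
 have ev: "eventually (%K. w \<in> A K) sequentially" if "w \<in> space P" for w
 proof -
  obtain K0 :: nat where K0: "QV t w < real K0" using reals_Archimedean2 by blast
  show ?thesis using eventually_ge_at_top[of K0] by eventually_elim (use K0 that in \<open>simp add: A_def\<close>)
 qed
 have l1: "(%K. expectation (%w. ind B w * ind (A K) w * D w)) \<longlonglongrightarrow> expectation (%w. ind B w * D w)"
 proof (rule integral_dominated_convergence[OF _ _ domi])
  show "AE w in P. (%K. ind B w * ind (A K) w * D w) \<longlonglongrightarrow> ind B w * D w"
  proof (intro AE_I2 tendsto_eventually)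
   fix w assume "w \<in> space P"
   from ev[OF this] show "eventually (%K. ind B w * ind (A K) w * D w = ind B w * D w) sequentially"
    by eventually_elim simp
  qed
  show "AE w in P. norm (ind B w * ind (A K) w * D w) <= 2 + u^2 / 2 * QV t w" for K
   using Db by eventually_elim (use QV_nonneg in \<open>simp split: split_indicator\<close>)
 qed measurable
 have l2: "\<epsilon> \<longlonglongrightarrow> expectation (%_. 0)"
  unfolding \<epsilon>_def
 proof (rule integral_dominated_convergence[OF _ _ domi])
  show "AE w in P. (%K. ind (space P - A K) w * (2 + u^2 / 2 * QV t w)) \<longlonglongrightarrow> 0"
  proof (intro AE_I2 tendsto_eventually)
   fix w assume "w \<in> space P"
   from ev[OF this] show "eventually (%K. ind (space P - A K) w * (2 + u^2 / 2 * QV t w) = 0) sequentially"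
    by eventually_elim simp
  qed
  show "AE w in P. norm (ind (space P - A K) w * (2 + u^2 / 2 * QV t w)) <= 2 + u^2 / 2 * QV t w" for K
   using QV_nonneg by (intro AE_I2) (simp split: split_indicator)
 qed measurable
 have "\<bar>expectation (%w. ind B w * D w)\<bar> <= expectation (%_. 0)"
  by (rule LIMSEQ_le[OF tendsto_rabs[OF l1] l2]) (use step in blast)
 thus "expectation (%w. ind B w * cos_increment M Eta u th s t w) = 0"
  by (simp add: D_def)
qed

end

section \<open>Optional stopping\<close>

context weak_sol
begin

text \<open>Its integrability gives one dominating variable for the compensated cosine at all times,
  and so allows optional stopping at unbounded stopping times.\<close>

definition total_QV :: "'a => real" where
 "total_QV w = (\<integral>v. ind {0<..} v * (Eta v w)^2 \<partial>lborel)"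

lemma total_integrand_measurable: "(%x. ind {0<..} (fst x) * (Eta (fst x) (snd x))^2 :: real) \<in> borel_measurable (borel \<Otimes>\<^sub>M P)"
proof -
 have "(%x. ind {0<..} (fst x) * (Eta (fst x) (snd x))^2 :: real) = (%x. ind {0<..} (fst x) * (Eta (max 0 (fst x)) (snd x))^2)"
  by (auto simp: fun_eq_iff max_def split: split_indicator)
 moreover note [measurable] = Eta_measurable
 have "(%x. ind {0<..} (fst x) * (Eta (max 0 (fst x)) (snd x))^2 :: real) \<in> borel_measurable (borel \<Otimes>\<^sub>M P)"
  by measurable
 ultimately show ?thesis by simp
qed

lemma total_nn_bound: "(\<integral>\<^sup>+w. \<integral>\<^sup>+v. ennreal (ind {0<..} v * (Eta v w)^2) \<partial>lborel \<partial>P) <= ennreal (8 * (r - l)^2)"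
proof -
 have pm: "(%v. ind {0<..real n} v * (Eta v w)^2) \<in> borel_measurable borel" if "w \<in> space P" for n w
  using pathwise_measurable[OF QV_integrand_measurable[of "%_. 1" 0 "real n"] that] by simp
 have sup: "(\<integral>\<^sup>+v. ennreal (ind {0<..} v * (Eta v w)^2) \<partial>lborel) = (SUP n. \<integral>\<^sup>+v. ennreal (ind {0<..real n} v * (Eta v w)^2) \<partial>lborel)"
  if w: "w \<in> space P" for w
 proof -
  have "(\<integral>\<^sup>+v. ennreal (ind {0<..} v * (Eta v w)^2) \<partial>lborel) = (\<integral>\<^sup>+v. (SUP n. ennreal (ind {0<..real n} v * (Eta v w)^2)) \<partial>lborel)"
  proof (intro nn_integral_cong)
   fix v :: real
   obtain N :: nat where N: "v <= real N" using real_arch_simple by blast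
   have "(%n. ennreal (ind {0<..real n} v * (Eta v w)^2)) \<longlonglongrightarrow> ennreal (ind {0<..} v * (Eta v w)^2)"
   proof (rule tendsto_eventually)
    show "eventually (%n. ennreal (ind {0<..real n} v * (Eta v w)^2) = ennreal (ind {0<..} v * (Eta v w)^2)) sequentially"
     using eventually_ge_at_top[of N] by eventually_elim (use N in \<open>auto split: split_indicator\<close>)
   qed
   moreover have "incseq (%n. ennreal (ind {0<..real n} v * (Eta v w)^2))"
    by (intro monoI ennreal_leI mult_right_mono) (auto split: split_indicator)
   ultimately show "ennreal (ind {0<..} v * (Eta v w)^2) = (SUP n. ennreal (ind {0<..real n} v * (Eta v w)^2))"
    using LIMSEQ_SUP LIMSEQ_unique by blast
  qed
  also have "... = (SUP n. \<integral>\<^sup>+v. ennreal (ind {0<..real n} v * (Eta v w)^2) \<partial>lborel)"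
  proof (rule nn_integral_monotone_convergence_SUP)
   show "incseq (%n v. ennreal (ind {0<..real n} v * (Eta v w)^2))"
    by (intro monoI le_funI ennreal_leI mult_right_mono) (auto split: split_indicator)
  qed (use pm[OF w] in simp)
  finally show ?thesis .
 qed
 have m: "(%w. \<integral>\<^sup>+v. ennreal (ind {0<..real n} v * (Eta v w)^2) \<partial>lborel) \<in> borel_measurable P" for n
 proof -
  have cong: "sets (lborel \<Otimes>\<^sub>M P) = sets (borel \<Otimes>\<^sub>M P)" by (rule sets_pair_measure_cong) auto
  have "(%x. ennreal (ind {0<..real n} (fst x) * ((%_. 1) (M (fst x) (snd x)) * (Eta (fst x) (snd x))^2))) \<in> borel_measurable (borel \<Otimes>\<^sub>M P)"
   by (intro measurable_compose[OF _ measurable_ennreal] QV_integrand_measurable) auto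
  hence 1: "(%x. ennreal (ind {0<..real n} (fst x) * (Eta (fst x) (snd x))^2)) \<in> borel_measurable (lborel \<Otimes>\<^sub>M P)"
   by (simp add: measurable_cong_sets[OF cong refl])
  have "(%(w, v). ennreal (ind {0<..real n} v * (Eta v w)^2)) \<in> borel_measurable (P \<Otimes>\<^sub>M lborel)"
   using measurable_compose[OF measurable_pair_swap' 1] by (simp add: split_beta')
  thus ?thesis by (rule lborel.borel_measurable_nn_integral)
 qed
 have "(\<integral>\<^sup>+w. \<integral>\<^sup>+v. ennreal (ind {0<..} v * (Eta v w)^2) \<partial>lborel \<partial>P) = (\<integral>\<^sup>+w. (SUP n. \<integral>\<^sup>+v. ennreal (ind {0<..real n} v * (Eta v w)^2) \<partial>lborel) \<partial>P)"
  by (intro nn_integral_cong sup)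
 also have "... = (SUP n. \<integral>\<^sup>+w. \<integral>\<^sup>+v. ennreal (ind {0<..real n} v * (Eta v w)^2) \<partial>lborel \<partial>P)"
 proof (rule nn_integral_monotone_convergence_SUP[OF _ m])
  show "incseq (%n w. \<integral>\<^sup>+v. ennreal (ind {0<..real n} v * (Eta v w)^2) \<partial>lborel)"
   by (intro monoI le_funI nn_integral_mono ennreal_leI mult_right_mono) (auto split: split_indicator)
 qed
 also have "... <= ennreal (8 * (r - l)^2)"
 proof (rule SUP_least)
  fix n :: nat
  have "(\<integral>\<^sup>+w. \<integral>\<^sup>+v. ennreal (ind {0<..real n} v * (Eta v w)^2) \<partial>lborel \<partial>P) = (\<integral>\<^sup>+w. ennreal (QV (real n) w) \<partial>P)"
  proof (rule nn_integral_cong_AE)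
   show "AE w in P. (\<integral>\<^sup>+v. ennreal (ind {0<..real n} v * (Eta v w)^2) \<partial>lborel) = ennreal (QV (real n) w)"
    using path_integrable_AE
   proof eventually_elim
    case (elim w)
    show ?case unfolding QV_def by (rule nn_integral_eq_integral[OF spec[OF elim]]) simp
   qed
  qed
  also have "... <= ennreal (8 * (r - l)^2)" by (rule QV_bound) simp
  finally show "(\<integral>\<^sup>+w. \<integral>\<^sup>+v. ennreal (ind {0<..real n} v * (Eta v w)^2) \<partial>lborel \<partial>P) <= ennreal (8 * (r - l)^2)" .
 qed
 finally show ?thesis .
qed

lemma total_pair_integrable: "integrable (lborel \<Otimes>\<^sub>M P) (%x. ind {0<..} (fst x) * (Eta (fst x) (snd x))^2)"
proof -
 interpret pl: pair_sigma_finite lborel P ..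
 have cong: "sets (lborel \<Otimes>\<^sub>M P) = sets (borel \<Otimes>\<^sub>M P)" by (rule sets_pair_measure_cong) auto
 have m[measurable]: "(%x. ind {0<..} (fst x) * (Eta (fst x) (snd x))^2 :: real) \<in> borel_measurable (lborel \<Otimes>\<^sub>M P)"
  using total_integrand_measurable by (simp add: measurable_cong_sets[OF cong refl])
 have m2: "(%x. ennreal (ind {0<..} (fst x) * (Eta (fst x) (snd x))^2)) \<in> borel_measurable (lborel \<Otimes>\<^sub>M P)"
  by (rule measurable_compose[OF m measurable_ennreal])
 have "(\<integral>\<^sup>+x. ennreal (ind {0<..} (fst x) * (Eta (fst x) (snd x))^2) \<partial>(lborel \<Otimes>\<^sub>M P)) = (\<integral>\<^sup>+w. \<integral>\<^sup>+v. ennreal (ind {0<..} v * (Eta v w)^2) \<partial>lborel \<partial>P)"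
  using pl.nn_integral_snd[OF m2] by simp
 also have "... < \<infinity>" by (rule le_less_trans[OF total_nn_bound]) simp
 finally show ?thesis
  by (intro integrableI_bounded m) (simp add: abs_mult)
qed

lemma total_path_integrable: "AE w in P. integrable lborel (%v. ind {0<..} v * (Eta v w)^2)"
 and total_QV_integrable: "integrable P total_QV"
proof -
 interpret pl: pair_sigma_finite lborel P ..
 have i: "integrable (lborel \<Otimes>\<^sub>M P) (%(v, w). ind {0<..} v * (Eta v w)^2)"
  using total_pair_integrable by (simp add: split_beta')
 show "AE w in P. integrable lborel (%v. ind {0<..} v * (Eta v w)^2)"
  using pl.AE_integrable_snd[OF i] .
 show "integrable P total_QV" unfolding total_QV_def[abs_def] using pl.integrable_snd[OF i] .
qed

lemma total_QV_nonneg: "0 <= total_QV w"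
 unfolding total_QV_def by (intro integral_nonneg_AE) auto

lemma QV_le_total:
 assumes "integrable lborel (%v. ind {0<..} v * (Eta v w)^2)"
 shows "QV t w <= total_QV w"
 unfolding QV_def total_QV_def by (rule integral_mono'[OF assms]) (auto split: split_indicator)

lemma sub_path_integrable:
 assumes "integrable lborel (%v. ind {0<..} v * (Eta v w)^2)" "w \<in> space P" "0 <= s"
 shows "integrable lborel (%v. ind {s<..t} v * (cos (u * M v w + th) * (Eta v w)^2))"
proof (rule Bochner_Integration.integrable_bound[OF assms(1)])
 have mm: "(%v. ind {s<..t} v * (cos (u * M v w + th) * (Eta v w)^2)) \<in> borel_measurable borel"
  by (rule pathwise_measurable[OF QV_integrand_measurable[where g="%z. cos (u * z + th)"] assms(2)]) (use assms(3) in auto)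
 thus "(%v. ind {s<..t} v * (cos (u * M v w + th) * (Eta v w)^2)) \<in> borel_measurable lborel" by simp
 have "\<bar>cos (u * M v w + th) * (Eta v w)^2\<bar> <= (Eta v w)^2" for v
  using mult_right_mono[OF abs_cos_le_one[of "u * M v w + th"], of "(Eta v w)^2"] by (simp add: abs_mult)
 thus "AE v in lborel. norm (ind {s<..t} v * (cos (u * M v w + th) * (Eta v w)^2)) <= norm (ind {0<..} v * (Eta v w)^2)"
  using assms(3) by (intro AE_I2) (simp split: split_indicator)
qed

lemma sets_F_measurable_stopping:
 assumes "stopping_time F T" shows "T \<in> borel_measurable P"
 by (rule measurable_stopping_time[OF assms]) (auto simp: space_F intro: sets_F_sub)

lemma process_at_measurable:
 assumes Y: "(%x. Y (max 0 (fst x)) (snd x)) \<in> borel_measurable (borel \<Otimes>\<^sub>M P)"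
  and T: "T \<in> borel_measurable P" "!!w. w \<in> space P ==> 0 <= T w"
 shows "(%w. Y (T w) w) \<in> borel_measurable P"
proof -
 have "(%w. (T w, w)) \<in> P \<rightarrow>\<^sub>M borel \<Otimes>\<^sub>M P" using T by measurable
 from measurable_compose[OF this Y] have "(%w. Y (max 0 (T w)) w) \<in> borel_measurable P" by simp
 also have "?this \<longleftrightarrow> ?thesis" using T(2) by (intro measurable_cong) (simp add: max_def)
 finally show ?thesis .
qed

lemma M_at_measurable:
 "T \<in> borel_measurable P ==> (!!w. w \<in> space P ==> 0 <= T w) ==> (%w. M (T w) w) \<in> borel_measurable P"
 by (rule process_at_measurable[OF process_joint_measurable[OF M_measurable M_cont]])

lemma random_interval_measurable:
 assumes S[measurable]: "S \<in> borel_measurable P" and T[measurable]: "T \<in> borel_measurable P"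
  and S0: "!!w. w \<in> space P ==> 0 <= S w" and g[measurable]: "g \<in> borel_measurable borel"
 shows "(%x. ind {S (snd x)<..T (snd x)} (fst x) * (g (M (fst x) (snd x)) * (Eta (fst x) (snd x))^2) :: real) \<in> borel_measurable (borel \<Otimes>\<^sub>M P)"
proof -
 note [measurable] = Eta_measurable process_joint_measurable[OF M_measurable M_cont]
 have "(%x. (if S (snd x) < fst x & fst x <= T (snd x) then 1 else 0) * (g (M (max 0 (fst x)) (snd x)) * (Eta (max 0 (fst x)) (snd x))^2) :: real) \<in> borel_measurable (borel \<Otimes>\<^sub>M P)"
  by measurable
 also have "?this \<longleftrightarrow> ?thesis"
 proof (rule measurable_cong)
  fix x :: "real \<times> 'a" assume "x \<in> space (borel \<Otimes>\<^sub>M P)"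
  hence "0 <= S (snd x)" by (intro S0) (auto simp: space_pair_measure)
  thus "(if S (snd x) < fst x & fst x <= T (snd x) then 1 else 0) * (g (M (max 0 (fst x)) (snd x)) * (Eta (max 0 (fst x)) (snd x))^2)
   = ind {S (snd x)<..T (snd x)} (fst x) * (g (M (fst x) (snd x)) * (Eta (fst x) (snd x))^2)"
   by (auto simp: max_def split: split_indicator)
 qed
 finally show ?thesis .
qed

definition stopped_cos :: "real => real => real => 'a => real" where
 "stopped_cos u th t w = cos_increment M Eta u th 0 t w"

lemma stopped_cos_bound:
 assumes "integrable lborel (%v. ind {0<..} v * (Eta v w)^2)" "integrable lborel (%v. ind {0<..t} v * (Eta v w)^2)"
 shows "\<bar>stopped_cos u th t w\<bar> <= 2 + u^2 / 2 * total_QV w"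
proof -
 have "u^2 / 2 * QV t w <= u^2 / 2 * total_QV w" by (intro mult_left_mono QV_le_total assms(1)) simp
 thus ?thesis using cos_increment_bound[OF assms(2), of 0 u th] unfolding stopped_cos_def by simp
qed

lemma stopped_cos_mono:
 assumes st: "0 <= s" "s <= t" and B: "B \<in> sets (F s)"
 shows "expectation (%w. ind B w * stopped_cos u th s w) = expectation (%w. ind B w * stopped_cos u th t w)"
proof -
 have B0: "integrable P (%w. ind B w * stopped_cos u th s w)"
 proof (rule Bochner_Integration.integrable_bound)
  show "integrable P (%w. 2 + u^2 / 2 * total_QV w)" using total_QV_integrable by simp
  show "(%w. ind B w * stopped_cos u th s w) \<in> borel_measurable P"
   using sets_F_sub[OF B] M_cos_increment_measurable[OF order_refl st(1)] unfolding stopped_cos_def by measurable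
  show "AE w in P. norm (ind B w * stopped_cos u th s w) <= norm (2 + u^2 / 2 * total_QV w)"
   using total_path_integrable path_integrable_AE
  proof eventually_elim
   case (elim w)
   have "0 <= u^2 / 2 * total_QV w" using total_QV_nonneg by simp
   thus ?case using stopped_cos_bound[OF elim(1) spec[OF elim(2)], of u th s] by (simp split: split_indicator)
  qed
 qed
 have "expectation (%w. ind B w * stopped_cos u th t w) = expectation (%w. ind B w * stopped_cos u th s w + ind B w * cos_increment M Eta u th s t w)"
 proof (rule integral_cong_AE)
  show "(%w. ind B w * stopped_cos u th t w) \<in> borel_measurable P"
  proof -
   have "0 <= t" using st by simp
   from M_cos_increment_measurable[OF order_refl this] sets_F_sub[OF B] show ?thesis
    unfolding stopped_cos_def by measurable
  qed
  show "(%w. ind B w * stopped_cos u th s w + ind B w * cos_increment M Eta u th s t w) \<in> borel_measurable P"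
   using B0 M_cos_increment(1)[OF st B] by measurable
  show "AE w in P. ind B w * stopped_cos u th t w = ind B w * stopped_cos u th s w + ind B w * cos_increment M Eta u th s t w"
   using total_path_integrable AE_space
  proof eventually_elim
   case (elim w)
   have "stopped_cos u th t w = stopped_cos u th s w + cos_increment M Eta u th s t w"
    unfolding stopped_cos_def by (rule cos_increment_add[OF st]) (rule sub_path_integrable[OF elim order_refl])
   thus ?case by (simp add: distrib_left)
  qed
 qed
 also have "... = expectation (%w. ind B w * stopped_cos u th s w)"
  using B0 M_cos_increment[OF st B] by simp
 finally show ?thesis by simp
qed

text \<open>For stopping times with values on a grid, the event of each value lies in the past of
  that value, so every summand can be moved to one common later time. A general time is approximated
  from above, using continuous paths and domination by the total quadratic variation.\<close>

lemma stopped_cos_bounded_stopping: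
 assumes T: "stopping_time F T" and T0: "!!w. w \<in> space P ==> 0 <= T w" and TK: "!!w. w \<in> space P ==> T w <= real K"
 shows "expectation (%w. stopped_cos u th (T w) w) = 0"
proof -
 note [measurable] = sets_F_measurable_stopping[OF T]
 \<comment> \<open>Because of the \<open>+ 1\<close> the grid time lies strictly above
   \<open>T w\<close>, so the event that it equals \<open>i / (j + 1)\<close> is described by strict
   inequalities for \<open>T\<close> and is decided by that time.\<close>
 define Tj where "Tj j w = (real_of_int \<lfloor>T w * real (Suc j)\<rfloor> + 1) / real (Suc j)" for j w
 define k where "k j w = nat \<lfloor>T w * real (Suc j)\<rfloor> + 1" for j w
 have kT: "Tj j w = real (k j w) / real (Suc j)" if "w \<in> space P" for j w
  using T0[OF that] unfolding Tj_def k_def by simp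
 have kle: "k j w <= K * Suc j + 1" if "w \<in> space P" for j w
 proof -
  have "T w * real (Suc j) <= real K * real (Suc j)" by (rule mult_right_mono[OF TK[OF that]]) simp
  hence "\<lfloor>T w * real (Suc j)\<rfloor> <= \<lfloor>real (K * Suc j)\<rfloor>" by (intro floor_mono) (simp only: of_nat_mult)
  hence "\<lfloor>T w * real (Suc j)\<rfloor> <= int (K * Suc j)" by (simp del: of_nat_mult of_nat_Suc)
  thus ?thesis unfolding k_def by linarith
 qed
 have ev: "{w \<in> space P. k j w = i} \<in> sets (F (real i / real (Suc j)))" for i j
 proof -
  have s: "0 < real (Suc j)" by simp
  have "{w \<in> space P. k j w = i} = {w \<in> space P. T w < real i / real (Suc j) & ~ T w < (real i - 1) / real (Suc j)}"
  proof -
   have "k j w = i \<longleftrightarrow> T w < real i / real (Suc j) & ~ T w < (real i - 1) / real (Suc j)" if "w \<in> space P" for w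
   proof -
    have p: "0 <= T w * real (Suc j)" using T0[OF that] by simp
    have "k j w = i \<longleftrightarrow> \<lfloor>T w * real (Suc j)\<rfloor> = int i - 1" unfolding k_def using p by linarith
    also have "... \<longleftrightarrow> real i - 1 <= T w * real (Suc j) & T w * real (Suc j) < real i"
     by (subst floor_eq_iff) auto
    also have "... \<longleftrightarrow> T w < real i / real (Suc j) & ~ T w < (real i - 1) / real (Suc j)"
     using s by (simp add: not_less pos_less_divide_eq pos_divide_le_eq conj_commute del: of_nat_Suc)
    finally show ?thesis .
   qed
   thus ?thesis by blast
  qed
  moreover have "Measurable.pred (F (real i / real (Suc j))) (%w. T w < real i / real (Suc j))"
   by (rule stopping_time_less_const[OF T])
  moreover have "Measurable.pred (F (real i / real (Suc j))) (%w. T w < (real i - 1) / real (Suc j))"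
   using stopping_time_less_const[OF T, of "(real i - 1) / real (Suc j)"] by (rule measurable_F_mono) (intro divide_right_mono, auto)
  ultimately show ?thesis by (simp add: pred_def space_F[symmetric, of "real i / real (Suc j)"])
 qed
 have evP[measurable]: "{w \<in> space P. k j w = i} \<in> sets P" for i j by (rule sets_F_sub[OF ev])
 have Ki: "real i / real (Suc j) <= real (K + 1)" if "i <= K * Suc j + 1" for i j
 proof -
  have "real i <= real K * real (Suc j) + 1" using that by (metis of_nat_1 of_nat_add of_nat_le_iff of_nat_mult)
  also have "... <= real (K + 1) * real (Suc j)" by (simp add: algebra_simps)
  finally show ?thesis by (subst pos_divide_le_eq) auto
 qed
 have bd: "AE w in P. ALL t. \<bar>stopped_cos u th t w\<bar> <= 2 + u^2 / 2 * total_QV w"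
  using total_path_integrable path_integrable_AE
 proof eventually_elim
  case (elim w)
  show ?case using stopped_cos_bound[OF elim(1) spec[OF elim(2)]] by blast
 qed
 have domi: "integrable P (%w. 2 + u^2 / 2 * total_QV w)" using total_QV_integrable by simp
 have scm: "stopped_cos u th t \<in> borel_measurable P" if "0 <= t" for t
  unfolding stopped_cos_def[abs_def] using M_cos_increment_measurable[of 0 t] that by simp
 have sci: "integrable P (%w. ind B w * stopped_cos u th t w)" if [measurable]: "B \<in> sets P" and t: "0 <= t" for B t
 proof (rule Bochner_Integration.integrable_bound[OF domi])
  show "AE w in P. norm (ind B w * stopped_cos u th t w) <= norm (2 + u^2 / 2 * total_QV w)"
   using bd
  proof eventually_elim
   case (elim w)
   have "0 <= u^2 / 2 * total_QV w" using total_QV_nonneg by simp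
   thus ?case using spec[OF elim, of t] by (simp split: split_indicator)
  qed
 qed (use scm[OF t] in measurable)
 have split: "stopped_cos u th (Tj j w) w = (\<Sum>i\<le>K * Suc j + 1. ind {w \<in> space P. k j w = i} w * stopped_cos u th (real i / real (Suc j)) w)"
  if w: "w \<in> space P" for j w
 proof -
  have "(\<Sum>i\<le>K * Suc j + 1. ind {w \<in> space P. k j w = i} w * stopped_cos u th (real i / real (Suc j)) w) = (\<Sum>i\<le>K * Suc j + 1. if k j w = i then stopped_cos u th (real i / real (Suc j)) w else 0)"
   using w by (intro sum.cong) auto
  also have "... = stopped_cos u th (real (k j w) / real (Suc j)) w"
   using kle[OF w, of j] by (subst sum.delta') auto
  finally show ?thesis by (simp add: kT[OF w])
 qed
 have Ej: "expectation (%w. stopped_cos u th (Tj j w) w) = 0" for j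
 proof -
  have "expectation (%w. stopped_cos u th (Tj j w) w) = expectation (%w. \<Sum>i\<le>K * Suc j + 1. ind {w \<in> space P. k j w = i} w * stopped_cos u th (real i / real (Suc j)) w)"
   by (intro Bochner_Integration.integral_cong refl split)
  also have "... = (\<Sum>i\<le>K * Suc j + 1. expectation (%w. ind {w \<in> space P. k j w = i} w * stopped_cos u th (real i / real (Suc j)) w))"
   by (intro Bochner_Integration.integral_sum sci) auto
  \<comment> \<open>All grid values are at most \<open>K + 1\<close>; at this common time the
    indicators add up to 1.\<close>
  also have "... = (\<Sum>i\<le>K * Suc j + 1. expectation (%w. ind {w \<in> space P. k j w = i} w * stopped_cos u th (real (K + 1)) w))"
   by (intro sum.cong refl stopped_cos_mono ev Ki) auto
  also have "... = expectation (%w. \<Sum>i\<le>K * Suc j + 1. ind {w \<in> space P. k j w = i} w * stopped_cos u th (real (K + 1)) w)"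
   by (intro Bochner_Integration.integral_sum[symmetric] sci) auto
  also have "... = expectation (%w. ind (space P) w * stopped_cos u th (real (K + 1)) w)"
  proof (intro Bochner_Integration.integral_cong refl)
   fix w assume w: "w \<in> space P"
   have "(\<Sum>i\<le>K * Suc j + 1. ind {w \<in> space P. k j w = i} w * stopped_cos u th (real (K + 1)) w) = (\<Sum>i\<le>K * Suc j + 1. if k j w = i then stopped_cos u th (real (K + 1)) w else 0)"
    using w by (intro sum.cong) auto
   also have "... = stopped_cos u th (real (K + 1)) w"
    using kle[OF w, of j] by (subst sum.delta') auto
   finally show "(\<Sum>i\<le>K * Suc j + 1. ind {w \<in> space P. k j w = i} w * stopped_cos u th (real (K + 1)) w) = ind (space P) w * stopped_cos u th (real (K + 1)) w"
    using w by simp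
  qed
  also have "... = 0"
   unfolding stopped_cos_def by (rule M_cos_increment(2)) (use sets.top[of "F 0"] space_F in auto)
  finally show ?thesis .
 qed
 have Tjm[measurable]: "(%w. stopped_cos u th (Tj j w) w) \<in> borel_measurable P" for j
 proof -
  have "(%w. \<Sum>i\<le>K * Suc j + 1. ind {w \<in> space P. k j w = i} w * stopped_cos u th (real i / real (Suc j)) w) \<in> borel_measurable P"
   by (intro borel_measurable_sum borel_measurable_integrable[OF sci]) auto
  also have "?this \<longleftrightarrow> ?thesis" by (intro measurable_cong) (simp only: split)
  finally show ?thesis .
 qed
 have lim: "AE w in P. (%j. stopped_cos u th (Tj j w) w) \<longlonglongrightarrow> stopped_cos u th (T w) w"
  using total_path_integrable AE_space
 proof eventually_elim
  case (elim w)
  have Tlim: "(%j. Tj j w) \<longlonglongrightarrow> T w"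
  proof -
   have "(%j. real_of_int \<lfloor>T w * real (Suc j)\<rfloor> / real (Suc j) + 1 / real (Suc j)) \<longlonglongrightarrow> T w + 0"
    by (intro tendsto_add floor_approx LIMSEQ_Suc[OF lim_1_over_n])
   thus ?thesis by (simp add: Tj_def add_divide_distrib)
  qed
  have gt: "T w < Tj j w" for j
   unfolding Tj_def by (subst pos_less_divide_eq) (auto simp del: of_nat_Suc)
  have Mc: "(%j. M (Tj j w) w) \<longlonglongrightarrow> M (T w) w"
   by (rule continuous_on_tendsto_compose[OF M_path[OF elim(2)] Tlim])
     (use T0[OF elim(2)] gt in \<open>auto intro: less_imp_le order_trans intro!: always_eventually\<close>)
  have I: "(%j. \<integral>v. ind {0<..Tj j w} v * (cos (u * M v w + th) * (Eta v w)^2) \<partial>lborel) \<longlonglongrightarrow> (\<integral>v. ind {0<..T w} v * (cos (u * M v w + th) * (Eta v w)^2) \<partial>lborel)"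
  proof (rule integral_dominated_convergence[OF _ _ elim(1)])
   show "AE v in lborel. (%j. ind {0<..Tj j w} v * (cos (u * M v w + th) * (Eta v w)^2)) \<longlonglongrightarrow> ind {0<..T w} v * (cos (u * M v w + th) * (Eta v w)^2)"
   proof (intro AE_I2 tendsto_mult tendsto_const tendsto_eventually)
    fix v
    show "eventually (%j. ind {0<..Tj j w} v = (ind {0<..T w} v :: real)) sequentially"
    proof (cases "v <= T w")
     case True
     hence "v <= Tj j w" for j using gt[of j] by simp
     thus ?thesis using True by (simp add: indicator_def)
    next
     case False
     hence "eventually (%j. Tj j w < v) sequentially" by (intro order_tendstoD(2)[OF Tlim]) simp
     thus ?thesis by eventually_elim (use False in \<open>simp add: indicator_def\<close>)
    qed
   qed
   have "\<bar>cos (u * M v w + th) * (Eta v w)^2\<bar> <= (Eta v w)^2" for v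
    using mult_right_mono[OF abs_cos_le_one[of "u * M v w + th"], of "(Eta v w)^2"] by (simp add: abs_mult)
   thus "AE v in lborel. norm (ind {0<..Tj j w} v * (cos (u * M v w + th) * (Eta v w)^2)) <= ind {0<..} v * (Eta v w)^2" for j
    by (intro AE_I2) (simp split: split_indicator)
  qed (use sub_path_integrable[OF elim, of 0] in \<open>auto intro: borel_measurable_integrable\<close>)
  show ?case unfolding stopped_cos_def cos_increment_def
   by (intro tendsto_intros Mc I)
 qed
 have "(%j. expectation (%w. stopped_cos u th (Tj j w) w)) \<longlonglongrightarrow> expectation (%w. stopped_cos u th (T w) w)"
 proof (rule integral_dominated_convergence[OF _ _ domi lim])
  show "AE w in P. norm (stopped_cos u th (Tj j w) w) <= 2 + u^2 / 2 * total_QV w" for j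
   using bd by eventually_elim simp
  show "(%w. stopped_cos u th (T w) w) \<in> borel_measurable P"
  proof -
   have [measurable]: "(%w. M (T w) w) \<in> borel_measurable P" "M 0 \<in> borel_measurable P"
    using T0 by (auto intro!: M_at_measurable M_measurable)
   have [measurable]: "(%w. \<integral>v. ind {0<..T w} v * (cos (u * M v w + th) * (Eta v w)^2) \<partial>lborel) \<in> borel_measurable P"
    by (rule integral_over_time_measurable[OF random_interval_measurable[where S="%_. 0" and g="%z. cos (u * z + th)"]]) auto
   show ?thesis unfolding stopped_cos_def cos_increment_def by measurable
  qed
 qed measurable
 thus ?thesis unfolding Ej by (rule LIMSEQ_unique[OF _ tendsto_const])
qed

end

section \<open>Sigma-algebras of stopping times\<close>

context usual_filtration
begin

lemma subalgebra_pre_sigma: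
 assumes T: "stopping_time F T" shows "subalgebra P (pre_sigma T)"
 unfolding subalgebra_def
proof
 show "space (pre_sigma T) = space P" by (rule space_pre_sigma)
 show "sets (pre_sigma T) \<subseteq> sets P"
 proof
  fix A assume A: "A \<in> sets (pre_sigma T)"
  have "A = (\<Union>n::nat. {w \<in> A. T w <= real n})" using real_arch_simple by blast
  also have "... \<in> sets P"
   by (intro sets.countable_UN) (auto intro: sets_F_sub[OF sets_pre_sigmaD[OF T A]])
  finally show "A \<in> sets P" .
 qed
qed

lemma pre_sigma_sets_P: "stopping_time F T ==> A \<in> sets (pre_sigma T) ==> A \<in> sets P"
 using subalgebra_pre_sigma by (auto simp: subalgebra_def)

lemma pre_sigma_measurable_P: "stopping_time F T ==> f \<in> measurable (pre_sigma T) N ==> f \<in> measurable P N"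
 by (rule measurable_from_subalg[OF subalgebra_pre_sigma])

lemma sigma_finite_pre_sigma: "stopping_time F T ==> sigma_finite_subalgebra P (pre_sigma T)"
 by (rule finite_measure_subalgebra_is_sigma_finite)
   (auto simp: finite_measure_subalgebra_def finite_measure_subalgebra_axioms_def intro: subalgebra_pre_sigma finite_measure_axioms)

lemma pre_sigma_mono_measurable:
 assumes "stopping_time F S" "stopping_time F T" "!!w. w \<in> space P ==> S w <= T w" "f \<in> measurable (pre_sigma S) N"
 shows "f \<in> measurable (pre_sigma T) N"
 by (rule measurable_from_subalg[OF _ assms(4)])
   (use mono_pre_sigma[OF assms(1-3)] in \<open>simp add: subalgebra_def space_pre_sigma\<close>)

text \<open>Running on to \<open>T\<close> on \<open>B\<close> only and stopping at \<open>S\<close>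
  elsewhere turns plain expectations at stopping times into integrals over an arbitrary event known
  at time \<open>S\<close>; this replaces conditional expectations in many places below.\<close>

lemma stopping_time_patch:
 assumes S: "stopping_time F S" and T: "stopping_time F T" and le: "!!w. w \<in> space P ==> S w <= T w" and B: "B \<in> sets (pre_sigma S)"
 shows "stopping_time F (%w. if w \<in> B then T w else S w)"
proof
 fix t
 have 1: "{w \<in> B. S w <= t} \<in> sets (F t)" by (rule sets_pre_sigmaD[OF S B])
 have "space (pre_sigma S) - B \<in> sets (pre_sigma S)" using B by (rule sets.compl_sets)
 hence 2: "{w \<in> space P - B. S w <= t} \<in> sets (F t)" using sets_pre_sigmaD[OF S, of "space P - B" t] by (simp only: space_pre_sigma)
 have 3: "{w \<in> space P. T w <= t} \<in> sets (F t)" using stopping_timeD[OF T, of t] by (simp add: pred_def space_F)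
 have BS: "B \<subseteq> space P" using sets.sets_into_space[OF B] by (simp add: space_pre_sigma)
 have "{w \<in> space P. (if w \<in> B then T w else S w) <= t} = ({w \<in> B. S w <= t} \<inter> {w \<in> space P. T w <= t}) \<union> {w \<in> space P - B. S w <= t}"
  using le BS by (auto intro: order_trans)
 also have "... \<in> sets (F t)" using 1 2 3 by auto
 finally show "Measurable.pred (F t) (%w. (if w \<in> B then T w else S w) <= t)"
  by (simp add: pred_def space_F)
qed

end

lemma q_same: "double_integral g y y = 0"
proof -
 have "double_integral g y y = (\<integral>\<^sup>+ (u::real). 0 \<partial>lborel)"
  unfolding double_integral_def
  by (intro nn_integral_cong_AE) (use AE_lborel_singleton[of y] in \<open>eventually_elim, simp split: split_indicator\<close>)
 thus ?thesis by simp
qed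

section \<open>Optional stopping at unbounded times and the occupation identity for the
  solution\<close>

context weak_sol
begin

text \<open>The times \<open>min (T w) n\<close> agree with \<open>T w\<close> from some
  \<open>n\<close> on, and all values are dominated by one integrable variable.\<close>

lemma stopped_cos_stopping:
 assumes T: "stopping_time F T" and T0: "!!w. w \<in> space P ==> 0 <= T w"
 shows "integrable P (%w. stopped_cos u th (T w) w)" "expectation (%w. stopped_cos u th (T w) w) = 0"
proof -
 have m: "(%w. stopped_cos u th (T w) w) \<in> borel_measurable P" if "T \<in> borel_measurable P" "!!w. w \<in> space P ==> 0 <= T w" for T
 proof -
  have [measurable]: "(%w. M (T w) w) \<in> borel_measurable P" "M 0 \<in> borel_measurable P"
   using that by (auto intro!: M_at_measurable M_measurable)
  have [measurable]: "(%w. \<integral>v. ind {0<..T w} v * (cos (u * M v w + th) * (Eta v w)^2) \<partial>lborel) \<in> borel_measurable P"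
   by (rule integral_over_time_measurable[OF random_interval_measurable[where S="%_. 0" and g="%z. cos (u * z + th)"]]) (use that in auto)
  show ?thesis unfolding stopped_cos_def cos_increment_def by measurable
 qed
 have Tm: "T \<in> borel_measurable P" by (rule sets_F_measurable_stopping[OF T])
 have domi: "integrable P (%w. 2 + u^2 / 2 * total_QV w)" using total_QV_integrable by simp
 have bd: "AE w in P. ALL t. \<bar>stopped_cos u th t w\<bar> <= 2 + u^2 / 2 * total_QV w"
  using total_path_integrable path_integrable_AE
 proof eventually_elim
  case (elim w)
  show ?case using stopped_cos_bound[OF elim(1) spec[OF elim(2)]] by blast
 qed
 show "integrable P (%w. stopped_cos u th (T w) w)"
 proof (rule Bochner_Integration.integrable_bound[OF domi m[OF Tm T0]])
  show "AE w in P. norm (stopped_cos u th (T w) w) <= norm (2 + u^2 / 2 * total_QV w)"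
   using bd
  proof eventually_elim
   case (elim w)
   have "0 <= u^2 / 2 * total_QV w" using total_QV_nonneg by simp
   thus ?case using spec[OF elim, of "T w"] by simp
  qed
 qed
 define Tn where "Tn n w = min (T w) (real n)" for n w
 have Tn: "stopping_time F (Tn n)" for n
  unfolding Tn_def by (rule stopping_time_min[OF T stopping_time_const])
 have E0: "expectation (%w. stopped_cos u th (Tn n w) w) = 0" for n
  by (rule stopped_cos_bounded_stopping[OF Tn, where K=n]) (use T0 in \<open>auto simp: Tn_def\<close>)
 have "(%n. expectation (%w. stopped_cos u th (Tn n w) w)) \<longlonglongrightarrow> expectation (%w. stopped_cos u th (T w) w)"
 proof (rule integral_dominated_convergence[OF m[OF Tm T0] _ domi])
  show "(%w. stopped_cos u th (Tn n w) w) \<in> borel_measurable P" for n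
   by (rule m[OF sets_F_measurable_stopping[OF Tn]]) (use T0 in \<open>auto simp: Tn_def\<close>)
  show "AE w in P. (%n. stopped_cos u th (Tn n w) w) \<longlonglongrightarrow> stopped_cos u th (T w) w"
  proof (intro AE_I2 tendsto_eventually)
   fix w
   obtain N :: nat where N: "T w <= real N" using real_arch_simple by blast
   show "eventually (%n. stopped_cos u th (Tn n w) w = stopped_cos u th (T w) w) sequentially"
    using eventually_ge_at_top[of N]
   proof eventually_elim
    case (elim n)
    hence "Tn n w = T w" using N by (simp add: Tn_def)
    thus ?case by simp
   qed
  qed
  show "AE w in P. norm (stopped_cos u th (Tn n w) w) <= 2 + u^2 / 2 * total_QV w" for n
   using bd by eventually_elim simp
 qed
 thus "expectation (%w. stopped_cos u th (T w) w) = 0"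
  unfolding E0 by (rule LIMSEQ_unique[OF _ tendsto_const])
qed

lemma M_at_range:
 assumes "!!w. w \<in> space P ==> 0 <= T w"
 shows "AE w in P. M (T w) w \<in> {l..r}"
 using M_range AE_space by eventually_elim (use assms in blast)

lemma M_bound: "x \<in> {l..r} ==> \<bar>x\<bar> <= max \<bar>l\<bar> \<bar>r\<bar>"
 by auto

lemma M_at_integrable:
 assumes T: "T \<in> borel_measurable P" and T0: "!!w. w \<in> space P ==> 0 <= T w"
 shows "integrable P (%w. M (T w) w)" "integrable P (%w. (M (T w) w)\<^sup>2)"
proof -
 note [measurable] = M_at_measurable[OF assms]
 have rng: "AE w in P. M (T w) w \<in> {l..r}" by (rule M_at_range[OF T0])
 show i: "integrable P (%w. M (T w) w)"
 proof (rule integrable_const_bound)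
  show "AE w in P. norm (M (T w) w) <= max \<bar>l\<bar> \<bar>r\<bar>"
   using rng by eventually_elim (use M_bound in simp)
 qed measurable
 show "integrable P (%w. (M (T w) w)\<^sup>2)"
 proof (rule integrable_const_bound)
  show "AE w in P. norm ((M (T w) w)^2) <= (max \<bar>l\<bar> \<bar>r\<bar>)^2"
   using rng
  proof eventually_elim
   case (elim w)
   have "\<bar>M (T w) w\<bar>\<^sup>2 <= (max \<bar>l\<bar> \<bar>r\<bar>)^2" by (intro power_mono M_bound elim) simp
   thus ?case by simp
  qed
 qed measurable
qed

text \<open>The martingale property is also extracted from cosines: the phase turns the cosine into
  \<open>sin (u * (x - m))\<close>, the drift is of order \<open>u^2\<close>, and
  \<open>mean_zero_from_sin\<close> concludes.\<close>

lemma M_at_expectation: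
 assumes T: "stopping_time F T" and T0: "!!w. w \<in> space P ==> 0 <= T w"
 shows "expectation (%w. M (T w) w) = m"
proof -
 have Tm: "T \<in> borel_measurable P" by (rule sets_F_measurable_stopping[OF T])
 note [measurable] = M_at_measurable[OF Tm T0] M_measurable[OF order_refl]
 have i: "integrable P (%w. M (T w) w - m)" using M_at_integrable(1)[OF Tm T0] by simp
 have "expectation (%w. M (T w) w - m) = 0"
 proof (rule mean_zero_from_sin[OF i])
  fix u :: real
  define th where "th = - (u * m) - pi / 2"
  have c: "cos (u * x + th) = sin (u * (x - m))" for x
  proof -
   have "u * x + th = u * (x - m) - pi / 2" by (simp add: th_def algebra_simps)
   thus ?thesis by (simp add: cos_diff)
  qed
  note sc = stopped_cos_stopping[OF T T0, of u th]
  have isn: "integrable P (%w. sin (u * (M (T w) w - m)))"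
   by (rule integrable_const_bound[of _ 1]) auto
  have ae: "AE w in P. \<bar>stopped_cos u th (T w) w - sin (u * (M (T w) w - m))\<bar> <= u^2 / 2 * total_QV w"
   using M_0 total_path_integrable path_integrable_AE
  proof eventually_elim
   case (elim w)
   let ?I = "\<integral>v. ind {0<..T w} v * (cos (u * M v w + th) * (Eta v w)^2) \<partial>lborel"
   have e: "stopped_cos u th (T w) w - sin (u * (M (T w) w - m)) = u^2 / 2 * ?I"
    unfolding stopped_cos_def cos_increment_def elim(1) c by simp
   have "\<bar>?I\<bar> <= (\<integral>v. \<bar>ind {0<..T w} v * (cos (u * M v w + th) * (Eta v w)^2)\<bar> \<partial>lborel)" by (rule integral_abs_bound)
   also have "... <= total_QV w" unfolding total_QV_def
   proof (rule integral_mono'[OF elim(2)])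
    fix v
    have "\<bar>cos (u * M v w + th) * (Eta v w)^2\<bar> <= (Eta v w)^2"
     using mult_right_mono[OF abs_cos_le_one[of "u * M v w + th"], of "(Eta v w)^2"] by (simp add: abs_mult)
    thus "\<bar>ind {0<..T w} v * (cos (u * M v w + th) * (Eta v w)^2)\<bar> <= ind {0<..} v * (Eta v w)^2"
     by (simp split: split_indicator)
   qed simp
   finally have "u^2 / 2 * \<bar>?I\<bar> <= u^2 / 2 * total_QV w" by (intro mult_left_mono) auto
   thus ?case unfolding e by (simp add: abs_mult)
  qed
  have "\<bar>expectation (%w. sin (u * (M (T w) w - m)))\<bar> = \<bar>expectation (%w. stopped_cos u th (T w) w - sin (u * (M (T w) w - m)))\<bar>"
   using sc isn by simp
  also have "... <= expectation (%w. \<bar>stopped_cos u th (T w) w - sin (u * (M (T w) w - m))\<bar>)" by (rule integral_abs_bound)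
  also have "... <= expectation (%w. u\<^sup>2 / 2 * total_QV w)"
   by (rule integral_mono_AE) (use sc isn total_QV_integrable ae in auto)
  also have "... = (expectation total_QV / 2) * u^2" by simp
  finally show "\<bar>expectation (%w. sin (u * (M (T w) w - m)))\<bar> <= (expectation total_QV / 2) * u^2" .
 qed
 thus ?thesis using M_at_integrable(1)[OF Tm T0] by (simp add: prob_space)
qed

context
 fixes S T :: "'a => real"
 assumes S: "stopping_time F S" and T: "stopping_time F T"
  and S0: "!!w. w \<in> space P ==> 0 <= S w" and ST: "!!w. w \<in> space P ==> S w <= T w"
begin

lemma T0: "w \<in> space P ==> 0 <= T w"
 using S0 ST by (meson order_trans)

lemma Sm: "S \<in> borel_measurable P" and Tm: "T \<in> borel_measurable P"
 using S T by (auto intro: sets_F_measurable_stopping)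

lemma M_increment_on:
 assumes B: "B \<in> sets (pre_sigma S)"
 shows "expectation (%w. ind B w * (M (T w) w - M (S w) w)) = 0"
proof -
 let ?T = "%w. if w \<in> B then T w else S w"
 have TB: "stopping_time F ?T" by (rule stopping_time_patch[OF S T ST B])
 have TB0: "0 <= ?T w" if "w \<in> space P" for w using S0[OF that] T0[OF that] by simp
 have "expectation (%w. ind B w * (M (T w) w - M (S w) w)) = expectation (%w. M (?T w) w - M (S w) w)"
  by (intro Bochner_Integration.integral_cong) (auto split: split_indicator)
 also have "... = 0"
  using M_at_expectation[OF TB TB0] M_at_expectation[OF S S0]
   M_at_integrable(1)[OF sets_F_measurable_stopping[OF TB] TB0] M_at_integrable(1)[OF Sm S0] by simp
 finally show ?thesis .
qed

text \<open>Testing on events of \<open>pre_sigma S\<close> says that the conditional expectation of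
  the increment given that sigma-algebra is zero; factors known at time \<open>S\<close> can then be
  pulled out.\<close>

lemma M_increment_orthogonal:
 assumes \<phi>: "\<phi> \<in> borel_measurable (pre_sigma S)" and i: "integrable P (%w. \<phi> w * (M (T w) w - M (S w) w))"
 shows "expectation (%w. \<phi> w * (M (T w) w - M (S w) w)) = 0"
proof -
 interpret sub: sigma_finite_subalgebra P "pre_sigma S" by (rule sigma_finite_pre_sigma[OF S])
 let ?D = "%w. M (T w) w - M (S w) w"
 have iD: "integrable P ?D" using M_at_integrable(1)[OF Tm T0] M_at_integrable(1)[OF Sm S0] by simp
 have ce: "AE w in P. real_cond_exp P (pre_sigma S) ?D w = 0"
 proof (rule sub.real_cond_exp_charact)
  fix A assume "A \<in> sets (pre_sigma S)"
  from M_increment_on[OF this] show "(\<integral>x\<in>A. ?D x \<partial>P) = (\<integral>x\<in>A. 0 \<partial>P)"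
   by (simp add: set_lebesgue_integral_def)
 qed (use iD in auto)
 have "expectation (%w. \<phi> w * ?D w) = expectation (%w. \<phi> w * real_cond_exp P (pre_sigma S) ?D w)"
  by (rule sub.real_cond_exp_intg(2)[OF i \<phi> borel_measurable_integrable[OF iD], symmetric])
 also have "... = expectation (%_. 0)"
 proof (rule integral_cong_AE)
  show "(%w. \<phi> w * real_cond_exp P (pre_sigma S) ?D w) \<in> borel_measurable P"
   using pre_sigma_measurable_P[OF S \<phi>] by measurable
  show "AE w in P. \<phi> w * real_cond_exp P (pre_sigma S) ?D w = 0" using ce by eventually_elim simp
 qed simp
 finally show ?thesis by simp
qed

end

text \<open>On the event \<open>T w <= t\<close> the value is \<open>M\<close> at
  \<open>min (T w) t\<close>, a composition of maps measurable for \<open>F t\<close>. Time is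
  clamped to the range from 0 to \<open>t\<close> so that joint measurability with respect to
  \<open>F t\<close> is available.\<close>

lemma M_at_pre_sigma:
 assumes T: "stopping_time F T" and T0: "!!w. w \<in> space P ==> 0 <= T w"
 shows "(%w. M (T w) w) \<in> borel_measurable (pre_sigma T)"
proof (rule borel_measurableI_le, rule sets_pre_sigmaI[OF T])
 fix c t :: real
 show "{w \<in> {w \<in> space (pre_sigma T). M (T w) w <= c}. T w <= t} \<in> sets (F t)"
 proof (cases "0 <= t")
  case False
  hence "{w \<in> {w \<in> space (pre_sigma T). M (T w) w <= c}. T w <= t} = {}" using T0 by (force simp: space_pre_sigma)
  thus ?thesis by (simp only: sets.empty_sets)
 next
  case True
  have jm: "(%(s, w). M (min t (max 0 s)) w) \<in> borel_measurable (borel \<Otimes>\<^sub>M F t)"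
  proof (rule measurable_jointly_continuous)
   show "M (min t (max 0 s)) \<in> borel_measurable (F t)" for s
    using True by (intro measurable_F_mono[OF M_adapted]) auto
   fix w assume "w \<in> space (F t)"
   hence "continuous_on {0..} (%t. M t w)" by (intro M_path) (simp add: space_F)
   thus "continuous_on UNIV (%s. M (min t (max 0 s)) w)"
    by (rule continuous_on_compose2) (use True in \<open>auto intro!: continuous_intros\<close>)
  qed
  have mm: "(%w. min (T w) t) \<in> borel_measurable (F t)"
  proof (rule borel_measurableI_le)
   fix s
   show "{w \<in> space (F t). min (T w) t <= s} \<in> sets (F t)"
   proof (cases "t <= s")
    case True
    hence "{w \<in> space (F t). min (T w) t <= s} = space (F t)" by auto
    thus ?thesis by simp
   next
    case False
    hence "{w \<in> space (F t). min (T w) t <= s} = {w \<in> space (F t). T w <= s}" by auto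
    also have "... \<in> sets (F t)" using stopping_time_le_const[OF T, of s t] False by (simp add: pred_def)
    finally show ?thesis .
   qed
  qed
  have "(%w. (min (T w) t, w)) \<in> F t \<rightarrow>\<^sub>M borel \<Otimes>\<^sub>M F t" using mm by measurable
  from measurable_compose[OF this jm] have "(%w. M (min t (max 0 (min (T w) t))) w) \<in> borel_measurable (F t)" by simp
  hence "{w \<in> space (F t). M (min t (max 0 (min (T w) t))) w <= c} \<in> sets (F t)" by measurable
  moreover have "{w \<in> space (F t). T w <= t} \<in> sets (F t)" using stopping_timeD[OF T, of t] by (simp add: pred_def)
  moreover have "{w \<in> {w \<in> space (pre_sigma T). M (T w) w <= c}. T w <= t} = {w \<in> space (F t). M (min t (max 0 (min (T w) t))) w <= c} \<inter> {w \<in> space (F t). T w <= t}"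
   using T0 by (auto simp: space_pre_sigma space_F min_def max_def)
  ultimately show ?thesis by auto
 qed
qed

text \<open>The cosine identity is the difference of optional stopping at \<open>T\<close> and at
  \<open>S\<close>, and the orthogonality conditions are the martingale property at
  \<open>S\<close>; \<open>occupation_identity\<close> then extends it to every nonnegative Borel
  \<open>g\<close>.\<close>

theorem occupation_between:
 assumes S: "stopping_time F S" and T: "stopping_time F T"
  and S0: "!!w. w \<in> space P ==> 0 <= S w" and ST: "!!w. w \<in> space P ==> S w <= T w"
  and g[measurable]: "g \<in> borel_measurable borel"
 shows "(\<integral>\<^sup>+w. \<integral>\<^sup>+v. ennreal (ind {S w<..T w} v * (Eta v w)^2) * g (M v w) \<partial>lborel \<partial>P)
  = 2 * (\<integral>\<^sup>+w. double_integral g (M (S w) w) (M (T w) w) \<partial>P)"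
proof -
 note T0 = T0[OF S T S0 ST] and Sm = Sm[OF S T S0 ST] and Tm = Tm[OF S T S0 ST]
 \<comment> \<open>The case distinction makes the weight vanish at nonpositive times for every
   argument, as \<open>occupation_measure\<close> requires; \<open>S\<close> is known to be
   nonnegative only on \<open>space P\<close>.\<close>
 define wt where "wt v w = (if w \<in> space P then ind {S w<..T w} v * (Eta v w)^2 else 0)" for v w
 have wm: "(%x. wt (fst x) (snd x)) \<in> borel_measurable (borel \<Otimes>\<^sub>M P)"
 proof -
  have "(%x. ind {S (snd x)<..T (snd x)} (fst x) * ((%_. 1) (M (fst x) (snd x)) * (Eta (fst x) (snd x))^2) :: real) \<in> borel_measurable (borel \<Otimes>\<^sub>M P)"
   by (rule random_interval_measurable[OF Sm Tm S0]) auto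
  also have "?this \<longleftrightarrow> ?thesis"
   by (intro measurable_cong) (auto simp: wt_def space_pair_measure)
  finally show ?thesis .
 qed
 have w0: "0 <= wt v w" for v w by (simp add: wt_def)
 have w1: "wt v w = 0" if "v <= 0" for v w using that S0[of w] by (auto simp: wt_def split: split_indicator)
 have cong: "sets (lborel \<Otimes>\<^sub>M P) = sets (borel \<Otimes>\<^sub>M P)" by (rule sets_pair_measure_cong) auto
 have wi: "integrable (lborel \<Otimes>\<^sub>M P) (%x. wt (fst x) (snd x))"
 proof (rule Bochner_Integration.integrable_bound[OF total_pair_integrable])
  show "(%x. wt (fst x) (snd x)) \<in> borel_measurable (lborel \<Otimes>\<^sub>M P)"
   using wm by (simp add: measurable_cong_sets[OF cong refl])
  show "AE x in lborel \<Otimes>\<^sub>M P. norm (wt (fst x) (snd x)) <= norm (ind {0<..} (fst x) * (Eta (fst x) (snd x))^2)"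
  proof (intro AE_I2)
   fix x
   show "norm (wt (fst x) (snd x)) <= norm (ind {0<..} (fst x) * (Eta (fst x) (snd x))^2)"
    using S0[of "snd x"] by (auto simp: wt_def split: split_indicator)
  qed
 qed
 have Xm: "(%x. M (max 0 (fst x)) (snd x)) \<in> borel_measurable (borel \<Otimes>\<^sub>M P)"
  by (rule process_joint_measurable[OF M_measurable M_cont])
 let ?\<nu> = "occupation_measure P M wt"
 note occ = occupation_measure[OF Xm wm w0 w1]
 note [measurable] = M_at_measurable[OF Sm S0] M_at_measurable[OF Tm T0]
 have rng: "AE w in P. M (S w) w \<in> {l..r}" "AE w in P. M (T w) w \<in> {l..r}"
  by (rule M_at_range[OF S0], assumption) (rule M_at_range[OF T0], assumption)
 have iS: "integrable P (%w. M (S w) w)" "integrable P (%w. M (T w) w)"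
  using M_at_integrable[OF Sm S0] M_at_integrable[OF Tm T0] by auto
 have "(\<integral>\<^sup>+z. g z \<partial>?\<nu>) = 2 * (\<integral>\<^sup>+w. double_integral g (M (S w) w) (M (T w) w) \<partial>P)"
 proof (rule occupation_identity)
  show "integrable P (%w. (M (S w) w)\<^sup>2)" "integrable P (%w. (M (T w) w)\<^sup>2)"
   using M_at_integrable[OF Sm S0] M_at_integrable[OF Tm T0] by auto
  show "finite_measure ?\<nu>" by (rule occ(3)) (auto simp: wi)
  show "sets ?\<nu> = sets borel" by (rule occ(1)) auto
  fix u th :: real
  have sS: "(%w. sin (u * M (S w) w + th)) \<in> borel_measurable (pre_sigma S)"
   using M_at_pre_sigma[OF S S0] by measurable
  show "expectation (%w. sin (u * M (S w) w + th) * (M (T w) w - M (S w) w)) = 0"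
  proof (rule M_increment_orthogonal[OF S T S0 ST sS])
   show "integrable P (%w. sin (u * M (S w) w + th) * (M (T w) w - M (S w) w))"
   proof (rule Bochner_Integration.integrable_bound)
    show "integrable P (%w. M (T w) w - M (S w) w)" using iS by simp
    have "\<bar>sin a * b\<bar> <= \<bar>b\<bar>" for a b :: real using mult_right_mono[OF abs_sin_le_one[of a], of "\<bar>b\<bar>"] by (simp add: abs_mult)
    thus "AE w in P. norm (sin (u * M (S w) w + th) * (M (T w) w - M (S w) w)) <= norm (M (T w) w - M (S w) w)" by auto
   qed measurable
  qed auto
  let ?IS = "%w. \<integral>v. ind {0<..S w} v * (cos (u * M v w + th) * (Eta v w)^2) \<partial>lborel"
  let ?IT = "%w. \<integral>v. ind {0<..T w} v * (cos (u * M v w + th) * (Eta v w)^2) \<partial>lborel"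
  let ?C = "%w. cos (u * M (T w) w + th) - cos (u * M (S w) w + th)"
  note scS = stopped_cos_stopping[OF S S0, of u th] and scT = stopped_cos_stopping[OF T T0, of u th]
  have wcos: "AE w in P. (\<integral>v. wt v w * cos (u * M v w + th) \<partial>lborel) = ?IT w - ?IS w"
   using total_path_integrable AE_space
  proof eventually_elim
   case (elim w)
   have "(\<integral>v. wt v w * cos (u * M v w + th) \<partial>lborel) = (\<integral>v. ind {0<..T w} v * (cos (u * M v w + th) * (Eta v w)^2) - ind {0<..S w} v * (cos (u * M v w + th) * (Eta v w)^2) \<partial>lborel)"
    using elim(2) S0[OF elim(2)] ST[OF elim(2)] by (intro Bochner_Integration.integral_cong) (auto simp: wt_def split: split_indicator)
   also have "... = ?IT w - ?IS w"
    by (rule Bochner_Integration.integral_diff[OF sub_path_integrable[OF elim order_refl] sub_path_integrable[OF elim order_refl]])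
   finally show ?case .
  qed
  have ImS: "?IS \<in> borel_measurable P" "?IT \<in> borel_measurable P"
   using S0 T0 by (auto intro!: integral_over_time_measurable[OF random_interval_measurable[where S="%_. 0" and g="%z. cos (u * z + th)"]] Sm Tm)
  have wm2: "(%w. \<integral>v. wt v w * cos (u * M v w + th) \<partial>lborel) \<in> borel_measurable P"
  proof (rule integral_over_time_measurable)
   have eq: "(%x. wt (fst x) (snd x) * cos (u * M (fst x) (snd x) + th)) = (%x. wt (fst x) (snd x) * cos (u * M (max 0 (fst x)) (snd x) + th))"
   proof
    fix x show "wt (fst x) (snd x) * cos (u * M (fst x) (snd x) + th) = wt (fst x) (snd x) * cos (u * M (max 0 (fst x)) (snd x) + th)"
     using w1[of "fst x" "snd x"] by (cases "fst x <= 0") (simp_all add: max_def)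
   qed
   note [measurable] = wm Xm
   show "(%x. wt (fst x) (snd x) * cos (u * M (fst x) (snd x) + th)) \<in> borel_measurable (borel \<Otimes>\<^sub>M P)"
    unfolding eq by measurable
  qed
  have C: "?C w = (stopped_cos u th (T w) w - stopped_cos u th (S w) w) - u\<^sup>2 / 2 * (?IT w - ?IS w)" for w
   unfolding stopped_cos_def cos_increment_def by (simp add: algebra_simps)
  have iC: "integrable P ?C"
  proof (rule integrable_const_bound[of _ 2])
   have "\<bar>cos a - cos b\<bar> <= 2" for a b :: real using abs_cos_le_one[of a] abs_cos_le_one[of b] by linarith
   thus "AE w in P. norm (?C w) <= 2" by auto
  qed measurable
  have "u^2 / 2 * expectation (%w. ?IT w - ?IS w) = expectation (%w. u\<^sup>2 / 2 * (?IT w - ?IS w))" by simp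
  also have "... = expectation (%w. (stopped_cos u th (T w) w - stopped_cos u th (S w) w) - ?C w)"
   unfolding C by simp
  also have "... = - expectation ?C" using scS scT iC by simp
  finally have E: "expectation ?C = - (u^2 / 2) * expectation (%w. ?IT w - ?IS w)" by simp
  have "(\<integral>z. cos (u * z + th) \<partial>?\<nu>) = expectation (%w. \<integral>v. wt v w * cos (u * M v w + th) \<partial>lborel)"
   by (rule occ(4)) (auto simp: wi)
  also have "... = expectation (%w. ?IT w - ?IS w)"
   by (rule integral_cong_AE[OF wm2 borel_measurable_diff[OF ImS(2) ImS(1)] wcos])
  finally show "expectation ?C = - (u^2 / 2) * (\<integral>z. cos (u * z + th) \<partial>?\<nu>)" using E by simp
 next
  show "expectation (%w. M (S w) w * (M (T w) w - M (S w) w)) = 0"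
  proof (rule M_increment_orthogonal[OF S T S0 ST M_at_pre_sigma[OF S S0]])
   show "integrable P (%w. M (S w) w * (M (T w) w - M (S w) w))"
   proof (rule integrable_const_bound)
    show "AE w in P. norm (M (S w) w * (M (T w) w - M (S w) w)) <= max \<bar>l\<bar> \<bar>r\<bar> * (2 * max \<bar>l\<bar> \<bar>r\<bar>)"
     using rng
    proof eventually_elim
     case (elim w)
     have "\<bar>M (T w) w - M (S w) w\<bar> <= 2 * max \<bar>l\<bar> \<bar>r\<bar>"
      using M_bound[OF elim(1)] M_bound[OF elim(2)] by linarith
     hence "\<bar>M (S w) w\<bar> * \<bar>M (T w) w - M (S w) w\<bar> <= max \<bar>l\<bar> \<bar>r\<bar> * (2 * max \<bar>l\<bar> \<bar>r\<bar>)"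
      by (intro mult_mono M_bound elim) auto
     thus ?case by (simp add: abs_mult)
    qed
   qed measurable
  qed auto
 qed measurable
 also have "(\<integral>\<^sup>+z. g z \<partial>?\<nu>) = (\<integral>\<^sup>+w. \<integral>\<^sup>+v. ennreal (wt v w) * g (M v w) \<partial>lborel \<partial>P)"
  by (rule occ(2)) auto
 also have "... = (\<integral>\<^sup>+w. \<integral>\<^sup>+v. ennreal (ind {S w<..T w} v * (Eta v w)^2) * g (M v w) \<partial>lborel \<partial>P)"
  by (intro nn_integral_cong) (simp add: wt_def)
 finally show ?thesis .
qed

end

section \<open>Exit times\<close>

lemma kern_mono:
 assumes "y <= x & x <= x' | x' <= x & x <= y"
 shows "kern y x z <= kern y x' z"
 using assms by (auto simp: kern_def max_def)

lemma double_integral_mono: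
 assumes "g \<in> borel_measurable borel" "y <= x & x <= x' | x' <= x & x <= y"
 shows "double_integral g y x <= double_integral g y x'"
 unfolding double_integral_eq_kern[OF assms(1)]
 by (intro nn_integral_mono mult_right_mono ennreal_leI kern_mono assms) simp

lemma qdens_measurable:
 assumes [measurable]: "\<eta> \<in> borel_measurable borel"
 shows "qdens \<eta> \<in> borel_measurable borel"
 unfolding qdens_def[abs_def] by measurable

lemma q_mono:
 "\<eta> \<in> borel_measurable borel ==> y <= x & x <= x' | x' <= x & x <= y ==> q \<eta> y x <= q \<eta> y x'"
 unfolding q_eq_double_integral by (intro double_integral_mono qdens_measurable)

lemma q_self: "q \<eta> y y = 0"
 unfolding q_eq_double_integral by (rule q_same)

lemma q_measurable:
 assumes "\<eta> \<in> borel_measurable borel" "f \<in> borel_measurable N" "h \<in> borel_measurable N"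
 shows "(%w. q \<eta> (f w) (h w)) \<in> borel_measurable N"
 unfolding q_eq_double_integral by (intro double_integral_measurable qdens_measurable assms)

text \<open>By compactness a path inside the open interval keeps a margin
  \<open>1 / (k + 1)\<close>. The resulting closed condition passes to limits of rational times; the
  endpoint \<open>t\<close> is added because the other times are approached by rationals from the
  right. Countably many conditions up to \<open>t\<close> give measurability in
  \<open>F t\<close>.\<close>

lemma path_inside_iff_rational:
 fixes f :: "real => real"
 assumes f: "continuous_on {0..} f" and S: "0 <= S" "S <= t"
 shows "(\<forall>s\<in>{S..t}. f s \<in> {Lo<..<Hi}) \<longleftrightarrow> (\<exists>k::nat. \<forall>s\<in>insert t (\<rat> \<inter> {0..t}). S <= s --> Lo + 1 / real (Suc k) <= f s & f s <= Hi - 1 / real (Suc k))"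
proof
 assume in_: "\<forall>s\<in>{S..t}. f s \<in> {Lo<..<Hi}"
 have c: "continuous_on {S..t} f" using f S by (auto intro: continuous_on_subset)
 obtain a where a: "a \<in> {S..t}" "\<forall>s\<in>{S..t}. f a <= f s"
  using continuous_attains_inf[OF compact_Icc _ c] S by auto
 obtain b where b: "b \<in> {S..t}" "\<forall>s\<in>{S..t}. f s <= f b"
  using continuous_attains_sup[OF compact_Icc _ c] S by auto
 have "0 < min (f a - Lo) (Hi - f b)" using in_ a(1) b(1) by simp
 then obtain k :: nat where k: "1 / real (Suc k) < min (f a - Lo) (Hi - f b)"
  using reals_Archimedean unfolding inverse_eq_divide by blast
 have "Lo + 1 / real (Suc k) <= f s & f s <= Hi - 1 / real (Suc k)" if "s \<in> {S..t}" for s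
  using k a(2) b(2) that by (smt (verit) min_less_iff_conj)
 thus "\<exists>k::nat. \<forall>s\<in>insert t (\<rat> \<inter> {0..t}). S <= s --> Lo + 1 / real (Suc k) <= f s & f s <= Hi - 1 / real (Suc k)"
  using S by (intro exI[of _ k]) auto
next
 assume "\<exists>k::nat. \<forall>s\<in>insert t (\<rat> \<inter> {0..t}). S <= s --> Lo + 1 / real (Suc k) <= f s & f s <= Hi - 1 / real (Suc k)"
 then obtain k :: nat where k0: "\<forall>s\<in>insert t (\<rat> \<inter> {0..t}). S <= s --> Lo + 1 / real (Suc k) <= f s & f s <= Hi - 1 / real (Suc k)" ..
 have k: "f s \<in> {Lo + 1 / real (Suc k)..Hi - 1 / real (Suc k)}" if "s \<in> insert t (\<rat> \<inter> {0..t})" "S <= s" for s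
  using bspec[OF k0 that(1)] that(2) by simp
 show "\<forall>s\<in>{S..t}. f s \<in> {Lo<..<Hi}"
 proof
  fix s assume s: "s \<in> {S..t}"
  have "f s \<in> {Lo + 1 / real (Suc k)..Hi - 1 / real (Suc k)}"
  proof (cases "s = t")
   case True thus ?thesis using k[of t] S by simp
  next
   case False
   hence st: "s < t" using s by simp
   have "\<exists>q\<in>\<rat>. s < q & q < min t (s + 1 / real (Suc n))" for n :: nat
    using Rats_dense_in_real[of s "min t (s + 1 / real (Suc n))"] st by auto
   then obtain q where q: "!!n. q n \<in> \<rat>" "!!n. s < q n" "!!n. q n < min t (s + 1 / real (Suc n))" by metis
   have "q \<longlonglongrightarrow> s"
   proof (rule tendsto_sandwich[where f="%_. s" and h="%n. s + 1 / real (Suc n)"])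
    have "(%n. s + 1 / real (Suc n)) \<longlonglongrightarrow> s + 0" by (intro tendsto_intros LIMSEQ_Suc[OF lim_1_over_n])
    thus "(%n. s + 1 / real (Suc n)) \<longlonglongrightarrow> s" by simp
    show "eventually (%n. s <= q n) sequentially" using q(2) by (intro always_eventually allI less_imp_le)
    show "eventually (%n. q n <= s + 1 / real (Suc n)) sequentially"
     using q(3) by (intro always_eventually allI) (metis less_imp_le min_less_iff_conj)
   qed simp
   moreover have q0: "0 <= q n" for n using q(2)[of n] s S by simp
   ultimately have lim: "(%n. f (q n)) \<longlonglongrightarrow> f s"
    using s S by (intro continuous_on_tendsto_compose[OF f]) auto
   have mem: "f (q n) \<in> {Lo + 1 / real (Suc k)..Hi - 1 / real (Suc k)}" for n
   proof (rule k)
    show "q n \<in> insert t (\<rat> \<inter> {0..t})" using q(1)[of n] q(3)[of n] q0[of n] by simp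
    show "S <= q n" using q(2)[of n] s by simp
   qed
   show ?thesis by (rule closed_sequentially[OF closed_atLeastAtMost mem lim])
  qed
  moreover have "0 < 1 / real (Suc k)" by simp
  ultimately show "f s \<in> {Lo<..<Hi}" by (smt (verit) atLeastAtMost_iff greaterThanLessThan_iff)
 qed
qed

context usual_filtration
begin

lemma pre_sigma_restrict:
 assumes S: "stopping_time F S" and f: "f \<in> borel_measurable (pre_sigma S)"
 shows "(%w. if S w <= s then f w else (0::real)) \<in> borel_measurable (F s)"
proof (rule borel_measurableI_le)
 fix c
 have "{w \<in> space (pre_sigma S). f w <= c} \<in> sets (pre_sigma S)" using f by measurable
 from sets_pre_sigmaD[OF S this, of s] have 1: "{w \<in> {w \<in> space P. f w <= c}. S w <= s} \<in> sets (F s)" by (simp add: space_pre_sigma)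
 have 2: "{w \<in> space P. S w <= s} \<in> sets (F s)" using stopping_timeD[OF S, of s] by (simp add: pred_def space_F)
 have "{w \<in> space (F s). (if S w <= s then f w else 0) <= c} = {w \<in> {w \<in> space P. f w <= c}. S w <= s} \<union> (if 0 <= c then space (F s) - {w \<in> space P. S w <= s} else {})"
  by (auto simp: space_F)
 also have "... \<in> sets (F s)" using 1 2 by auto
 finally show "{w \<in> space (F s). (if S w <= s then f w else 0) <= c} \<in> sets (F s)" .
qed

end

section \<open>Expected duration, absorption, and exit from random intervals\<close>

locale weak_sol_nz = weak_sol P F W M \<eta> m l r for P :: "'a measure" and F W M \<eta> m l r +
 assumes eta_nz: "!!x. x \<in> {l<..<r} ==> \<eta> x ~= 0"
begin

text \<open>With \<open>g = qdens \<eta>\<close> the product with \<open>\<eta>^2\<close> is 2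
  wherever \<open>M\<close> is inside the open interval, so the occupation integral is twice the
  elapsed time; the factor 2 on the other side of \<open>occupation_between\<close> cancels it.
  Leaving the interval at the single time \<open>T w\<close> does not matter. The event
  \<open>B\<close> enters by patching \<open>T\<close>.\<close>

lemma duration:
 assumes S: "stopping_time F S" and T: "stopping_time F T"
  and S0: "!!w. w \<in> space P ==> 0 <= S w" and ST: "!!w. w \<in> space P ==> S w <= T w"
  and B: "B \<in> sets (pre_sigma S)"
  and inside: "AE w in P. w \<in> B --> (ALL v. S w < v & v < T w --> M v w \<in> {l<..<r})"
 shows "(\<integral>\<^sup>+w. ind B w * ennreal (T w - S w) \<partial>P) = (\<integral>\<^sup>+w. ind B w * q \<eta> (M (S w) w) (M (T w) w) \<partial>P)"
proof -
 let ?T = "%w. if w \<in> B then T w else S w"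
 have TB: "stopping_time F ?T" by (rule stopping_time_patch[OF S T ST B])
 have STB: "S w <= ?T w" if "w \<in> space P" for w using ST[OF that] by simp
 have [measurable]: "B \<in> sets P" by (rule pre_sigma_sets_P[OF S B])
 note [measurable] = sets_F_measurable_stopping[OF S] sets_F_measurable_stopping[OF T]
 have [measurable]: "(%w. M (S w) w) \<in> borel_measurable P" "(%w. M (?T w) w) \<in> borel_measurable P"
  using S0 STB by (auto intro!: M_at_measurable sets_F_measurable_stopping[OF TB] sets_F_measurable_stopping[OF S] intro: order_trans)
 have eq: "AE w in P. (\<integral>\<^sup>+v. ennreal (ind {S w<..?T w} v * (Eta v w)^2) * qdens \<eta> (M v w) \<partial>lborel) = 2 * (ind B w * ennreal (T w - S w))"
  using inside AE_space
 proof eventually_elim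
  case (elim w)
  show ?case
  proof (cases "w \<in> B")
   case True
   have "(\<integral>\<^sup>+v. ennreal (ind {S w<..?T w} v * (Eta v w)^2) * qdens \<eta> (M v w) \<partial>lborel) = (\<integral>\<^sup>+v. 2 * ind {S w<..T w} v \<partial>lborel)"
   proof (rule nn_integral_cong_AE)
    show "AE v in lborel. ennreal (ind {S w<..?T w} v * (Eta v w)^2) * qdens \<eta> (M v w) = 2 * ind {S w<..T w} v"
     using AE_lborel_singleton[of "T w"]
    proof eventually_elim
     case (elim v)
     show ?case
     proof (cases "v \<in> {S w<..T w}")
      case in_: True
      hence "M v w \<in> {l<..<r}" using \<open>w \<in> B --> _\<close> True elim by auto
      hence nz: "\<eta> (M v w) ~= 0" by (rule eta_nz)
      hence "ennreal ((Eta v w)^2) * qdens \<eta> (M v w) = ennreal ((Eta v w)^2 * (2 / (Eta v w)^2))"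
       by (simp add: qdens_def ennreal_mult[symmetric])
      also have "... = 2" using nz by simp
      finally show ?thesis using in_ True by simp
     qed (use True in simp)
    qed
   qed
   also have "... = 2 * ennreal (T w - S w)" using ST[OF elim(2)] by (simp add: nn_integral_cmult)
   finally show ?thesis using True by simp
  qed simp
 qed
 have "2 * (\<integral>\<^sup>+w. ind B w * ennreal (T w - S w) \<partial>P) = (\<integral>\<^sup>+w. 2 * (ind B w * ennreal (T w - S w)) \<partial>P)"
  by (rule nn_integral_cmult[symmetric]) measurable
 also have "... = (\<integral>\<^sup>+w. \<integral>\<^sup>+v. ennreal (ind {S w<..?T w} v * (Eta v w)^2) * qdens \<eta> (M v w) \<partial>lborel \<partial>P)"
  by (rule nn_integral_cong_AE) (use eq in \<open>eventually_elim, simp\<close>)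
 also have "... = 2 * (\<integral>\<^sup>+w. double_integral (qdens \<eta>) (M (S w) w) (M (?T w) w) \<partial>P)"
  by (rule occupation_between[OF S TB S0 STB qdens_measurable[OF eta_borel]])
 also have "(\<integral>\<^sup>+w. double_integral (qdens \<eta>) (M (S w) w) (M (?T w) w) \<partial>P) = (\<integral>\<^sup>+w. ind B w * q \<eta> (M (S w) w) (M (T w) w) \<partial>P)"
  by (intro nn_integral_cong) (auto simp: q_eq_double_integral q_same split: split_indicator)
 finally show ?thesis by (simp add: ennreal_mult_cancel_left)
qed

text \<open>From an endpoint of \<open>[l, r]\<close> the increment of \<open>M\<close> has a fixed
  sign because of the range, and its mean over the event of starting there is zero; hence it
  vanishes.\<close>

lemma absorption:
 assumes S: "stopping_time F S" and T: "stopping_time F T"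
  and S0: "!!w. w \<in> space P ==> 0 <= S w" and ST: "!!w. w \<in> space P ==> S w <= T w"
 shows "AE w in P. M (S w) w ~: {l<..<r} --> M (T w) w = M (S w) w"
proof -
 note T0 = T0[OF S T S0 ST] and Sm = Sm[OF S T S0 ST] and Tm = Tm[OF S T S0 ST]
 have rng: "AE w in P. M (S w) w \<in> {l..r}" "AE w in P. M (T w) w \<in> {l..r}"
  by (rule M_at_range[OF S0], assumption) (rule M_at_range[OF T0], assumption)
 note [measurable] = M_at_pre_sigma[OF S S0]
 have main: "AE w in P. w \<in> B --> M (T w) w = M (S w) w"
  if B: "B \<in> sets (pre_sigma S)" and sg: "AE w in P. 0 <= ind B w * (c * (M (T w) w - M (S w) w))" and c: "c ~= 0" for B and c :: real
 proof -
  have BP: "B \<in> sets P" by (rule pre_sigma_sets_P[OF S B])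
  have "integrable P (%w. M (T w) w - M (S w) w)"
   using M_at_integrable(1)[OF Tm T0] M_at_integrable(1)[OF Sm S0] by simp
  from integrable_mult_indicator[OF BP this]
  have i: "integrable P (%w. ind B w * (M (T w) w - M (S w) w))" by simp
  have "expectation (%w. c * (ind B w * (M (T w) w - M (S w) w))) = 0"
   using M_increment_on[OF S T S0 ST B] by simp
  hence "expectation (%w. ind B w * (c * (M (T w) w - M (S w) w))) = 0" by (simp add: mult.left_commute)
  moreover have "integrable P (%w. ind B w * (c * (M (T w) w - M (S w) w)))"
   using integrable_mult_right[OF i, of c] by (simp add: mult.left_commute)
  ultimately have "AE w in P. ind B w * (c * (M (T w) w - M (S w) w)) = 0"
   using sg by (subst (asm) integral_nonneg_eq_0_iff_AE) auto
  thus ?thesis by eventually_elim (use c in \<open>auto split: split_indicator_asm\<close>)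
 qed
 have B1: "{w \<in> space (pre_sigma S). M (S w) w <= l} \<in> sets (pre_sigma S)"
  and B2: "{w \<in> space (pre_sigma S). r <= M (S w) w} \<in> sets (pre_sigma S)" by measurable
 have "AE w in P. w \<in> {w \<in> space (pre_sigma S). M (S w) w <= l} --> M (T w) w = M (S w) w"
 proof (rule main[of _ 1, OF B1])
  show "AE w in P. 0 <= ind {w \<in> space (pre_sigma S). M (S w) w <= l} w * (1 * (M (T w) w - M (S w) w))"
   using rng by eventually_elim (auto split: split_indicator)
 qed simp
 moreover have "AE w in P. w \<in> {w \<in> space (pre_sigma S). r <= M (S w) w} --> M (T w) w = M (S w) w"
 proof (rule main[of _ "-1", OF B2])
  show "AE w in P. 0 <= ind {w \<in> space (pre_sigma S). r <= M (S w) w} w * (- 1 * (M (T w) w - M (S w) w))"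
   using rng by eventually_elim (auto split: split_indicator)
 qed simp
 ultimately show ?thesis
  using AE_space by eventually_elim (auto simp: space_pre_sigma)
qed

context
 fixes S Lo Hi :: "'a => real"
 assumes S: "stopping_time F S" and S0: "!!w. w \<in> space P ==> 0 <= S w"
  and Lo: "Lo \<in> borel_measurable (pre_sigma S)" and Hi: "Hi \<in> borel_measurable (pre_sigma S)"
begin

definition exits_by :: "real => 'a => bool" where
 "exits_by t w \<longleftrightarrow> (EX s. S w <= s & s <= t & M s w ~: {Lo w<..<Hi w})"

text \<open>The borders may depend on the past of \<open>S\<close>. An empty interval is allowed and
  gives the exit time \<open>S w\<close>; the embedding uses this to let a cell rest. When the path
  never leaves, the infimum is a meaningless default.\<close>

definition exit_time :: "'a => real" where
 "exit_time w = Inf {s. S w <= s & M s w ~: {Lo w<..<Hi w}}"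

lemma exits_by_measurable:
 assumes t: "0 <= t"
 shows "{w \<in> space P. S w <= t & exits_by t w} \<in> sets (F t)"
proof -
 let ?R = "insert t (\<rat> \<inter> {0..t})"
 have cR: "countable ?R" by (simp add: countable_rat)
 let ?in = "%k s w. S w <= s --> Lo w + 1 / real (Suc k) <= M s w & M s w <= Hi w - 1 / real (Suc k)"
 have m: "Measurable.pred (F t) (?in k s)" if s: "s \<in> ?R" for k s
 proof -
  have st: "0 <= s" "s <= t" using s t by auto
  have [measurable]: "Measurable.pred (F t) (%w. S w <= s)" by (rule stopping_time_le_const[OF S st(2)])
  have [measurable]: "(%w. if S w <= s then Lo w else 0) \<in> borel_measurable (F t)" "(%w. if S w <= s then Hi w else 0) \<in> borel_measurable (F t)" "M s \<in> borel_measurable (F t)"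
   using measurable_F_mono[OF pre_sigma_restrict[OF S Lo] st(2)] measurable_F_mono[OF pre_sigma_restrict[OF S Hi] st(2)] measurable_F_mono[OF M_adapted[OF st(1)] st(2)] by auto
  have "Measurable.pred (F t) (%w. S w <= s --> (if S w <= s then Lo w else 0) + 1 / real (Suc k) <= M s w & M s w <= (if S w <= s then Hi w else 0) - 1 / real (Suc k))"
   by measurable
  also have "?this \<longleftrightarrow> ?thesis" by (intro measurable_cong) auto
  finally show ?thesis .
 qed
 have "Measurable.pred (F t) (%w. \<forall>s\<in>?R. ?in k s w)" for k
  by (rule measurable_pred_countable(1)[OF cR m])
 hence "Measurable.pred (F t) (%w. S w <= t & ~ (EX k. \<forall>s\<in>?R. ?in k s w))"
  by (intro pred_intros_logic pred_intros_countable stopping_timeD[OF S])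
 hence "{w \<in> space P. S w <= t & ~ (EX k. \<forall>s\<in>?R. ?in k s w)} \<in> sets (F t)" by (simp add: pred_def space_F)
 also have "{w \<in> space P. S w <= t & ~ (EX k. \<forall>s\<in>?R. ?in k s w)} = {w \<in> space P. S w <= t & exits_by t w}"
 proof (intro Collect_cong conj_cong refl)
  fix w assume w: "w \<in> space P" "S w <= t"
  thus "(~ (EX k. \<forall>s\<in>?R. ?in k s w)) = exits_by t w"
   using path_inside_iff_rational[OF M_path[OF w(1)] S0[OF w(1)] w(2), of "Lo w" "Hi w"] unfolding exits_by_def by (metis atLeastAtMost_iff)
 qed
 finally show ?thesis .
qed

lemma exit_time:
 assumes w: "w \<in> space P" and ex: "exits_by t w"
 shows "S w <= exit_time w" "exit_time w <= t" "M (exit_time w) w ~: {Lo w<..<Hi w}"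
  "!!s. S w <= s ==> s < exit_time w ==> M s w \<in> {Lo w<..<Hi w}"
  "M (S w) w \<in> {Lo w<..<Hi w} ==> M (exit_time w) w \<in> {Lo w, Hi w}"
  "M (S w) w ~: {Lo w<..<Hi w} ==> exit_time w = S w"
proof -
 let ?E = "{s. S w <= s & M s w ~: {Lo w<..<Hi w}}"
 have c: "continuous_on {S w..} (%s. M s w)" by (rule continuous_on_subset[OF M_path[OF w]]) (use S0[OF w] in auto)
 have "closed ({S w..} \<inter> (%s. M s w) -` (- {Lo w<..<Hi w}))"
  by (intro continuous_closed_preimage c) auto
 also have "{S w..} \<inter> (%s. M s w) -` (- {Lo w<..<Hi w}) = ?E" by auto
 finally have cl: "closed ?E" .
 have ne: "?E ~= {}" using ex by (auto simp: exits_by_def)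
 have bb: "bdd_below ?E" by (intro bdd_belowI[of _ "S w"]) auto
 have inE: "exit_time w \<in> ?E" unfolding exit_time_def by (rule closed_contains_Inf[OF ne bb cl])
 thus 1: "S w <= exit_time w" and 3: "M (exit_time w) w ~: {Lo w<..<Hi w}" by auto
 obtain s where s: "s \<in> ?E" "s <= t" using ex by (auto simp: exits_by_def)
 have low: "exit_time w <= s" if "s \<in> ?E" for s unfolding exit_time_def by (rule cInf_lower[OF that bb])
 show "exit_time w <= t" using low[OF s(1)] s(2) by simp
 show 4: "M s w \<in> {Lo w<..<Hi w}" if "S w <= s" "s < exit_time w" for s
  using low[of s] that by auto
 show "exit_time w = S w" if "M (S w) w ~: {Lo w<..<Hi w}"
  using low[of "S w"] that 1 by auto
 show "M (exit_time w) w \<in> {Lo w, Hi w}" if "M (S w) w \<in> {Lo w<..<Hi w}"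
 proof -
  have lt: "S w < exit_time w" using 1 3 that by (cases "S w = exit_time w") auto
  have "M (exit_time w) w \<in> {Lo w..Hi w}"
  proof (rule closed_sequentially[OF closed_atLeastAtMost])
   let ?x = "%n. exit_time w - (exit_time w - S w) / real (Suc n)"
   have x: "S w <= ?x n" "?x n < exit_time w" for n
   proof -
    have "(exit_time w - S w) / real (Suc n) <= (exit_time w - S w) / 1"
     by (rule divide_left_mono) (use lt in auto)
    thus "S w <= ?x n" by simp
    show "?x n < exit_time w" using lt by simp
   qed
   show "M (?x n) w \<in> {Lo w..Hi w}" for n using 4[OF x(1)[of n] x(2)[of n]] by (meson atLeastAtMost_iff greaterThanLessThan_iff less_imp_le)
   have "(%n. exit_time w - (exit_time w - S w) * (1 / real (Suc n))) \<longlonglongrightarrow> exit_time w - (exit_time w - S w) * 0"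
    by (intro tendsto_intros LIMSEQ_Suc[OF lim_1_over_n])
   thus "(%n. M (?x n) w) \<longlonglongrightarrow> M (exit_time w) w"
    by (intro continuous_on_tendsto_compose[OF c]) (use x(1) 1 in auto)
  qed
  with 3 show ?thesis by auto
 qed
qed

text \<open>A real-valued stopping time available before it is known that the exit takes place, so
  that \<open>duration\<close> can be used to prove exactly that.\<close>

definition capped_exit :: "nat => 'a => real" where
 "capped_exit n w = (if exits_by (S w + real n) w then exit_time w else S w + real n)"

lemma capped_exit:
 assumes w: "w \<in> space P"
 shows "S w <= capped_exit n w" "capped_exit n w <= S w + real n"
  "!!s. S w <= s ==> s < capped_exit n w ==> M s w \<in> {Lo w<..<Hi w}"
  "M (S w) w \<in> {Lo w<..<Hi w} ==> M (capped_exit n w) w \<in> {Lo w..Hi w}"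
proof -
 show "S w <= capped_exit n w" "capped_exit n w <= S w + real n"
  using exit_time(1,2)[OF w, of "S w + real n"] by (auto simp: capped_exit_def)
 show "M s w \<in> {Lo w<..<Hi w}" if "S w <= s" "s < capped_exit n w" for s
  using exit_time(4)[OF w, of "S w + real n" s] that by (auto simp: capped_exit_def exits_by_def split: if_splits)
 show "M (capped_exit n w) w \<in> {Lo w..Hi w}" if in_: "M (S w) w \<in> {Lo w<..<Hi w}"
 proof (cases "exits_by (S w + real n) w")
  case True
  thus ?thesis using exit_time(5)[OF w True in_] in_ by (auto simp: capped_exit_def)
 next
  case False
  hence "M (S w + real n) w \<in> {Lo w<..<Hi w}"
   unfolding exits_by_def by (metis add_increasing2 of_nat_0_le_iff order_refl)
  thus ?thesis using False by (auto simp: capped_exit_def)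
 qed
qed

lemma capped_exit_stopping: "stopping_time F (capped_exit n)"
proof
 fix t
 show "Measurable.pred (F t) (%w. capped_exit n w <= t)"
 proof (cases "0 <= t")
  case False
  have "{w \<in> space P. capped_exit n w <= t} = {}"
  proof -
   have "~ capped_exit n w <= t" if "w \<in> space P" for w using capped_exit(1)[OF that, of n] S0[OF that] False by linarith
   thus ?thesis by blast
  qed
  thus ?thesis by (simp only: pred_def space_F sets.empty_sets)
 next
  case True
  have iff: "capped_exit n w <= t \<longleftrightarrow> (S w <= t & exits_by t w) | S w <= t - real n" if w: "w \<in> space P" for w
  proof
   assume le: "capped_exit n w <= t"
   have St: "S w <= t" using capped_exit(1)[OF w, of n] le by simp
   show "(S w <= t & exits_by t w) | S w <= t - real n"
   proof (cases "exits_by (S w + real n) w")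
    case True
    hence "exits_by t w"
     using exit_time(1,3)[OF w True] le unfolding exits_by_def by (auto simp: capped_exit_def exits_by_def)
    thus ?thesis using St by simp
   qed (use le in \<open>simp add: capped_exit_def\<close>)
  next
   assume "(S w <= t & exits_by t w) | S w <= t - real n"
   thus "capped_exit n w <= t"
   proof
    assume a: "S w <= t & exits_by t w"
    show ?thesis
    proof (cases "exits_by (S w + real n) w")
     case True
     thus ?thesis using exit_time(2)[OF w, of t] a by (simp add: capped_exit_def)
    next
     case False
     have "~ t <= S w + real n" using False a unfolding exits_by_def by (meson order_trans)
     thus ?thesis using False by (simp add: capped_exit_def)
    qed
   next
    assume "S w <= t - real n"
    thus ?thesis using capped_exit(2)[OF w, of n] by linarith
   qed
  qed
  have "{w \<in> space P. capped_exit n w <= t} = {w \<in> space P. S w <= t & exits_by t w} \<union> {w \<in> space P. S w <= t - real n}"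
   using iff by blast
  also have "... \<in> sets (F t)"
   using exits_by_measurable[OF True] stopping_time_le_const[OF S, of "t - real n" t] by (auto simp: pred_def space_F)
  finally show ?thesis by (simp add: pred_def space_F)
 qed
qed

text \<open>On \<open>Bj j\<close> the value of \<open>q\<close> from the start to either border is
  at most \<open>j\<close>, and \<open>q\<close> grows away from its first argument, so the capped
  exit takes at most \<open>j\<close> in mean there. Paths that never exit take \<open>n\<close> for
  every cap \<open>n\<close>; thus \<open>n * prob (Cj j) <= j\<close> for all
  \<open>n\<close>.\<close>

lemma exits_AE:
 assumes ok: "AE w in P. M (S w) w \<in> {Lo w<..<Hi w} --> l <= Lo w & Hi w <= r & q \<eta> (M (S w) w) (Lo w) < \<infinity> & q \<eta> (M (S w) w) (Hi w) < \<infinity>"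
 shows "AE w in P. EX t. exits_by t w"
proof -
 note [measurable] = M_at_pre_sigma[OF S S0] Lo Hi
 note [measurable] = q_measurable[OF eta_borel M_at_pre_sigma[OF S S0] Lo] q_measurable[OF eta_borel M_at_pre_sigma[OF S S0] Hi]
 note Sm[measurable] = sets_F_measurable_stopping[OF S]
 note Em[measurable] = sets_F_measurable_stopping[OF capped_exit_stopping]
 define Bj where "Bj j = {w \<in> space (pre_sigma S). Lo w < M (S w) w & M (S w) w < Hi w & l <= Lo w & Hi w <= r & q \<eta> (M (S w) w) (Lo w) <= ennreal (real j) & q \<eta> (M (S w) w) (Hi w) <= ennreal (real j)}" for j
 have B: "Bj j \<in> sets (pre_sigma S)" for j unfolding Bj_def by measurable
 have BP[measurable]: "Bj j \<in> sets P" for j by (rule pre_sigma_sets_P[OF S B])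
 define Cj where "Cj j = {w \<in> space P. w \<in> Bj j & (ALL n. capped_exit n w - S w = real n)}" for j
 have Cm[measurable]: "Cj j \<in> sets P" for j unfolding Cj_def by measurable
 have null: "Cj j \<in> null_sets P" for j
 proof -
  have "ennreal (real n) * emeasure P (Cj j) <= ennreal (real j)" for n
  proof -
   have "ennreal (real n) * emeasure P (Cj j) = (\<integral>\<^sup>+w. ennreal (real n) * ind (Cj j) w \<partial>P)" by (simp add: nn_integral_cmult_indicator)
   also have "... <= (\<integral>\<^sup>+w. ind (Bj j) w * ennreal (capped_exit n w - S w) \<partial>P)"
    by (intro nn_integral_mono) (auto simp: Cj_def split: split_indicator)
   also have "... = (\<integral>\<^sup>+w. ind (Bj j) w * q \<eta> (M (S w) w) (M (capped_exit n w) w) \<partial>P)"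
   proof (rule duration[OF S capped_exit_stopping S0 capped_exit(1) B])
    show "AE w in P. w \<in> Bj j --> (ALL v. S w < v & v < capped_exit n w --> M v w \<in> {l<..<r})"
    proof (intro AE_I2 impI allI)
     fix w v assume w: "w \<in> space P" "w \<in> Bj j" "S w < v & v < capped_exit n w"
     hence "M v w \<in> {Lo w<..<Hi w}" using capped_exit(3)[OF w(1), of v n] by simp
     thus "M v w \<in> {l<..<r}" using w(2) by (auto simp: Bj_def)
    qed
   qed
   also have "... <= (\<integral>\<^sup>+w. ennreal (real j) \<partial>P)"
   proof (rule nn_integral_mono)
    fix w assume w: "w \<in> space P"
    show "ind (Bj j) w * q \<eta> (M (S w) w) (M (capped_exit n w) w) <= ennreal (real j)"
    proof (cases "w \<in> Bj j")
     case True
     hence b: "Lo w < M (S w) w" "M (S w) w < Hi w" "q \<eta> (M (S w) w) (Lo w) <= ennreal (real j)" "q \<eta> (M (S w) w) (Hi w) <= ennreal (real j)" by (auto simp: Bj_def)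
     have r: "M (capped_exit n w) w \<in> {Lo w..Hi w}" by (rule capped_exit(4)[OF w]) (use b in simp)
     have "q \<eta> (M (S w) w) (M (capped_exit n w) w) <= ennreal (real j)"
     proof (cases "M (capped_exit n w) w <= M (S w) w")
      case True
      thus ?thesis using r by (intro order_trans[OF q_mono[OF eta_borel, of _ _ "Lo w"] b(3)]) auto
     next
      case False
      thus ?thesis using r by (intro order_trans[OF q_mono[OF eta_borel, of _ _ "Hi w"] b(4)]) auto
     qed
     thus ?thesis using True by simp
    qed simp
   qed
   also have "... = ennreal (real j)" by (simp add: emeasure_space_1)
   finally show ?thesis .
  qed
  hence "real n * prob (Cj j) <= real j" for n
   by (simp add: emeasure_eq_measure ennreal_mult[symmetric] del: ennreal_of_nat_eq_real_of_nat)
  hence "prob (Cj j) = 0"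
   by (metis (no_types) ex_less_of_nat_mult measure_nonneg not_less order_le_less)
  thus ?thesis by (simp add: null_sets_def emeasure_eq_measure)
 qed
 have "AE w in P. ALL j. w ~: Cj j" by (subst AE_all_countable) (intro allI AE_not_in null)
 thus ?thesis using ok AE_space
 proof eventually_elim
  case (elim w)
  show ?case
  proof (cases "M (S w) w \<in> {Lo w<..<Hi w}")
   case False
   hence "exits_by (S w) w" unfolding exits_by_def by auto
   thus ?thesis ..
  next
   case True
   hence qf: "l <= Lo w" "Hi w <= r" "q \<eta> (M (S w) w) (Lo w) < \<infinity>" "q \<eta> (M (S w) w) (Hi w) < \<infinity>" using elim(2) by auto
   obtain a b where ab: "q \<eta> (M (S w) w) (Lo w) = ennreal a" "q \<eta> (M (S w) w) (Hi w) = ennreal b" "0 <= a" "0 <= b"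
    using qf(3,4) by (cases "q \<eta> (M (S w) w) (Lo w)"; cases "q \<eta> (M (S w) w) (Hi w)") auto
   obtain j :: nat where "max a b <= real j" using real_arch_simple by blast
   hence "w \<in> Bj j" using True elim(3) qf ab by (auto simp: Bj_def space_pre_sigma intro!: ennreal_leI simp del: ennreal_of_nat_eq_real_of_nat)
   then obtain n where "capped_exit n w - S w ~= real n" using elim(1,3) by (auto simp: Cj_def)
   hence "exits_by (S w + real n) w" by (auto simp: capped_exit_def split: if_splits)
   thus ?thesis ..
  qed
 qed
qed

text \<open>On the null set of paths that never exit the time is set to \<open>S\<close>; since null
  sets belong to \<open>F 0\<close>, this does not spoil the stopping property.\<close>

theorem exit_stopping_time:
 assumes ok: "AE w in P. M (S w) w \<in> {Lo w<..<Hi w} --> l <= Lo w & Hi w <= r & q \<eta> (M (S w) w) (Lo w) < \<infinity> & q \<eta> (M (S w) w) (Hi w) < \<infinity>"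
 shows "EX T. stopping_time F T & (\<forall>w\<in>space P. S w <= T w) &
  (AE w in P. (M (S w) w \<in> {Lo w<..<Hi w} --> M (T w) w \<in> {Lo w, Hi w}) &
    (M (S w) w ~: {Lo w<..<Hi w} --> T w = S w) &
    (ALL v. S w <= v & v < T w --> M v w \<in> {Lo w<..<Hi w}))"
proof -
 define T where "T w = (if EX t. exits_by t w then exit_time w else S w)" for w
 obtain N where N: "N \<in> null_sets P" "{w \<in> space P. ~ (EX t. exits_by t w)} \<subseteq> N"
  using AE_E[OF exits_AE[OF ok]] by (metis (mono_tags, lifting) null_setsI)
 have ST: "S w <= T w" if "w \<in> space P" for w
  using exit_time(1)[OF that] by (auto simp: T_def)
 have stop: "stopping_time F T"
 proof
  fix t
  show "Measurable.pred (F t) (%w. T w <= t)"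
  proof (cases "0 <= t")
   case False
   have "{w \<in> space P. T w <= t} = {}"
   proof -
    have "~ T w <= t" if "w \<in> space P" for w using ST[OF that] S0[OF that] False by linarith
    thus ?thesis by blast
   qed
   thus ?thesis by (simp only: pred_def space_F sets.empty_sets)
  next
   case True
   have iff: "T w <= t \<longleftrightarrow> (S w <= t & exits_by t w) | (S w <= t & ~ (EX t. exits_by t w))" if w: "w \<in> space P" for w
   proof (cases "EX t. exits_by t w")
    case True
    then obtain t' where t': "exits_by t' w" by blast
    have "exit_time w <= t \<longleftrightarrow> S w <= t & exits_by t w"
     using exit_time(1,3)[OF w t'] exit_time(2)[OF w, of t] unfolding exits_by_def by (meson order_trans)
    thus ?thesis using True by (simp add: T_def)
   qed (auto simp: T_def)
   have "{w \<in> space P. T w <= t} = {w \<in> space P. S w <= t & exits_by t w} \<union> {w \<in> space P. S w <= t & ~ (EX t. exits_by t w)}"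
    using iff by blast
   also have "... \<in> sets (F t)"
   proof (rule sets.Un[OF exits_by_measurable[OF True] null_in_F[OF N(1) _ True]])
    show "{w \<in> space P. S w <= t & ~ (EX t. exits_by t w)} \<subseteq> N" using N(2) by (rule order_trans[rotated]) auto
   qed
   finally show ?thesis by (simp add: pred_def space_F)
  qed
 qed
 have ae: "AE w in P. (M (S w) w \<in> {Lo w<..<Hi w} --> M (T w) w \<in> {Lo w, Hi w}) &
    (M (S w) w ~: {Lo w<..<Hi w} --> T w = S w) &
    (ALL v. S w <= v & v < T w --> M v w \<in> {Lo w<..<Hi w})"
  using exits_AE[OF ok] AE_space
 proof eventually_elim
  case (elim w)
  then obtain t where t: "exits_by t w" by blast
  have "T w = exit_time w" using elim by (simp add: T_def)
  show ?case unfolding \<open>T w = exit_time w\<close>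
  proof (intro conjI impI allI)
   show "M v w \<in> {Lo w<..<Hi w}" if "S w <= v & v < exit_time w" for v
    using exit_time(4)[OF elim(2) t] that by simp
  qed (erule exit_time(5,6)[OF elim(2) t])+
 qed
 have "\<forall>w\<in>space P. S w <= T w" using ST ..
 note all = conjI[OF stop conjI[OF this ae]]
 show ?thesis by (rule exI[of _ T]) (rule all)
qed

end

end

section \<open>Refining cells of a centred law\<close>

definition cut :: "nat => real" where "cut = from_nat_into \<rat>"

text \<open>The level-\<open>n\<close> partition is encoded as a function of a point, so constancy
  on cells is a statement about pairs of points and no list of intervals is needed. A cut point
  belongs to the part on its left.\<close>

definition cell :: "nat => real => real set" where
 "cell n x = {y. \<forall>i<n. (y <= cut i) = (x <= cut i)}"

lemma cell_self: "x \<in> cell n x"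
 by (simp add: cell_def)

lemma cell_eq: "y \<in> cell n x ==> cell n y = cell n x"
 by (auto simp: cell_def)

lemma cell_0: "cell 0 x = UNIV"
 by (simp add: cell_def)

lemma cell_Suc: "cell (Suc n) x = cell n x \<inter> (if x <= cut n then {..cut n} else {cut n<..})"
 by (auto simp: cell_def less_Suc_eq)

lemma cell_sets[measurable]: "cell n x \<in> sets borel"
 by (induction n) (auto simp: cell_0 cell_Suc)

lemma finite_cells: "finite (range (cell n))"
proof (induction n)
 case 0
 show ?case by (simp add: cell_0[abs_def])
next
 case (Suc n)
 have "range (cell (Suc n)) \<subseteq> (%(C, D). C \<inter> D) ` (range (cell n) \<times> {{..cut n}, {cut n<..}})"
 proof (rule image_subsetI)
  fix x show "cell (Suc n) x \<in> (%(C, D). C \<inter> D) ` (range (cell n) \<times> {{..cut n}, {cut n<..}})"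
   by (rule image_eqI[of _ _ "(cell n x, if x <= cut n then {..cut n} else {cut n<..})"]) (simp_all add: cell_Suc)
 qed
 moreover have "finite (range (cell n) \<times> {{..cut n}, {cut n<..}})" using Suc by simp
 ultimately show ?case by (meson finite_imageI finite_subset)
qed

lemma cell_sum: "(f x :: real) = (\<Sum>C\<in>range (cell n). ind C x * f x)"
proof -
 have "(\<Sum>C\<in>range (cell n). ind C x * f x) = (\<Sum>C\<in>range (cell n). if C = cell n x then f x else 0)"
 proof (intro sum.cong refl)
  fix C assume "C \<in> range (cell n)"
  then obtain x0 where C: "C = cell n x0" by blast
  show "ind C x * f x = (if C = cell n x then f x else 0)"
  proof (cases "x \<in> C")
   case True
   thus ?thesis using cell_eq[of x n x0] by (simp add: C)
  next
   case False
   hence "C ~= cell n x" using cell_self[of x n] by blast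
   thus ?thesis using False by simp
  qed
 qed
 also have "... = f x" using finite_cells[of n] by simp
 finally show ?thesis ..
qed

lemma cell_fun_measurable:
 fixes \<psi> :: "real => real"
 assumes "!!x y. y \<in> cell n x ==> \<psi> y = \<psi> x"
 shows "\<psi> \<in> borel_measurable borel"
proof -
 have "(%x. \<Sum>C\<in>range (cell n). ind C x * \<psi> x) \<in> borel_measurable borel"
 proof (intro borel_measurable_sum)
  fix C assume "C \<in> range (cell n)"
  then obtain x0 where C: "C = cell n x0" by blast
  have "(%x. ind C x * \<psi> x) = (%x. ind C x * \<psi> x0)"
   using assms by (auto simp: C split: split_indicator)
  also have "... \<in> borel_measurable borel" unfolding C by measurable
  finally show "(%x. ind C x * \<psi> x) \<in> borel_measurable borel" .
 qed
 thus ?thesis using cell_sum[of \<psi> _ n] by simp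
qed

text \<open>The mean of \<open>f\<close> at the exit from the interval between \<open>a\<close> and
  \<open>b\<close> for a martingale started at \<open>z\<close>; outside the interval there is no
  motion and the value is \<open>f z\<close>.\<close>

definition interp :: "(real => real) => real => real => real => real" where
 "interp f a b z = (if a < z & z < b then ((b - z) * f a + (z - a) * f b) / (b - a) else f z)"

definition slope :: "(real => real) => real => real => real" where
 "slope f a b = (f b - f a) / (b - a)"

text \<open>On two points every function is affine. The slope term is a coefficient known before the
  move times a martingale increment, so it disappears in expectation, for \<open>M\<close> as well
  as for the conditional means of \<open>\<mu>\<close>.\<close>

lemma interp_two_point:
 assumes "a < z & z < b --> wt \<in> {a, b}" "~ (a < z & z < b) --> wt = z"
 shows "f wt = interp f a b z + slope f a b * (wt - z)"
proof (cases "a < z & z < b")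
 case True
 hence "interp f a b z + slope f a b * (wt - z) = ((b - z) * f a + (z - a) * f b + (f b - f a) * (wt - z)) / (b - a)"
  by (simp add: interp_def slope_def add_divide_distrib)
 also have "... = ((b - wt) * f a + (wt - a) * f b) / (b - a)" by (simp add: algebra_simps)
 also have "... = f wt" using True assms by auto
 finally show ?thesis ..
qed (use assms in \<open>auto simp: interp_def\<close>)

lemma interp_bound:
 assumes "!!x. \<bar>f x\<bar> <= K"
 shows "\<bar>interp f a b z\<bar> <= K"
proof (cases "a < z & z < b")
 case True
 have "\<bar>(b - z) * f a + (z - a) * f b\<bar> <= (b - z) * K + (z - a) * K"
  using True assms[of a] assms[of b] by (intro order_trans[OF abs_triangle_ineq] add_mono) (auto simp: abs_mult intro!: mult_left_mono)
 also have "... = K * (b - a)" by (simp add: algebra_simps)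
 finally show ?thesis using True by (simp add: interp_def abs_mult divide_le_eq)
next
 case False
 show ?thesis unfolding interp_def if_not_P[OF False] by (rule assms)
qed

locale bounded_centred = prob_space \<mu> for \<mu> :: "real measure" +
 fixes c d :: real
 assumes mu_sets[measurable_cong]: "sets \<mu> = sets borel" and mu_supp: "AE x in \<mu>. x \<in> {c..d}" and mu_mean: "(\<integral>x. x \<partial>\<mu>) = 0"
begin

definition bary :: "real set => real" where
 "bary A = (\<integral>x. ind A x * x \<partial>\<mu>) / prob A"

text \<open>The conditional expectation of the identity under \<open>\<mu>\<close> given the
  level-\<open>n\<close> partition. These form a martingale converging to the identity, and its
  transitions are the ones copied by exit times of \<open>M\<close>.\<close>

definition bc :: "nat => real => real" where "bc n x = bary (cell n x)"

definition splits :: "nat => real => bool" where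
 "splits n z \<longleftrightarrow> 0 < prob (cell n z \<inter> {..cut n}) & 0 < prob (cell n z \<inter> {cut n<..})"

definition lowr :: "nat => real => real" where
 "lowr n z = (if splits n z then bary (cell n z \<inter> {..cut n}) else z)"

definition uppr :: "nat => real => real" where
 "uppr n z = (if splits n z then bary (cell n z \<inter> {cut n<..}) else z)"

lemma integrable_id: "integrable \<mu> (%x. x)"
proof (rule integrable_const_bound[where B="max \<bar>c\<bar> \<bar>d\<bar>"])
 show "AE x in \<mu>. norm x <= max \<bar>c\<bar> \<bar>d\<bar>" using mu_supp by eventually_elim auto
qed simp

lemma integrable_on: "A \<in> sets borel ==> integrable \<mu> (%x. ind A x * x)"
 using integrable_mult_indicator[OF _ integrable_id, of A] by (simp add: mu_sets)

text \<open>Also valid for null sets: division by zero makes \<open>bary\<close> equal to 0 there,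
  and the integral is 0 too.\<close>

lemma bary_times:
 assumes A: "A \<in> sets borel" shows "bary A * prob A = (\<integral>x. ind A x * x \<partial>\<mu>)"
proof (cases "prob A = 0")
 case True
 hence "A \<in> null_sets \<mu>" using A by (simp add: null_sets_def emeasure_eq_measure mu_sets)
 from AE_not_in[OF this] have "AE x in \<mu>. ind A x * x = 0" by eventually_elim auto
 hence "(\<integral>x. ind A x * x \<partial>\<mu>) = 0" by (rule integral_eq_zero_AE)
 thus ?thesis using True by simp
qed (simp add: bary_def)

lemma integral_on_const: "A \<in> sets borel ==> (\<integral>x. ind A x * k \<partial>\<mu>) = k * prob A"
 by (simp add: mu_sets sets_eq_imp_space_eq[OF mu_sets] mult.commute)

lemma bary_le:
 assumes A: "A \<in> sets borel" "0 < prob A" and le: "AE x in \<mu>. x \<in> A --> x <= k" shows "bary A <= k"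
proof -
 have "integrable \<mu> (%x. ind A x * k)" using A by (simp add: mu_sets emeasure_eq_measure)
 moreover have "AE x in \<mu>. ind A x * x <= ind A x * k" using le by eventually_elim (auto split: split_indicator)
 ultimately have "(\<integral>x. ind A x * x \<partial>\<mu>) <= (\<integral>x. ind A x * k \<partial>\<mu>)"
  by (intro integral_mono_AE integrable_on A(1))
 hence "bary A * prob A <= k * prob A" unfolding bary_times[OF A(1)] integral_on_const[OF A(1)] .
 thus ?thesis using A(2) by simp
qed

lemma bary_ge:
 assumes A: "A \<in> sets borel" "0 < prob A" and le: "AE x in \<mu>. x \<in> A --> k <= x" shows "k <= bary A"
proof -
 have "integrable \<mu> (%x. ind A x * k)" using A by (simp add: mu_sets emeasure_eq_measure)
 moreover have "AE x in \<mu>. ind A x * k <= ind A x * x" using le by eventually_elim (auto split: split_indicator)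
 ultimately have "(\<integral>x. ind A x * k \<partial>\<mu>) <= (\<integral>x. ind A x * x \<partial>\<mu>)"
  by (intro integral_mono_AE integrable_on A(1))
 hence "k * prob A <= bary A * prob A" unfolding bary_times[OF A(1)] integral_on_const[OF A(1)] .
 thus ?thesis using A(2) by simp
qed

lemma bary_gt:
 assumes A: "A \<in> sets borel" "0 < prob A" and gt: "A \<subseteq> {k<..}" shows "k < bary A"
proof (rule ccontr)
 assume "~ k < bary A"
 moreover have "AE x in \<mu>. x \<in> A --> k <= x" by (rule AE_I2) (use gt in auto)
 from bary_ge[OF A this] have "k <= bary A" .
 ultimately have "bary A = k" by simp
 hence "(\<integral>x. ind A x * x \<partial>\<mu>) - (\<integral>x. ind A x * k \<partial>\<mu>) = 0"
  unfolding bary_times[OF A(1), symmetric] integral_on_const[OF A(1)] by simp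
 moreover have i: "integrable \<mu> (%x. ind A x * x)" "integrable \<mu> (%x. ind A x * k)"
  using A by (auto simp: mu_sets emeasure_eq_measure intro!: integrable_on)
 ultimately have "(\<integral>x. ind A x * x - ind A x * k \<partial>\<mu>) = 0" by simp
 moreover have "AE x in \<mu>. 0 <= ind A x * x - ind A x * k" by (rule AE_I2) (use gt in \<open>auto split: split_indicator\<close>)
 ultimately have "AE x in \<mu>. ind A x * x - ind A x * k = 0"
  using i by (subst (asm) integral_nonneg_eq_0_iff_AE) auto
 hence "AE x in \<mu>. x ~: A" by eventually_elim (use gt in \<open>auto split: split_indicator_asm\<close>)
 hence "prob A = 0" using A(1) by (simp add: prob_eq_0 mu_sets)
 thus False using A(2) by simp
qed

lemma bary_in:
 assumes A: "A \<in> sets borel" "0 < prob A" shows "bary A \<in> {c..d}"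
proof -
 have "AE x in \<mu>. x \<in> A --> c <= x" "AE x in \<mu>. x \<in> A --> x <= d" using mu_supp by (eventually_elim, simp)+
 with A show ?thesis by (simp add: bary_le bary_ge)
qed

lemma bary_union:
 assumes A: "A \<in> sets borel"
 shows "bary A * prob A = bary (A \<inter> {..k}) * prob (A \<inter> {..k}) + bary (A \<inter> {k<..}) * prob (A \<inter> {k<..})"
  "prob A = prob (A \<inter> {..k}) + prob (A \<inter> {k<..})"
proof -
 have S: "A \<inter> {..k} \<in> sets borel" "A \<inter> {k<..} \<in> sets borel" using A by auto
 have "(\<integral>x. ind A x * x \<partial>\<mu>) = (\<integral>x. ind (A \<inter> {..k}) x * x + ind (A \<inter> {k<..}) x * x \<partial>\<mu>)"
  by (intro Bochner_Integration.integral_cong) (auto split: split_indicator)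
 thus "bary A * prob A = bary (A \<inter> {..k}) * prob (A \<inter> {..k}) + bary (A \<inter> {k<..}) * prob (A \<inter> {k<..})"
  unfolding bary_times[OF A] bary_times[OF S(1)] bary_times[OF S(2)]
  using Bochner_Integration.integral_add[OF integrable_on[OF S(1)] integrable_on[OF S(2)]] by simp
 have u: "prob (A \<inter> {..k} \<union> A \<inter> {k<..}) = prob (A \<inter> {..k}) + prob (A \<inter> {k<..})"
  by (rule finite_measure_Union) (use S in \<open>auto simp: mu_sets\<close>)
 have e: "A \<inter> {..k} \<union> A \<inter> {k<..} = A" by auto
 show "prob A = prob (A \<inter> {..k}) + prob (A \<inter> {k<..})" using u unfolding e .
qed

lemma bc_0: "bc 0 x = 0"
 using mu_mean prob_space by (simp add: bc_def cell_0 bary_def sets_eq_imp_space_eq[OF mu_sets])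

lemma bc_in: "0 < prob (cell n x) ==> bc n x \<in> {c..d}"
 unfolding bc_def by (rule bary_in[OF cell_sets])

text \<open>Cells are intervals closed on the right and open on the left at cuts, so the barycentre
  satisfies the weak inequalities trivially and the strict ones by \<open>bary_gt\<close>. Hence the
  position of a barycentre identifies its cell.\<close>

lemma bc_mem:
 assumes p: "0 < prob (cell n x)" shows "bc n x \<in> cell n x"
proof -
 have "(bc n x <= cut i) = (x <= cut i)" if i: "i < n" for i
 proof (cases "x <= cut i")
  case True
  hence "bc n x <= cut i" unfolding bc_def using i by (intro bary_le cell_sets p AE_I2) (auto simp: cell_def)
  thus ?thesis using True by simp
 next
  case False
  hence "cut i < bc n x" unfolding bc_def using i by (intro bary_gt cell_sets p) (auto simp: cell_def)
  thus ?thesis using False by simp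
 qed
 thus ?thesis by (simp add: cell_def)
qed

lemma cell_positive: "AE x in \<mu>. 0 < prob (cell n x)"
proof -
 have "AE x in \<mu>. \<forall>C\<in>range (cell n). prob C = 0 --> x ~: C"
  by (rule AE_finite_allI[OF finite_cells]) (auto simp: prob_eq_0 mu_sets)
 thus ?thesis
 proof eventually_elim
  case (elim x)
  hence "prob (cell n x) ~= 0" using cell_self[of x n] by blast
  thus ?case using measure_nonneg[of \<mu> "cell n x"] by linarith
 qed
qed

lemma splits_cong: "cell n y = cell n x ==> splits n y = splits n x"
 by (simp add: splits_def)

text \<open>The two halves balance around the barycentre:
  \<open>(z - bary A) * prob A = (bary B - z) * prob B\<close>. The half barycentres are separated
  by the cut, so both sides must be positive.\<close>

lemma bary_strict:
 assumes fx: "bc n z = z" and s: "splits n z"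
 shows "lowr n z < z" "z < uppr n z" "lowr n z <= cut n" "cut n < uppr n z"
proof -
 let ?A = "cell n z \<inter> {..cut n}" and ?B = "cell n z \<inter> {cut n<..}"
 have AB: "?A \<in> sets borel" "?B \<in> sets borel" by measurable
 have p: "0 < prob ?A" "0 < prob ?B" using s by (auto simp: splits_def)
 have 1: "bary ?A <= cut n" by (intro bary_le AB p AE_I2) auto
 have 2: "cut n < bary ?B" by (intro bary_gt AB p) auto
 have "z * (prob ?A + prob ?B) = bary ?A * prob ?A + bary ?B * prob ?B"
  using bary_union[OF cell_sets, of n z "cut n"] fx unfolding bc_def by metis
 hence e: "(z - bary ?A) * prob ?A = (bary ?B - z) * prob ?B" by (simp add: algebra_simps)
 have "bary ?A < z & z < bary ?B"
 proof (rule ccontr)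
  assume n: "~ (bary ?A < z & z < bary ?B)"
  show False
  proof (cases "bary ?A < z")
   case True
   hence "z >= bary ?B" using n by simp
   hence "(bary ?B - z) * prob ?B <= 0" using p by (simp add: mult_nonpos_nonneg)
   moreover have "0 < (z - bary ?A) * prob ?A" using True p by simp
   ultimately show False using e by simp
  next
   case False
   hence "(z - bary ?A) * prob ?A <= 0" using p by (simp add: mult_nonpos_nonneg)
   moreover have "0 < (bary ?B - z) * prob ?B" using False 1 2 p by simp
   ultimately show False using e by simp
  qed
 qed
 with 1 2 s show "lowr n z < z" "z < uppr n z" "lowr n z <= cut n" "cut n < uppr n z" by (auto simp: lowr_def uppr_def)
qed

lemma splits_range:
 assumes "splits n z" shows "lowr n z \<in> {c..d}" "uppr n z \<in> {c..d}"
 using assms by (auto simp: splits_def lowr_def uppr_def simp del: atLeastAtMost_iff intro!: bary_in)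

text \<open>Keeps the invariant of the construction: after leaving the interval between the two half
  barycentres, or resting when only one half has mass, the point is again the barycentre of its own
  cell of the next level.\<close>

lemma bc_child:
 assumes fx: "bc n z = z" and p: "0 < prob (cell n z)"
 shows "splits n z ==> wt \<in> {lowr n z, uppr n z} ==> bc (Suc n) wt = wt & 0 < prob (cell (Suc n) wt)"
  "~ splits n z ==> bc (Suc n) z = z & 0 < prob (cell (Suc n) z)"
proof -
 let ?A = "cell n z \<inter> {..cut n}" and ?B = "cell n z \<inter> {cut n<..}"
 have AB: "?A \<in> sets borel" "?B \<in> sets borel" by measurable
 have AI: "wt \<in> cell n z" if wt: "wt = bary D" "D \<in> sets borel" "D \<subseteq> cell n z" "0 < prob D" for wt D
 proof -
  have "(wt <= cut i) = (z <= cut i)" if i: "i < n" for i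
  proof (cases "z <= cut i")
   case True
   hence "wt <= cut i" unfolding wt(1) using i wt(3) True by (intro bary_le wt AE_I2) (auto simp: cell_def)
   thus ?thesis using True by simp
  next
   case False
   have "D \<subseteq> {cut i<..}"
   proof
    fix x assume "x \<in> D"
    hence "x \<in> cell n z" using wt(3) by blast
    hence "(x <= cut i) = (z <= cut i)" using i by (simp add: cell_def)
    with False show "x \<in> {cut i<..}" by simp
   qed
   hence "cut i < wt" unfolding wt(1) by (intro bary_gt wt)
   thus ?thesis using False by simp
  qed
  thus ?thesis by (simp add: cell_def)
 qed
 show "bc (Suc n) wt = wt & 0 < prob (cell (Suc n) wt)" if s: "splits n z" and wt: "wt \<in> {lowr n z, uppr n z}"
 proof (cases "wt = lowr n z")
  case True
  hence "cell n wt = cell n z" using s by (intro cell_eq AI[of _ "?A"]) (auto simp: lowr_def splits_def)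
  hence "cell (Suc n) wt = ?A" using True bary_strict[OF fx s] by (simp add: cell_Suc)
  thus ?thesis using s True by (simp add: bc_def lowr_def splits_def)
 next
  case False
  hence wu: "wt = uppr n z" using wt by simp
  hence "cell n wt = cell n z" using s by (intro cell_eq AI[of _ "?B"]) (auto simp: uppr_def splits_def)
  hence "cell (Suc n) wt = ?B" using wu bary_strict[OF fx s] by (simp add: cell_Suc)
  thus ?thesis using s wu by (simp add: bc_def uppr_def splits_def)
 qed
 show "bc (Suc n) z = z & 0 < prob (cell (Suc n) z)" if s: "~ splits n z"
 proof -
  note u = bary_union[OF cell_sets, of n z "cut n"]
  consider "prob ?A = 0" | "prob ?B = 0" using s measure_nonneg[of \<mu> ?A] measure_nonneg[of \<mu> ?B] unfolding splits_def by linarith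
  thus ?thesis
  proof cases
   case 1
   hence pB: "prob ?B = prob (cell n z)" using u by simp
   hence "bary ?B = z" using u(1) 1 p fx by (simp add: bc_def)
   moreover have "cut n < bary ?B" using pB p by (intro bary_gt AB) auto
   ultimately show ?thesis using pB p by (simp add: cell_Suc bc_def)
  next
   case 2
   hence pA: "prob ?A = prob (cell n z)" using u by simp
   hence "bary ?A = z" using u(1) 2 p fx by (simp add: bc_def)
   moreover have "bary ?A <= cut n" using pA p by (intro bary_le AB AE_I2) auto
   ultimately show ?thesis using pA p by (simp add: cell_Suc bc_def)
  qed
 qed
qed

lemma bc_fixed: "0 < prob (cell n x) ==> bc n (bc n x) = bc n x & cell n (bc n x) = cell n x"
 using cell_eq[OF bc_mem] by (simp add: bc_def)

text \<open>The conditional means of a sample \<open>x\<close> make the same moves as the exit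
  points of \<open>M\<close>: to one of the two half barycentres if the cell splits, otherwise
  none.\<close>

lemma bc_step:
 assumes p: "0 < prob (cell (Suc n) x)"
 defines "z \<equiv> bc n x"
 shows "splits n z --> bc (Suc n) x \<in> {lowr n z, uppr n z}" "~ splits n z --> bc (Suc n) x = z"
proof -
 let ?A = "cell n x \<inter> {..cut n}" and ?B = "cell n x \<inter> {cut n<..}"
 have "prob (cell (Suc n) x) <= prob (cell n x)" by (rule finite_measure_mono) (auto simp: cell_Suc mu_sets)
 hence p0: "0 < prob (cell n x)" using p by simp
 have cz: "cell n z = cell n x" "bc n z = z" using bc_fixed[OF p0] by (auto simp: z_def)
 show "splits n z --> bc (Suc n) x \<in> {lowr n z, uppr n z}"
  by (auto simp: lowr_def uppr_def cz bc_def cell_Suc)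
 show "~ splits n z --> bc (Suc n) x = z"
 proof
  assume s: "~ splits n z"
  note u = bary_union[OF cell_sets, of n x "cut n"]
  show "bc (Suc n) x = z"
  proof (cases "x <= cut n")
   case True
   hence pA: "0 < prob ?A" using p by (simp add: cell_Suc)
   hence "prob ?B = 0" using s measure_nonneg[of \<mu> ?B] unfolding splits_def cz by linarith
   hence "bary ?A = bary (cell n x)" using u pA by simp
   thus ?thesis using True by (simp add: bc_def cell_Suc z_def)
  next
   case False
   hence pA: "0 < prob ?B" using p by (simp add: cell_Suc)
   hence "prob ?A = 0" using s measure_nonneg[of \<mu> ?A] unfolding splits_def cz by linarith
   hence "bary ?B = bary (cell n x)" using u pA by simp
   thus ?thesis using False by (simp add: bc_def cell_Suc z_def)
  qed
 qed
qed

lemma bc_integral: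
 assumes \<psi>: "!!x y. y \<in> cell n x ==> \<psi> y = \<psi> x"
 shows "integrable \<mu> (%x. \<psi> x * bc n x)" "integrable \<mu> (%x. \<psi> x * x)" "(\<integral>x. \<psi> x * bc n x \<partial>\<mu>) = (\<integral>x. \<psi> x * x \<partial>\<mu>)"
proof -
 have on: "integrable \<mu> (%x. ind C x * (\<psi> x * bc n x)) & integrable \<mu> (%x. ind C x * (\<psi> x * x)) &
  (\<integral>x. ind C x * (\<psi> x * bc n x) \<partial>\<mu>) = (\<integral>x. ind C x * (\<psi> x * x) \<partial>\<mu>)" if "C \<in> range (cell n)" for C
 proof -
  obtain x0 where C: "C = cell n x0" using \<open>C \<in> range (cell n)\<close> by blast
  have e: "ind C x * (\<psi> x * bc n x) = ind C x * (\<psi> x0 * bary C)" "ind C x * (\<psi> x * x) = \<psi> x0 * (ind C x * x)" for x :: real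
   using \<psi>[of x x0] cell_eq[of x n x0] by (auto simp: C bc_def split: split_indicator)
  have Cs: "C \<in> sets borel" unfolding C by (rule cell_sets)
  show ?thesis unfolding e integral_on_const[OF Cs] using bary_times[OF Cs] Cs
   by (auto simp: mu_sets emeasure_eq_measure intro!: integrable_on)
 qed
 have s: "(%x. \<psi> x * bc n x) = (%x. \<Sum>C\<in>range (cell n). ind C x * (\<psi> x * bc n x))"
  "(%x. \<psi> x * x) = (%x. \<Sum>C\<in>range (cell n). ind C x * (\<psi> x * x))"
  by (rule ext, rule cell_sum)+
 show "integrable \<mu> (%x. \<psi> x * bc n x)" by (subst s(1)) (use on in \<open>intro Bochner_Integration.integrable_sum, blast\<close>)
 show "integrable \<mu> (%x. \<psi> x * x)" by (subst s(2)) (use on in \<open>intro Bochner_Integration.integrable_sum, blast\<close>)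
 have "(\<integral>x. \<psi> x * bc n x \<partial>\<mu>) = (\<Sum>C\<in>range (cell n). \<integral>x. ind C x * (\<psi> x * bc n x) \<partial>\<mu>)"
  by (subst s(1), rule Bochner_Integration.integral_sum) (use on in blast)
 also have "... = (\<Sum>C\<in>range (cell n). \<integral>x. ind C x * (\<psi> x * x) \<partial>\<mu>)" using on by (intro sum.cong) auto
 also have "... = (\<integral>x. \<psi> x * x \<partial>\<mu>)"
  by (subst s(2), rule Bochner_Integration.integral_sum[symmetric]) (use on in blast)
 finally show "(\<integral>x. \<psi> x * bc n x \<partial>\<mu>) = (\<integral>x. \<psi> x * x \<partial>\<mu>)" .
qed

lemma bc_measurable[measurable]: "bc n \<in> borel_measurable borel"
 by (rule cell_fun_measurable[where n=n]) (simp add: bc_def cell_eq)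

lemma splits_measurable[measurable]: "Measurable.pred borel (splits n)"
proof -
 have "(%x. if splits n x then 1 else (0::real)) \<in> borel_measurable borel"
  by (rule cell_fun_measurable[where n=n]) (simp add: splits_cong[OF cell_eq])
 hence "Measurable.pred borel (%x. (if splits n x then 1 else (0::real)) = 1)" by measurable
 thus ?thesis by (simp add: if_split_eq1)
qed

lemma lowr_measurable[measurable]: "lowr n \<in> borel_measurable borel" and uppr_measurable[measurable]: "uppr n \<in> borel_measurable borel"
proof -
 have [measurable]: "(%z. bary (cell n z \<inter> {..cut n})) \<in> borel_measurable borel" "(%z. bary (cell n z \<inter> {cut n<..})) \<in> borel_measurable borel"
  by (rule cell_fun_measurable[where n=n], simp add: cell_eq)+
 show "lowr n \<in> borel_measurable borel" "uppr n \<in> borel_measurable borel" unfolding lowr_def[abs_def] uppr_def[abs_def] by measurable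
qed

text \<open>The slope is constant on level-\<open>n\<close> cells, and on such functions
  \<open>bc (Suc n)\<close>, \<open>bc n\<close> and the identity have the same integrals. The slope
  term of \<open>interp_two_point\<close> therefore integrates to zero, leaving the same recursion
  as \<open>law_step\<close> gives for \<open>M\<close>.\<close>

lemma bc_interp:
 assumes f: "f \<in> borel_measurable borel" "!!x. \<bar>f x\<bar> <= K"
 shows "(\<integral>x. f (bc (Suc n) x) \<partial>\<mu>) = (\<integral>x. interp f (lowr n (bc n x)) (uppr n (bc n x)) (bc n x) \<partial>\<mu>)"
proof -
 note [measurable] = f(1)
 let ?s = "%x. slope f (lowr n (bc n x)) (uppr n (bc n x))" and ?h = "%x. interp f (lowr n (bc n x)) (uppr n (bc n x)) (bc n x)"
 have c1: "?s y = ?s x" if "y \<in> cell n x" for x y using cell_eq[OF that] by (simp add: bc_def)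
 have c2: "?s y = ?s x" if "y \<in> cell (Suc n) x" for x y using c1[of y x] that by (auto simp: cell_Suc)
 have m: "?h \<in> borel_measurable borel" by (rule cell_fun_measurable[where n=n]) (simp add: bc_def cell_eq)
 have i: "integrable \<mu> ?h"
  by (rule integrable_const_bound[where B=K]) (use interp_bound[of f K, OF f(2)] m in \<open>auto simp: measurable_cong_sets[OF mu_sets refl]\<close>)
 have "(\<integral>x. f (bc (Suc n) x) \<partial>\<mu>) = (\<integral>x. ?h x + (?s x * bc (Suc n) x - ?s x * bc n x) \<partial>\<mu>)"
 proof (rule integral_cong_AE)
  show "AE x in \<mu>. f (bc (Suc n) x) = ?h x + (?s x * bc (Suc n) x - ?s x * bc n x)"
   using cell_positive[of "Suc n"] cell_positive[of n]
  proof eventually_elim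
   case (elim x)
   have sp: "lowr n (bc n x) < bc n x & bc n x < uppr n (bc n x) \<longleftrightarrow> splits n (bc n x)"
    using bary_strict[of n "bc n x"] bc_fixed[OF elim(2)] by (auto simp: lowr_def)
   have "f (bc (Suc n) x) = ?h x + ?s x * (bc (Suc n) x - bc n x)"
    by (rule interp_two_point) (unfold sp, rule bc_step[OF elim(1)], rule bc_step[OF elim(1)])
   thus ?case by (simp add: algebra_simps)
  qed
 next
  have "?s \<in> borel_measurable borel" by (rule cell_fun_measurable[OF c1])
  thus "(%x. ?h x + (?s x * bc (Suc n) x - ?s x * bc n x)) \<in> borel_measurable \<mu>" using m by (simp add: measurable_cong_sets[OF mu_sets refl])
 qed measurable
 also have "... = (\<integral>x. ?h x \<partial>\<mu>) + ((\<integral>x. ?s x * bc (Suc n) x \<partial>\<mu>) - (\<integral>x. ?s x * bc n x \<partial>\<mu>))"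
  using i bc_integral(1)[of "Suc n" ?s] bc_integral(1)[of n ?s] c1 c2 by simp
 also have "... = (\<integral>x. ?h x \<partial>\<mu>)"
  using bc_integral(3)[of "Suc n" ?s] bc_integral(3)[of n ?s] c1 c2 by simp
 finally show ?thesis .
qed

text \<open>All cells of almost every point have positive mass. Two rational cuts close to
  \<open>x\<close> on either side confine its later cells, and with them the barycentres, to a small
  neighbourhood.\<close>

lemma bc_limit: "AE x in \<mu>. (%n. bc n x) \<longlonglongrightarrow> x"
proof -
 have "AE x in \<mu>. ALL n. 0 < prob (cell n x)" by (subst AE_all_countable) (intro allI cell_positive)
 thus ?thesis
 proof eventually_elim
  case (elim x)
  have dense: "EX i. a < cut i & cut i < b" if "a < b" for a b :: real
  proof -
   obtain q where q: "q \<in> \<rat>" "a < q" "q < b" using Rats_dense_in_real[OF \<open>a < b\<close>] by blast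
   obtain i where "cut i = q" using from_nat_into_surj[OF countable_rat q(1)] unfolding cut_def by blast
   thus ?thesis using q(2,3) by (intro exI[of _ i]) simp
  qed
  show ?case
  proof (rule LIMSEQ_I)
   fix e :: real assume "0 < e"
   then obtain i j where i: "x - e < cut i" "cut i < x" and j: "x < cut j" "cut j < x + e" using dense[of "x - e" x] dense[of x "x + e"] by auto
   have "norm (bc n x - x) < e" if n: "Suc (max i j) <= n" for n
   proof -
    have "\<forall>k<n. (bc n x <= cut k) = (x <= cut k)" using bc_mem[OF elim[rule_format], of n] unfolding cell_def by (rule CollectD)
    moreover have "i < n" "j < n" using n by auto
    ultimately have "cut i < bc n x" "bc n x <= cut j" using i j by (metis not_le, metis less_imp_le)
    thus ?thesis using i j by simp
   qed
   thus "EX no. \<forall>n\<ge>no. norm (bc n x - x) < e" by blast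
  qed
 qed
qed

end

section \<open>Embedding one step\<close>

text \<open>Finite \<open>q\<close> from one interior point to both borders carries over to every
  other interior starting point: the kernels started at \<open>z\<close> are dominated by a
  combination of the two kernels started at \<open>y\<close>.\<close>

lemma q_finite_between:
 assumes eta: "\<eta> \<in> borel_measurable borel" and fin: "q \<eta> y e < \<infinity>" "q \<eta> y h < \<infinity>"
  and ord: "e <= y" "y <= h" "e < z" "z < h" "x \<in> {e..h}"
 shows "q \<eta> z x < \<infinity>"
proof -
 note [measurable] = qdens_measurable[OF eta]
 \<comment> \<open>The constants matter only for \<open>u\<close> between \<open>y\<close> and
   \<open>z\<close>. There the ratio of the distances of \<open>u\<close> to the two borders is at
   most the corresponding ratio at \<open>z\<close>, since it is monotone in
   \<open>u\<close>.\<close>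
 define K1 K2 where "K1 = 1 + (h - z) / (z - e)" and "K2 = 1 + (z - e) / (h - z)"
 have pos: "0 < z - e" "0 < h - z" using ord by auto
 have K: "1 <= K1" "1 <= K2" using pos by (auto simp: K1_def K2_def)
 have le: "kern z x u <= K1 * kern y e u + K2 * kern y h u" for u
 proof -
  have n: "kern y e u <= K1 * kern y e u" "kern y h u <= K2 * kern y h u" "0 <= K1 * kern y e u" "0 <= K2 * kern y h u"
   using K kern_nonneg[of y e u] kern_nonneg[of y h u] mult_right_mono[OF K(1) kern_nonneg[of y e u]] mult_right_mono[OF K(2) kern_nonneg[of y h u]] by auto
  consider "z <= u" "y <= u" | "z <= u" "u < y" | "u < z" "u < y" | "u < z" "y <= u" by linarith
  thus ?thesis
  proof cases
   case 1
   hence "kern z x u <= kern y h u" using ord by (auto simp: kern_def)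
   thus ?thesis using n by linarith
  next
   case 2
   have "(z - e) * (h - u) <= (h - z) * (u - e)" using mult_mono[of "h - u" "h - z" "z - e" "u - e"] 2 ord by (simp add: mult.commute)
   hence "h - u <= (h - z) / (z - e) * (u - e)" using pos by (simp add: field_simps)
   also have "... <= K1 * (u - e)" using 2 ord by (intro mult_right_mono) (auto simp: K1_def)
   finally have "h - u <= K1 * kern y e u" using 2 ord by (simp add: kern_def)
   moreover have "kern z x u <= h - u" using 2 ord by (auto simp: kern_def)
   ultimately show ?thesis using n by linarith
  next
   case 3
   hence "kern z x u <= kern y e u" using ord by (auto simp: kern_def)
   thus ?thesis using n by linarith
  next
   case 4
   have "(h - z) * (u - e) <= (z - e) * (h - u)" using mult_mono[of "u - e" "z - e" "h - z" "h - u"] 4 ord by (simp add: mult.commute)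
   hence "u - e <= (z - e) / (h - z) * (h - u)" using pos by (simp add: field_simps)
   also have "... <= K2 * (h - u)" using 4 ord by (intro mult_right_mono) (auto simp: K2_def)
   finally have "u - e <= K2 * kern y h u" using 4 ord by (simp add: kern_def)
   moreover have "kern z x u <= u - e" using 4 ord by (auto simp: kern_def)
   ultimately show ?thesis using n by linarith
  qed
 qed
 have "q \<eta> z x <= (\<integral>\<^sup>+u. ennreal K1 * (ennreal (kern y e u) * qdens \<eta> u) + ennreal K2 * (ennreal (kern y h u) * qdens \<eta> u) \<partial>lborel)"
  unfolding q_eq_double_integral double_integral_eq_kern[OF qdens_measurable[OF eta]]
 proof (rule nn_integral_mono)
  fix u
  have "ennreal (kern z x u) * qdens \<eta> u <= ennreal (K1 * kern y e u + K2 * kern y h u) * qdens \<eta> u"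
   by (intro mult_right_mono ennreal_leI le) simp
  also have "... = ennreal K1 * (ennreal (kern y e u) * qdens \<eta> u) + ennreal K2 * (ennreal (kern y h u) * qdens \<eta> u)"
   using K by (simp add: ennreal_plus ennreal_mult kern_nonneg distrib_right mult.assoc)
  finally show "ennreal (kern z x u) * qdens \<eta> u <= ..." .
 qed
 also have "... = ennreal K1 * q \<eta> y e + ennreal K2 * q \<eta> y h"
  unfolding q_eq_double_integral double_integral_eq_kern[OF qdens_measurable[OF eta]]
  by (simp add: nn_integral_add nn_integral_cmult)
 also have "... < \<infinity>" using fin by (simp add: ennreal_mult_less_top)
 finally show ?thesis .
qed

lemma (in bounded_centred) prob_UNIV: "prob UNIV = 1"
 using prob_space sets_eq_imp_space_eq[OF mu_sets] by simp

locale embedding_step = weak_sol_nz P F W M \<eta> m l r + mu: bounded_centred \<mu> c d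
 for P :: "'a measure" and F W M \<eta> m l r \<mu> c d +
 fixes a :: "real => real" and S :: "'a => real"
 assumes a_borel: "a \<in> borel_measurable borel" and a_nonneg: "!!y. 0 <= a y" and a_zero: "!!y. y ~: {l<..<r} ==> a y = 0"
  and reach: "!!y. y \<in> {l<..<r} ==> l <= y + a y * c & y + a y * d <= r & q \<eta> y (y + a y * c) < \<infinity> & q \<eta> y (y + a y * d) < \<infinity>"
  and S: "stopping_time F S" and S0: "!!w. w \<in> space P ==> 0 <= S w"
begin

definition Y :: "'a => real" where "Y w = M (S w) w"
definition A :: "'a => real" where "A w = a (Y w)"
text \<open>The displacement since \<open>S\<close> in units of the scale factor, meant to become a
  sample of \<open>\<mu>\<close>. Where \<open>A w = 0\<close> it is 0 by division by zero, which is
  why statements on its law are restricted to \<open>A w ~= 0\<close>.\<close>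

definition Z :: "('a => real) => 'a => real" where "Z T w = (M (T w) w - Y w) / A w"

text \<open>The condition \<open>mu.bc n (Z T w) = Z T w\<close> says that the rescaled position is
  the barycentre of a level-\<open>n\<close> cell. Together with positive mass this suffices to
  build the next stage from the current position and the starting point.\<close>

definition stage :: "nat => ('a => real) => bool" where
 "stage n T \<longleftrightarrow> stopping_time F T & (\<forall>w\<in>space P. S w <= T w) &
  (AE w in P. (A w = 0 --> T w = S w) & (A w ~= 0 --> mu.bc n (Z T w) = Z T w & 0 < mu.prob (cell n (Z T w))) &
   (ALL v. S w <= v & v < T w --> M v w \<in> {l<..<r}))"

definition moves :: "nat => ('a => real) => ('a => real) => bool" where
 "moves n T T' \<longleftrightarrow> (\<forall>w\<in>space P. T w <= T' w) &
  (AE w in P. A w ~= 0 --> (mu.splits n (Z T w) --> Z T' w \<in> {mu.lowr n (Z T w), mu.uppr n (Z T w)}) &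
   (~ mu.splits n (Z T w) --> Z T' w = Z T w))"

lemma zero_in: "c <= 0" "0 <= d"
 using mu.bc_in[of 0 0] by (auto simp: mu.bc_0 cell_0 mu.prob_UNIV)

lemma A_pos: "A w ~= 0 ==> 0 < A w & Y w \<in> {l<..<r}"
 using a_nonneg[of "Y w"] a_zero[of "Y w"] unfolding A_def by (metis order_le_less)

lemma M_eq: "A w ~= 0 ==> M (T w) w = Y w + A w * Z T w"
 by (simp add: Z_def)

lemma Y_measurable: "Y \<in> borel_measurable (pre_sigma S)"
 unfolding Y_def[abs_def] by (rule M_at_pre_sigma[OF S S0])

lemma A_measurable: "A \<in> borel_measurable (pre_sigma S)"
 unfolding A_def[abs_def] by (rule measurable_compose[OF Y_measurable a_borel])

lemma Z_measurable:
 assumes T: "stopping_time F T" and ST: "!!w. w \<in> space P ==> S w <= T w"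
 shows "Z T \<in> borel_measurable (pre_sigma T)"
proof -
 have T0: "0 <= T w" if "w \<in> space P" for w using S0[OF that] ST[OF that] by simp
 note [measurable] = M_at_pre_sigma[OF T T0] pre_sigma_mono_measurable[OF S T ST Y_measurable] pre_sigma_mono_measurable[OF S T ST A_measurable]
 show ?thesis unfolding Z_def[abs_def] by measurable
qed

lemma stage_0: "stage 0 S"
 unfolding stage_def using S by (auto simp: Z_def Y_def mu.bc_0 cell_0 mu.prob_UNIV)

lemma stage_Suc:
 assumes T: "stage n T"
 shows "EX T'. stage (Suc n) T' & moves n T T'"
proof -
 have st: "stopping_time F T" and ST: "!!w. w \<in> space P ==> S w <= T w"
  and inv: "AE w in P. (A w = 0 --> T w = S w) & (A w ~= 0 --> mu.bc n (Z T w) = Z T w & 0 < mu.prob (cell n (Z T w))) &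
   (ALL v. S w <= v & v < T w --> M v w \<in> {l<..<r})" using T by (auto simp: stage_def)
 have T0: "0 <= T w" if "w \<in> space P" for w using S0[OF that] ST[OF that] by simp
 let ?s = "%w. A w ~= 0 & mu.splits n (Z T w)"
 \<comment> \<open>Where nothing is to be split, both borders equal the current position; the
   interval is then empty and the exit time leaves \<open>T\<close> unchanged.\<close>
 define Lo where "Lo w = (if ?s w then Y w + A w * mu.lowr n (Z T w) else M (T w) w)" for w
 define Hi where "Hi w = (if ?s w then Y w + A w * mu.uppr n (Z T w) else M (T w) w)" for w
 note [measurable] = M_at_pre_sigma[OF st T0] pre_sigma_mono_measurable[OF S st ST Y_measurable] pre_sigma_mono_measurable[OF S st ST A_measurable] Z_measurable[OF st ST]
 have LH: "Lo \<in> borel_measurable (pre_sigma T)" "Hi \<in> borel_measurable (pre_sigma T)" unfolding Lo_def[abs_def] Hi_def[abs_def] by measurable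
 have bounds: "Lo w < M (T w) w & M (T w) w < Hi w & Y w + A w * c <= Lo w & Hi w <= Y w + A w * d"
  if s: "?s w" and f: "mu.bc n (Z T w) = Z T w" for w
 proof -
  have "0 < A w" using A_pos s by blast
  thus ?thesis using mu.bary_strict(1,2)[OF f] mu.splits_range[of n "Z T w"] s M_eq[of w T] by (auto simp: Lo_def Hi_def)
 qed
 have ok: "AE w in P. M (T w) w \<in> {Lo w<..<Hi w} --> l <= Lo w & Hi w <= r & q \<eta> (M (T w) w) (Lo w) < \<infinity> & q \<eta> (M (T w) w) (Hi w) < \<infinity>"
  using inv
 proof eventually_elim
  case (elim w)
  show ?case
  proof
   assume in_: "M (T w) w \<in> {Lo w<..<Hi w}"
   have s: "?s w" using in_ by (auto simp: Lo_def Hi_def split: if_splits)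
   note b = bounds[OF s] and yI = A_pos[of w]
   have re: "l <= Y w + A w * c" "Y w + A w * d <= r" "q \<eta> (Y w) (Y w + A w * c) < \<infinity>" "q \<eta> (Y w) (Y w + A w * d) < \<infinity>"
    using reach[of "Y w"] yI s by (auto simp: A_def)
   have o: "Y w + A w * c <= Y w" "Y w <= Y w + A w * d" using zero_in yI s by (auto simp: mult_nonneg_nonpos)
   have "q \<eta> (M (T w) w) x < \<infinity>" if "x \<in> {Y w + A w * c..Y w + A w * d}" for x
    by (rule q_finite_between[OF eta_borel re(3,4) o _ _ that]) (use b elim s in auto)
   thus "l <= Lo w & Hi w <= r & q \<eta> (M (T w) w) (Lo w) < \<infinity> & q \<eta> (M (T w) w) (Hi w) < \<infinity>"
    using b elim s re(1,2) by auto
  qed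
 qed
 obtain T' where T': "stopping_time F T'" "\<forall>w\<in>space P. T w <= T' w"
  "AE w in P. (M (T w) w \<in> {Lo w<..<Hi w} --> M (T' w) w \<in> {Lo w, Hi w}) &
    (M (T w) w ~: {Lo w<..<Hi w} --> T' w = T w) &
    (ALL v. T w <= v & v < T' w --> M v w \<in> {Lo w<..<Hi w})"
  by (rule exE[OF exit_stopping_time[OF st T0 LH ok]], assumption) (elim conjE, rule that)
 have main: "AE w in P. (A w = 0 --> T' w = S w) &
   (A w ~= 0 --> (mu.splits n (Z T w) --> Z T' w \<in> {mu.lowr n (Z T w), mu.uppr n (Z T w)}) & (~ mu.splits n (Z T w) --> Z T' w = Z T w)) &
   (A w ~= 0 --> mu.bc (Suc n) (Z T' w) = Z T' w & 0 < mu.prob (cell (Suc n) (Z T' w))) &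
   (ALL v. S w <= v & v < T' w --> M v w \<in> {l<..<r})"
  using inv T'(3) ok
 proof eventually_elim
  case (elim w)
  have stay: "T' w = T w" if "~ ?s w"
  proof -
   have "Lo w = M (T w) w" unfolding Lo_def if_not_P[OF that] ..
   hence "M (T w) w ~: {Lo w<..<Hi w}" by simp
   thus ?thesis using elim(2) by blast
  qed
  show ?case
  proof (cases "?s w")
   case True
   hence f: "mu.bc n (Z T w) = Z T w" "0 < mu.prob (cell n (Z T w))" using elim(1) by auto
   have in_: "M (T w) w \<in> {Lo w<..<Hi w}" using bounds[OF True f(1)] by simp
   hence "M (T' w) w \<in> {Lo w, Hi w}" using elim(2) by blast
   hence z: "Z T' w \<in> {mu.lowr n (Z T w), mu.uppr n (Z T w)}" using True by (auto simp: Z_def[of T'] Lo_def Hi_def)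
   have "M v w \<in> {l<..<r}" if v: "S w <= v" "v < T' w" for v
   proof (cases "v < T w")
    case True thus ?thesis using elim(1) v by blast
   next
    case False
    hence "M v w \<in> {Lo w<..<Hi w}" using elim(2) v by auto
    thus ?thesis using elim(3) in_ by auto
   qed
   thus ?thesis using True z mu.bc_child(1)[OF f _ z] by blast
  next
   case False
   hence e: "T' w = T w" "Z T' w = Z T w" using stay by (auto simp: Z_def)
   have "mu.bc (Suc n) (Z T w) = Z T w & 0 < mu.prob (cell (Suc n) (Z T w))" if "A w ~= 0"
    using mu.bc_child(2)[of n "Z T w"] elim(1) False that by blast
   thus ?thesis using elim(1) False unfolding e by blast
  qed
 qed
 have "stage (Suc n) T'"
  unfolding stage_def
 proof (intro conjI ballI T'(1))
  show "S w <= T' w" if "w \<in> space P" for w using ST[OF that] T'(2) that by (meson order_trans)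
 qed (use main in \<open>eventually_elim, blast\<close>)
 moreover have "moves n T T'"
  unfolding moves_def
 proof (intro conjI T'(2))
 qed (use main in \<open>eventually_elim, blast\<close>)
 ultimately show ?thesis by blast
qed

text \<open>By \<open>interp_two_point\<close> the change of \<open>f\<close> beyond its
  interpolation is the slope times the increment of \<open>Z\<close>. The slope divided by
  \<open>A\<close>, restricted to \<open>B\<close>, is known at time \<open>T\<close>, so this term
  is orthogonal to the increment of \<open>M\<close>.\<close>

lemma law_step:
 assumes T: "stage n T" "moves n T T'" "stage (Suc n) T'" and f: "f \<in> borel_measurable borel" "!!x. \<bar>f x\<bar> <= K"
  and B: "B \<in> sets (pre_sigma S)" "!!w. w \<in> B ==> A w ~= 0"
 shows "expectation (%w. ind B w * f (Z T' w)) = expectation (%w. ind B w * interp f (mu.lowr n (Z T w)) (mu.uppr n (Z T w)) (Z T w))"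
proof -
 have st: "stopping_time F T" "stopping_time F T'" and ST: "!!w. w \<in> space P ==> S w <= T w" "!!w. w \<in> space P ==> S w <= T' w"
  and TT: "!!w. w \<in> space P ==> T w <= T' w" using T by (auto simp: stage_def moves_def)
 have T0: "0 <= T w" "0 <= T' w" if "w \<in> space P" for w using S0[OF that] ST[OF that] by auto
 let ?h = "%w. interp f (mu.lowr n (Z T w)) (mu.uppr n (Z T w)) (Z T w)" and ?s = "%w. slope f (mu.lowr n (Z T w)) (mu.uppr n (Z T w))"
 define \<phi> where "\<phi> w = ind B w * (?s w / A w)" for w
 note [measurable] = f(1)
 have B': "B \<in> sets (pre_sigma T)" using pre_sigma_mono_measurable[OF S st(1) ST(1), of "ind B :: 'a => real" borel] B(1)
  sets.sets_into_space[OF B(1)] by (simp add: space_pre_sigma borel_measurable_indicator_iff Int_absorb2)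
 have \<phi>: "\<phi> \<in> borel_measurable (pre_sigma T)"
 proof -
  note [measurable] = B' Z_measurable[OF st(1) ST(1)] pre_sigma_mono_measurable[OF S st(1) ST(1) A_measurable]
  show ?thesis unfolding \<phi>_def[abs_def] slope_def by measurable
 qed
 note [measurable] = pre_sigma_measurable_P[OF st(1) Z_measurable[OF st(1) ST(1)]] pre_sigma_measurable_P[OF st(2) Z_measurable[OF st(2) ST(2)]]
  pre_sigma_sets_P[OF S B(1)] pre_sigma_measurable_P[OF st(1) \<phi>]
  M_at_measurable[OF sets_F_measurable_stopping[OF st(1)] T0(1)] M_at_measurable[OF sets_F_measurable_stopping[OF st(2)] T0(2)]
 have hm[measurable]: "?h \<in> borel_measurable P" unfolding interp_def by measurable
 have i: "integrable P (%w. ind B w * f (Z T' w))" "integrable P (%w. ind B w * ?h w)"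
  using f(2) interp_bound[of f K, OF f(2)] order_trans[OF abs_ge_zero f(2)] by (auto intro!: integrable_const_bound[where B=K] AE_I2 split: split_indicator)
 have eq: "AE w in P. \<phi> w * (M (T' w) w - M (T w) w) = ind B w * f (Z T' w) - ind B w * ?h w"
 proof -
  have "AE w in P. A w ~= 0 --> mu.bc n (Z T w) = Z T w" using T(1) unfolding stage_def by (auto elim: eventually_mono)
  moreover have "AE w in P. A w ~= 0 --> (mu.splits n (Z T w) --> Z T' w \<in> {mu.lowr n (Z T w), mu.uppr n (Z T w)}) &
   (~ mu.splits n (Z T w) --> Z T' w = Z T w)" using T(2) unfolding moves_def by blast
  ultimately show ?thesis
  proof eventually_elim
   case (elim w)
   show ?case
   proof (cases "w \<in> B")
    case True
    hence A: "A w ~= 0" by (rule B(2))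
    have sp: "mu.lowr n (Z T w) < Z T w & Z T w < mu.uppr n (Z T w) \<longleftrightarrow> mu.splits n (Z T w)"
     using mu.bary_strict[of n "Z T w"] elim(1) A by (auto simp: mu.lowr_def)
    have "f (Z T' w) = ?h w + ?s w * (Z T' w - Z T w)"
     by (rule interp_two_point) (unfold sp, use elim(2) A in auto)
    moreover have "Z T' w - Z T w = (M (T' w) w - M (T w) w) / A w" by (simp add: Z_def diff_divide_distrib)
    ultimately show ?thesis using True by (simp add: \<phi>_def)
   qed (simp add: \<phi>_def)
  qed
 qed
 have "integrable P (%w. \<phi> w * (M (T' w) w - M (T w) w))"
  using Bochner_Integration.integrable_diff[OF i] by (subst integrable_cong_AE[OF _ _ eq]) auto
 from M_increment_orthogonal[OF st T0(1) TT \<phi> this]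
 have "expectation (%w. ind B w * f (Z T' w) - ind B w * ?h w) = 0"
  by (subst integral_cong_AE[OF _ _ eq, symmetric]) auto
 thus ?thesis using Bochner_Integration.integral_diff[OF i] by simp
qed

text \<open>Induction over all bounded Borel \<open>f\<close> at once: one level is traded for an
  interpolation of \<open>f\<close> on both sides, by \<open>law_step\<close> for \<open>M\<close>
  and by \<open>mu.bc_interp\<close> for \<open>\<mu>\<close>. The factor \<open>prob B\<close>
  expresses independence of the past.\<close>

lemma law_stage:
 assumes st: "!!n. stage n (\<tau> n)" "!!n. moves n (\<tau> n) (\<tau> (Suc n))" and \<tau>0: "\<tau> 0 = S"
  and f: "f \<in> borel_measurable borel" "!!x. \<bar>f x\<bar> <= K"
  and B: "B \<in> sets (pre_sigma S)" "!!w. w \<in> B ==> A w ~= 0"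
 shows "expectation (%w. ind B w * f (Z (\<tau> n) w)) = prob B * (\<integral>x. f (mu.bc n x) \<partial>\<mu>)"
 using f
proof (induction n arbitrary: f)
 case 0
 have "Z (\<tau> 0) w = 0" for w by (simp add: Z_def Y_def \<tau>0)
 thus ?case using pre_sigma_sets_P[OF S B(1)] mu.prob_space by (simp add: mu.bc_0 mult.commute emeasure_eq_measure)
next
 case (Suc n)
 note [measurable] = Suc.prems(1)
 let ?g = "%z. interp f (mu.lowr n z) (mu.uppr n z) z"
 have g: "?g \<in> borel_measurable borel" "\<bar>?g x\<bar> <= K" for x
  using interp_bound[of f K, OF Suc.prems(2)] by (auto simp: interp_def)
 show ?case
  using law_step[OF st(1)[of n] st(2) st(1) Suc.prems B] Suc.IH[OF g] mu.bc_interp[OF Suc.prems, of n] by simp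
qed

text \<open>The stages increase in time, and the expected duration stays bounded because
  \<open>Z\<close> remains in \<open>[c, d]\<close>; so their supremum is finite almost surely. Path
  continuity and \<open>mu.bc_limit\<close> carry the law of the stages over to the limit through
  cosines.\<close>

theorem embedded_step:
 "EX T. stopping_time F T & (\<forall>w\<in>space P. S w <= T w) &
  (AE w in P. (ALL v. S w <= v & v < T w --> M v w \<in> {l<..<r}) & (A w = 0 --> T w = S w)) &
  (\<forall>B\<in>sets (pre_sigma S). (\<forall>w\<in>B. A w ~= 0) --> (\<forall>E\<in>sets borel. prob (B \<inter> {w \<in> space P. Z T w \<in> E}) = prob B * mu.prob E))"
proof -
 obtain \<tau> where "ALL n. (stage n (\<tau> n) & (n = 0 --> \<tau> n = S)) & moves n (\<tau> n) (\<tau> (Suc n))"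
 proof (atomize_elim, rule dependent_nat_choice)
  show "EX T. stage 0 T & (0 = (0::nat) --> T = S)" using stage_0 by blast
  show "EX T'. (stage (Suc n) T' & (Suc n = 0 --> T' = S)) & moves n T T'" if "stage n T & (n = 0 --> T = S)" for T n
   using stage_Suc[of n T] that by blast
 qed
 hence sg: "stage n (\<tau> n)" and mv: "moves n (\<tau> n) (\<tau> (Suc n))" and \<tau>0: "\<tau> 0 = S" for n by auto
 have st: "stopping_time F (\<tau> n)" for n using sg[of n] by (simp add: stage_def)
 have ST: "S w <= \<tau> n w" if "w \<in> space P" for w n using sg[of n] that by (simp add: stage_def)
 have mono: "\<tau> n w <= \<tau> (Suc n) w" if "w \<in> space P" for w n using mv[of n] that by (simp add: moves_def)
 have \<tau>0': "0 <= \<tau> n w" if "w \<in> space P" for w n using ST[OF that] S0[OF that] by (rule order_trans[rotated])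
 have inv: "AE w in P. ALL n. (A w = 0 --> \<tau> n w = S w) & (A w ~= 0 --> Z (\<tau> n) w \<in> {c..d}) &
   (ALL v. S w <= v & v < \<tau> n w --> M v w \<in> {l<..<r})"
 proof (subst AE_all_countable, intro allI)
  fix n
  have "AE w in P. (A w = 0 --> \<tau> n w = S w) & (A w ~= 0 --> mu.bc n (Z (\<tau> n) w) = Z (\<tau> n) w & 0 < mu.prob (cell n (Z (\<tau> n) w))) &
   (ALL v. S w <= v & v < \<tau> n w --> M v w \<in> {l<..<r})" using sg[of n] unfolding stage_def by blast
  thus "AE w in P. (A w = 0 --> \<tau> n w = S w) & (A w ~= 0 --> Z (\<tau> n) w \<in> {c..d}) &
   (ALL v. S w <= v & v < \<tau> n w --> M v w \<in> {l<..<r})"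
   by eventually_elim (metis mu.bc_in)
 qed
 have bdd: "AE w in P. bdd_above (range (%n. \<tau> n w))"
 proof -
  have m1: "(%w. q \<eta> (Y w) (Y w + A w * k)) \<in> borel_measurable (pre_sigma S)" for k
  proof -
   note [measurable] = Y_measurable A_measurable
   show ?thesis by (intro q_measurable[OF eta_borel]) measurable
  qed
  note [measurable] = A_measurable m1[of c] m1[of d]
  \<comment> \<open>On \<open>Bj j\<close> every stage takes at most \<open>j\<close> in mean;
    monotone convergence makes the supremum of the stages finite there, and these events exhaust
    \<open>A w ~= 0\<close>.\<close>
  define Bj where "Bj j = {w \<in> space (pre_sigma S). A w ~= 0 & q \<eta> (Y w) (Y w + A w * c) <= ennreal (real j) & q \<eta> (Y w) (Y w + A w * d) <= ennreal (real j)}" for j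
  have B: "Bj j \<in> sets (pre_sigma S)" for j unfolding Bj_def by measurable
  note [measurable] = pre_sigma_sets_P[OF S B] sets_F_measurable_stopping[OF S] sets_F_measurable_stopping[OF st]
  have "AE w in P. w \<in> Bj j --> (SUP n. ennreal (\<tau> n w - S w)) < \<infinity>" for j
  proof -
   have le: "(\<integral>\<^sup>+w. ind (Bj j) w * ennreal (\<tau> n w - S w) \<partial>P) <= ennreal (real j)" for n
   proof -
    have "(\<integral>\<^sup>+w. ind (Bj j) w * ennreal (\<tau> n w - S w) \<partial>P) = (\<integral>\<^sup>+w. ind (Bj j) w * q \<eta> (M (S w) w) (M (\<tau> n w) w) \<partial>P)"
    proof (rule duration[OF S st S0 ST B])
     show "AE w in P. w \<in> Bj j --> (ALL v. S w < v & v < \<tau> n w --> M v w \<in> {l<..<r})" using inv by eventually_elim auto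
    qed
    also have "... <= (\<integral>\<^sup>+w. ennreal (real j) \<partial>P)"
    proof (rule nn_integral_mono_AE, use inv in eventually_elim)
     case (elim w)
     show ?case
     proof (cases "w \<in> Bj j")
      case True
      hence b: "A w ~= 0" "q \<eta> (Y w) (Y w + A w * c) <= ennreal (real j)" "q \<eta> (Y w) (Y w + A w * d) <= ennreal (real j)" by (auto simp: Bj_def)
      have z: "c <= Z (\<tau> n) w" "Z (\<tau> n) w <= d" using elim b(1) by auto
      have Ap: "0 < A w" using A_pos[OF b(1)] by simp
      have e: "M (\<tau> n w) w = Y w + A w * Z (\<tau> n) w" by (rule M_eq[OF b(1)])
      have "q \<eta> (Y w) (M (\<tau> n w) w) <= ennreal (real j)"
      proof (cases "Z (\<tau> n) w <= 0")
       case True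
       hence "q \<eta> (Y w) (M (\<tau> n w) w) <= q \<eta> (Y w) (Y w + A w * c)"
        unfolding e using z Ap by (intro q_mono[OF eta_borel]) (auto simp: mult_nonneg_nonpos)
       thus ?thesis using b(2) by (rule order_trans)
      next
       case False
       hence "q \<eta> (Y w) (M (\<tau> n w) w) <= q \<eta> (Y w) (Y w + A w * d)"
        unfolding e using z Ap by (intro q_mono[OF eta_borel]) auto
       thus ?thesis using b(3) by (rule order_trans)
      qed
      thus ?thesis using True by (simp add: Y_def)
     qed simp
    qed
    also have "... = ennreal (real j)" by (simp add: emeasure_space_1)
    finally show ?thesis .
   qed
   have "(\<integral>\<^sup>+w. (SUP n. ind (Bj j) w * ennreal (\<tau> n w - S w)) \<partial>P) = (SUP n. \<integral>\<^sup>+w. ind (Bj j) w * ennreal (\<tau> n w - S w) \<partial>P)"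
    by (rule nn_integral_monotone_convergence_SUP_AE) (auto intro!: AE_I2 mult_left_mono ennreal_leI mono)
   also have "... <= ennreal (real j)" by (rule SUP_least) (rule le)
   finally have "(\<integral>\<^sup>+w. (SUP n. ind (Bj j) w * ennreal (\<tau> n w - S w)) \<partial>P) ~= \<infinity>" by (auto simp: top_unique)
   from nn_integral_PInf_AE[OF _ this] have "AE w in P. (SUP n. ind (Bj j) w * ennreal (\<tau> n w - S w)) ~= \<infinity>" by measurable
   thus ?thesis by eventually_elim (auto simp: less_top[symmetric])
  qed
  hence "AE w in P. ALL j. w \<in> Bj j --> (SUP n. ennreal (\<tau> n w - S w)) < \<infinity>" by (subst AE_all_countable) blast
  thus ?thesis using inv AE_space
  proof eventually_elim
   case (elim w)
   show ?case
   proof (cases "A w = 0")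
    case True
    hence "\<tau> n w = S w" for n using elim(2) by blast
    thus ?thesis by (intro bdd_aboveI[of _ "S w"]) auto
   next
    case False
    have "q \<eta> (Y w) (Y w + A w * c) < \<infinity>" "q \<eta> (Y w) (Y w + A w * d) < \<infinity>"
     using reach[of "Y w"] A_pos[OF False] by (auto simp: A_def)
    then obtain u v where uv: "q \<eta> (Y w) (Y w + A w * c) = ennreal u" "q \<eta> (Y w) (Y w + A w * d) = ennreal v"
     by (cases "q \<eta> (Y w) (Y w + A w * c)"; cases "q \<eta> (Y w) (Y w + A w * d)") auto
    obtain j :: nat where "max u v <= real j" using real_arch_simple by blast
    hence "w \<in> Bj j" using False elim(3) uv by (auto simp: Bj_def space_pre_sigma intro!: ennreal_leI simp del: ennreal_of_nat_eq_real_of_nat)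
    hence fin: "(SUP n. ennreal (\<tau> n w - S w)) < \<infinity>" using elim(1) by blast
    then obtain K where K: "(SUP n. ennreal (\<tau> n w - S w)) = ennreal K" "0 <= K" by (cases "SUP n. ennreal (\<tau> n w - S w)") auto
    have "\<tau> n w <= S w + K" for n
    proof -
     have "ennreal (\<tau> n w - S w) <= ennreal K" unfolding K(1)[symmetric] by (rule SUP_upper) simp
     thus ?thesis using K(2) by (simp add: ennreal_le_iff)
    qed
    thus ?thesis by (intro bdd_aboveI[of _ "S w + K"]) auto
   qed
  qed
 qed
 \<comment> \<open>Unbounded sequences occur only on a null set, where the time is reset to
   \<open>S\<close>.\<close>
 define T where "T w = (if bdd_above (range (%n. \<tau> n w)) then (SUP n. \<tau> n w) else S w)" for w
 have STT: "S w <= T w" if "w \<in> space P" for w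
  using cSUP_upper[of 0 UNIV "%n. \<tau> n w"] by (simp add: T_def \<tau>0)
 have T0: "0 <= T w" if "w \<in> space P" for w using STT[OF that] S0[OF that] by simp
 obtain N where N: "N \<in> null_sets P" "{w \<in> space P. ~ bdd_above (range (%n. \<tau> n w))} \<subseteq> N"
  using AE_E[OF bdd] by (metis (mono_tags, lifting) null_setsI)
 have stop: "stopping_time F T"
 proof
  fix t
  show "Measurable.pred (F t) (%w. T w <= t)"
  proof (cases "0 <= t")
   case False
   have "~ T w <= t" if "w \<in> space P" for w using T0[OF that] False by linarith
   hence "{w \<in> space P. T w <= t} = {}" by blast
   thus ?thesis by (simp only: pred_def space_F sets.empty_sets)
  next
   case True
   have iff: "T w <= t \<longleftrightarrow> (ALL n. \<tau> n w <= t) | (S w <= t & ~ bdd_above (range (%n. \<tau> n w)))" for w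
   proof (cases "bdd_above (range (%n. \<tau> n w))")
    case bb: True
    thus ?thesis using cSUP_le_iff[of UNIV "%n. \<tau> n w" t] by (simp add: T_def)
   next
    case False
    moreover have "~ (ALL n. \<tau> n w <= t)"
    proof
     assume "ALL n. \<tau> n w <= t"
     hence "bdd_above (range (%n. \<tau> n w))" by (intro bdd_aboveI[of _ t]) auto
     with False show False by contradiction
    qed
    ultimately show ?thesis unfolding T_def by (metis (full_types))
   qed
   have "{w \<in> space P. ALL n. \<tau> n w <= t} \<in> sets (F t)"
    using pred_intros_countable(1)[OF stopping_timeD[OF st]] by (simp add: pred_def space_F)
   moreover have "{w \<in> space P. S w <= t & ~ bdd_above (range (%n. \<tau> n w))} \<in> sets (F t)"
    by (rule null_in_F[OF N(1) order_trans[OF _ N(2)] True]) auto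
   ultimately have "{w \<in> space P. ALL n. \<tau> n w <= t} \<union> {w \<in> space P. S w <= t & ~ bdd_above (range (%n. \<tau> n w))} \<in> sets (F t)" by (rule sets.Un)
   also have "{w \<in> space P. ALL n. \<tau> n w <= t} \<union> {w \<in> space P. S w <= t & ~ bdd_above (range (%n. \<tau> n w))} = {w \<in> space P. T w <= t}"
    unfolding iff by blast
   finally show ?thesis by (simp add: pred_def space_F)
  qed
 qed
 have lim: "AE w in P. (%n. \<tau> n w) \<longlonglongrightarrow> T w & (%n. M (\<tau> n w) w) \<longlonglongrightarrow> M (T w) w"
  using bdd AE_space
 proof eventually_elim
  case (elim w)
  have "incseq (%n. \<tau> n w)" using mono[OF elim(2)] by (intro incseq_SucI)
  hence l: "(%n. \<tau> n w) \<longlonglongrightarrow> T w" using LIMSEQ_incseq_SUP[OF elim(1)] elim(1) by (simp add: T_def)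
  have "(%n. M (\<tau> n w) w) \<longlonglongrightarrow> M (T w) w"
   by (rule continuous_on_tendsto_compose[OF M_path[OF elim(2)] l]) (use T0 \<tau>0' elim(2) in auto)
  with l show ?case ..
 qed
 have inside: "AE w in P. (ALL v. S w <= v & v < T w --> M v w \<in> {l<..<r}) & (A w = 0 --> T w = S w)"
  using inv lim
 proof eventually_elim
  case (elim w)
  have "M v w \<in> {l<..<r}" if "S w <= v" "v < T w" for v
  proof -
   have "\<forall>\<^sub>F n in sequentially. v < \<tau> n w" using order_tendstoD(1)[of _ "T w"] elim(2) that by blast
   then obtain n where "v < \<tau> n w" using eventually_happens'[OF sequentially_bot] by blast
   thus ?thesis using elim(1) that by blast
  qed
  moreover have "T w = S w" if "A w = 0"
  proof -
   have "\<tau> n w = S w" for n using elim(1) that by blast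
   hence "(%n. S w) \<longlonglongrightarrow> T w" using elim(2) by simp
   thus ?thesis using LIMSEQ_unique[OF _ tendsto_const] by blast
  qed
  ultimately show ?case by blast
 qed
 have law: "prob (B \<inter> {w \<in> space P. Z T w \<in> E}) = prob B * mu.prob E"
  if B: "B \<in> sets (pre_sigma S)" "\<forall>w\<in>B. A w ~= 0" and E: "E \<in> sets borel" for B E
 proof -
  have ZP[measurable]: "Z T \<in> borel_measurable P" by (rule pre_sigma_measurable_P[OF stop Z_measurable[OF stop STT]])
  have Zn[measurable]: "Z (\<tau> n) \<in> borel_measurable P" for n by (rule pre_sigma_measurable_P[OF st Z_measurable[OF st ST]])
  note BP[measurable] = pre_sigma_sets_P[OF S B(1)]
  \<comment> \<open>For bounded continuous test functions both sides of \<open>law_stage\<close>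
    converge; cosines suffice by \<open>finite_measure_eqI_cos\<close>, applied to the law of
    \<open>Z T\<close> weighted by \<open>B\<close> and to \<open>\<mu>\<close> scaled by
    \<open>prob B\<close>.\<close>
  have cosP: "expectation (%w. ind B w * (1 + cos (u * Z T w + th))) = prob B * (\<integral>x. 1 + cos (u * x + th) \<partial>\<mu>)" for u th
  proof (rule LIMSEQ_unique)
   have b: "\<bar>1 + cos x\<bar> <= 2" for x :: real using cos_le_one[of x] cos_ge_minus_one[of x] by linarith
   show "(%n. expectation (%w. ind B w * (1 + cos (u * Z (\<tau> n) w + th)))) \<longlonglongrightarrow> expectation (%w. ind B w * (1 + cos (u * Z T w + th)))"
   proof (rule integral_dominated_convergence[where w="%_. 2"])
    show "AE w in P. (%n. ind B w * (1 + cos (u * Z (\<tau> n) w + th))) \<longlonglongrightarrow> ind B w * (1 + cos (u * Z T w + th))"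
     using lim
    proof eventually_elim
     case (elim w)
     have "(%n. Z (\<tau> n) w) \<longlonglongrightarrow> Z T w" unfolding Z_def divide_inverse using elim by (intro tendsto_mult tendsto_diff tendsto_const) blast
     thus ?case by (intro tendsto_intros)
    qed
    show "AE w in P. norm (ind B w * (1 + cos (u * Z (\<tau> n) w + th))) <= 2" for n
     by (rule AE_I2) (use b in \<open>auto split: split_indicator\<close>)
   qed auto
   have "expectation (%w. ind B w * (1 + cos (u * Z (\<tau> n) w + th))) = prob B * (\<integral>x. 1 + cos (u * mu.bc n x + th) \<partial>\<mu>)" for n
    by (rule law_stage[where f="%z. 1 + cos (u * z + th)" and K=2, OF sg mv \<tau>0 _ b B(1)]) (use B(2) in auto)
   moreover have "(%n. \<integral>x. 1 + cos (u * mu.bc n x + th) \<partial>\<mu>) \<longlonglongrightarrow> (\<integral>x. 1 + cos (u * x + th) \<partial>\<mu>)"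
   proof (rule integral_dominated_convergence[where w="%_. 2"])
    show "AE x in \<mu>. (%n. 1 + cos (u * mu.bc n x + th)) \<longlonglongrightarrow> 1 + cos (u * x + th)"
     using mu.bc_limit by eventually_elim (intro tendsto_intros)
   qed (use b in auto)
   ultimately show "(%n. expectation (%w. ind B w * (1 + cos (u * Z (\<tau> n) w + th)))) \<longlonglongrightarrow> prob B * (\<integral>x. 1 + cos (u * x + th) \<partial>\<mu>)"
    by (simp add: tendsto_mult_left)
  qed
  let ?N1 = "distr (density P (ind B)) borel (Z T)" and ?N2 = "scale_measure (ennreal (prob B)) \<mu>"
  have e1: "emeasure ?N1 E' = ennreal (prob (B \<inter> {w \<in> space P. Z T w \<in> E'}))" if E': "E' \<in> sets borel" for E'
  proof -
   have "emeasure ?N1 E' = (\<integral>\<^sup>+w. ind B w * ind (Z T -` E' \<inter> space P) w \<partial>P)"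
    using E' by (subst emeasure_distr) (auto simp: emeasure_density)
   also have "... = (\<integral>\<^sup>+w. ind (B \<inter> {w \<in> space P. Z T w \<in> E'}) w \<partial>P)"
    by (intro nn_integral_cong) (auto split: split_indicator)
   also have "... = ennreal (prob (B \<inter> {w \<in> space P. Z T w \<in> E'}))" using E' by (simp add: emeasure_eq_measure)
   finally show ?thesis .
  qed
  have "?N1 = ?N2"
  proof (rule finite_measure_eqI_cos)
   show "finite_measure ?N1" using e1[of UNIV] by (intro finite_measureI) simp
   show "finite_measure ?N2" by (intro finite_measureI) (simp add: space_scale_measure mu.emeasure_space_1)
   show "(\<integral>\<^sup>+z. ennreal (1 + cos (u * z + th)) \<partial>?N1) = (\<integral>\<^sup>+z. ennreal (1 + cos (u * z + th)) \<partial>?N2)" for u th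
   proof -
    have p: "0 <= 1 + cos x" and b: "1 + cos x <= 2" for x :: real using cos_le_one[of x] cos_ge_minus_one[of x] by linarith+
    have "(\<integral>\<^sup>+z. ennreal (1 + cos (u * z + th)) \<partial>?N1) = (\<integral>\<^sup>+w. ind B w * ennreal (1 + cos (u * Z T w + th)) \<partial>P)"
     by (subst nn_integral_distr) (auto simp: nn_integral_density)
    also have "... = (\<integral>\<^sup>+w. ennreal (ind B w * (1 + cos (u * Z T w + th))) \<partial>P)"
     by (intro nn_integral_cong) (auto split: split_indicator)
    also have "... = ennreal (expectation (%w. ind B w * (1 + cos (u * Z T w + th))))"
     using p b by (intro nn_integral_eq_integral integrable_const_bound[where B=2] AE_I2) (auto split: split_indicator)
    also have "... = ennreal (prob B) * ennreal (\<integral>x. 1 + cos (u * x + th) \<partial>\<mu>)"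
     unfolding cosP using p by (intro ennreal_mult integral_nonneg) auto
    also have "ennreal (\<integral>x. 1 + cos (u * x + th) \<partial>\<mu>) = (\<integral>\<^sup>+x. ennreal (1 + cos (u * x + th)) \<partial>\<mu>)"
     using p b by (intro nn_integral_eq_integral[symmetric] mu.integrable_const_bound[where B=2] AE_I2) auto
    also have "ennreal (prob B) * (\<integral>\<^sup>+x. ennreal (1 + cos (u * x + th)) \<partial>\<mu>) = (\<integral>\<^sup>+z. ennreal (1 + cos (u * z + th)) \<partial>?N2)"
     by (subst nn_integral_scale_measure) auto
    finally show ?thesis .
   qed
  qed (simp_all add: mu.mu_sets)
  hence "ennreal (prob (B \<inter> {w \<in> space P. Z T w \<in> E})) = ennreal (prob B) * emeasure \<mu> E" using e1[OF E] by simp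
  thus ?thesis by (simp add: mu.emeasure_eq_measure ennreal_mult[symmetric])
 qed
 have 1: "\<forall>w\<in>space P. S w <= T w" using STT ..
 have 2: "\<forall>B\<in>sets (pre_sigma S). (\<forall>w\<in>B. A w ~= 0) --> (\<forall>E\<in>sets borel. prob (B \<inter> {w \<in> space P. Z T w \<in> E}) = prob B * mu.prob E)"
  by (intro ballI impI) (rule law, assumption+)
 note all = conjI[OF stop conjI[OF 1 conjI[OF inside 2]]]
 show ?thesis by (rule exI[of _ T]) (rule all)
qed

end

text \<open>The hypothesis on rectangles says that, under \<open>P\<close> weighted by
  \<open>B\<close>, the pair has a product law. Integrating out the second component then works for
  every nonnegative Borel function of the pair.\<close>

lemma (in prob_space) nn_integral_independent:
 fixes U V :: "'a => real" and f :: "real \<times> real => ennreal"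
 assumes \<mu>: "prob_space \<mu>" "sets \<mu> = sets borel"
  and U[measurable]: "U \<in> borel_measurable M" and V[measurable]: "V \<in> borel_measurable M" and B[measurable]: "B \<in> sets M"
  and rect: "!!E E'. E \<in> sets borel ==> E' \<in> sets borel ==>
   prob (B \<inter> {w \<in> space M. U w \<in> E & V w \<in> E'}) = prob (B \<inter> {w \<in> space M. U w \<in> E}) * measure \<mu> E'"
  and f[measurable]: "f \<in> borel_measurable (borel \<Otimes>\<^sub>M borel)"
 shows "(\<integral>\<^sup>+w. ind B w * f (U w, V w) \<partial>M) = (\<integral>\<^sup>+w. ind B w * (\<integral>\<^sup>+x. f (U w, x) \<partial>\<mu>) \<partial>M)"
proof -
 interpret mu: prob_space \<mu> by fact
 note [measurable_cong] = \<mu>(2)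
 define N where "N = distr (density M (ind B)) borel U"
 define K where "K = distr (density M (ind B)) (borel \<Otimes>\<^sub>M borel) (%w. (U w, V w))"
 have eN: "emeasure N E = ennreal (prob (B \<inter> {w \<in> space M. U w \<in> E}))" if [measurable]: "E \<in> sets borel" for E
 proof -
  have "emeasure N E = (\<integral>\<^sup>+w. ind B w * ind (U -` E \<inter> space M) w \<partial>M)"
   unfolding N_def by (subst emeasure_distr) (auto simp: emeasure_density)
  also have "... = (\<integral>\<^sup>+w. ind (B \<inter> {w \<in> space M. U w \<in> E}) w \<partial>M)"
   by (intro nn_integral_cong) (auto split: split_indicator)
  also have "... = ennreal (prob (B \<inter> {w \<in> space M. U w \<in> E}))" by (simp add: emeasure_eq_measure)
  finally show ?thesis .
 qed
 have eK: "emeasure K (E \<times> E') = ennreal (prob (B \<inter> {w \<in> space M. U w \<in> E & V w \<in> E'}))" if [measurable]: "E \<in> sets borel" "E' \<in> sets borel" for E E'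
 proof -
  have "emeasure K (E \<times> E') = (\<integral>\<^sup>+w. ind B w * ind ((%w. (U w, V w)) -` (E \<times> E') \<inter> space M) w \<partial>M)"
   unfolding K_def by (subst emeasure_distr) (auto simp: emeasure_density)
  also have "... = (\<integral>\<^sup>+w. ind (B \<inter> {w \<in> space M. U w \<in> E & V w \<in> E'}) w \<partial>M)"
   by (intro nn_integral_cong) (auto split: split_indicator)
  also have "... = ennreal (prob (B \<inter> {w \<in> space M. U w \<in> E & V w \<in> E'}))" by (simp add: emeasure_eq_measure)
  finally show ?thesis .
 qed
 have sN[measurable_cong]: "sets N = sets borel" by (simp add: N_def)
 interpret N: finite_measure N using eN[of UNIV] by (intro finite_measureI) (simp add: N_def)
 have NK: "N \<Otimes>\<^sub>M \<mu> = K"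
 proof (rule pair_measure_eqI)
  show "sets (N \<Otimes>\<^sub>M \<mu>) = sets K" unfolding K_def using sets_pair_measure_cong[OF sN \<mu>(2)] by simp
  show "emeasure N E * emeasure \<mu> E' = emeasure K (E \<times> E')" if "E \<in> sets N" "E' \<in> sets \<mu>" for E E'
   using that eN eK rect by (simp add: sN \<mu>(2) mu.emeasure_eq_measure ennreal_mult[symmetric])
 qed (unfold_locales)
 have "(\<integral>\<^sup>+w. ind B w * f (U w, V w) \<partial>M) = (\<integral>\<^sup>+z. f z \<partial>K)"
  unfolding K_def by (subst nn_integral_distr) (auto simp: nn_integral_density)
 also have "... = (\<integral>\<^sup>+u. \<integral>\<^sup>+x. f (u, x) \<partial>\<mu> \<partial>N)"
  unfolding NK[symmetric] by (rule mu.nn_integral_fst[symmetric]) measurable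
 also have "... = (\<integral>\<^sup>+w. ind B w * (\<integral>\<^sup>+x. f (U w, x) \<partial>\<mu>) \<partial>M)"
  unfolding N_def by (subst nn_integral_distr) (auto simp: nn_integral_density)
 finally show ?thesis .
qed

section \<open>A complete step: embedding, waiting at the endpoints, joint law\<close>

context usual_filtration
begin

lemma stopping_time_later:
 assumes T: "stopping_time F T" and f: "f \<in> borel_measurable (pre_sigma T)" and le: "!!w. w \<in> space P ==> T w <= f w"
 shows "stopping_time F f"
proof
 fix t
 have "{w \<in> space (pre_sigma T). f w <= t} \<in> sets (pre_sigma T)" using f by measurable
 from sets_pre_sigmaD[OF T this, of t] have "{w \<in> {w \<in> space P. f w <= t}. T w <= t} \<in> sets (F t)" by (simp add: space_pre_sigma)
 also have "{w \<in> {w \<in> space P. f w <= t}. T w <= t} = {w \<in> space P. f w <= t}" using le by (auto intro: order_trans)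
 finally show "Measurable.pred (F t) (%w. f w <= t)" by (simp add: pred_def space_F)
qed

end

locale embedding = weak_sol_nz P F W M \<eta> m l r + mu: bounded_centred \<mu> c d
 for P :: "'a measure" and F W M \<eta> m l r \<mu> c d +
 fixes a :: "real => real" and \<epsilon> :: real
 assumes a_borel: "a \<in> borel_measurable borel" and a_nonneg: "!!y. 0 <= a y" and a_zero: "!!y. y ~: {l<..<r} ==> a y = 0"
  and reach: "!!y. y \<in> {l<..<r} ==> l <= y + a y * c & y + a y * d <= r & q \<eta> y (y + a y * c) < \<infinity> & q \<eta> y (y + a y * d) < \<infinity>"
  and eps: "0 <= \<epsilon>"
  and G_le: "!!y. y \<in> {l<..<r} ==> G \<mu> \<eta> y (a y) <= ennreal \<epsilon>"
  and G_less: "!!y. y \<in> {l<..<r} ==> G \<mu> \<eta> y (a y) < ennreal \<epsilon> ==> 0 < measure \<mu> {x. y + a y * x ~: {l<..<r}}"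
begin

lemma G_outside: "y ~: {l<..<r} ==> G \<mu> \<eta> y (a y) = 0"
 by (simp add: G_def a_zero q_self)

lemma G_measurable: "(%y. G \<mu> \<eta> y (a y)) \<in> borel_measurable borel"
proof -
 note [measurable] = a_borel
 have "(%z. q \<eta> (fst z) (fst z + a (fst z) * snd z)) \<in> borel_measurable (borel \<Otimes>\<^sub>M \<mu>)"
  by (intro q_measurable[OF eta_borel]) measurable
 hence "(%(y, x). q \<eta> y (y + a y * x)) \<in> borel_measurable (borel \<Otimes>\<^sub>M \<mu>)" by (simp add: case_prod_beta')
 thus ?thesis unfolding G_def by (rule mu.borel_measurable_nn_integral)
qed

text \<open>The waiting time for starting point \<open>y\<close>, spent only if the step ends
  outside the open interval. Dividing the missing time by the probability of this event makes its
  mean contribution exactly the deficit. For \<open>y\<close> outside the interval that probability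
  is 1, and the whole \<open>\<epsilon>\<close> is spent waiting.\<close>

definition waste :: "real => real" where
 "waste y = (\<epsilon> - enn2real (G \<mu> \<eta> y (a y))) / measure \<mu> {x. y + a y * x ~: {l<..<r}}"

lemma out_measurable: "(%y. measure \<mu> {x. y + a y * x ~: {l<..<r}}) \<in> borel_measurable borel"
proof -
 note [measurable] = a_borel
 have "(%y. \<integral>\<^sup>+x. ind (- {l<..<r}) (y + a y * x) \<partial>\<mu>) \<in> borel_measurable borel" by measurable
 also have "(%y. \<integral>\<^sup>+x. ind (- {l<..<r}) (y + a y * x) \<partial>\<mu>) = (%y. emeasure \<mu> {x. y + a y * x ~: {l<..<r}})"
 proof
  fix y
  have [measurable]: "{x. y + a y * x ~: {l<..<r}} \<in> sets borel" by measurable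
  have "(\<integral>\<^sup>+x. ind (- {l<..<r}) (y + a y * x) \<partial>\<mu>) = (\<integral>\<^sup>+x. ind {x. y + a y * x ~: {l<..<r}} x \<partial>\<mu>)"
   by (intro nn_integral_cong) (auto split: split_indicator)
  thus "(\<integral>\<^sup>+x. ind (- {l<..<r}) (y + a y * x) \<partial>\<mu>) = emeasure \<mu> {x. y + a y * x ~: {l<..<r}}" by simp
 qed
 finally show ?thesis unfolding measure_def by measurable
qed

lemma waste_measurable: "waste \<in> borel_measurable borel"
proof -
 note [measurable] = G_measurable out_measurable
 show ?thesis unfolding waste_def[abs_def] by measurable
qed

lemma G_le': "G \<mu> \<eta> y (a y) <= ennreal \<epsilon>"
 using G_le[of y] G_outside[of y] by (cases "y \<in> {l<..<r}") auto

lemma enn2real_G: "ennreal (enn2real (G \<mu> \<eta> y (a y))) = G \<mu> \<eta> y (a y)" "enn2real (G \<mu> \<eta> y (a y)) <= \<epsilon>"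
proof -
 have "G \<mu> \<eta> y (a y) < \<top>" using G_le'[of y] by (rule order_le_less_trans) simp
 thus e: "ennreal (enn2real (G \<mu> \<eta> y (a y))) = G \<mu> \<eta> y (a y)" by simp
 show "enn2real (G \<mu> \<eta> y (a y)) <= \<epsilon>" using eps G_le'[of y] by (rule enn2real_leI)
qed

lemma waste_nonneg: "0 <= waste y"
 unfolding waste_def using enn2real_G(2)[of y] by simp

lemma waste_balance: "G \<mu> \<eta> y (a y) + ennreal (waste y) * (\<integral>\<^sup>+x. ind (- {l<..<r}) (y + a y * x) \<partial>\<mu>) = ennreal \<epsilon>"
proof -
 let ?E = "{x. y + a y * x ~: {l<..<r}}" and ?g = "enn2real (G \<mu> \<eta> y (a y))"
 have [measurable]: "?E \<in> sets borel" by measurable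
 have "(\<integral>\<^sup>+x. ind (- {l<..<r}) (y + a y * x) \<partial>\<mu>) = (\<integral>\<^sup>+x. ind ?E x \<partial>\<mu>)"
  by (intro nn_integral_cong) (auto split: split_indicator)
 hence e: "(\<integral>\<^sup>+x. ind (- {l<..<r}) (y + a y * x) \<partial>\<mu>) = ennreal (mu.prob ?E)" by (simp add: mu.emeasure_eq_measure)
 have "waste y * mu.prob ?E = \<epsilon> - ?g"
 proof (cases "mu.prob ?E = 0")
  \<comment> \<open>The default of the division by zero is right: with probability 0 of ending
    outside, \<open>G_less\<close> rules out a deficit, and a starting point outside would make the
    probability 1.\<close>
  case True
  have "?E = UNIV" if "y ~: {l<..<r}" using that by (simp add: a_zero)
  hence y: "y \<in> {l<..<r}" using True mu.prob_UNIV by force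
  have "~ G \<mu> \<eta> y (a y) < ennreal \<epsilon>" using G_less[OF y] True by auto
  hence "G \<mu> \<eta> y (a y) = ennreal \<epsilon>" using G_le'[of y] by simp
  thus ?thesis using True eps by simp
 qed (simp add: waste_def)
 hence "?g + waste y * mu.prob ?E = \<epsilon>" by simp
 hence "ennreal \<epsilon> = ennreal ?g + ennreal (waste y) * ennreal (mu.prob ?E)"
  using waste_nonneg[of y] by (simp add: ennreal_plus[symmetric] ennreal_mult[symmetric] del: ennreal_plus)
 thus ?thesis unfolding e enn2real_G(1) ..
qed

text \<open>The third conjunct, over all events of \<open>pre_sigma S\<close>, says that the
  duration has conditional mean \<open>\<epsilon>\<close>. The last one says that, given the past,
  the new position is the old one plus \<open>a\<close> times an independent sample of
  \<open>\<mu>\<close>. Nonnegative integrals avoid any integrability side condition.\<close>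

definition next_stop :: "('a => real) => ('a => real) => bool" where
 "next_stop S T \<longleftrightarrow> stopping_time F T & (\<forall>w\<in>space P. S w <= T w) &
  (\<forall>B\<in>sets (pre_sigma S). (\<integral>\<^sup>+w. ind B w * ennreal (T w - S w) \<partial>P) = ennreal \<epsilon> * emeasure P B) &
  (\<forall>B\<in>sets (pre_sigma S). \<forall>f\<in>borel_measurable (borel \<Otimes>\<^sub>M borel).
   (\<integral>\<^sup>+w. ind B w * f (M (S w) w, M (T w) w) \<partial>P) =
   (\<integral>\<^sup>+w. ind B w * (\<integral>\<^sup>+x. f (M (S w) w, M (S w) w + a (M (S w) w) * x) \<partial>\<mu>) \<partial>P))"

text \<open>The embedded step takes \<open>G\<close> at its starting point in conditional mean, by
  \<open>duration\<close> and the joint law. Waiting afterwards fills the gap up to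
  \<open>\<epsilon>\<close> without changing the position, by \<open>absorption\<close>.\<close>

theorem next_time:
 assumes S: "stopping_time F S" and S0: "!!w. w \<in> space P ==> 0 <= S w"
 shows "EX T. next_stop S T"
proof -
 interpret E: embedding_step P F W M \<eta> m l r \<mu> c d a S
  by unfold_locales (fact a_borel a_nonneg a_zero reach S S0)+
 obtain T where T: "stopping_time F T" and ST: "\<forall>w\<in>space P. S w <= T w"
  and in_: "AE w in P. (ALL v. S w <= v & v < T w --> M v w \<in> {l<..<r}) & (E.A w = 0 --> T w = S w)"
  and law: "\<forall>B\<in>sets (pre_sigma S). (\<forall>w\<in>B. E.A w ~= 0) --> (\<forall>E\<in>sets borel. prob (B \<inter> {w \<in> space P. E.Z T w \<in> E}) = prob B * mu.prob E)"
  by (rule exE[OF E.embedded_step]) (elim conjE, rule that)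
 have ST': "S w <= T w" and T0: "0 <= T w" if "w \<in> space P" for w using ST S0[OF that] that by force+
 note YS[measurable] = E.Y_measurable
 note [measurable] = pre_sigma_measurable_P[OF S YS] M_at_measurable[OF sets_F_measurable_stopping[OF T] T0] sets_F_measurable_stopping[OF T] sets_F_measurable_stopping[OF S] a_borel waste_measurable
 have YM: "M (S w) w = E.Y w" for w by (simp add: E.Y_def)
 have joint: "(\<integral>\<^sup>+w. ind B w * f (E.Y w, M (T w) w) \<partial>P) = (\<integral>\<^sup>+w. ind B w * (\<integral>\<^sup>+x. f (E.Y w, E.Y w + a (E.Y w) * x) \<partial>\<mu>) \<partial>P)"
  if B: "B \<in> sets (pre_sigma S)" and f[measurable]: "f \<in> borel_measurable (borel \<Otimes>\<^sub>M borel)" for B and f :: "real \<times> real => ennreal"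
 proof -
  \<comment> \<open>The independence statement covers only nonzero scale factors. On the rest of
    \<open>B\<close> the step neither takes time nor moves, and the inner integral over
    \<open>\<mu>\<close> is constant.\<close>
  define D where "D = B \<inter> {w \<in> space (pre_sigma S). E.A w ~= 0}"
  note [measurable] = E.A_measurable
  have DS: "D \<in> sets (pre_sigma S)" unfolding D_def using B by measurable
  note [measurable] = pre_sigma_sets_P[OF S B] pre_sigma_sets_P[OF S DS] pre_sigma_measurable_P[OF T E.Z_measurable[OF T ST']]
  let ?f = "%(u, x). f (u, u + a u * x)" and ?R = "%w. \<integral>\<^sup>+x. f (E.Y w, E.Y w + a (E.Y w) * x) \<partial>\<mu>"
  have "(\<integral>\<^sup>+w. ind D w * ?f (E.Y w, E.Z T w) \<partial>P) = (\<integral>\<^sup>+w. ind D w * (\<integral>\<^sup>+x. ?f (E.Y w, x) \<partial>\<mu>) \<partial>P)"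
  proof (rule nn_integral_independent[OF mu.prob_space_axioms mu.mu_sets])
   show "prob (D \<inter> {w \<in> space P. E.Y w \<in> A & E.Z T w \<in> A'}) = prob (D \<inter> {w \<in> space P. E.Y w \<in> A}) * mu.prob A'"
    if A: "A \<in> sets borel" "A' \<in> sets borel" for A A'
   proof -
    have "D \<inter> {w \<in> space (pre_sigma S). E.Y w \<in> A} \<in> sets (pre_sigma S)" using DS A(1) by measurable
    moreover have "\<forall>w\<in>D \<inter> {w \<in> space (pre_sigma S). E.Y w \<in> A}. E.A w ~= 0" by (auto simp: D_def)
    ultimately have "prob (D \<inter> {w \<in> space P. E.Y w \<in> A} \<inter> {w \<in> space P. E.Z T w \<in> A'}) = prob (D \<inter> {w \<in> space P. E.Y w \<in> A}) * mu.prob A'"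
     using law A(2) unfolding space_pre_sigma by blast
    also have "D \<inter> {w \<in> space P. E.Y w \<in> A} \<inter> {w \<in> space P. E.Z T w \<in> A'} = D \<inter> {w \<in> space P. E.Y w \<in> A & E.Z T w \<in> A'}" by blast
    finally show ?thesis .
   qed
  qed measurable
  hence 1: "(\<integral>\<^sup>+w. ind D w * f (E.Y w, E.Y w + a (E.Y w) * E.Z T w) \<partial>P) = (\<integral>\<^sup>+w. ind D w * ?R w \<partial>P)" by simp
  have "AE w in P. ind B w * f (E.Y w, M (T w) w) = ind D w * f (E.Y w, E.Y w + a (E.Y w) * E.Z T w) + ind (B - D) w * ?R w"
   using in_ AE_space
  proof eventually_elim
   case (elim w)
   show ?case
   proof (cases "E.A w = 0")
    case True
    hence "a (E.Y w) = 0" "M (T w) w = E.Y w" "w ~: D" using elim by (auto simp: D_def E.A_def E.Y_def)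
    thus ?thesis by (auto simp: mu.emeasure_space_1 split: split_indicator)
   next
    case False
    hence "M (T w) w = E.Y w + a (E.Y w) * E.Z T w" using E.M_eq[of w T] by (simp add: E.A_def)
    thus ?thesis using False elim(2) by (auto simp: D_def space_pre_sigma split: split_indicator)
   qed
  qed
  hence "(\<integral>\<^sup>+w. ind B w * f (E.Y w, M (T w) w) \<partial>P) =
   (\<integral>\<^sup>+w. ind D w * f (E.Y w, E.Y w + a (E.Y w) * E.Z T w) + ind (B - D) w * ?R w \<partial>P)"
   by (rule nn_integral_cong_AE)
  also have "... = (\<integral>\<^sup>+w. ind D w * ?R w \<partial>P) + (\<integral>\<^sup>+w. ind (B - D) w * ?R w \<partial>P)"
   unfolding 1[symmetric] by (rule nn_integral_add) measurable
  also have "... = (\<integral>\<^sup>+w. ind D w * ?R w + ind (B - D) w * ?R w \<partial>P)"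
   by (rule nn_integral_add[symmetric]) measurable
  also have "... = (\<integral>\<^sup>+w. ind B w * ?R w \<partial>P)"
   by (intro nn_integral_cong) (auto simp: D_def split: split_indicator)
  finally show ?thesis .
 qed
 \<comment> \<open>This is known at time \<open>T\<close>: the final position is known then and the
   starting position even earlier. Hence adding it yields a stopping time.\<close>
 define \<Delta> where "\<Delta> w = ind (- {l<..<r}) (M (T w) w) * waste (E.Y w)" for w
 define T' where "T' w = T w + \<Delta> w" for w
 have \<Delta>0: "0 <= \<Delta> w" for w using waste_nonneg by (simp add: \<Delta>_def)
 have T': "stopping_time F T'"
 proof (rule stopping_time_later[OF T])
  note [measurable] = M_at_pre_sigma[OF T T0] pre_sigma_mono_measurable[OF S T ST' YS] measurable_stopping_time_pre_sigma[OF T]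
  show "T' \<in> borel_measurable (pre_sigma T)" unfolding T'_def[abs_def] \<Delta>_def by measurable
  show "T w <= T' w" for w using \<Delta>0 by (simp add: T'_def)
 qed
 have TT': "T w <= T' w" for w using \<Delta>0 by (simp add: T'_def)
 have same: "AE w in P. M (T' w) w = M (T w) w"
 proof -
  have "AE w in P. M (T w) w ~: {l<..<r} --> M (T' w) w = M (T w) w" by (rule absorption[OF T T' T0 TT'])
  thus ?thesis
  proof eventually_elim
   case (elim w)
   thus ?case by (cases "M (T w) w \<in> {l<..<r}") (simp_all add: T'_def \<Delta>_def)
  qed
 qed
 have dur: "(\<integral>\<^sup>+w. ind B w * ennreal (T' w - S w) \<partial>P) = ennreal \<epsilon> * emeasure P B" if B: "B \<in> sets (pre_sigma S)" for B
 proof -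
  note [measurable] = pre_sigma_sets_P[OF S B] G_measurable
  have [measurable]: "(%z. q \<eta> (fst z) (snd z)) \<in> borel_measurable (borel \<Otimes>\<^sub>M borel)" by (intro q_measurable[OF eta_borel]) measurable
  let ?wt = "%z. ind (- {l<..<r}) (snd z) * ennreal (waste (fst z)) :: ennreal"
  have "(\<integral>\<^sup>+w. ind B w * ennreal (T' w - S w) \<partial>P) = (\<integral>\<^sup>+w. ind B w * ennreal (T w - S w) + ind B w * ?wt (E.Y w, M (T w) w) \<partial>P)"
  proof (intro nn_integral_cong)
   fix w assume "w \<in> space P"
   hence "ennreal (T' w - S w) = ennreal (T w - S w) + ennreal (\<Delta> w)" using ST'[of w] \<Delta>0[of w] by (simp add: T'_def ennreal_plus[symmetric] del: ennreal_plus)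
   thus "ind B w * ennreal (T' w - S w) = ind B w * ennreal (T w - S w) + ind B w * ?wt (E.Y w, M (T w) w)"
    by (auto simp: \<Delta>_def split: split_indicator)
  qed
  also have "... = (\<integral>\<^sup>+w. ind B w * ennreal (T w - S w) \<partial>P) + (\<integral>\<^sup>+w. ind B w * ?wt (E.Y w, M (T w) w) \<partial>P)"
   by (rule nn_integral_add) measurable
  also have "(\<integral>\<^sup>+w. ind B w * ennreal (T w - S w) \<partial>P) = (\<integral>\<^sup>+w. ind B w * q \<eta> (M (S w) w) (M (T w) w) \<partial>P)"
  proof (rule duration[OF S T S0 ST' B])
   show "AE w in P. w \<in> B --> (ALL v. S w < v & v < T w --> M v w \<in> {l<..<r})" using in_ by eventually_elim auto
  qed
  also have "... = (\<integral>\<^sup>+w. ind B w * G \<mu> \<eta> (E.Y w) (a (E.Y w)) \<partial>P)"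
   unfolding YM G_def using joint[OF B, of "%z. q \<eta> (fst z) (snd z)"] by simp
  also have "(\<integral>\<^sup>+w. ind B w * ?wt (E.Y w, M (T w) w) \<partial>P) =
   (\<integral>\<^sup>+w. ind B w * (\<integral>\<^sup>+x. ?wt (E.Y w, E.Y w + a (E.Y w) * x) \<partial>\<mu>) \<partial>P)"
   by (rule joint[OF B]) measurable
  also have "(\<integral>\<^sup>+w. ind B w * G \<mu> \<eta> (E.Y w) (a (E.Y w)) \<partial>P) + ... =
   (\<integral>\<^sup>+w. ind B w * G \<mu> \<eta> (E.Y w) (a (E.Y w)) + ind B w * (\<integral>\<^sup>+x. ?wt (E.Y w, E.Y w + a (E.Y w) * x) \<partial>\<mu>) \<partial>P)"
   by (rule nn_integral_add[symmetric]) measurable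
  also have "... = (\<integral>\<^sup>+w. ennreal \<epsilon> * ind B w \<partial>P)"
  proof (intro nn_integral_cong)
   fix w
   have "(\<integral>\<^sup>+x. ?wt (E.Y w, E.Y w + a (E.Y w) * x) \<partial>\<mu>) = ennreal (waste (E.Y w)) * (\<integral>\<^sup>+x. ind (- {l<..<r}) (E.Y w + a (E.Y w) * x) \<partial>\<mu>)"
    by (subst nn_integral_cmult[symmetric]) (auto simp: mult.commute)
   thus "ind B w * G \<mu> \<eta> (E.Y w) (a (E.Y w)) + ind B w * (\<integral>\<^sup>+x. ?wt (E.Y w, E.Y w + a (E.Y w) * x) \<partial>\<mu>) = ennreal \<epsilon> * ind B w"
    using waste_balance[of "E.Y w"] by (auto split: split_indicator)
  qed
  also have "... = ennreal \<epsilon> * emeasure P B" by (simp add: nn_integral_cmult_indicator)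
  finally show ?thesis .
 qed
 have law': "(\<integral>\<^sup>+w. ind B w * f (M (S w) w, M (T' w) w) \<partial>P) =
   (\<integral>\<^sup>+w. ind B w * (\<integral>\<^sup>+x. f (M (S w) w, M (S w) w + a (M (S w) w) * x) \<partial>\<mu>) \<partial>P)"
  if "B \<in> sets (pre_sigma S)" "f \<in> borel_measurable (borel \<Otimes>\<^sub>M borel)" for B and f :: "real \<times> real => ennreal"
  unfolding YM joint[OF that, symmetric] by (rule nn_integral_cong_AE) (use same in \<open>eventually_elim, simp\<close>)
 have 1: "\<forall>w\<in>space P. S w <= T' w" using ST' TT' by (meson order_trans)
 show ?thesis unfolding next_stop_def by (rule exI[of _ T']) (intro conjI ballI T' 1[rule_format] dur law')
qed

end

section \<open>The embedded random walk\<close>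

lemma rwalk_eq: "rwalk m a X n w = rwalk m a (%k x. x k) n (%k. X k w)"
 by (induction n) auto

lemma rwalk_restrict: "k <= n ==> rwalk m a (%k x. x k) k (restrict x {..<n}) = rwalk m a (%k x. x k) k x"
 by (induction k) auto

lemma rwalk_measurable:
 assumes [measurable]: "a \<in> borel_measurable borel" "!!k. X k \<in> borel_measurable Q"
 shows "rwalk m a X n \<in> borel_measurable Q"
proof (induction n)
 case 0
 have "rwalk m a X 0 = (%_. m)" by (simp add: fun_eq_iff)
 thus ?case by simp
next
 case (Suc n)
 note [measurable] = Suc
 have "rwalk m a X (Suc n) = (%w. rwalk m a X n w + a (rwalk m a X n w) * X n w)" by (simp add: fun_eq_iff)
 thus ?case by simp
qed

lemma rwalk_measurable_PiM:
 assumes [measurable]: "a \<in> borel_measurable borel"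
 shows "k <= n ==> rwalk m a (%k x. x k) k \<in> borel_measurable (PiM {..<n} (%_. borel))"
proof (induction k)
 case 0
 have "rwalk m a (%k x. x k) 0 = (%_. m)" by (simp add: fun_eq_iff)
 thus ?case by simp
next
 case (Suc k)
 have [measurable]: "(%x. x k) \<in> borel_measurable (PiM {..<n} (%_. borel))" by (rule measurable_component_singleton) (use Suc.prems in simp)
 have [measurable]: "rwalk m a (%k x. x k) k \<in> borel_measurable (PiM {..<n} (%_. borel))" using Suc by simp
 have "rwalk m a (%k x. x k) (Suc k) = (%x. rwalk m a (%k x. x k) k x + a (rwalk m a (%k x. x k) k x) * x k)" by (simp add: fun_eq_iff)
 thus ?case by simp
qed

context prob_space
begin

text \<open>The walk up to index \<open>n\<close> is a function of the innovations with indices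
  below \<open>n\<close>, because \<open>X n\<close> first enters at \<open>Suc n\<close>; the
  blocks of indices below \<open>n\<close> and equal to \<open>n\<close> are independent.\<close>

lemma rwalk_independent:
 assumes X: "indep_vars (%_. borel) X UNIV" and a: "a \<in> borel_measurable borel"
  and A: "!!i. A i \<in> sets borel" and E: "E \<in> sets borel" "E' \<in> sets borel"
 shows "prob ({w \<in> space M. \<forall>i\<in>{..n}. rwalk m a X i w \<in> A i} \<inter> {w \<in> space M. rwalk m a X n w \<in> E & X n w \<in> E'}) =
  prob ({w \<in> space M. \<forall>i\<in>{..n}. rwalk m a X i w \<in> A i} \<inter> {w \<in> space M. rwalk m a X n w \<in> E}) * measure (distr M borel (X n)) E'"
proof -
 let ?wt = "rwalk m a (%k x. x k)" and ?P = "PiM {..<n} (%_. borel) :: (nat => real) measure" and ?R = "PiM {n} (%_. borel) :: (nat => real) measure"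
 have Xm[measurable]: "X k \<in> borel_measurable M" for k using X by (auto simp: indep_vars_def)
 define U where "U = {x \<in> space ?P. (\<forall>i\<in>{..n}. ?wt i x \<in> A i) & ?wt n x \<in> E}"
 define V where "V = {x \<in> space ?R. x n \<in> E'}"
 have "Measurable.pred ?P (%x. (\<forall>i\<in>{..n}. ?wt i x \<in> A i) & ?wt n x \<in> E)"
  by (intro pred_intros_logic pred_intros_finite pred_sets2[OF A] pred_sets2[OF E(1)] rwalk_measurable_PiM[OF a]) auto
 hence U: "U \<in> sets ?P" by (simp add: U_def pred_def)
 have "(%x. x n) \<in> borel_measurable ?R" by (rule measurable_component_singleton) simp
 hence V: "V \<in> sets ?R" unfolding V_def using E(2) by measurable
 have ind: "indep_var ?P (%w. restrict (%i. X i w) {..<n}) ?R (%w. restrict (%i. X i w) {n})"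
  by (rule indep_var_restrict[OF X]) auto
 have pre: "(%w. restrict (%i. X i w) {..<n}) -` U \<inter> space M = {w \<in> space M. \<forall>i\<in>{..n}. rwalk m a X i w \<in> A i} \<inter> {w \<in> space M. rwalk m a X n w \<in> E}"
  unfolding U_def rwalk_eq[of m a X] by (auto simp: rwalk_restrict space_PiM)
 have preV: "(%w. restrict (%i. X i w) {n}) -` V \<inter> space M = X n -` E' \<inter> space M"
  unfolding V_def by (auto simp: space_PiM)
 have "{w \<in> space M. \<forall>i\<in>{..n}. rwalk m a X i w \<in> A i} \<inter> {w \<in> space M. rwalk m a X n w \<in> E & X n w \<in> E'} =
   ((%w. restrict (%i. X i w) {..<n}) -` U \<inter> space M) \<inter> ((%w. restrict (%i. X i w) {n}) -` V \<inter> space M)"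
  unfolding pre preV by auto
 also have "... = (%w. (restrict (%i. X i w) {..<n}, restrict (%i. X i w) {n})) -` (U \<times> V) \<inter> space M" by auto
 finally have "prob ({w \<in> space M. \<forall>i\<in>{..n}. rwalk m a X i w \<in> A i} \<inter> {w \<in> space M. rwalk m a X n w \<in> E & X n w \<in> E'}) =
   prob ((%w. restrict (%i. X i w) {..<n}) -` U \<inter> space M) * prob ((%w. restrict (%i. X i w) {n}) -` V \<inter> space M)"
  using indep_varD[OF ind U V] by simp
 thus ?thesis unfolding pre preV using E(2) by (simp add: measure_distr)
qed

end

context embedding
begin

text \<open>Times are chosen one after the other by \<open>next_time\<close>. Equality of the path
  laws needs only cylinder events, which are compared by induction through the common Markov
  transition; the conditional expectation is characterised by its integrals over past
  events.\<close>

theorem random_walk_embedding: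
 fixes Q :: "'b measure" and X :: "nat => 'b => real"
 assumes Q: "prob_space Q" and X: "prob_space.indep_vars Q (%_. borel) X UNIV" and law: "ALL k. distr Q borel (X k) = \<mu>"
 shows "\<exists>\<tau> :: nat => 'a => real.
  (\<forall>w\<in>space P. \<tau> 0 w = 0) & (ALL k. \<forall>w\<in>space P. 0 <= \<tau> k w & \<tau> k w <= \<tau> (Suc k) w) & (ALL k. stopping_time F (\<tau> k)) &
  distr P (Pi\<^sub>M UNIV (%_. borel)) (%w k. M (\<tau> k w) w) = distr Q (Pi\<^sub>M UNIV (%_. borel)) (%w k. rwalk m a X k w) &
  (ALL k. AE w in P. nn_cond_exp P (pre_sigma (\<tau> k)) (%w. ennreal (\<tau> (Suc k) w)) w = ennreal (\<tau> k w + \<epsilon>))"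
proof -
 interpret Q: prob_space Q by fact
 obtain \<tau> where "ALL n. (stopping_time F (\<tau> n) & (\<forall>w\<in>space P. 0 <= \<tau> n w) & (n = 0 --> \<tau> n = (%_. 0))) & next_stop (\<tau> n) (\<tau> (Suc n))"
 proof (atomize_elim, rule dependent_nat_choice[where Q="%_. next_stop" and
   P="%n T. stopping_time F T & (\<forall>w\<in>space P. 0 <= T w) & (n = 0 --> T = (%_. 0))"])
  show "EX T. stopping_time F T & (\<forall>w\<in>space P. 0 <= T w) & (0 = (0::nat) --> T = (%_. 0))"
   by (rule exI[of _ "%_. 0"]) (simp add: stopping_time_const)
  show "EX T'. (stopping_time F T' & (\<forall>w\<in>space P. 0 <= T' w) & (Suc n = 0 --> T' = (%_. 0))) & next_stop T T'"
   if T: "stopping_time F T & (\<forall>w\<in>space P. 0 <= T w) & (n = 0 --> T = (%_. 0))" for T n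
  proof -
   obtain T' where T': "next_stop T T'" using next_time[of T] T by blast
   hence "stopping_time F T'" "\<forall>w\<in>space P. T w <= T' w" unfolding next_stop_def by blast+
   hence "stopping_time F T' & (\<forall>w\<in>space P. 0 <= T' w)" using T by (meson order_trans)
   thus ?thesis using T' by blast
  qed
 qed
 hence st: "stopping_time F (\<tau> n)" and \<tau>0: "w \<in> space P ==> 0 <= \<tau> n w" and zero: "\<tau> 0 w = 0" and nx: "next_stop (\<tau> n) (\<tau> (Suc n))" for n w by auto
 have mono: "\<tau> n w <= \<tau> (Suc n) w" if "w \<in> space P" for n w using nx[of n] that unfolding next_stop_def by blast
 have dur: "(\<integral>\<^sup>+w. ind B w * ennreal (\<tau> (Suc n) w - \<tau> n w) \<partial>P) = ennreal \<epsilon> * emeasure P B" if "B \<in> sets (pre_sigma (\<tau> n))" for n B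
  using nx[of n] that unfolding next_stop_def by blast
 have step: "(\<integral>\<^sup>+w. ind B w * f (M (\<tau> n w) w, M (\<tau> (Suc n) w) w) \<partial>P) =
   (\<integral>\<^sup>+w. ind B w * (\<integral>\<^sup>+x. f (M (\<tau> n w) w, M (\<tau> n w) w + a (M (\<tau> n w) w) * x) \<partial>\<mu>) \<partial>P)"
  if "B \<in> sets (pre_sigma (\<tau> n))" "f \<in> borel_measurable (borel \<Otimes>\<^sub>M borel)" for n B and f :: "real \<times> real => ennreal"
  using nx[of n] that unfolding next_stop_def by blast
 note tm[measurable] = sets_F_measurable_stopping[OF st]
 have Vm[measurable]: "(%w. M (\<tau> n w) w) \<in> borel_measurable P" for n by (rule M_at_measurable[OF tm \<tau>0])
 have Xm[measurable]: "X k \<in> borel_measurable Q" for k using X by (auto simp: Q.indep_vars_def)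
 note am[measurable] = a_borel
 have Rm[measurable]: "rwalk m a X n \<in> borel_measurable Q" for n by (rule rwalk_measurable[OF a_borel Xm])
 have cond: "AE w in P. nn_cond_exp P (pre_sigma (\<tau> k)) (%w. ennreal (\<tau> (Suc k) w)) w = ennreal (\<tau> k w + \<epsilon>)" for k
 proof -
  have "AE w in P. ennreal (\<tau> k w + \<epsilon>) = nn_cond_exp P (pre_sigma (\<tau> k)) (%w. ennreal (\<tau> (Suc k) w)) w"
  proof (rule sigma_finite_subalgebra.nn_cond_exp_charact[OF sigma_finite_pre_sigma[OF st]])
   fix B assume B: "B \<in> sets (pre_sigma (\<tau> k))"
   note [measurable] = pre_sigma_sets_P[OF st B]
   have "(\<integral>\<^sup>+w. ennreal (\<tau> (Suc k) w) * ind B w \<partial>P) = (\<integral>\<^sup>+w. ind B w * ennreal (\<tau> (Suc k) w - \<tau> k w) + ind B w * ennreal (\<tau> k w) \<partial>P)"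
   proof (rule nn_integral_cong)
    fix w assume w: "w \<in> space P"
    have "ennreal (\<tau> (Suc k) w) = ennreal (\<tau> (Suc k) w - \<tau> k w) + ennreal (\<tau> k w)"
     using mono[OF w, of k] \<tau>0[OF w, of k] by (simp add: ennreal_plus[symmetric] del: ennreal_plus)
    thus "ennreal (\<tau> (Suc k) w) * ind B w = ind B w * ennreal (\<tau> (Suc k) w - \<tau> k w) + ind B w * ennreal (\<tau> k w)"
     by (simp split: split_indicator)
   qed
   also have "... = ennreal \<epsilon> * emeasure P B + (\<integral>\<^sup>+w. ind B w * ennreal (\<tau> k w) \<partial>P)"
    unfolding dur[OF B, symmetric] by (rule nn_integral_add) measurable
   also have "... = (\<integral>\<^sup>+w. ennreal \<epsilon> * ind B w \<partial>P) + (\<integral>\<^sup>+w. ind B w * ennreal (\<tau> k w) \<partial>P)" by (simp add: nn_integral_cmult_indicator)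
   also have "... = (\<integral>\<^sup>+w. ennreal \<epsilon> * ind B w + ind B w * ennreal (\<tau> k w) \<partial>P)" by (rule nn_integral_add[symmetric]) measurable
   also have "... = (\<integral>\<^sup>+w. ennreal (\<tau> k w + \<epsilon>) * ind B w \<partial>P)"
    using eps \<tau>0 by (intro nn_integral_cong) (simp add: add.commute split: split_indicator)
   finally show "(\<integral>\<^sup>+w. ennreal (\<tau> (Suc k) w) * ind B w \<partial>P) = (\<integral>\<^sup>+w. ennreal (\<tau> k w + \<epsilon>) * ind B w \<partial>P)" .
  next
   note [measurable] = measurable_stopping_time_pre_sigma[OF st]
   show "(%w. ennreal (\<tau> k w + \<epsilon>)) \<in> borel_measurable (pre_sigma (\<tau> k))" by measurable
  qed measurable
  thus ?thesis by eventually_elim simp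
 qed
 define BP where "BP A n = {w \<in> space P. \<forall>i\<in>{..n}. M (\<tau> i w) w \<in> A i}" for A :: "nat => real set" and n :: nat
 define BQ where "BQ A n = {w \<in> space Q. \<forall>i\<in>{..n}. rwalk m a X i w \<in> A i}" for A :: "nat => real set" and n :: nat
 \<comment> \<open>The extra test function \<open>h\<close> of the last position makes the induction
   close: one step forward becomes one more integration of \<open>h\<close> against
   \<open>\<mu>\<close>.\<close>
 have key: "(\<integral>\<^sup>+w. ind (BP A n) w * h (M (\<tau> n w) w) \<partial>P) = (\<integral>\<^sup>+w. ind (BQ A n) w * h (rwalk m a X n w) \<partial>Q)"
  if A: "!!i. A i \<in> sets borel" and "h \<in> borel_measurable borel" for A n and h :: "real => ennreal"
  using that(2)
 proof (induction n arbitrary: h)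
  case 0
  have "AE w in P. ind (BP A 0) w * h (M (\<tau> 0 w) w) = ind (A 0) m * h m"
   using M_0 AE_space
  proof eventually_elim
   case (elim w)
   hence "ind (BP A 0) w = (ind (A 0) m :: ennreal)" by (simp add: BP_def zero indicator_def)
   thus ?case using elim(1) by (simp add: zero)
  qed
  hence "(\<integral>\<^sup>+w. ind (BP A 0) w * h (M (\<tau> 0 w) w) \<partial>P) = (\<integral>\<^sup>+w. ind (A 0) m * h m \<partial>P)"
   by (rule nn_integral_cong_AE)
  moreover have "(\<integral>\<^sup>+w. ind (BQ A 0) w * h (rwalk m a X 0 w) \<partial>Q) = (\<integral>\<^sup>+w. ind (A 0) m * h m \<partial>Q)"
   by (rule nn_integral_cong) (simp add: BQ_def indicator_def)
  ultimately show ?case by (simp add: emeasure_space_1 Q.emeasure_space_1)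
 next
  case (Suc n)
  note [measurable] = Suc.prems A
  \<comment> \<open>\<open>g\<close> absorbs the constraint on the newest position, and
    \<open>g'\<close> integrates it over one step, so the statement at \<open>Suc n\<close> becomes
    the one at \<open>n\<close> with test function \<open>g'\<close>.\<close>
  define g where "g y = ind (A (Suc n)) y * h y" for y
  define g' where "g' y = (\<integral>\<^sup>+x. g (y + a y * x) \<partial>\<mu>)" for y
  have gm[measurable]: "g \<in> borel_measurable borel" unfolding g_def[abs_def] by measurable
  have g'm: "g' \<in> borel_measurable borel" unfolding g'_def[abs_def] by measurable
  have "BP A n \<in> sets (pre_sigma (\<tau> n))"
  proof -
   have "(%w. M (\<tau> i w) w) \<in> borel_measurable (pre_sigma (\<tau> n))" if "i \<in> {..n}" for i
   proof (rule pre_sigma_mono_measurable[OF st st _ M_at_pre_sigma[OF st \<tau>0]])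
    show "\<tau> i w <= \<tau> n w" if w: "w \<in> space P" for w
     by (rule lift_Suc_mono_le[of "%k. \<tau> k w", OF mono[OF w]]) (use \<open>i \<in> {..n}\<close> in simp)
   qed
   hence "Measurable.pred (pre_sigma (\<tau> n)) (%w. \<forall>i\<in>{..n}. M (\<tau> i w) w \<in> A i)"
    by (intro pred_intros_finite pred_sets2[OF A]) auto
   thus ?thesis by (simp add: BP_def pred_def space_pre_sigma)
  qed
  from step[OF this, of "%z. g (snd z)"]
  have p: "(\<integral>\<^sup>+w. ind (BP A n) w * g (M (\<tau> (Suc n) w) w) \<partial>P) = (\<integral>\<^sup>+w. ind (BP A n) w * g' (M (\<tau> n w) w) \<partial>P)"
   by (simp add: g'_def)
  have BQm: "BQ A n \<in> sets Q"
  proof -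
   have "Measurable.pred Q (%w. \<forall>i\<in>{..n}. rwalk m a X i w \<in> A i)" by (intro pred_intros_finite pred_sets2[OF A] Rm) auto
   thus ?thesis by (simp add: BQ_def pred_def)
  qed
  have "(\<integral>\<^sup>+w. ind (BQ A n) w * (%(u, x). g (u + a u * x)) (rwalk m a X n w, X n w) \<partial>Q) =
    (\<integral>\<^sup>+w. ind (BQ A n) w * (\<integral>\<^sup>+x. (%(u, x). g (u + a u * x)) (rwalk m a X n w, x) \<partial>\<mu>) \<partial>Q)"
  proof (rule Q.nn_integral_independent[where f="%(u, x). g (u + a u * x)", OF mu.prob_space_axioms mu.mu_sets Rm[of n] Xm[of n] BQm])
   show "Q.prob (BQ A n \<inter> {w \<in> space Q. rwalk m a X n w \<in> E & X n w \<in> E'}) = Q.prob (BQ A n \<inter> {w \<in> space Q. rwalk m a X n w \<in> E}) * mu.prob E'"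
    if "E \<in> sets borel" "E' \<in> sets borel" for E E'
    using Q.rwalk_independent[where m=m, OF X a_borel A that, of n] law unfolding BQ_def by simp
  qed measurable
  hence r: "(\<integral>\<^sup>+w. ind (BQ A n) w * g (rwalk m a X (Suc n) w) \<partial>Q) = (\<integral>\<^sup>+w. ind (BQ A n) w * g' (rwalk m a X n w) \<partial>Q)"
   by (simp add: g'_def)
  have "(\<integral>\<^sup>+w. ind (BP A (Suc n)) w * h (M (\<tau> (Suc n) w) w) \<partial>P) = (\<integral>\<^sup>+w. ind (BP A n) w * g (M (\<tau> (Suc n) w) w) \<partial>P)"
   by (rule nn_integral_cong) (auto simp: BP_def g_def atMost_Suc split: split_indicator)
  also have "... = (\<integral>\<^sup>+w. ind (BQ A n) w * g (rwalk m a X (Suc n) w) \<partial>Q)" unfolding p r by (rule Suc.IH[OF g'm])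
  also have "... = (\<integral>\<^sup>+w. ind (BQ A (Suc n)) w * h (rwalk m a X (Suc n) w) \<partial>Q)"
   by (rule nn_integral_cong) (auto simp: BQ_def g_def atMost_Suc simp del: rwalk.simps split: split_indicator)
  finally show ?case .
 qed
 let ?B = "%_::nat. borel :: real measure"
 have mP: "(%w k. M (\<tau> k w) w) \<in> measurable P (PiM UNIV ?B)"
  by (rule measurable_PiM_single'[where f="%k w. M (\<tau> k w) w"]) (rule Vm, simp)
 have mQ: "(%w k. rwalk m a X k w) \<in> measurable Q (PiM UNIV ?B)"
  by (rule measurable_PiM_single'[where f="rwalk m a X"]) (rule Rm, simp)
 have dist: "distr P (PiM UNIV ?B) (%w k. M (\<tau> k w) w) = distr Q (PiM UNIV ?B) (%w k. rwalk m a X k w)"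
 proof (rule measure_eqI_PiM_infinite)
  fix A :: "nat => real set" and J :: "nat set" assume J: "finite J" "!!i. i \<in> J ==> A i \<in> sets borel"
  \<comment> \<open>Padding with \<open>UNIV\<close> turns a cylinder over an arbitrary finite index
    set into one over an initial segment.\<close>
  define A' where "A' i = (if i \<in> J then A i else UNIV)" for i
  have A': "A' i \<in> sets borel" for i using J(2) by (simp add: A'_def)
  obtain n where n: "!!i. i \<in> J ==> i <= n" using J(1) by (meson finite_nat_set_iff_bounded_le)
  have cyl: "x \<in> prod_emb UNIV ?B J (Pi\<^sub>E J A) \<longleftrightarrow> (\<forall>i\<in>{..n}. x i \<in> A' i)" for x
   using n by (auto simp: prod_emb_iff A'_def PiE_iff)
  have S: "prod_emb UNIV ?B J (Pi\<^sub>E J A) \<in> sets (PiM UNIV ?B)" by (rule sets_PiM_I) (use J in auto)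
  have eP: "emeasure (distr P (PiM UNIV ?B) (%w k. M (\<tau> k w) w)) (prod_emb UNIV ?B J (Pi\<^sub>E J A)) = emeasure P (BP A' n)"
   unfolding emeasure_distr[OF mP S] by (rule arg_cong[where f="emeasure P"]) (auto simp: cyl BP_def)
  have eQ: "emeasure (distr Q (PiM UNIV ?B) (%w k. rwalk m a X k w)) (prod_emb UNIV ?B J (Pi\<^sub>E J A)) = emeasure Q (BQ A' n)"
   unfolding emeasure_distr[OF mQ S] by (rule arg_cong[where f="emeasure Q"]) (auto simp: cyl BQ_def)
  have sP: "BP A' n \<in> sets P" "BQ A' n \<in> sets Q"
   using measurable_sets[OF mP S] measurable_sets[OF mQ S] by (auto simp: cyl BP_def BQ_def vimage_def Int_def conj_commute)
  have "emeasure P (BP A' n) = emeasure Q (BQ A' n)" using key[of A' "%_. 1" n, OF A'] sP by simp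
  thus "emeasure (distr P (PiM UNIV ?B) (%w k. M (\<tau> k w) w)) (prod_emb UNIV ?B J (Pi\<^sub>E J A)) =
   emeasure (distr Q (PiM UNIV ?B) (%w k. rwalk m a X k w)) (prod_emb UNIV ?B J (Pi\<^sub>E J A))" unfolding eP eQ .
 next
  interpret D: prob_space "distr P (PiM UNIV ?B) (%w k. M (\<tau> k w) w)" by (rule prob_space_distr[OF mP])
  show "finite_measure (distr P (PiM UNIV ?B) (%w k. M (\<tau> k w) w))" by unfold_locales
 qed simp_all
 have z: "\<forall>w\<in>space P. \<tau> 0 w = 0" using zero by simp
 have mo: "ALL k. \<forall>w\<in>space P. 0 <= \<tau> k w & \<tau> k w <= \<tau> (Suc k) w" using mono \<tau>0 by simp
 note all = conjI[OF z conjI[OF mo conjI[OF allI[OF st] conjI[OF dist allI[OF cond]]]]]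
 show ?thesis by (rule exI[of _ \<tau>]) (rule all)
qed

end

section \<open>The scale factor\<close>

lemma kern_shrink:
 assumes "x <= x' & x' <= y' & y' <= y | y <= y' & y' <= x' & x' <= x"
 shows "kern y' x' u <= kern y x u"
 using assms by (auto simp: kern_def max_def)

text \<open>For fixed \<open>y\<close> and \<open>u\<close> the kernel is the positive part of an
  affine function of \<open>x\<close>. This is the source of convexity of \<open>q\<close> in its
  second argument and of \<open>G\<close> in the step size.\<close>

lemma kern_convex:
 assumes t: "0 <= t" "t <= 1"
 shows "kern y ((1 - t) * x + t * x') u <= (1 - t) * kern y x u + t * kern y x' u"
proof -
 have m: "max 0 ((1 - t) * v + t * wt) <= (1 - t) * max 0 v + t * max 0 wt" for v wt :: real
  using t by (intro max.boundedI add_nonneg_nonneg mult_nonneg_nonneg add_mono mult_left_mono) auto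
 show ?thesis using m[of "x - u" "x' - u"] m[of "u - x" "u - x'"] by (auto simp: kern_def algebra_simps)
qed

lemma nn_integral_pos_if_nonzero_on:
 fixes e f :: real and h :: "real => ennreal"
 assumes "!!u. u \<in> {e<..<f} ==> h u ~= 0" "e < f" and h[measurable]: "h \<in> borel_measurable borel"
 shows "0 < (\<integral>\<^sup>+u. h u \<partial>lborel)"
proof (rule ccontr)
 assume "~ 0 < (\<integral>\<^sup>+u. h u \<partial>lborel)"
 hence "AE u in lborel. h u = 0" by (simp add: nn_integral_0_iff_AE)
 hence "AE u in lborel. u ~: {e<..<f}" by eventually_elim (use assms(1) in blast)
 from AE_lborel_notin_Ioo[OF this] show False using assms(2) by simp
qed

section \<open>The hull of the support of the law, and boundary values of \<open>q\<close>\<close>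

locale scale_data =
 fixes \<eta> :: "real => real" and l r m :: real and \<mu> :: "real measure"
 assumes lr: "l < r" and eta_borel: "\<eta> \<in> borel_measurable borel"
  and eta_nz: "\<forall>x\<in>{l<..<r}. \<eta> x ~= 0" and eta_zero: "ALL x. x ~: {l<..<r} --> \<eta> x = 0"
  and eta_loc: "ALL a b. l < a & b < r --> set_integrable lborel {a..b} (%z. 1 / (\<eta> z)^2)"
  and m_in: "m \<in> {l<..<r}"
  and mu_prob: "prob_space \<mu>" and mu_sets: "sets \<mu> = sets borel"
  and mu_int: "integrable \<mu> (%x. x)" and mu_centered: "(\<integral>x. x \<partial>\<mu>) = 0" and mu_nondeg: "\<mu> ~= return borel 0"
  and bdd: "bdd_below (supp \<mu>)" "bdd_above (supp \<mu>)"
begin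

sublocale mu: prob_space \<mu> by (rule mu_prob)

abbreviation c :: real where "c \<equiv> Inf (supp \<mu>)"
abbreviation d :: real where "d \<equiv> Sup (supp \<mu>)"

lemma space_mu: "space \<mu> = UNIV"
 using sets_eq_imp_space_eq[OF mu_sets] by simp

text \<open>Only countably many intervals with rational endpoints have to be excluded: a point
  outside the support lies in such an interval of measure zero.\<close>

lemma AE_supp: "AE x in \<mu>. x \<in> supp \<mu>"
proof -
 have "AE x in \<mu>. \<forall>p\<in>\<rat>. \<forall>s\<in>\<rat>. emeasure \<mu> {p<..<s} = 0 --> x ~: {p<..<s}"
  unfolding AE_ball_countable[OF countable_rat]
 proof (intro ballI)
  fix p s :: real
  show "AE x in \<mu>. emeasure \<mu> {p<..<s} = 0 --> x ~: {p<..<s}"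
  proof (cases "emeasure \<mu> {p<..<s} = 0")
   case True
   hence "{p<..<s} \<in> null_sets \<mu>" by (simp add: null_sets_def mu_sets)
   from AE_not_in[OF this] show ?thesis by eventually_elim blast
  qed simp
 qed
 thus ?thesis
 proof eventually_elim
  case (elim x)
  have "0 < emeasure \<mu> (ball x e)" if e: "0 < e" for e
  proof (rule ccontr)
   assume n: "~ 0 < emeasure \<mu> (ball x e)"
   obtain p where p: "p \<in> \<rat>" "x - e < p" "p < x" using Rats_dense_in_real[of "x - e" x] e by auto
   obtain s where s: "s \<in> \<rat>" "x < s" "s < x + e" using Rats_dense_in_real[of x "x + e"] e by auto
   have "{p<..<s} \<subseteq> ball x e" using p s by (auto simp: dist_real_def)
   hence "emeasure \<mu> {p<..<s} <= emeasure \<mu> (ball x e)" by (intro emeasure_mono) (simp_all add: mu_sets)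
   hence "emeasure \<mu> {p<..<s} = 0" using n by simp
   thus False using elim p s by auto
  qed
  thus ?case by (simp add: supp_def)
 qed
qed

lemma supp_ne: "supp \<mu> ~= {}"
 using AE_supp mu.AE_False by auto

lemma AE_hull: "AE x in \<mu>. x \<in> {c..d}"
 using AE_supp by eventually_elim (simp add: cInf_lower cSup_upper bdd)

text \<open>The extreme points are approached by support points, and a ball around such a point fits
  into the given one; closedness of the support is not invoked.\<close>

lemma ball_pos:
 assumes k: "k \<in> {c, d}" and s: "0 < s" shows "0 < emeasure \<mu> (ball k s)"
proof -
 obtain x where x: "x \<in> supp \<mu>" "\<bar>x - k\<bar> < s"
 proof (cases "k = c")
  case True
  obtain x where "x \<in> supp \<mu>" "x < c + s" using cInf_lessD[OF supp_ne, of "c + s"] s by auto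
  thus ?thesis using that[of x] cInf_lower[OF _ bdd(1), of x] True by auto
 next
  case False
  obtain x where "x \<in> supp \<mu>" "d - s < x" using less_cSupD[OF supp_ne, of "d - s"] s by auto
  thus ?thesis using that[of x] cSup_upper[OF _ bdd(2), of x] False k by auto
 qed
 have "0 < emeasure \<mu> (ball x (s - \<bar>x - k\<bar>))" using x by (simp add: supp_def)
 also have "... <= emeasure \<mu> (ball k s)" by (intro emeasure_mono) (auto simp: mu_sets dist_real_def)
 finally show ?thesis .
qed

lemma not_AE_zero: "~ (AE x in \<mu>. x = 0)"
proof
 assume z: "AE x in \<mu>. x = 0"
 have "\<mu> = return borel 0"
 proof (rule measure_eqI)
  fix A assume A: "A \<in> sets \<mu>"
  show "emeasure \<mu> A = emeasure (return borel 0) A"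
  proof (cases "0 \<in> A")
   case True
   have "AE x in \<mu>. x \<in> A" using z by eventually_elim (use True in simp)
   thus ?thesis using True A by (simp add: mu_sets mu.emeasure_eq_1_AE)
  next
   case False
   have "AE x in \<mu>. x ~: A" using z by eventually_elim (use False in auto)
   hence "emeasure \<mu> A = 0" using A AE_iff_measurable[of A \<mu> "%x. x ~: A"] sets.sets_into_space[OF A] by (auto simp: space_mu)
   thus ?thesis using False A by (simp add: mu_sets)
  qed
 qed (simp add: mu_sets)
 thus False using mu_nondeg by simp
qed

lemma c_neg: "c < 0"
proof (rule ccontr)
 assume "~ c < 0"
 hence "AE x in \<mu>. 0 <= x" using AE_hull by (auto elim!: eventually_mono)
 thus False using integral_nonneg_eq_0_iff_AE[OF mu_int] mu_centered not_AE_zero by simp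
qed

lemma d_pos: "0 < d"
proof (rule ccontr)
 assume "~ 0 < d"
 have "AE x in \<mu>. 0 <= - x" using AE_hull by eventually_elim (use \<open>~ 0 < d\<close> in auto)
 hence "AE x in \<mu>. - x = 0" using integral_nonneg_eq_0_iff_AE[of \<mu> "%x. - x"] mu_int mu_centered by simp
 thus False using not_AE_zero by simp
qed

sublocale hull: bounded_centred \<mu> c d
 by unfold_locales (fact mu_sets AE_hull mu_centered)+

lemma q_kern: "q \<eta> y x = (\<integral>\<^sup>+u. ennreal (kern y x u) * qdens \<eta> u \<partial>lborel)"
 unfolding q_eq_double_integral by (rule double_integral_eq_kern[OF qdens_measurable[OF eta_borel]])

lemma q_inside: assumes "y \<in> {l<..<r}" "x \<in> {l<..<r}" shows "q \<eta> y x < \<infinity>"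
proof -
 let ?J = "{min x y..max x y}"
 have J: "?J \<subseteq> {l<..<r}" using assms by auto
 have i: "integrable lborel (%z. ind ?J z *\<^sub>R (1 / (\<eta> z)^2))" using eta_loc assms by (auto simp: set_integrable_def)
 have "q \<eta> y x <= (\<integral>\<^sup>+u. ennreal (2 * \<bar>x - y\<bar>) * ennreal (norm (ind ?J u *\<^sub>R (1 / (\<eta> u)^2))) \<partial>lborel)"
  unfolding q_kern
 proof (rule nn_integral_mono)
  fix u
  show "ennreal (kern y x u) * qdens \<eta> u <= ennreal (2 * \<bar>x - y\<bar>) * ennreal (norm (ind ?J u *\<^sub>R (1 / (\<eta> u)^2)))"
  proof (cases "u \<in> ?J")
   case True
   hence "\<eta> u ~= 0" using eta_nz J by blast
   moreover have "kern y x u <= \<bar>x - y\<bar>" using True by (auto simp: kern_def)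
   ultimately have "ennreal (kern y x u) * qdens \<eta> u <= ennreal \<bar>x - y\<bar> * ennreal (2 / (\<eta> u)^2)" unfolding qdens_def by (simp add: mult_right_mono ennreal_leI)
   also have "... = ennreal (2 * \<bar>x - y\<bar>) * ennreal (norm (ind ?J u *\<^sub>R (1 / (\<eta> u)^2)))"
    using True by (simp add: ennreal_mult[symmetric])
   finally show ?thesis .
  next
   case False
   hence "kern y x u = 0" by (auto simp: kern_def)
   thus ?thesis by simp
  qed
 qed
 also have "... = ennreal (2 * \<bar>x - y\<bar>) * (\<integral>\<^sup>+u. ennreal (norm (ind ?J u *\<^sub>R (1 / (\<eta> u)^2))) \<partial>lborel)"
  using i by (intro nn_integral_cmult) (auto dest: borel_measurable_integrable)
 also have "... < \<infinity>" using i by (simp add: integrable_iff_bounded ennreal_mult_less_top)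
 finally show ?thesis .
qed

text \<open>The density is infinite outside the open interval, and the kernel is positive on a
  nondegenerate interval there. Through this convention the definition of the scale factor forbids
  leaving \<open>[l, r]\<close>.\<close>

lemma q_outside: assumes y: "y \<in> {l<..<r}" and x: "x ~: {l..r}" shows "q \<eta> y x = \<infinity>"
proof (rule ccontr)
 assume n: "q \<eta> y x ~= \<infinity>"
 note [measurable] = qdens_measurable[OF eta_borel]
 obtain e f where ef: "e < f" "!!u. u \<in> {e<..<f} ==> 0 < kern y x u & u ~: {l<..<r}"
 proof (cases "x < l")
  case True thus ?thesis using y by (intro that[of x l]) (auto simp: kern_def)
 next
  case False thus ?thesis using y x by (intro that[of r x]) (auto simp: kern_def)
 qed
 have "AE u in lborel. ennreal (kern y x u) * qdens \<eta> u ~= \<infinity>" using n unfolding q_kern by (intro nn_integral_PInf_AE) auto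
 hence "AE u in lborel. u ~: {e<..<f}"
 proof eventually_elim
  case (elim u)
  show ?case
  proof
   assume u: "u \<in> {e<..<f}"
   hence "qdens \<eta> u = \<infinity>" using ef(2) eta_zero by (simp add: qdens_def)
   thus False using elim ef(2)[OF u] by (simp add: ennreal_mult_top)
  qed
 qed
 from AE_lborel_notin_Ioo[OF this] show False using ef(1) by simp
qed

lemma q_pos: assumes "x ~= y" shows "0 < q \<eta> y x"
 unfolding q_kern
proof (rule nn_integral_pos_if_nonzero_on[of "min x y" "max x y"])
 show "min x y < max x y" using assms by auto
 show "ennreal (kern y x u) * qdens \<eta> u ~= 0" if "u \<in> {min x y<..<max x y}" for u
 proof -
  have "0 < kern y x u" using that by (auto simp: kern_def)
  thus ?thesis by (auto simp: qdens_def)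
 qed
 note [measurable] = qdens_measurable[OF eta_borel]
 show "(%u. ennreal (kern y x u) * qdens \<eta> u) \<in> borel_measurable borel" by measurable
qed

text \<open>Monotonicity bounds the approaching values by the value at the end, and lower
  semicontinuity prevents a jump upwards there. So the boundary limits in the hypotheses are the
  values of \<open>q\<close> at \<open>l\<close> and \<open>r\<close>.\<close>

lemma q_tendsto_end:
 assumes "Fl <= at e" "\<forall>\<^sub>F x in Fl. m <= x & x <= e | e <= x & x <= m"
 shows "(q \<eta> m \<longlongrightarrow> q \<eta> m e) Fl"
proof (rule order_tendstoI)
 show "\<forall>\<^sub>F x in Fl. q \<eta> m x < b" if "q \<eta> m e < b" for b
  using assms(2) by eventually_elim (use that q_mono[OF eta_borel, of m _ e] in \<open>blast intro: order_le_less_trans\<close>)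
 show "\<forall>\<^sub>F x in Fl. b < q \<eta> m x" if b: "b < q \<eta> m e" for b
 proof (rule filter_leD[OF assms(1)], rule sequentially_imp_eventually_at, intro allI impI)
  fix f :: "nat => real" assume "(ALL n. f n ~= e) & f \<longlonglongrightarrow> e"
  hence "b < liminf (%n. q \<eta> m (f n))"
   using b double_integral_lsc[OF qdens_measurable[OF eta_borel], of f e m] unfolding q_eq_double_integral by (meson order_less_le_trans)
  thus "\<forall>\<^sub>F n in sequentially. b < q \<eta> m (f n)" by (rule less_LiminfD)
 qed
qed

lemma Lim_left: "Lim (at_right l) (%x. q \<eta> m x) = q \<eta> m l"
proof (rule tendsto_Lim)
 have "\<forall>\<^sub>F x in at_right l. x \<in> {l<..<m}" using m_in by (intro eventually_at_rightI[of l m]) auto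
 thus "(q \<eta> m \<longlongrightarrow> q \<eta> m l) (at_right l)"
  by (intro q_tendsto_end at_le) (auto elim: eventually_mono)
qed (simp add: trivial_limit_at_right_real)

lemma Lim_right: "Lim (at_left r) (%x. q \<eta> m x) = q \<eta> m r"
proof (rule tendsto_Lim)
 have "\<forall>\<^sub>F x in at_left r. x \<in> {m<..<r}" using m_in by (intro eventually_at_leftI[of m r]) auto
 thus "(q \<eta> m \<longlongrightarrow> q \<eta> m r) (at_left r)"
  by (intro q_tendsto_end at_le) (auto elim: eventually_mono)
qed (simp add: trivial_limit_at_left_real)

text \<open>Whether an end has finite \<open>q\<close> does not depend on the interior starting
  point.\<close>

lemma q_end:
 assumes y: "y \<in> {l<..<r}"
 shows "q \<eta> m l < \<infinity> ==> q \<eta> y l < \<infinity>" "q \<eta> m r < \<infinity> ==> q \<eta> y r < \<infinity>"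
proof -
 \<comment> \<open>Auxiliary interior points beyond both \<open>m\<close> and \<open>y\<close>, one
   on each side, serve as the opposite border for \<open>q_finite_between\<close>.\<close>
 define h g where "h = (max m y + r) / 2" and "g = (min m y + l) / 2"
 have h: "m <= h" "y < h" "h \<in> {l<..<r}" and g: "g <= m" "g < y" "g \<in> {l<..<r}" using y m_in by (auto simp: h_def g_def)
 show "q \<eta> y l < \<infinity>" if "q \<eta> m l < \<infinity>"
  by (rule q_finite_between[OF eta_borel that q_inside[OF m_in h(3)]]) (use y m_in h in auto)
 show "q \<eta> y r < \<infinity>" if "q \<eta> m r < \<infinity>"
  by (rule q_finite_between[OF eta_borel q_inside[OF m_in g(3)] that]) (use y m_in g in auto)
qed

section \<open>The function \<open>G\<close>, the largest possible step, and the scale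
  factor\<close>

abbreviation Gy where "Gy y b \<equiv> G \<mu> \<eta> y b"

lemma q_step_measurable[measurable]: "(%x. q \<eta> y (y + b * x)) \<in> borel_measurable \<mu>"
 unfolding measurable_cong_sets[OF mu_sets refl] by (intro q_measurable[OF eta_borel]) measurable

lemma G_start: "Gy y 0 = 0"
 by (simp add: G_def q_self)

lemma G_mono: "0 <= b ==> b <= b' ==> Gy y b <= Gy y b'"
 unfolding G_def
proof (intro nn_integral_mono q_mono[OF eta_borel])
 fix x assume b: "0 <= b" "b <= b'"
 show "y <= y + b * x & y + b * x <= y + b' * x | y + b' * x <= y + b * x & y + b * x <= y"
  using b by (cases "0 <= x") (auto simp: mult_right_mono mult_right_mono_neg mult_nonneg_nonpos)
qed

lemma G_lsc:
 assumes "bs \<longlonglongrightarrow> b" shows "Gy y b <= liminf (%n. Gy y (bs n))"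
proof -
 have "Gy y b <= (\<integral>\<^sup>+x. liminf (%n. q \<eta> y (y + bs n * x)) \<partial>\<mu>)"
  unfolding G_def q_eq_double_integral
  by (intro nn_integral_mono double_integral_lsc qdens_measurable eta_borel tendsto_intros assms)
 also have "... <= liminf (%n. Gy y (bs n))" unfolding G_def by (rule nn_integral_liminf) measurable
 finally show ?thesis .
qed

lemma G_convex:
 assumes t: "0 <= t" "t <= 1"
 shows "Gy y ((1 - t) * b + t * b') <= ennreal (1 - t) * Gy y b + ennreal t * Gy y b'"
proof -
 note [measurable] = qdens_measurable[OF eta_borel]
 have "q \<eta> y (y + ((1 - t) * b + t * b') * x) <= ennreal (1 - t) * q \<eta> y (y + b * x) + ennreal t * q \<eta> y (y + b' * x)" for x
 proof -
  have e: "y + ((1 - t) * b + t * b') * x = (1 - t) * (y + b * x) + t * (y + b' * x)" by (simp add: algebra_simps)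
  have "q \<eta> y (y + ((1 - t) * b + t * b') * x) <= (\<integral>\<^sup>+u. ennreal (1 - t) * (ennreal (kern y (y + b * x) u) * qdens \<eta> u) + ennreal t * (ennreal (kern y (y + b' * x) u) * qdens \<eta> u) \<partial>lborel)"
   unfolding q_kern
  proof (rule nn_integral_mono)
   fix u
   have "ennreal (kern y (y + ((1 - t) * b + t * b') * x) u) * qdens \<eta> u <= ennreal ((1 - t) * kern y (y + b * x) u + t * kern y (y + b' * x) u) * qdens \<eta> u"
    unfolding e by (intro mult_right_mono ennreal_leI kern_convex t) simp
   also have "... = ennreal (1 - t) * (ennreal (kern y (y + b * x) u) * qdens \<eta> u) + ennreal t * (ennreal (kern y (y + b' * x) u) * qdens \<eta> u)"
    using t by (simp add: ennreal_plus ennreal_mult kern_nonneg distrib_right mult.assoc)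
   finally show "ennreal (kern y (y + ((1 - t) * b + t * b') * x) u) * qdens \<eta> u <= ..." .
  qed
  also have "... = ennreal (1 - t) * q \<eta> y (y + b * x) + ennreal t * q \<eta> y (y + b' * x)"
   unfolding q_kern by (simp add: nn_integral_add nn_integral_cmult)
  finally show ?thesis .
 qed
 hence "Gy y ((1 - t) * b + t * b') <= (\<integral>\<^sup>+x. ennreal (1 - t) * q \<eta> y (y + b * x) + ennreal t * q \<eta> y (y + b' * x) \<partial>\<mu>)"
  unfolding G_def by (intro nn_integral_mono)
 also have "... = ennreal (1 - t) * Gy y b + ennreal t * Gy y b'" unfolding G_def by (simp add: nn_integral_add nn_integral_cmult)
 finally show ?thesis .
qed

abbreviation ab where "ab y \<equiv> abar \<mu> l r y"

lemma le_ab: "b <= ab y \<longleftrightarrow> l <= y + b * c & y + b * d <= r"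
 using c_neg d_pos by (auto simp: abar_def neg_le_divide_eq pos_le_divide_eq algebra_simps)

lemma less_ab: "b < ab y \<longleftrightarrow> l < y + b * c & y + b * d < r"
 using c_neg d_pos by (auto simp: abar_def neg_less_divide_eq pos_less_divide_eq algebra_simps)

lemma ab_hits: "y + ab y * c = l | y + ab y * d = r"
 using le_ab[of "ab y" y] less_ab[of "ab y" y] by auto

lemma ab_pos: "y \<in> {l<..<r} ==> 0 < ab y"
 using less_ab[of 0 y] by simp

text \<open>A step longer than \<open>ab y\<close> carries an extreme point of the support strictly
  out of \<open>[l, r]\<close>, together with a small ball of positive mass, on which
  \<open>q\<close> is infinite.\<close>

lemma G_beyond:
 assumes y: "y \<in> {l<..<r}" and b: "ab y < b" shows "Gy y b = \<infinity>"
proof -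
 have b0: "0 < b" using ab_pos[OF y] b by simp
 have "y + b * c < l | r < y + b * d" using le_ab[of b y] b by auto
 then obtain k g where k: "k \<in> {c, d}" and g: "0 < g" "!!x. \<bar>x - k\<bar> < g ==> y + b * x ~: {l..r}"
 proof
  assume a: "y + b * c < l"
  show ?thesis
  proof (rule that[of c "(l - (y + b * c)) / b"])
   show "y + b * x ~: {l..r}" if x: "\<bar>x - c\<bar> < (l - (y + b * c)) / b" for x
   proof -
    have "x - c < (l - (y + b * c)) / b" using x by linarith
    hence "b * (x - c) < l - (y + b * c)" using b0 by (simp add: pos_less_divide_eq mult.commute)
    thus ?thesis by (simp add: algebra_simps)
   qed
  qed (use a b0 in auto)
 next
  assume a: "r < y + b * d"
  show ?thesis
  proof (rule that[of d "(y + b * d - r) / b"])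
   show "y + b * x ~: {l..r}" if x: "\<bar>x - d\<bar> < (y + b * d - r) / b" for x
   proof -
    have "d - x < (y + b * d - r) / b" using x by linarith
    hence "b * (d - x) < y + b * d - r" using b0 by (simp add: pos_less_divide_eq mult.commute)
    thus ?thesis by (simp add: algebra_simps)
   qed
  qed (use a b0 in auto)
 qed
 have "\<infinity> * emeasure \<mu> (ball k g) = (\<integral>\<^sup>+x. \<infinity> * ind (ball k g) x \<partial>\<mu>)" by (simp add: nn_integral_cmult_indicator mu_sets)
 also have "... <= Gy y b" unfolding G_def
  using q_outside[OF y] g(2) by (intro nn_integral_mono) (auto simp: dist_real_def abs_minus_commute split: split_indicator)
 finally show ?thesis using ball_pos[OF k g(1)] by (auto simp: ennreal_top_mult top_unique zero_less_iff_neq_zero)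
qed

lemma G_finite:
 assumes y: "y \<in> {l<..<r}" and b: "0 <= b" "b < ab y" shows "Gy y b < \<infinity>"
proof -
 have "b * c <= 0" "0 <= b * d" using b c_neg d_pos by (simp_all add: mult_nonneg_nonpos)
 hence I: "y + b * c \<in> {l<..<r}" "y + b * d \<in> {l<..<r}" using b y less_ab[of b y] by auto
 have "Gy y b <= (\<integral>\<^sup>+x. q \<eta> y (y + b * c) + q \<eta> y (y + b * d) \<partial>\<mu>)"
  unfolding G_def
 proof (rule nn_integral_mono_AE, use AE_hull in eventually_elim)
  case (elim x)
  show ?case
  proof (cases "0 <= x")
   case True
   hence "q \<eta> y (y + b * x) <= q \<eta> y (y + b * d)" using elim b by (intro q_mono[OF eta_borel]) (auto intro: mult_left_mono)
   thus ?thesis by (simp add: add_increasing)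
  next
   case False
   hence "q \<eta> y (y + b * x) <= q \<eta> y (y + b * c)" using elim b by (intro q_mono[OF eta_borel]) (auto intro: mult_left_mono simp: mult_nonneg_nonpos)
   thus ?thesis by (simp add: add_increasing2)
  qed
 qed
 also have "... < \<infinity>" using q_inside[OF y I(1)] q_inside[OF y I(2)] by (simp add: mu.emeasure_space_1)
 finally show ?thesis .
qed

text \<open>Close to the end the liminf hypothesis gives the bound. A starting point farther away,
  whose longest step just reaches the end, sends a neighbourhood of the extreme value across a fixed
  interior stretch; this costs a fixed amount of \<open>q\<close> with a fixed positive
  probability.\<close>

lemma end_lower:
 assumes end_: "e = l & k = c & Fl = at_right l | e = r & k = d & Fl = at_left r"
  and pos: "0 < Liminf Fl (%y. Gy y (ab y))"
 shows "\<exists>\<kappa>>0. \<forall>y\<in>{l<..<r}. y + ab y * k = e --> \<kappa> <= Gy y (ab y)"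
proof -
 obtain \<kappa>1 where \<kappa>1: "0 < \<kappa>1" "\<kappa>1 < Liminf Fl (%y. Gy y (ab y))" using dense[OF pos] by blast
 have ev: "\<forall>\<^sub>F y in Fl. \<kappa>1 < Gy y (ab y)" by (rule less_LiminfD[OF \<kappa>1(2)])
 obtain \<delta>1 where \<delta>1: "0 < \<delta>1" "!!y. y \<in> {l<..<r} ==> \<bar>y - e\<bar> < \<delta>1 ==> \<kappa>1 < Gy y (ab y)"
  using end_
 proof (elim disjE conjE)
  assume e: "e = l" "Fl = at_right l"
  then obtain b where "l < b" "!!y. l < y ==> y < b ==> \<kappa>1 < Gy y (ab y)" using ev by (auto simp: eventually_at_right_field)
  thus thesis using e by (intro that[of "b - l"]) auto
 next
  assume e: "e = r" "Fl = at_left r"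
  then obtain b where "b < r" "!!y. b < y ==> y < r ==> \<kappa>1 < Gy y (ab y)" using ev by (auto simp: eventually_at_left_field)
  thus thesis using e by (intro that[of "r - b"]) auto
 qed
 define \<delta> where "\<delta> = min \<delta>1 ((r - l) / 2)"
 have \<delta>: "0 < \<delta>" using \<delta>1(1) lr by (simp add: \<delta>_def)
 have \<delta>': "\<delta> <= (r - l) / 2" "\<delta> <= \<delta>1" unfolding \<delta>_def by (rule min.cobounded2, rule min.cobounded1)
 \<comment> \<open>The fixed stretch: \<open>p1\<close> at distance \<open>\<delta>\<close> from the
   end and \<open>p2\<close> at half of it. Starting points at distance at least
   \<open>\<delta>\<close> lie on one side of it, and landing points within
   \<open>\<delta> / 2\<close> of the end on the other.\<close>
 define p1 p2 where "p1 = (if e = l then l + \<delta> else r - \<delta>)" and "p2 = (if e = l then l + \<delta> / 2 else r - \<delta> / 2)"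
 have el: "e = l & k = c | e = r & k = d & e ~= l" using end_ lr by auto
 \<comment> \<open>Since \<open>ab y * \<bar>k\<bar>\<close> is the distance from \<open>y\<close>
   to the end, hence at most \<open>r - l\<close>, this radius is stretched by \<open>ab y\<close>
   to at most \<open>\<delta> / 2\<close>, whatever \<open>y\<close> is.\<close>
 define s where "s = \<delta> * \<bar>k\<bar> / (2 * (r - l))"
 have k0: "0 < \<bar>k\<bar>" using el c_neg d_pos by auto
 have s: "0 < s" using \<delta> k0 lr by (simp add: s_def)
 define \<kappa>2 where "\<kappa>2 = q \<eta> p1 p2 * emeasure \<mu> (ball k s)"
 have p12: "p2 ~= p1" using \<delta> by (auto simp: p1_def p2_def)
 have kd: "k \<in> {c, d}" using el by auto
 have \<kappa>2: "0 < \<kappa>2" unfolding \<kappa>2_def using q_pos[OF p12] ball_pos[OF kd s] by (simp add: ennreal_zero_less_mult_iff)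
 have "min \<kappa>1 \<kappa>2 <= Gy y (ab y)" if y: "y \<in> {l<..<r}" "y + ab y * k = e" for y
 proof (cases "\<bar>y - e\<bar> < \<delta>")
  case True
  thus ?thesis using \<delta>1(2)[OF y(1)] \<delta>'(2) by (auto intro: min.coboundedI1)
 next
  case far: False
  have "y - e = - (ab y * k)" using y(2) by simp
  hence "ab y * \<bar>k\<bar> = \<bar>y - e\<bar>" using ab_pos[OF y(1)] by (simp add: abs_mult)
  also have "... <= r - l" using y el by auto
  finally have "ab y * s <= \<delta> / 2" using \<delta> lr mult_left_mono[of "ab y * \<bar>k\<bar>" "r - l" \<delta>] by (simp add: s_def field_simps)
  have "q \<eta> p1 p2 <= q \<eta> y (y + ab y * x)" if x: "x \<in> ball k s" for x
  proof -
   have "ab y * \<bar>x - k\<bar> <= ab y * s" using x ab_pos[OF y(1)] by (intro mult_left_mono) (auto simp: dist_real_def)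
   hence "ab y * \<bar>x - k\<bar> <= \<delta> / 2" using \<open>ab y * s <= \<delta> / 2\<close> by linarith
   hence "\<bar>ab y * (x - k)\<bar> <= \<delta> / 2" using ab_pos[OF y(1)] by (simp add: abs_mult)
   moreover have "y + ab y * x - e = ab y * (x - k)" using y(2) by (simp add: right_diff_distrib)
   ultimately have "y + ab y * x <= e + \<delta> / 2" "e - \<delta> / 2 <= y + ab y * x" by linarith+
   hence "y + ab y * x <= p2 & p2 <= p1 & p1 <= y | y <= p1 & p1 <= p2 & p2 <= y + ab y * x"
    using el far y(1) \<delta> unfolding p1_def p2_def by (auto split: if_splits)
   thus ?thesis unfolding q_kern by (intro nn_integral_mono mult_right_mono ennreal_leI kern_shrink) auto
  qed
  hence "(\<integral>\<^sup>+x. q \<eta> p1 p2 * ind (ball k s) x \<partial>\<mu>) <= Gy y (ab y)"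
   unfolding G_def by (intro nn_integral_mono) (auto split: split_indicator)
  hence "\<kappa>2 <= Gy y (ab y)" by (simp add: \<kappa>2_def nn_integral_cmult_indicator mu_sets)
  thus ?thesis by (rule min.coboundedI2)
 qed
 thus ?thesis using \<kappa>1(1) \<kappa>2 by (intro exI[of _ "min \<kappa>1 \<kappa>2"]) auto
qed

text \<open>The supremum is attained by lower semicontinuity of \<open>G\<close>. If the value there
  is strictly below the target, convexity and finiteness of \<open>G\<close> before
  \<open>ab y\<close> would permit a longer step, unless the longest step is already taken.\<close>

lemma scale_factor_point:
 assumes N: "0 < N" and a: "scale_factor \<mu> \<eta> l r N a" and y: "y \<in> {l<..<r}"
 shows "0 <= a y" "a y <= ab y" "Gy y (a y) <= ennreal (1 / real N)" "Gy y (a y) < ennreal (1 / real N) ==> a y = ab y"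
  "!!b. 0 <= b ==> b < a y ==> Gy y b <= ennreal (1 / real N)"
proof -
 let ?\<epsilon> = "1 / real N"
 have up: "b <= a y" if "0 <= b" "Gy y b <= ennreal ?\<epsilon>" for b using a y that unfolding scale_factor_def by blast
 have least: "a y <= k" if "!!b. 0 <= b ==> Gy y b <= ennreal ?\<epsilon> ==> b <= k" for k using a y that unfolding scale_factor_def by blast
 show a0: "0 <= a y" using up[of 0] by (simp add: G_start)
 show le: "a y <= ab y"
 proof (rule least, rule ccontr)
  fix b assume "0 <= b" "Gy y b <= ennreal ?\<epsilon>" "~ b <= ab y"
  thus False using G_beyond[OF y, of b] by (simp add: top_unique)
 qed
 show below: "Gy y b <= ennreal ?\<epsilon>" if b: "0 <= b" "b < a y" for b
 proof (rule ccontr)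
  assume n: "~ Gy y b <= ennreal ?\<epsilon>"
  have "a y <= b"
  proof (rule least, rule ccontr)
   fix b' assume "0 <= b'" "Gy y b' <= ennreal ?\<epsilon>" "~ b' <= b"
   thus False using G_mono[of b b' y] b n by (meson le_cases order_trans)
  qed
  thus False using b by simp
 qed
 show G_le: "Gy y (a y) <= ennreal ?\<epsilon>"
 proof (cases "a y = 0")
  case False
  have t: "(%n. a y - a y * (1 / real (Suc n))) \<longlonglongrightarrow> a y - a y * 0"
   by (intro tendsto_intros LIMSEQ_Suc[OF lim_1_over_n])
  have "Gy y (a y) <= liminf (%n. Gy y (a y - a y * (1 / real (Suc n))))" using G_lsc[OF t, of y] by simp
  also have "... <= liminf (%n::nat. ennreal ?\<epsilon>)"
  proof (intro Liminf_mono always_eventually allI below)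
   fix n :: nat
   have "a y * (1 / real (Suc n)) <= a y * 1" using a0 by (intro mult_left_mono) auto
   thus "0 <= a y - a y * (1 / real (Suc n))" by simp
   show "a y - a y * (1 / real (Suc n)) < a y" using a0 False by simp
  qed
  also have "... = ennreal ?\<epsilon>" by (simp add: Liminf_const)
  finally show ?thesis .
 qed (simp add: G_start)
 show "a y = ab y" if less: "Gy y (a y) < ennreal ?\<epsilon>"
 proof (rule ccontr)
  assume "a y ~= ab y"
  define b' where "b' = (a y + ab y) / 2"
  have b': "a y < b'" "b' < ab y" using le \<open>a y ~= ab y\<close> by (auto simp: b'_def)
  obtain K where K: "Gy y b' = ennreal K" "0 <= K" using G_finite[OF y _ b'(2)] a0 b'(1) by (cases "Gy y b'") auto
  obtain g where g: "Gy y (a y) = ennreal g" "0 <= g" using less by (cases "Gy y (a y)") auto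
  have gl: "g < ?\<epsilon>" using less g by (simp add: ennreal_less_iff)
  \<comment> \<open>A convex weight so small that moving this fraction of the way to
    \<open>b'\<close> raises \<open>G\<close> by at most the available slack; \<open>K + 1\<close>
    avoids division by zero.\<close>
  define t where "t = min 1 ((?\<epsilon> - g) / (K + 1))"
  have t: "0 < t" "t <= 1" using gl K(2) by (auto simp: t_def)
  have "t * (K + 1) <= (?\<epsilon> - g) / (K + 1) * (K + 1)" using K(2) by (intro mult_right_mono) (auto simp: t_def)
  hence tK: "t * (K + 1) <= ?\<epsilon> - g" using K(2) by simp
  have "Gy y ((1 - t) * a y + t * b') <= ennreal (1 - t) * Gy y (a y) + ennreal t * Gy y b'" using t by (intro G_convex) auto
  also have "... = ennreal ((1 - t) * g + t * K)" using t K g by (simp add: ennreal_plus ennreal_mult)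
  also have "... <= ennreal ?\<epsilon>"
  proof (rule ennreal_leI)
   have "0 <= t * g" using t g by simp
   thus "(1 - t) * g + t * K <= ?\<epsilon>" using tK t by (simp add: algebra_simps)
  qed
  finally have G: "Gy y ((1 - t) * a y + t * b') <= ennreal ?\<epsilon>" .
  have "0 <= (1 - t) * a y + t * b'" using t a0 b' by simp
  from up[OF this G] have "(1 - t) * a y + t * b' <= a y" .
  hence "t * (b' - a y) <= 0" by (simp add: algebra_simps)
  thus False using t b' by (simp add: mult_le_0_iff)
 qed
qed

lemma scale_factor_unique:
 assumes N: "0 < N" shows "\<exists>!a. scale_factor \<mu> \<eta> l r N a"
proof (rule ex_ex1I)
 let ?S = "%y. {b. 0 <= b & Gy y b <= ennreal (1 / real N)}"
 define a where "a y = (if y \<in> {l<..<r} then Sup (?S y) else 0)" for y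
 have "scale_factor \<mu> \<eta> l r N a"
  unfolding scale_factor_def
 proof (intro conjI allI impI ballI)
  fix y assume y: "y \<in> {l<..<r}"
  have b: "bdd_above (?S y)"
  proof (rule bdd_aboveI[of _ "ab y"], rule ccontr)
   fix b assume "b \<in> ?S y" "~ b <= ab y"
   thus False using G_beyond[OF y, of b] by (simp add: top_unique)
  qed
  have z: "0 \<in> ?S y" by (simp add: G_start)
  have ay: "a y = Sup (?S y)" using y by (simp add: a_def)
  show "0 <= a y" unfolding ay by (rule cSup_upper[OF z b])
  show "b' <= a y" if "0 <= b'" "Gy y b' <= ennreal (1 / real N)" for b' unfolding ay using that by (intro cSup_upper b) simp
  show "a y <= k" if "\<forall>b\<ge>0. Gy y b <= ennreal (1 / real N) --> b <= k" for k unfolding ay using that z by (intro cSup_least) auto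
 qed (auto simp: a_def)
 thus "EX a. scale_factor \<mu> \<eta> l r N a" by (rule exI[of _ a])
next
 fix a a' assume a: "scale_factor \<mu> \<eta> l r N a" "scale_factor \<mu> \<eta> l r N a'"
 have le: "f y <= g y" if "scale_factor \<mu> \<eta> l r N f" "scale_factor \<mu> \<eta> l r N g" "y \<in> {l<..<r}" for f g y
 proof -
  have 1: "\<forall>b\<ge>0. Gy y b <= ennreal (1 / real N) --> b <= g y" using that(2,3) unfolding scale_factor_def by simp
  have 2: "ALL k. (\<forall>b\<ge>0. Gy y b <= ennreal (1 / real N) --> b <= k) --> f y <= k" using that(1,3) unfolding scale_factor_def by simp
  show ?thesis by (rule 2[THEN spec, THEN mp, OF 1])
 qed
 show "a = a'"
 proof
  fix y show "a y = a' y"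
  proof (cases "y \<in> {l<..<r}")
   case True
   thus ?thesis using le[OF a(1,2)] le[OF a(2,1)] by (meson antisym)
  next
   case False
   hence "a y = 0" "a' y = 0" using a unfolding scale_factor_def by blast+
   thus ?thesis by simp
  qed
 qed
qed

text \<open>A supremum of step sizes exceeds \<open>k\<close> exactly if some admissible rational
  step does, because every step below the supremum is admissible; this leaves a countable
  union.\<close>

lemma scale_factor_measurable:
 assumes N: "0 < N" and a: "scale_factor \<mu> \<eta> l r N a" shows "a \<in> borel_measurable borel"
proof (rule borel_measurableI_greater)
 fix k
 have [measurable]: "(%y. Gy y b) \<in> borel_measurable borel" for b
 proof -
  have "(%z. q \<eta> (fst z) (fst z + b * snd z)) \<in> borel_measurable (borel \<Otimes>\<^sub>M \<mu>)"
   unfolding measurable_cong_sets[OF sets_pair_measure_cong[OF refl mu_sets] refl] by (intro q_measurable[OF eta_borel]) measurable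
  hence "(%(y, x). q \<eta> y (y + b * x)) \<in> borel_measurable (borel \<Otimes>\<^sub>M \<mu>)" by (simp add: case_prod_beta')
  thus ?thesis unfolding G_def by (rule mu.borel_measurable_nn_integral)
 qed
 have iff: "k < a y \<longleftrightarrow> k < 0 | y \<in> {l<..<r} & (\<exists>b\<in>\<rat>. k < b & 0 <= b & Gy y b <= ennreal (1 / real N))" for y
 proof (cases "y \<in> {l<..<r}")
  case True
  note p = scale_factor_point[OF N a True]
  show ?thesis
  proof
   assume "k < a y"
   show "k < 0 | y \<in> {l<..<r} & (\<exists>b\<in>\<rat>. k < b & 0 <= b & Gy y b <= ennreal (1 / real N))"
   proof (cases "k < 0")
    case False
    obtain b where b: "b \<in> \<rat>" "k < b" "b < a y" using Rats_dense_in_real[OF \<open>k < a y\<close>] by blast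
    hence "0 <= b" using False by simp
    thus ?thesis using True b p(5)[of b] by blast
   qed simp
  next
   assume "k < 0 | y \<in> {l<..<r} & (\<exists>b\<in>\<rat>. k < b & 0 <= b & Gy y b <= ennreal (1 / real N))"
   thus "k < a y"
   proof
    assume "y \<in> {l<..<r} & (\<exists>b\<in>\<rat>. k < b & 0 <= b & Gy y b <= ennreal (1 / real N))"
    then obtain b where b: "k < b" "0 <= b" "Gy y b <= ennreal (1 / real N)" by blast
    hence "b <= a y" using a True unfolding scale_factor_def by blast
    thus ?thesis using b by simp
   qed (use p(1) in simp)
  qed
 next
  case False
  have "a y = 0" using a False unfolding scale_factor_def by blast
  show ?thesis unfolding \<open>a y = 0\<close> using False by blast
 qed
 let ?U = "\<Union>b\<in>\<rat> \<inter> {b. k < b & 0 <= b}. {y \<in> space borel. Gy y b <= ennreal (1 / real N)}"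
 have "{y \<in> space borel. Gy y b <= ennreal (1 / real N)} \<in> sets borel" for b by measurable
 hence U: "?U \<in> sets borel" by (intro sets.countable_UN'' countable_Int1 countable_rat)
 show "{y \<in> space borel. k < a y} \<in> sets borel"
 proof (cases "k < 0")
  case True
  hence "{y \<in> space borel. k < a y} = UNIV" using iff by simp
  thus ?thesis by simp
 next
  case False
  hence "{y \<in> space borel. k < a y} = {l<..<r} \<inter> ?U" unfolding iff by auto
  thus ?thesis using U by simp
 qed
qed

text \<open>Once \<open>1 / N\<close> is below the constants of \<open>end_lower\<close>, a step can
  touch an end only if \<open>q\<close> is finite there, which gives finite \<open>q\<close> to both
  extreme points. A strict deficit forces the longest step, which touches an end; the atom at the
  corresponding extreme point then has positive mass.\<close>

theorem scale_factor_eventually: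
 assumes left_fin: "q \<eta> m l < \<infinity> ==> 0 < measure \<mu> {c}" and left_inf: "q \<eta> m l = \<infinity> ==> 0 < Liminf (at_right l) (%y. Gy y (ab y))"
  and right_fin: "q \<eta> m r < \<infinity> ==> 0 < measure \<mu> {d}" and right_inf: "q \<eta> m r = \<infinity> ==> 0 < Liminf (at_left r) (%y. Gy y (ab y))"
 shows "\<exists>N0>0. \<forall>N\<ge>N0. ALL a. scale_factor \<mu> \<eta> l r N a --> (\<forall>y\<in>{l<..<r}.
  l <= y + a y * c & y + a y * d <= r & q \<eta> y (y + a y * c) < \<infinity> & q \<eta> y (y + a y * d) < \<infinity> &
  (Gy y (a y) < ennreal (1 / real N) --> 0 < measure \<mu> {x. y + a y * x ~: {l<..<r}}))"
proof -
 have "\<exists>\<kappa>>0. \<forall>y\<in>{l<..<r}. q \<eta> m l = \<infinity> --> y + ab y * c = l --> \<kappa> <= Gy y (ab y)"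
  using end_lower[of l c "at_right l"] left_inf by (cases "q \<eta> m l = \<infinity>") (auto intro: exI[of _ 1])
 then obtain \<kappa>l where \<kappa>l: "0 < \<kappa>l" "!!y. y \<in> {l<..<r} ==> q \<eta> m l = \<infinity> ==> y + ab y * c = l ==> \<kappa>l <= Gy y (ab y)" by blast
 have "\<exists>\<kappa>>0. \<forall>y\<in>{l<..<r}. q \<eta> m r = \<infinity> --> y + ab y * d = r --> \<kappa> <= Gy y (ab y)"
  using end_lower[of r d "at_left r"] right_inf by (cases "q \<eta> m r = \<infinity>") (auto intro: exI[of _ 1])
 then obtain \<kappa>r where \<kappa>r: "0 < \<kappa>r" "!!y. y \<in> {l<..<r} ==> q \<eta> m r = \<infinity> ==> y + ab y * d = r ==> \<kappa>r <= Gy y (ab y)" by blast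
 \<comment> \<open>The two constants may be infinite, so a positive real number is inserted below
   both before it is compared with \<open>1 / N\<close>.\<close>
 have "0 < min \<kappa>l \<kappa>r" using \<kappa>l(1) \<kappa>r(1) by simp
 then obtain z where z: "0 < z" "z < min \<kappa>l \<kappa>r" using dense by blast
 then obtain e where e: "z = ennreal e" "0 < e" by (cases z) auto
 obtain n where n: "1 / real (Suc n) < e" using reals_Archimedean[OF e(2)] unfolding inverse_eq_divide by blast
 show ?thesis
 proof (intro exI[of _ "Suc n"] conjI allI impI ballI)
  fix N a y assume N: "Suc n <= N" and a: "scale_factor \<mu> \<eta> l r N a" and y: "y \<in> {l<..<r}"
  have N0: "0 < N" using N by simp
  note p = scale_factor_point[OF N0 a y]
  have "1 / real N <= 1 / real (Suc n)" using N by (intro divide_left_mono) auto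
  hence "1 / real N < e" using n by linarith
  hence "ennreal (1 / real N) < z" unfolding e(1) by (simp add: ennreal_less_iff)
  hence lt: "Gy y (a y) < min \<kappa>l \<kappa>r" using p(3) z(2) by (meson order_le_less_trans order_less_trans)
  have L: "q \<eta> m l < \<infinity>" and Lab: "a y = ab y" if h: "y + a y * c = l"
  proof -
   show "a y = ab y"
   proof (rule ccontr)
    assume "a y ~= ab y"
    hence "a y < ab y" using p(2) by simp
    thus False using less_ab[of "a y" y] h by simp
   qed
   thus "q \<eta> m l < \<infinity>" using \<kappa>l(2)[OF y] h lt by (metis infinity_ennreal_def min_less_iff_conj not_le top.not_eq_extremum)
  qed
  have R: "q \<eta> m r < \<infinity>" and Rab: "a y = ab y" if h: "y + a y * d = r"
  proof -
   show "a y = ab y"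
   proof (rule ccontr)
    assume "a y ~= ab y"
    hence "a y < ab y" using p(2) by simp
    thus False using less_ab[of "a y" y] h by simp
   qed
   thus "q \<eta> m r < \<infinity>" using \<kappa>r(2)[OF y] h lt by (metis infinity_ennreal_def min_less_iff_conj not_le top.not_eq_extremum)
  qed
  show lc: "l <= y + a y * c" and dr: "y + a y * d <= r" using le_ab[of "a y" y] p(2) by auto
  have s: "a y * c <= 0" "0 <= a y * d" using p(1) c_neg d_pos by (simp_all add: mult_nonneg_nonpos)
  show "q \<eta> y (y + a y * c) < \<infinity>"
  proof (cases "y + a y * c = l")
   case True
   thus ?thesis using q_end(1)[OF y L] by simp
  next
   case False
   thus ?thesis using lc s y by (intro q_inside[OF y]) auto
  qed
  show "q \<eta> y (y + a y * d) < \<infinity>"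
  proof (cases "y + a y * d = r")
   case True
   thus ?thesis using q_end(2)[OF y R] by simp
  next
   case False
   thus ?thesis using dr s y by (intro q_inside[OF y]) auto
  qed
  assume "Gy y (a y) < ennreal (1 / real N)"
  hence "a y = ab y" by (rule p(4))
  hence hits: "y + a y * c = l | y + a y * d = r" using ab_hits[of y] by simp
  have [measurable]: "{x. y + a y * x ~: {l<..<r}} \<in> sets borel" by measurable
  have at: "measure \<mu> {k} <= measure \<mu> {x. y + a y * x ~: {l<..<r}}" if "y + a y * k ~: {l<..<r}" for k
   using that by (intro mu.finite_measure_mono) (auto simp: mu_sets)
  from hits show "0 < measure \<mu> {x. y + a y * x ~: {l<..<r}}"
  proof
   assume h: "y + a y * c = l"
   thus ?thesis using left_fin[OF L[OF h]] at[of c] by simp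
  next
   assume h: "y + a y * d = r"
   thus ?thesis using right_fin[OF R[OF h]] at[of d] by simp
  qed
 qed simp
qed

end

theorem mainTheorem9:
  fixes P :: "'a measure" and F :: "real \<Rightarrow> 'a measure"
    and M W :: "real \<Rightarrow> 'a \<Rightarrow> real"
    and \<eta> :: "real \<Rightarrow> real" and l r m :: real
    and \<mu> :: "real measure"
    and Q :: "'b measure" and X :: "nat \<Rightarrow> 'b \<Rightarrow> real"
  assumes lr: "l < r"
    and eta_borel: "\<eta> \<in> borel_measurable borel"
    and eta_nz: "\<forall>x\<in>{l<..<r}. \<eta> x \<noteq> 0"
    and eta_zero: "\<forall>x. x \<notin> {l<..<r} \<longrightarrow> \<eta> x = 0"
    and eta_loc: "\<forall>a b. l < a \<and> b < r \<longrightarrow> set_integrable lborel {a..b} (\<lambda>z. 1 / (\<eta> z)\<^sup>2)"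
    and m_in: "m \<in> {l<..<r}"
    and usual: "usual_conditions P F"
    and sol: "weak_solution P F \<eta> m M W"
    and mu_prob: "prob_space \<mu>" and mu_sets: "sets \<mu> = sets borel"
    and mu_int: "integrable \<mu> (\<lambda>x. x)" and mu_centered: "(\<integral>x. x \<partial>\<mu>) = 0"
    and mu_nondeg: "\<mu> \<noteq> return borel 0"
    and X_prob: "prob_space Q"
    and X_indep: "prob_space.indep_vars Q (\<lambda>_. borel) X UNIV"
    and X_law: "\<forall>k. distr Q borel (X k) = \<mu>"
    and A3: "bdd_below (supp \<mu>)" "bdd_above (supp \<mu>)"
    and left_fin: "Lim (at_right l) (\<lambda>x. q \<eta> m x) < \<infinity> \<Longrightarrow> 0 < measure \<mu> {Inf (supp \<mu>)}"
    and left_inf: "Lim (at_right l) (\<lambda>x. q \<eta> m x) = \<infinity> \<Longrightarrow>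
                     0 < Liminf (at_right l) (\<lambda>y. G \<mu> \<eta> y (abar \<mu> l r y))"
    and right_fin: "Lim (at_left r) (\<lambda>x. q \<eta> m x) < \<infinity> \<Longrightarrow> 0 < measure \<mu> {Sup (supp \<mu>)}"
    and right_inf: "Lim (at_left r) (\<lambda>x. q \<eta> m x) = \<infinity> \<Longrightarrow>
                     0 < Liminf (at_left r) (\<lambda>y. G \<mu> \<eta> y (abar \<mu> l r y))"
  shows "\<exists>N0::nat. \<forall>N\<ge>N0.
     (\<exists>!a. scale_factor \<mu> \<eta> l r N a) \<and>
     (\<forall>a. scale_factor \<mu> \<eta> l r N a \<longrightarrow>
        (\<exists>\<tau> :: nat \<Rightarrow> 'a \<Rightarrow> real.
           (\<forall>\<omega>\<in>space P. \<tau> 0 \<omega> = 0) \<and>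
           (\<forall>k. \<forall>\<omega>\<in>space P. 0 \<le> \<tau> k \<omega> \<and> \<tau> k \<omega> \<le> \<tau> (Suc k) \<omega>) \<and>
           (\<forall>k. stopping_time F (\<tau> k)) \<and>
           distr P (Pi\<^sub>M UNIV (\<lambda>_. borel)) (\<lambda>\<omega> k. M (\<tau> k \<omega>) \<omega>)
             = distr Q (Pi\<^sub>M UNIV (\<lambda>_. borel)) (\<lambda>\<omega> k. rwalk m a X k \<omega>) \<and>
           (\<forall>k. AE \<omega> in P.
              nn_cond_exp P (filtration.pre_sigma (space P) F (\<tau> k)) (\<lambda>\<omega>. ennreal (\<tau> (Suc k) \<omega>)) \<omega>
                = ennreal (\<tau> k \<omega> + 1 / real N))))"
proof -
 interpret sc: scale_data \<eta> l r m \<mu>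
  by (rule scale_data.intro) (fact lr eta_borel eta_nz eta_zero eta_loc m_in mu_prob mu_sets mu_int mu_centered mu_nondeg A3)+
 have "\<exists>N0>0. \<forall>N\<ge>N0. ALL a. scale_factor \<mu> \<eta> l r N a --> (\<forall>y\<in>{l<..<r}.
  l <= y + a y * sc.c & y + a y * sc.d <= r & q \<eta> y (y + a y * sc.c) < \<infinity> & q \<eta> y (y + a y * sc.d) < \<infinity> &
  (G \<mu> \<eta> y (a y) < ennreal (1 / real N) --> 0 < measure \<mu> {x. y + a y * x ~: {l<..<r}}))"
  by (rule sc.scale_factor_eventually) (use left_fin left_inf right_fin right_inf in \<open>simp_all only: sc.Lim_left sc.Lim_right\<close>)
 \<comment> \<open>A positive \<open>N0\<close> excludes \<open>N = 0\<close>, for which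
   \<open>1 / real N\<close> would be the default value 0.\<close>
 then obtain N0 where N0: "0 < N0" and ok: "!!N a y. N0 <= N ==> scale_factor \<mu> \<eta> l r N a ==> y \<in> {l<..<r} ==>
  l <= y + a y * sc.c & y + a y * sc.d <= r & q \<eta> y (y + a y * sc.c) < \<infinity> & q \<eta> y (y + a y * sc.d) < \<infinity> &
  (G \<mu> \<eta> y (a y) < ennreal (1 / real N) --> 0 < measure \<mu> {x. y + a y * x ~: {l<..<r}})"
  by blast
 show ?thesis
 proof (rule exI[of _ N0], intro allI impI conjI)
  fix N assume N: "N0 <= N"
  hence Np: "0 < N" using N0 by simp
  show "\<exists>!a. scale_factor \<mu> \<eta> l r N a" by (rule sc.scale_factor_unique[OF Np])
  fix a assume a: "scale_factor \<mu> \<eta> l r N a"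
  have az: "a y = 0" if "y ~: {l<..<r}" for y using a that unfolding scale_factor_def by blast
  have a0: "0 <= a y" for y using az[of y] sc.scale_factor_point(1)[OF Np a, of y] by (cases "y \<in> {l<..<r}") auto
  interpret E: embedding P F W M \<eta> m l r \<mu> sc.c sc.d a "1 / real N"
  proof (unfold_locales)
   show "usual_conditions P F" by (rule usual)
   show "brownian_motion P F W" using sol by (simp add: weak_solution_def)
   show "weak_solution P F \<eta> m M W" by (rule sol)
   show "a \<in> borel_measurable borel" by (rule sc.scale_factor_measurable[OF Np a])
   show "0 < measure \<mu> {x. y + a y * x ~: {l<..<r}}" if "y \<in> {l<..<r}" "G \<mu> \<eta> y (a y) < ennreal (1 / real N)" for y
    using ok[OF N a that(1)] that(2) by blast
   show "l <= y + a y * sc.c & y + a y * sc.d <= r & q \<eta> y (y + a y * sc.c) < \<infinity> & q \<eta> y (y + a y * sc.d) < \<infinity>" if "y \<in> {l<..<r}" for y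
    using ok[OF N a that] by blast
   show "G \<mu> \<eta> y (a y) <= ennreal (1 / real N)" if "y \<in> {l<..<r}" for y by (rule sc.scale_factor_point(3)[OF Np a that])
  qed (use lr eta_borel eta_nz eta_zero m_in a0 az in auto)
  show "\<exists>\<tau> :: nat => 'a => real.
      (\<forall>w\<in>space P. \<tau> 0 w = 0) &
      (ALL k. \<forall>w\<in>space P. 0 <= \<tau> k w & \<tau> k w <= \<tau> (Suc k) w) &
      (ALL k. stopping_time F (\<tau> k)) &
      distr P (Pi\<^sub>M UNIV (%_. borel)) (%w k. M (\<tau> k w) w)
       = distr Q (Pi\<^sub>M UNIV (%_. borel)) (%w k. rwalk m a X k w) &
      (ALL k. AE w in P.
       nn_cond_exp P (filtration.pre_sigma (space P) F (\<tau> k)) (%w. ennreal (\<tau> (Suc k) w)) w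
        = ennreal (\<tau> k w + 1 / real N))"
   by (rule E.random_walk_embedding[OF X_prob X_indep X_law])
 qed
qed

end
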